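(* Let $\Omega\subset\mathbb{R}^2$ be a bounded, open and simply connected domain such that $0\in\Omega$. Fix $k\in\mathbb{N}\setminus\{0\}$. Then the map $(a,\alpha)\mapsto\lambda_k^{(a,\alpha)}$ is continuous in $\Omega\times(\mathbb{R}\setminus\mathbb{Z})$. Moreover, let $\alpha_0\in\mathbb{R}\setminus\mathbb{Z}$. If $\lambda_k^{(0,\alpha_0)}$ is a simple eigenvalue, then the map $(a,\alpha)\mapsto\lambda_k^{(a,\alpha)}$ is locally $C^\infty$ in a neighborhood of $(0,\alpha_0)$.
   Context: For $a=(a_1,a_2)\in\mathbb{R}^2$ and $\alpha\in\mathbb{R}$ the Aharonov--Bohm potential with pole $a$ and circulation $\alpha$ is $$A_a^\alpha(x_1,x_2)=\alpha\left(-\frac{x_2-a_2}{(x_1-a_1)^2+(x_2-a_2)^2},\ \frac{x_1-a_1}{(x_1-a_1)^2+(x_2-a_2)^2}\right).$$ For $a\in\Omega$, $H^{1,a}_0(\Omega,\mathbb{C})$ is the completion of $C_c^\infty(\Omega\setminus\{a\},\mathbb{C})$ with respect to the norm $\big(\|\nabla u\|_{L^2}^2+\|u\|_{L^2}^2+\|u/|x-a|\,\|_{L^2}^2\big)^{1/2}$. For $\alpha\notin\mathbb{Z}$, a number $\lambda$ is an eigenvalue of $(i\nabla+A_a^\alpha)^2$ with Dirichlet boundary conditions if there is $u\in H^{1,a}_0(\Omega,\mathbb{C})\setminus\{0\}$ (an eigenfunction) such that $$\int_\Omega(i\nabla+A_a^\alpha)u\cdot\overline{(i\nabla+A_a^\alpha)v}\,dx=\lambda\int_\Omega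 u\overline v\,dx\quad\text{for all }v\in H^{1,a}_0(\Omega,\mathbb{C}).$$ The eigenvalues form a diverging sequence of positive numbers of finite multiplicity (complex dimension of the eigenspace), enumerated as $0<\lambda_1^{(a,\alpha)}\le\lambda_2^{(a,\alpha)}\le\dots$, each repeated according to its multiplicity. Simple means of multiplicity one. *)

theory Defs
  imports "HOL-Analysis.Analysis"
begin

text \<open>On an open set of a finite-dimensional space, \<open>Ck_on n\<close> is the usual class \<open>C\<^sup>n\<close>:
  \<open>f\<close> is differentiable and every directional derivative is of class \<open>C\<^sup>n\<^sup>-\<^sup>1\<close>. It is used on
  open sets only.\<close>

primrec Ck_on :: "nat \<Rightarrow> 'a::real_normed_vector set \<Rightarrow> ('a \<Rightarrow> 'b::real_normed_vector) \<Rightarrow> bool" where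
  "Ck_on 0 S f \<longleftrightarrow> continuous_on S f"
| "Ck_on (Suc n) S f \<longleftrightarrow> (\<forall>x\<in>S. f differentiable (at x)) \<and>
     (\<forall>v. Ck_on n S (\<lambda>x. frechet_derivative f (at x) v))"

definition smooth_on :: "'a::real_normed_vector set \<Rightarrow> ('a \<Rightarrow> 'b::real_normed_vector) \<Rightarrow> bool" where
  "smooth_on S f \<longleftrightarrow> (\<forall>n. Ck_on n S f)"

definition test_functions :: "(real^2) set \<Rightarrow> (real^2 \<Rightarrow> complex) set" where
  "test_functions S = {\<phi>. smooth_on UNIV \<phi> \<and> compact (closure {x. \<phi> x \<noteq> 0}) \<and> closure {x. \<phi> x \<noteq> 0} \<subseteq> S}"

definition grad :: "(real^2 \<Rightarrow> complex) \<Rightarrow> real^2 \<Rightarrow> complex^2" where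
  "grad \<phi> x = (\<chi> j. frechet_derivative \<phi> (at x) (axis j 1))"

definition AB_potential :: "real^2 \<Rightarrow> real \<Rightarrow> real^2 \<Rightarrow> real^2" where
  "AB_potential a \<alpha> x = \<alpha> *\<^sub>R vector
     [- (x$2 - a$2) / ((x$1 - a$1)\<^sup>2 + (x$2 - a$2)\<^sup>2),
        (x$1 - a$1) / ((x$1 - a$1)\<^sup>2 + (x$2 - a$2)\<^sup>2)]"

text \<open>The square of the norm of \<open>H\<^sub>0\<^sup>1\<^sup>,\<^sup>a\<close>, for a function \<open>u\<close> with gradient \<open>G\<close>.\<close>

definition H1a_norm_sq :: "(real^2) set \<Rightarrow> real^2 \<Rightarrow> (real^2 \<Rightarrow> complex) \<Rightarrow> (real^2 \<Rightarrow> complex^2) \<Rightarrow> ennreal" where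
  "H1a_norm_sq \<Omega> a u G =
     (\<integral>\<^sup>+x. ennreal ((norm (G x))\<^sup>2) \<partial>lebesgue_on \<Omega>) +
     (\<integral>\<^sup>+x. ennreal ((norm (u x))\<^sup>2) \<partial>lebesgue_on \<Omega>) +
     (\<integral>\<^sup>+x. ennreal ((norm (u x) / norm (x - a))\<^sup>2) \<partial>lebesgue_on \<Omega>)"

text \<open>The norm is the \<open>L\<^sup>2\<close>-norm of \<open>(\<nabla>u, u, u/|x - a|)\<close>. As \<open>L\<^sup>2\<close> is complete, the completion
  of the test functions is therefore realised by the pairs \<open>(u, G)\<close> of functions, up to equality
  almost everywhere, which are limits of pairs \<open>(\<phi>, \<nabla>\<phi>)\<close>. Here \<open>G\<close> is the weak gradient of
  \<open>u\<close>, and \<open>u\<close> determines it almost everywhere.\<close>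

definition in_H10 :: "(real^2) set \<Rightarrow> real^2 \<Rightarrow> (real^2 \<Rightarrow> complex) \<Rightarrow> (real^2 \<Rightarrow> complex^2) \<Rightarrow> bool" where
  "in_H10 \<Omega> a u G \<longleftrightarrow>
     u \<in> borel_measurable (lebesgue_on \<Omega>) \<and> G \<in> borel_measurable (lebesgue_on \<Omega>) \<and>
     (\<exists>\<phi>. (\<forall>n::nat. \<phi> n \<in> test_functions (\<Omega> - {a})) \<and>
       (\<lambda>n. H1a_norm_sq \<Omega> a (\<lambda>x. \<phi> n x - u x) (\<lambda>x. grad (\<phi> n) x - G x)) \<longlonglongrightarrow> 0)"

text \<open>\<open>(i\<nabla> + A)u\<close> for a function \<open>u\<close> with gradient \<open>G\<close>.\<close>

definition magnetic_grad :: "real^2 \<Rightarrow> real \<Rightarrow> (real^2 \<Rightarrow> complex) \<Rightarrow> (real^2 \<Rightarrow> complex^2) \<Rightarrow> real^2 \<Rightarrow> complex^2" where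
  "magnetic_grad a \<alpha> u G x = (\<chi> j. \<i> * G x $ j + complex_of_real (AB_potential a \<alpha> x $ j) * u x)"

text \<open>The solutions \<open>u\<close> of the weak eigenvalue equation, including the zero function. Functions
  are not identified when they agree almost everywhere; this is taken care of below.\<close>

definition AB_eigenspace :: "(real^2) set \<Rightarrow> real^2 \<Rightarrow> real \<Rightarrow> complex \<Rightarrow> (real^2 \<Rightarrow> complex) set" where
  "AB_eigenspace \<Omega> a \<alpha> \<mu> = {u. \<exists>G. in_H10 \<Omega> a u G \<and>
     (\<forall>v H. in_H10 \<Omega> a v H \<longrightarrow>
       (\<integral>x. (\<Sum>j\<in>UNIV. magnetic_grad a \<alpha> u G x $ j * cnj (magnetic_grad a \<alpha> v H x $ j)) \<partial>lebesgue_on \<Omega>)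
       = \<mu> * (\<integral>x. u x * cnj (v x) \<partial>lebesgue_on \<Omega>))}"

text \<open>The eigenspace, modulo equality almost everywhere, has complex dimension \<open>m\<close>: it has a
  basis of \<open>m\<close> elements. For \<open>m = 0\<close> this says that \<open>\<mu>\<close> is not an eigenvalue.\<close>

definition has_multiplicity :: "(real^2) set \<Rightarrow> real^2 \<Rightarrow> real \<Rightarrow> complex \<Rightarrow> nat \<Rightarrow> bool" where
  "has_multiplicity \<Omega> a \<alpha> \<mu> m \<longleftrightarrow>
     (\<exists>b. (\<forall>i<m. b i \<in> AB_eigenspace \<Omega> a \<alpha> \<mu>) \<and>
       (\<forall>c. (AE x in lebesgue_on \<Omega>. (\<Sum>i<m. c i * b i x) = 0) \<longrightarrow> (\<forall>i<m. c i = 0)) \<and>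
       (\<forall>u\<in>AB_eigenspace \<Omega> a \<alpha> \<mu>. \<exists>c. AE x in lebesgue_on \<Omega>. u x = (\<Sum>i<m. c i * b i x)))"

text \<open>The sequence \<open>s 1 \<le> s 2 \<le> \<dots>\<close> lists all eigenvalues with multiplicity; the value \<open>s 0\<close> is
  irrelevant. As \<open>\<mu>\<close> ranges over the complex numbers, all eigenvalues are required to be positive
  reals.\<close>

definition enumerates_eigenvalues :: "(real^2) set \<Rightarrow> real^2 \<Rightarrow> real \<Rightarrow> (nat \<Rightarrow> real) \<Rightarrow> bool" where
  "enumerates_eigenvalues \<Omega> a \<alpha> s \<longleftrightarrow>
     (\<forall>j\<ge>1. 0 < s j) \<and> mono_on {1..} s \<and> filterlim s at_top sequentially \<and>
     (\<forall>\<mu>::complex. has_multiplicity \<Omega> a \<alpha> \<mu> (card {j. 1 \<le> j \<and> complex_of_real (s j) = \<mu>}))"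

text \<open>\<open>\<lambda>\<^sub>k\<^sup>(\<^sup>a\<^sup>,\<^sup>\<alpha>\<^sup>)\<close>, for \<open>k \<ge> 1\<close>.\<close>

definition AB_eigenvalue :: "(real^2) set \<Rightarrow> nat \<Rightarrow> real^2 \<Rightarrow> real \<Rightarrow> real" where
  "AB_eigenvalue \<Omega> k a \<alpha> = (THE t. \<exists>s. enumerates_eigenvalues \<Omega> a \<alpha> s \<and> s k = t)"

definition simple_eigenvalue :: "(real^2) set \<Rightarrow> real^2 \<Rightarrow> real \<Rightarrow> real \<Rightarrow> bool" where
  "simple_eigenvalue \<Omega> a \<alpha> \<mu> \<longleftrightarrow> has_multiplicity \<Omega> a \<alpha> (complex_of_real \<mu>) 1"

end

theory Submission
  imports Defs "HOL-Library.Diagonal_Subsequence"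
begin

text \<open>A diffeomorphism which moves the pole transports all the spaces \<open>H\<^sub>0\<^sup>1\<^sup>,\<^sup>a\<close>, for \<open>a\<close> near a given
  point \<open>a\<^sub>0\<close>, to a single closed subspace \<open>V\<close> of \<open>L\<^sup>2\<close>. There the eigenvalue problem becomes
  \<open>A u = \<lambda> B u\<close> with bounded symmetric operators \<open>A\<close> and \<open>B\<close> which depend smoothly on \<open>(a, \<alpha>)\<close>.
  The Hardy inequality for \<open>\<alpha> \<notin> \<int>\<close> makes the form of \<open>A\<close> coercive on \<open>V\<close>, and Rellich's theorem makes the
  form of \<open>B\<close> compact, so that the spectrum is given by the min-max principle. Comparing Rayleigh
  quotients yields the continuity of every eigenvalue. A simple eigenvalue is moreover a regular zero of a
  smooth scalar function, obtained by bordering \<open>A - \<lambda> B\<close>, and hence depends smoothly on \<open>(a, \<alpha>)\<close>.\<close>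

section \<open>Maps of class \<open>C\<^sup>n\<close>\<close>

text \<open>The obstacle is that the form domain and the potential are both singular at a pole that
  moves. Elements of V are therefore pairs (i grad v, v/|x - a0|) instead of functions v. For small
  d, \<open>\<Phi> d x - (a0 + d)\<close> is |x - a0| times a bounded vector that stays away from 0,
  so the potential acts on the second component as multiplication by a bounded function, and the
  pulled-back magnetic gradient is a bounded operator. Its coefficients are rational in the
  displacement d, with denominators \<open>Jac d\<close> and \<open>q d\<close>. Polynomials in d
  with operator coefficients are smooth in operator norm, and so are inverses of such families;
  nothing is differentiated under an integral sign. Complex spaces are treated as real ones with an
  isometry J such that J^2 = -1. A simple complex eigenvalue then has real multiplicity two, hence
  two border terms; because all operators commute with J, these still lead to one scalar equation.
  Coercivity is proved for the pole at a0 only and reaches nearby parameters by smallness in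
  operator norm.\<close>

lemma Ck_on_cong:
  assumes "open S" "\<And>x. x \<in> S \<Longrightarrow> f x = g x" "Ck_on n S f"
  shows "Ck_on n S g"
  using assms(2,3)
proof (induction n arbitrary: f g)
  case 0
  then show ?case by (auto cong: continuous_on_cong)
next
  case (Suc n)
  have der: "(g has_derivative frechet_derivative f (at x)) (at x)" if "x \<in> S" for x
  proof -
    have "(f has_derivative frechet_derivative f (at x)) (at x)"
      using Suc.prems that by (simp add: frechet_derivative_works)
    then show ?thesis
      by (rule has_derivative_transform_within_open[OF _ assms(1) that]) (use Suc.prems in auto)
  qed
  then have eq: "frechet_derivative f (at x) = frechet_derivative g (at x)" if "x \<in> S" for x
    using frechet_derivative_at that by blast
  show ?case
    using der Suc.prems Suc.IH[of "\<lambda>x. frechet_derivative f (at x) v" "\<lambda>x. frechet_derivative g (at x) v" for v]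
    by (auto simp: differentiable_def eq)
qed

lemma Ck_on_Suc_imp: "Ck_on (Suc n) S f \<Longrightarrow> Ck_on n S f"
proof (induction n arbitrary: f)
  case 0
  then show ?case
    by (auto intro!: continuous_at_imp_continuous_on differentiable_imp_continuous_within)
next
  case (Suc n)
  then show ?case by (metis Ck_on.simps(2))
qed

lemma Ck_on_continuous: "Ck_on n S f \<Longrightarrow> continuous_on S f"
  by (induction n) (auto dest: Ck_on_Suc_imp simp del: Ck_on.simps(2))

lemma Ck_on_Suc_frechet: "Ck_on (Suc n) S f \<Longrightarrow> Ck_on n S (\<lambda>x. frechet_derivative f (at x) v)"
  by simp

lemma Ck_on_Suc_has_derivative:
  "Ck_on (Suc n) S f \<Longrightarrow> x \<in> S \<Longrightarrow> (f has_derivative frechet_derivative f (at x)) (at x)"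
  by (simp add: frechet_derivative_works)

lemma Ck_on_subset: "Ck_on n S f \<Longrightarrow> T \<subseteq> S \<Longrightarrow> Ck_on n T f"
  by (induction n arbitrary: f) (auto intro: continuous_on_subset)

text \<open>Lets a proof name its derivative instead of handling \<open>frechet_derivative\<close>,
  which agrees with it by uniqueness. The closure properties below are inductions that feed the
  relevant derivative formula into this rule.\<close>

lemma Ck_on_SucI:
  assumes "open S" "\<And>x. x \<in> S \<Longrightarrow> (f has_derivative D x) (at x)" "\<And>v. Ck_on n S (\<lambda>x. D x v)"
  shows "Ck_on (Suc n) S f"
proof -
  have "D x = frechet_derivative f (at x)" if "x \<in> S" for x
    using assms(2) that frechet_derivative_at by blast
  then show ?thesis
    using assms Ck_on_cong[OF assms(1), of "\<lambda>x. D x v" "\<lambda>x. frechet_derivative f (at x) v" for v]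
    by (auto simp: differentiable_def)
qed

declare Ck_on.simps(2) [simp del]

lemma Ck_on_const: "Ck_on n S (\<lambda>x. c)"
  by (induction n arbitrary: c) (auto simp: frechet_derivative_const Ck_on.simps)

lemma Ck_on_bounded_linear:
  assumes "open S" "bounded_linear h" "Ck_on n S f"
  shows "Ck_on n S (\<lambda>x. h (f x))"
  using assms(3)
proof (induction n arbitrary: f)
  case 0
  then show ?case by (auto intro!: bounded_linear.continuous_on[OF assms(2)])
next
  case (Suc n)
  show ?case
    by (rule Ck_on_SucI[OF assms(1) bounded_linear.has_derivative[OF assms(2) Ck_on_Suc_has_derivative[OF Suc.prems]]
        Suc.IH[OF Ck_on_Suc_frechet[OF Suc.prems]]])
qed

lemma Ck_on_id: "open S \<Longrightarrow> Ck_on n S (\<lambda>x. x)"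
  by (cases n) (auto intro: Ck_on_SucI[OF _ has_derivative_ident Ck_on_const] continuous_on_id)

lemma Ck_on_add:
  assumes "open S" "Ck_on n S f" "Ck_on n S g"
  shows "Ck_on n S (\<lambda>x. f x + g x)"
  using assms(2,3)
proof (induction n arbitrary: f g)
  case 0
  then show ?case by (auto intro!: continuous_intros)
next
  case (Suc n)
  show ?case
    by (rule Ck_on_SucI[OF assms(1) has_derivative_add[OF Suc.prems[THEN Ck_on_Suc_has_derivative]]
        Suc.IH[OF Suc.prems[THEN Ck_on_Suc_frechet]]])
qed

lemma Ck_on_sum:
  assumes "open S" "\<And>i. i \<in> I \<Longrightarrow> Ck_on n S (f i)"
  shows "Ck_on n S (\<lambda>x. \<Sum>i\<in>I. f i x)"
  using assms(2) by (induction I rule: infinite_finite_induct) (auto intro: Ck_on_const Ck_on_add[OF assms(1)])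

lemma Ck_on_minus: "open S \<Longrightarrow> Ck_on n S f \<Longrightarrow> Ck_on n S (\<lambda>x. - f x)"
  by (rule Ck_on_bounded_linear[where h=uminus]) (auto intro: bounded_linear_minus bounded_linear_ident)

lemma Ck_on_diff: "open S \<Longrightarrow> Ck_on n S f \<Longrightarrow> Ck_on n S g \<Longrightarrow> Ck_on n S (\<lambda>x. f x - g x)"
  using Ck_on_add[OF _ _ Ck_on_minus, of S n f g] by simp

lemma Ck_on_bilinear:
  assumes "open S" "bounded_bilinear h" "Ck_on n S f" "Ck_on n S g"
  shows "Ck_on n S (\<lambda>x. h (f x) (g x))"
  using assms(3,4)
proof (induction n arbitrary: f g)
  case 0
  then show ?case by (auto intro!: bounded_bilinear.continuous_on[OF assms(2)])
next
  case (Suc n)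
  have "Ck_on n S f" "Ck_on n S g" using Suc.prems Ck_on_Suc_imp by auto
  then have "Ck_on n S (\<lambda>x. h (f x) (frechet_derivative g (at x) v) + h (frechet_derivative f (at x) v) (g x))" for v
    by (intro Ck_on_add[OF assms(1)] Suc.IH Suc.prems[THEN Ck_on_Suc_frechet])
  from Ck_on_SucI[OF assms(1) bounded_bilinear.FDERIV[OF assms(2) Suc.prems[THEN Ck_on_Suc_has_derivative]] this]
  show ?case .
qed

lemmas Ck_on_scaleR = Ck_on_bilinear[OF _ bounded_bilinear_scaleR]
lemmas Ck_on_mult = Ck_on_bilinear[OF _ bounded_bilinear_mult]
lemmas Ck_on_inner = Ck_on_bilinear[OF _ bounded_bilinear_inner]
lemmas Ck_on_blinfun_compose = Ck_on_bilinear[OF _ bounded_bilinear_blinfun_compose]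
lemmas Ck_on_blinfun_apply = Ck_on_bilinear[OF _ bounded_bilinear_blinfun_apply]

text \<open>\<open>Ck_on\<close> speaks of derivatives in fixed directions, but the chain rule
  applies the derivative of g to a direction that moves with x. A basis expansion reduces this to
  finitely many fixed directions, which is why the middle space of a composition is
  finite-dimensional.\<close>

lemma frechet_derivative_Basis_expand:
  fixes g :: "'a::euclidean_space \<Rightarrow> 'b::real_normed_vector"
  assumes "g differentiable (at y)"
  shows "frechet_derivative g (at y) w = (\<Sum>b\<in>Basis. (w \<bullet> b) *\<^sub>R frechet_derivative g (at y) b)"
proof -
  have "linear (frechet_derivative g (at y))"
    using assms by (rule linear_frechet_derivative)
  then have "frechet_derivative g (at y) (\<Sum>b\<in>Basis. (w \<bullet> b) *\<^sub>R b) = (\<Sum>b\<in>Basis. (w \<bullet> b) *\<^sub>R frechet_derivative g (at y) b)"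
    by (simp only: linear_sum linear_scale)
  then show ?thesis by (simp only: euclidean_representation)
qed

lemma Ck_on_compose:
  fixes f :: "'a::real_normed_vector \<Rightarrow> 'b::euclidean_space" and g :: "'b \<Rightarrow> 'c::real_normed_vector"
  assumes "open S" "open T" "f ` S \<subseteq> T" "Ck_on n S f" "Ck_on n T g"
  shows "Ck_on n S (\<lambda>x. g (f x))"
  using assms(4,5)
proof (induction n arbitrary: g)
  case 0
  then show ?case using assms(3) continuous_on_compose2[of T g S f] by simp
next
  case (Suc n)
  have f: "Ck_on n S f" using Suc.prems(1) by (rule Ck_on_Suc_imp)
  have D: "((\<lambda>x. g (f x)) has_derivative
     (\<lambda>v. \<Sum>b\<in>Basis. (frechet_derivative f (at x) v \<bullet> b) *\<^sub>R frechet_derivative g (at (f x)) b)) (at x)" if "x \<in> S" for x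
  proof -
    have "f x \<in> T" using that assms(3) by auto
    then have g: "g differentiable (at (f x))" using Suc.prems by (simp add: Ck_on.simps)
    have "((\<lambda>x. g (f x)) has_derivative (\<lambda>v. frechet_derivative g (at (f x)) (frechet_derivative f (at x) v))) (at x)"
      using has_derivative_compose[of f _ x UNIV g] Suc.prems g that
      by (simp add: frechet_derivative_works Ck_on.simps)
    then show ?thesis by (subst (asm) frechet_derivative_Basis_expand[OF g])
  qed
  show ?case
    by (rule Ck_on_SucI[OF assms(1) D], assumption)
       (intro Ck_on_sum Ck_on_scaleR Ck_on_inner Ck_on_const assms(1) Ck_on_Suc_frechet[OF Suc.prems(1)]
         Suc.IH[OF f Ck_on_Suc_frechet[OF Suc.prems(2)]])
qed

lemma Ck_on_Pair:
  assumes "open S" "Ck_on n S f" "Ck_on n S g"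
  shows "Ck_on n S (\<lambda>x. (f x, g x))"
proof -
  have "Ck_on n S (\<lambda>x. (f x, 0) + (0, g x))"
    by (intro Ck_on_add assms Ck_on_bounded_linear[where h="\<lambda>x. (x, 0)"] Ck_on_bounded_linear[where h="\<lambda>x. (0, x)"]
       bounded_linear_Pair bounded_linear_ident bounded_linear_zero)
  then show ?thesis by simp
qed

lemma Ck_on_fst: "open S \<Longrightarrow> Ck_on n S f \<Longrightarrow> Ck_on n S (\<lambda>x. fst (f x))"
  by (rule Ck_on_bounded_linear[OF _ bounded_linear_fst])

lemma Ck_on_snd: "open S \<Longrightarrow> Ck_on n S f \<Longrightarrow> Ck_on n S (\<lambda>x. snd (f x))"
  by (rule Ck_on_bounded_linear[OF _ bounded_linear_snd])

text \<open>Bootstrapping in the order of differentiability. Implicit and inverse functions satisfy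
  such an equation.\<close>

lemma Ck_on_implicit:
  fixes g :: "'a::euclidean_space \<Rightarrow> 'b::euclidean_space"
  assumes "open S" "open T" "continuous_on S g" "\<And>x. x \<in> S \<Longrightarrow> (x, g x) \<in> T"
    and "\<And>x. x \<in> S \<Longrightarrow> (g has_derivative (\<lambda>v. K v (x, g x))) (at x)"
    and "\<And>v. Ck_on n T (K v)"
  shows "Ck_on n S g"
  using assms(6)
proof (induction n)
  case 0
  then show ?case using assms(3) by simp
next
  case (Suc n)
  have g: "Ck_on n S g" using Suc Ck_on_Suc_imp by blast
  show ?case
  proof (rule Ck_on_SucI[OF assms(1,5)])
    fix v
    have "Ck_on n T (K v)" using Suc.prems Ck_on_Suc_imp by blast
    then show "Ck_on n S (\<lambda>x. K v (x, g x))"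
      using assms(4) Ck_on_compose[OF assms(1,2) _ Ck_on_Pair[OF assms(1) Ck_on_id[OF assms(1)] g]] by blast
  qed
qed

lemma blinfun_compose_assoc: "(f o\<^sub>L g) o\<^sub>L h = f o\<^sub>L (g o\<^sub>L h)"
  by (rule blinfun_eqI) simp

lemma blinfun_compose_id [simp]: "id_blinfun o\<^sub>L f = f" "f o\<^sub>L id_blinfun = f"
  by (auto intro: blinfun_eqI)

text \<open>All rests on g y - g x = - g y (f y - f x) g x. With the uniform bound C it gives
  continuity of g and then the derivative - g D g. This formula involves only g and the derivative
  of f, so smoothness is gained one order at a time.\<close>

lemma Ck_on_blinfun_inverse:
  fixes f :: "'a::real_normed_vector \<Rightarrow> 'b::real_normed_vector \<Rightarrow>\<^sub>L 'b"
  assumes "open S" "Ck_on n S f"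
    and fg: "\<And>x. x \<in> S \<Longrightarrow> f x o\<^sub>L g x = id_blinfun"
    and gf: "\<And>x. x \<in> S \<Longrightarrow> g x o\<^sub>L f x = id_blinfun"
    and bd: "\<And>x. x \<in> S \<Longrightarrow> norm (g x) \<le> C"
  shows "Ck_on n S g"
proof -
  have eq: "g y - g x = - (g y o\<^sub>L (f y - f x) o\<^sub>L g x)" if "x \<in> S" "y \<in> S" for x y
  proof -
    have "g y o\<^sub>L (f y - f x) o\<^sub>L g x = ((g y o\<^sub>L f y) o\<^sub>L g x) - (g y o\<^sub>L (f x o\<^sub>L g x))"
      by (simp add: bounded_bilinear.diff_left[OF bounded_bilinear_blinfun_compose]
          bounded_bilinear.diff_right[OF bounded_bilinear_blinfun_compose] blinfun_compose_assoc)
    also have "\<dots> = g x - g y" using that by (simp add: fg gf)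
    finally show ?thesis by simp
  qed
  have nb: "norm (g y - g x) \<le> C * C * norm (f y - f x)" if "x \<in> S" "y \<in> S" for x y
  proof -
    have "norm (g y - g x) \<le> norm (g y o\<^sub>L (f y - f x)) * norm (g x)"
      unfolding eq[OF that] norm_minus_cancel by (rule norm_blinfun_compose)
    also have "\<dots> \<le> (norm (g y) * norm (f y - f x)) * norm (g x)"
      by (intro mult_right_mono norm_blinfun_compose) auto
    also have "\<dots> \<le> (C * norm (f y - f x)) * C"
      using bd that order_trans[OF norm_ge_zero bd]
      by (intro mult_mono mult_right_mono) auto
    finally show ?thesis by (simp add: ac_simps)
  qed
  have contf: "continuous_on S f" using assms(2) by (rule Ck_on_continuous)
  have cont: "continuous_on S g"
    unfolding continuous_on_def
  proof
    fix x assume x: "x \<in> S"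
    have f': "(f \<longlongrightarrow> f x) (at x within S)" using contf x by (simp add: continuous_on_def)
    have "((\<lambda>y. C * C * norm (f y - f x)) \<longlongrightarrow> C * C * norm (f x - f x)) (at x within S)"
      by (rule tendsto_mult[OF tendsto_const tendsto_norm[OF tendsto_diff[OF f' tendsto_const]]])
    moreover have ev: "\<forall>\<^sub>F y in at x within S. norm (g y - g x) \<le> C * C * norm (f y - f x)"
      unfolding eventually_at_filter using nb[OF x] by (intro always_eventually) simp
    ultimately have "((\<lambda>y. g y - g x) \<longlongrightarrow> 0) (at x within S)"
      using Lim_null_comparison[OF ev] by simp
    then show "(g \<longlongrightarrow> g x) (at x within S)" by (rule LIM_zero_cancel)
  qed
  have der: "(g has_derivative (\<lambda>v. - (g x o\<^sub>L D v o\<^sub>L g x))) (at x)"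
    if x: "x \<in> S" and D: "(f has_derivative D) (at x)" for x D
  proof -
    interpret D: bounded_linear D using D by (rule has_derivative_bounded_linear)
    have bl: "bounded_linear (\<lambda>v. - (g x o\<^sub>L D v o\<^sub>L g x))"
      by (intro bounded_linear_minus bounded_bilinear.bounded_linear_left[OF bounded_bilinear_blinfun_compose, THEN bounded_linear_compose]
         bounded_bilinear.bounded_linear_right[OF bounded_bilinear_blinfun_compose, THEN bounded_linear_compose] D.bounded_linear)
    have gx: "(g \<longlongrightarrow> g x) (at x)"
      using cont x assms(1) by (simp add: continuous_on_eq_continuous_at isContD)
    obtain KD where KD: "\<And>v. norm (D v) \<le> norm v * KD" using D.bounded by blast
    define E where "E y = norm (f y - f x - D (y - x)) / norm (y - x)" for y
    have E: "(E \<longlongrightarrow> 0) (at x)"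
      using D unfolding has_derivative_iff_norm E_def by simp
    have bound: "norm (g y - g x + (g x o\<^sub>L D (y - x) o\<^sub>L g x)) / norm (y - x) \<le> C * C * E y + norm (g y - g x) * KD * C"
      if y: "y \<in> S" "y \<noteq> x" for y
    proof -
      have C0: "C \<ge> 0" using bd[OF x] norm_ge_zero order_trans by blast
      \<comment> \<open>The remainder splits into the linearisation error of f, between two bounded
        factors, and a term small by continuity of g.\<close>
      have "- (g y o\<^sub>L (f y - f x) o\<^sub>L g x) + (g x o\<^sub>L D (y - x) o\<^sub>L g x) =
          - (g y o\<^sub>L (f y - f x - D (y - x)) o\<^sub>L g x) - ((g y - g x) o\<^sub>L D (y - x) o\<^sub>L g x)"
        by (simp add: bounded_bilinear.diff_left[OF bounded_bilinear_blinfun_compose]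
          bounded_bilinear.diff_right[OF bounded_bilinear_blinfun_compose])
      then have "g y - g x + (g x o\<^sub>L D (y - x) o\<^sub>L g x) =
          - (g y o\<^sub>L (f y - f x - D (y - x)) o\<^sub>L g x) - ((g y - g x) o\<^sub>L D (y - x) o\<^sub>L g x)"
        by (simp only: eq[OF x y(1)])
      then have "norm (g y - g x + (g x o\<^sub>L D (y - x) o\<^sub>L g x)) \<le> norm (g y o\<^sub>L (f y - f x - D (y - x)) o\<^sub>L g x) + norm ((g y - g x) o\<^sub>L D (y - x) o\<^sub>L g x)"
        by (metis norm_minus_cancel norm_triangle_ineq4)
      also have "\<dots> \<le> C * norm (f y - f x - D (y - x)) * C + norm (g y - g x) * (norm (y - x) * KD) * C"
        by (intro add_mono order_trans[OF norm_blinfun_compose] mult_mono bd KD C0 y(1) x order_refl)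
             (auto intro: C0 mult_nonneg_nonneg order_trans[OF norm_ge_zero KD])
      finally show ?thesis using y(2) by (simp add: E_def field_simps)
    qed
    have "((\<lambda>y. C * C * E y + norm (g y - g x) * KD * C) \<longlongrightarrow> C * C * 0 + norm (g x - g x) * KD * C) (at x)"
      by (intro tendsto_add tendsto_mult tendsto_const tendsto_norm tendsto_diff E gx)
    moreover have ev: "\<forall>\<^sub>F y in at x. norm (norm (g y - g x - (- (g x o\<^sub>L D (y - x) o\<^sub>L g x))) / norm (y - x)) \<le> C * C * E y + norm (g y - g x) * KD * C"
    proof -
      have "\<forall>\<^sub>F y in at x. y \<in> S - {x}"
        using eventually_at_in_open[OF assms(1) x] .
      then show ?thesis by (rule eventually_mono) (use bound in simp)
    qed
    ultimately have "((\<lambda>y. norm (g y - g x - (- (g x o\<^sub>L D (y - x) o\<^sub>L g x))) / norm (y - x)) \<longlongrightarrow> 0) (at x)"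
      using Lim_null_comparison[OF ev] by simp
    then show ?thesis
      unfolding has_derivative_iff_norm using bl by simp
  qed
  from assms(2) show ?thesis
  proof (induction n)
    case 0
    then show ?case using cont by simp
  next
    case (Suc n)
    have g: "Ck_on n S g" using Suc Ck_on_Suc_imp by blast
    show ?case
      by (rule Ck_on_SucI[OF assms(1) der[OF _ Ck_on_Suc_has_derivative[OF Suc.prems]]], assumption, assumption)
         (intro Ck_on_minus Ck_on_blinfun_compose assms(1) g Ck_on_Suc_frechet[OF Suc.prems])
  qed
qed

text \<open>The derivative of \<open>inverse\<close> is a polynomial in its own value, so the
  bootstrapping lemma applies; \<open>snd p\<close> stands for that value.\<close>

lemma Ck_on_inverse:
  fixes f :: "'a::real_normed_vector \<Rightarrow> real"
  assumes "open S" "Ck_on n S f" "\<And>x. x \<in> S \<Longrightarrow> f x \<noteq> 0"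
  shows "Ck_on n S (\<lambda>x. inverse (f x))"
proof -
  have "Ck_on n (- {0::real}) inverse"
  proof (rule Ck_on_implicit[of _ UNIV _ "\<lambda>v p. - (snd p * v * snd p)"])
    fix x :: real assume "x \<in> - {0}"
    then show "(inverse has_derivative (\<lambda>v. - (snd (x, inverse x) * v * snd (x, inverse x)))) (at x)"
      by (auto intro: has_derivative_inverse')
  next
    fix v :: real
    show "Ck_on n UNIV (\<lambda>p::real \<times> real. - (snd p * v * snd p))"
      by (intro Ck_on_minus Ck_on_mult Ck_on_const Ck_on_snd Ck_on_id open_UNIV)
  qed (auto intro!: continuous_intros)
  then show ?thesis
    using assms by (intro Ck_on_compose[OF assms(1) _ _ assms(2), of "- {0}" inverse]) auto
qed

section \<open>Smooth bump and cutoff functions\<close>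

definition flat_exp :: "nat \<Rightarrow> real \<Rightarrow> real" where
  "flat_exp m t = (if t > 0 then inverse t ^ m * exp (- inverse t) else 0)"

lemma flat_exp_tendsto_0: "(flat_exp m \<longlongrightarrow> 0) (at 0)"
proof -
  have "((\<lambda>t. inverse t ^ m / exp (inverse t)) \<longlongrightarrow> 0) (at_right (0::real))"
    by (rule filterlim_compose[OF tendsto_power_div_exp_0 filterlim_inverse_at_top_right])
  then have "(flat_exp m \<longlongrightarrow> 0) (at_right 0)"
    by (rule Lim_transform_eventually)
       (auto simp: flat_exp_def eventually_at_filter exp_minus field_simps)
  moreover have "(flat_exp m \<longlongrightarrow> 0) (at_left 0)"
    by (rule Lim_transform_eventually[OF tendsto_const]) (auto simp: flat_exp_def eventually_at_filter)
  ultimately show ?thesis by (simp add: filterlim_split_at)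
qed

text \<open>The index m is there so that the family is closed under differentiation up to linear
  combinations; smoothness of all members is then a single induction.\<close>

lemma flat_exp_has_derivative:
  "(flat_exp m has_real_derivative - real m * flat_exp (Suc m) t + flat_exp (m + 2) t) (at t)"
proof -
  consider "t > 0" | "t < 0" | "t = 0" by linarith
  then show ?thesis
  proof cases
    case 1
    define e where "e = exp (- inverse t)"
    have "((\<lambda>t. inverse t ^ m * exp (- inverse t)) has_real_derivative
        (real m * inverse t ^ (m - 1) * (- (inverse t * inverse t))) * e + inverse t ^ m * (e * (inverse t * inverse t))) (at t)"
      unfolding e_def using 1 by (auto intro!: derivative_eq_intros)
    also have "(real m * inverse t ^ (m - 1) * (- (inverse t * inverse t))) * e + inverse t ^ m * (e * (inverse t * inverse t)) =
        - real m * flat_exp (Suc m) t + flat_exp (m + 2) t"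
      using 1 unfolding flat_exp_def e_def[symmetric] by (cases m) (simp_all add: algebra_simps)
    finally have "((\<lambda>t. inverse t ^ m * exp (- inverse t)) has_real_derivative
        - real m * flat_exp (Suc m) t + flat_exp (m + 2) t) (at t)" .
    then show ?thesis
      by (rule has_field_derivative_transform_within_open[of _ _ _ "{0<..}"]) (use 1 in \<open>auto simp: flat_exp_def\<close>)
  next
    case 2
    have "((\<lambda>t. 0) has_real_derivative - real m * flat_exp (Suc m) t + flat_exp (m + 2) t) (at t)"
      using 2 by (simp add: flat_exp_def)
    then show ?thesis
      by (rule has_field_derivative_transform_within_open[of _ _ _ "{..<0}"]) (use 2 in \<open>auto simp: flat_exp_def\<close>)
  next
    case 3
    \<comment> \<open>The difference quotient of \<open>flat_exp m\<close> at 0 is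
      \<open>flat_exp (Suc m)\<close>, whose limit is already known.\<close>
    have "(flat_exp m has_real_derivative 0) (at 0)"
      unfolding has_field_derivative_iff
      by (rule Lim_transform_eventually[OF flat_exp_tendsto_0[of "Suc m"]])
         (auto simp: flat_exp_def eventually_at_filter field_simps)
    then show ?thesis using 3 by (simp add: flat_exp_def)
  qed
qed

lemma Ck_on_flat_exp: "Ck_on n UNIV (flat_exp m)"
proof (induction n arbitrary: m)
  case 0
  show ?case
    using DERIV_isCont[OF flat_exp_has_derivative] by (auto intro: continuous_at_imp_continuous_on)
next
  case (Suc n)
  have "Ck_on n UNIV (\<lambda>t. (- real m * flat_exp (Suc m) t + flat_exp (m + 2) t) * v)" for v
    by (intro Ck_on_mult Ck_on_add Ck_on_const open_UNIV Suc.IH)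
  then show ?case
    by (rule Ck_on_SucI[OF open_UNIV flat_exp_has_derivative[THEN has_field_derivative_imp_has_derivative]])
qed

lemma flat_exp_0: "flat_exp 0 t \<ge> 0" "flat_exp 0 t > 0 \<longleftrightarrow> t > 0" "flat_exp 0 t = 0 \<longleftrightarrow> t \<le> 0"
  by (auto simp: flat_exp_def)

lemma Ck_on_norm_sq:
  fixes c :: "'a::real_inner"
  shows "Ck_on n UNIV (\<lambda>x. (norm (x - c))\<^sup>2)"
  unfolding power2_norm_eq_inner
  by (intro Ck_on_inner Ck_on_diff Ck_on_const Ck_on_id open_UNIV)

definition bump :: "'a::euclidean_space \<Rightarrow> real \<Rightarrow> 'a \<Rightarrow> real" where
  "bump c r x = flat_exp 0 (r\<^sup>2 - (norm (x - c))\<^sup>2)"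

lemma Ck_on_bump: "Ck_on n UNIV (bump c r)"
  unfolding bump_def
  by (rule Ck_on_compose[OF open_UNIV open_UNIV _ _ Ck_on_flat_exp])
     (intro subset_UNIV Ck_on_diff Ck_on_const Ck_on_norm_sq open_UNIV)+

lemma bump_nonneg: "bump c r x \<ge> 0"
  by (simp add: bump_def flat_exp_0)

lemma bump_pos_iff: "r > 0 \<Longrightarrow> bump c r x > 0 \<longleftrightarrow> x \<in> ball c r"
  using power_strict_mono[of "norm (x - c)" r 2] power2_less_imp_less[of "norm (x - c)" r]
  by (auto simp: bump_def flat_exp_0 dist_norm norm_minus_commute)

lemma bump_eq_0_iff: "r > 0 \<Longrightarrow> bump c r x = 0 \<longleftrightarrow> x \<notin> ball c r"
  using bump_pos_iff[of r c x] bump_nonneg[of c r x] by linarith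

text \<open>The numerator vanishes outside the large ball and the second term of the denominator
  inside the small one; r < R prevents both from vanishing at the same point.\<close>

definition cutoff :: "'a::euclidean_space \<Rightarrow> real \<Rightarrow> real \<Rightarrow> 'a \<Rightarrow> real" where
  "cutoff c r R x = bump c R x * inverse (bump c R x + flat_exp 0 ((norm (x - c))\<^sup>2 - r\<^sup>2))"

lemma cutoff_denom_pos:
  assumes "0 < r" "r < R"
  shows "bump c R x + flat_exp 0 ((norm (x - c))\<^sup>2 - r\<^sup>2) > 0"
proof (cases "x \<in> ball c R")
  case True
  then show ?thesis using assms by (intro add_pos_nonneg bump_pos_iff[THEN iffD2] flat_exp_0(1)) auto
next
  case False
  then have "r < norm (x - c)" using assms by (simp add: dist_norm norm_minus_commute)
  then have "r\<^sup>2 < (norm (x - c))\<^sup>2" using assms by (intro power_strict_mono) auto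
  then show ?thesis by (intro add_nonneg_pos bump_nonneg flat_exp_0(2)[THEN iffD2]) simp
qed

lemma Ck_on_cutoff:
  assumes "0 < r" "r < R"
  shows "Ck_on n UNIV (cutoff c r R)"
proof -
  have "Ck_on n UNIV (\<lambda>x. flat_exp 0 ((norm (x - c))\<^sup>2 - r\<^sup>2))"
    by (rule Ck_on_compose[OF open_UNIV open_UNIV subset_UNIV Ck_on_diff[OF open_UNIV Ck_on_norm_sq Ck_on_const] Ck_on_flat_exp])
  from Ck_on_inverse[OF open_UNIV Ck_on_add[OF open_UNIV Ck_on_bump this] less_imp_neq[OF cutoff_denom_pos[OF assms], THEN not_sym]]
  show ?thesis unfolding cutoff_def by (rule Ck_on_mult[OF open_UNIV Ck_on_bump])
qed

lemma cutoff_eq_1: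
  assumes "0 < r" "r < R" "norm (x - c) \<le> r"
  shows "cutoff c r R x = 1"
proof -
  have "flat_exp 0 ((norm (x - c))\<^sup>2 - r\<^sup>2) = 0"
    using power_mono[OF assms(3) norm_ge_zero, of 2] by (simp add: flat_exp_0(3))
  then show ?thesis
    using cutoff_denom_pos[OF assms(1,2), of c x] unfolding cutoff_def by simp
qed

lemma cutoff_eq_0: "0 < r \<Longrightarrow> r < R \<Longrightarrow> norm (x - c) \<ge> R \<Longrightarrow> cutoff c r R x = 0"
  using bump_eq_0_iff[of R c x] by (simp add: cutoff_def dist_norm norm_minus_commute)

section \<open>Pencils of symmetric operators\<close>

text \<open>The first-variation principle: it turns minimality along every line into an
  Euler-Lagrange equation, in the Riesz theorem and for Rayleigh quotients alike.\<close>

lemma linear_coeff_zero: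
  assumes "\<And>t::real. 2 * t * c + t\<^sup>2 * d \<ge> 0"
  shows "c = 0"
proof (rule ccontr)
  assume "c \<noteq> 0"
  \<comment> \<open>D exceeds both 0 and d, so at t = -c/D the polynomial equals (c^2/D)(d/D - 2)
    with d/D < 1, which is negative.\<close>
  define D where "D = \<bar>d\<bar> + 1"
  have D: "D > 0" "d < D" by (auto simp: D_def)
  have "2 * (- c / D) * c + (- c / D)\<^sup>2 * d \<ge> 0" by (rule assms)
  also have "2 * (- c / D) * c + (- c / D)\<^sup>2 * d = c\<^sup>2 / D * (d / D - 2)"
    using D(1) by (simp add: field_simps power2_eq_square)
  finally have "d / D - 2 \<ge> 0"
    using D(1) \<open>c \<noteq> 0\<close> by (simp add: zero_le_mult_iff zero_le_divide_iff)
  moreover have "d / D < 1" using D by simp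
  ultimately show False by simp
qed

text \<open>The quadratic functional Q is minimised over V: the parallelogram law makes a minimising
  sequence Cauchy, and the first variation at the limit is the claim. As V is an arbitrary closed
  subspace, this contains the projection theorem (take f = inner product with x) as well as the
  Riesz theorem.\<close>

lemma riesz_subspace:
  fixes f :: "'a::{real_inner,complete_space} \<Rightarrow> real"
  assumes f: "bounded_linear f" and V: "subspace V" "closed V"
  obtains u where "u \<in> V" "\<And>v. v \<in> V \<Longrightarrow> u \<bullet> v = f v"
proof -
  interpret f: bounded_linear f by fact
  obtain K where K: "\<And>x. \<bar>f x\<bar> \<le> norm x * K" using f.bounded by auto
  define Q where "Q u = u \<bullet> u - 2 * f u" for u
  have lower: "Q u \<ge> - K\<^sup>2" for u
  proof -
    have "Q u \<ge> (norm u)\<^sup>2 - 2 * (norm u * K)"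
      using K[of u] by (simp add: Q_def power2_norm_eq_inner)
    moreover have "(norm u - K)\<^sup>2 \<ge> 0" by simp
    ultimately show ?thesis by (simp add: power2_diff)
  qed
  have par: "(norm (u - v))\<^sup>2 = 2 * Q u + 2 * Q v - 4 * Q ((1/2) *\<^sub>R (u + v))" for u v
    by (simp add: Q_def power2_norm_eq_inner inner_simps inner_commute f.add f.scaleR algebra_simps)
  define m where "m = Inf (Q ` V)"
  have bdd: "bdd_below (Q ` V)" using lower by (intro bdd_belowI[of _ "- K\<^sup>2"]) auto
  have m: "m \<le> Q u" if "u \<in> V" for u
    unfolding m_def using bdd that by (intro cInf_lower) auto
  have "\<exists>u\<in>V. Q u < m + 1 / Suc n" for n
  proof -
    have "Q ` V \<noteq> {}" using V(1) subspace_0 by blast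
    then have "\<exists>y\<in>Q ` V. y < m + 1 / Suc n"
      unfolding m_def by (subst cInf_less_iff[OF _ bdd, symmetric]) (auto simp: m_def[symmetric])
    then show ?thesis by auto
  qed
  then obtain U where U: "\<And>n. U n \<in> V" "\<And>n. Q (U n) < m + 1 / Suc n" by metis
  have close: "(norm (U i - U j))\<^sup>2 \<le> 2 / Suc i + 2 / Suc j" for i j
  proof -
    have "(1/2) *\<^sub>R (U i + U j) \<in> V" using U(1) V(1) by (intro subspace_scale subspace_add) auto
    from m[OF this] U(2)[of i] U(2)[of j] show ?thesis unfolding par by simp
  qed
  have "Cauchy U"
  proof (rule metric_CauchyI)
    fix e :: real assume e: "e > 0"
    then obtain N where N: "inverse (real (Suc N)) < e\<^sup>2 / 4" using reals_Archimedean[of "e\<^sup>2 / 4"] by auto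
    have "dist (U i) (U j) < e" if "i \<ge> N" "j \<ge> N" for i j
    proof -
      have "1 / real (Suc i) \<le> inverse (real (Suc N))" "1 / real (Suc j) \<le> inverse (real (Suc N))"
        using that by (auto simp: field_simps)
      then have "(norm (U i - U j))\<^sup>2 < e\<^sup>2" using close[of i j] N by simp
      then show ?thesis using e by (auto simp: dist_norm intro: power2_less_imp_less)
    qed
    then show "\<exists>M. \<forall>m\<ge>M. \<forall>n\<ge>M. dist (U m) (U n) < e" by blast
  qed
  then obtain u where u: "U \<longlonglongrightarrow> u" using Cauchy_convergent convergent_def by blast
  have uV: "u \<in> V" using closed_sequentially[OF V(2) _ u] U(1) by blast
  have "(\<lambda>n. Q (U n)) \<longlonglongrightarrow> Q u"
    unfolding Q_def by (intro tendsto_diff tendsto_mult tendsto_const tendsto_inner u f.tendsto)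
  moreover have "(\<lambda>n. m + 1 / real (Suc n)) \<longlonglongrightarrow> m + 0"
    by (intro tendsto_add tendsto_const LIMSEQ_Suc[OF lim_1_over_n])
  ultimately have Qu: "Q u \<le> m"
    using U(2) by (intro LIMSEQ_le[of _ "Q u" _ m]) (auto intro: less_imp_le)
  have "u \<bullet> v = f v" if v: "v \<in> V" for v
  proof -
    have "2 * t * (u \<bullet> v - f v) + t\<^sup>2 * (v \<bullet> v) \<ge> 0" for t
    proof -
      have "Q u \<le> Q (u + t *\<^sub>R v)" using Qu m[of "u + t *\<^sub>R v"] uV v V(1)
        by (auto simp: subspace_add subspace_scale intro: order_trans)
      then show ?thesis
        by (simp add: Q_def inner_simps f.add f.scaleR inner_commute power2_eq_square algebra_simps)
    qed
    then have "u \<bullet> v - f v = 0" by (rule linear_coeff_zero)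
    then show ?thesis by simp
  qed
  then show thesis using uV that by blast
qed

lemma orthogonal_projection_ex:
  fixes V :: "'a::{real_inner,complete_space} set"
  assumes V: "subspace V" "closed V"
  obtains P :: "'a \<Rightarrow>\<^sub>L 'a" where "\<And>x. P x \<in> V" "\<And>x v. v \<in> V \<Longrightarrow> P x \<bullet> v = x \<bullet> v"
proof -
  have "\<exists>u\<in>V. \<forall>v\<in>V. u \<bullet> v = x \<bullet> v" for x
    using riesz_subspace[OF bounded_linear_inner_right V, of x] by metis
  then obtain p where p: "\<And>x. p x \<in> V" "\<And>x v. v \<in> V \<Longrightarrow> p x \<bullet> v = x \<bullet> v" by metis
  have uniq: "u = p x" if "u \<in> V" "\<And>v. v \<in> V \<Longrightarrow> u \<bullet> v = x \<bullet> v" for u x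
  proof -
    have "u - p x \<in> V" using that p V(1) by (intro subspace_diff) auto
    then have "(u - p x) \<bullet> (u - p x) = 0" using that p by (simp add: inner_diff_left)
    then show ?thesis by simp
  qed
  have "bounded_linear p"
  proof (rule bounded_linear_intro[where K=1])
    show "p (x + y) = p x + p y" for x y
      by (rule uniq[symmetric]) (auto simp: p V(1) inner_add_left subspace_add)
    show "p (r *\<^sub>R x) = r *\<^sub>R p x" for r x
      by (rule uniq[symmetric]) (auto simp: p V(1) subspace_scale)
    show "norm (p x) \<le> norm x * 1" for x
    proof -
      have "(norm (p x))\<^sup>2 = x \<bullet> p x" using p by (simp add: power2_norm_eq_inner)
      also have "\<dots> \<le> norm x * norm (p x)" by (rule norm_cauchy_schwarz)
      finally show ?thesis by (cases "p x = 0") (auto simp: power2_eq_square)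
    qed
  qed
  then show thesis using that[of "Blinfun p"] p by (simp add: bounded_linear_Blinfun_apply)
qed

section \<open>Adjoints and inverses of operators\<close>

lemma inner_eqI: "(\<And>x. u \<bullet> x = v \<bullet> x) \<Longrightarrow> u = (v::'a::real_inner)"
  using inner_eq_zero_iff[of "u - v"] by (simp add: inner_diff_left)

definition adjoint_blinfun :: "('a::{real_inner,complete_space} \<Rightarrow>\<^sub>L 'b::real_inner) \<Rightarrow> ('b \<Rightarrow>\<^sub>L 'a)" where
  "adjoint_blinfun L = (SOME M :: 'b \<Rightarrow>\<^sub>L 'a. \<forall>x y. M y \<bullet> x = y \<bullet> L x)"

lemma adjoint_blinfun:
  fixes L :: "'a::{real_inner,complete_space} \<Rightarrow>\<^sub>L 'b::real_inner"
  shows "adjoint_blinfun L y \<bullet> x = y \<bullet> L x"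
proof -
  have "\<exists>u. \<forall>x. u \<bullet> x = y \<bullet> L x" for y
    using riesz_subspace[OF bounded_linear_compose[OF bounded_linear_inner_right blinfun.bounded_linear_right] subspace_UNIV closed_UNIV, of y L]
    by (metis UNIV_I)
  then obtain m where m: "\<And>x y. m y \<bullet> x = y \<bullet> L x" by metis
  have "bounded_linear m"
  proof (rule bounded_linear_intro[where K="norm L"])
    show "m (x + y) = m x + m y" for x y
      by (rule inner_eqI) (simp add: m inner_add_left)
    show "m (r *\<^sub>R x) = r *\<^sub>R m x" for r x
      by (rule inner_eqI) (simp add: m)
    show "norm (m y) \<le> norm y * norm L" for y
    proof -
      have "(norm (m y))\<^sup>2 = y \<bullet> L (m y)" using m by (simp add: power2_norm_eq_inner)
      also have "\<dots> \<le> norm y * norm (L (m y))" by (rule norm_cauchy_schwarz)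
      also have "\<dots> \<le> norm y * (norm L * norm (m y))" by (intro mult_left_mono norm_blinfun) auto
      finally show ?thesis by (cases "m y = 0") (auto simp: power2_eq_square)
    qed
  qed
  then have M: "\<forall>x y. Blinfun m y \<bullet> x = y \<bullet> L x" using m by (simp add: bounded_linear_Blinfun_apply)
  then have "\<exists>M :: 'b \<Rightarrow>\<^sub>L 'a. \<forall>x y. M y \<bullet> x = y \<bullet> L x" by blast
  from someI_ex[OF this] show ?thesis unfolding adjoint_blinfun_def by blast
qed

text \<open>Being bounded and linear in operator norm, the passage to the adjoint preserves smooth
  dependence on parameters.\<close>

lemma bounded_linear_adjoint:
  "bounded_linear (adjoint_blinfun :: ('a::{real_inner,complete_space} \<Rightarrow>\<^sub>L 'b::real_inner) \<Rightarrow> _)"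
proof (rule bounded_linear_intro[where K=1])
  fix L M :: "'a \<Rightarrow>\<^sub>L 'b" and r :: real
  show "adjoint_blinfun (L + M) = adjoint_blinfun L + adjoint_blinfun M"
    by (rule blinfun_eqI, rule inner_eqI) (simp add: adjoint_blinfun blinfun.bilinear_simps inner_simps)
  show "adjoint_blinfun (r *\<^sub>R L) = r *\<^sub>R adjoint_blinfun L"
    by (rule blinfun_eqI, rule inner_eqI) (simp add: adjoint_blinfun blinfun.bilinear_simps)
  show "norm (adjoint_blinfun L) \<le> norm L * 1"
  proof (rule norm_blinfun_bound)
    fix y
    have "(norm (adjoint_blinfun L y))\<^sup>2 = y \<bullet> L (adjoint_blinfun L y)"
      by (simp add: power2_norm_eq_inner adjoint_blinfun)
    also have "\<dots> \<le> norm y * norm (L (adjoint_blinfun L y))" by (rule norm_cauchy_schwarz)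
    also have "\<dots> \<le> norm y * (norm L * norm (adjoint_blinfun L y))" by (intro mult_left_mono norm_blinfun) auto
    finally show "norm (adjoint_blinfun L y) \<le> norm L * 1 * norm y"
      by (cases "adjoint_blinfun L y = 0") (auto simp: power2_eq_square mult.commute)
  qed simp
qed

text \<open>The lower bound gives injectivity and a closed range. By symmetry a vector orthogonal to
  the range lies in the kernel, so the range is everything.\<close>

lemma symmetric_bounded_below_inverse:
  fixes S :: "'a::{real_inner,complete_space} \<Rightarrow>\<^sub>L 'a"
  assumes sym: "\<And>x y. S x \<bullet> y = x \<bullet> S y" and c: "c > 0" "\<And>x. c * norm x \<le> norm (S x)"
  obtains R :: "'a \<Rightarrow>\<^sub>L 'a" where "S o\<^sub>L R = id_blinfun" "R o\<^sub>L S = id_blinfun" "norm R \<le> 1 / c"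
proof -
  have inj: "S x = S y \<Longrightarrow> x = y" for x y
    using c(2)[of "x - y"] c(1) by (simp add: blinfun.bilinear_simps mult_le_0_iff)
  have bl: "bounded_linear (blinfun_apply S)" by (rule blinfun.bounded_linear_right)
  have "complete (range S)"
    using c by (intro complete_isometric_image[OF c(1) subspace_UNIV bl _ complete_UNIV]) auto
  then have cl: "closed (range S)" by (rule complete_imp_closed)
  have sub: "subspace (range S)"
    using bounded_linear.linear[OF bl] by (intro linear_subspace_image subspace_UNIV)
  have "\<exists>x. S x = y" for y
  proof -
    obtain u where u: "u \<in> range S" "\<And>v. v \<in> range S \<Longrightarrow> u \<bullet> v = y \<bullet> v"
      using riesz_subspace[OF bounded_linear_inner_right sub cl, of y] by blast
    \<comment> \<open>Here u is the projection of y onto the range, so u - y is orthogonal to S z;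
      symmetry moves S to the other side.\<close>
    have "S (u - y) \<bullet> z = 0" for z using u(2)[of "S z"] by (simp add: sym inner_diff_left)
    then have "S (u - y) = 0" using inner_eq_zero_iff by blast
    then have "u = y" using c(2)[of "u - y"] c(1) by (simp add: mult_le_0_iff)
    then show ?thesis using u(1) by auto
  qed
  then obtain R where R: "\<And>y. S (R y) = y" by metis
  have RS: "R (S x) = x" for x using inj R by blast
  have nR: "norm (R y) \<le> norm y * (1 / c)" for y
    using c(2)[of "R y"] c(1) R by (simp add: field_simps)
  have blR: "bounded_linear R"
    by (rule bounded_linear_intro[OF _ _ nR]) (rule inj, simp add: R blinfun.bilinear_simps)+
  show thesis
  proof (rule that[of "Blinfun R"])
    show "norm (Blinfun R) \<le> 1 / c"
      using nR c(1) by (intro norm_blinfun_bound) (auto simp: bounded_linear_Blinfun_apply[OF blR] mult.commute)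
  qed (auto intro!: blinfun_eqI simp: bounded_linear_Blinfun_apply[OF blR] R RS)
qed

text \<open>Gaussian elimination by induction on the number of equations. This is the dimension
  count behind the min-max comparison, the infinitude of the eigensystem and the uniqueness of
  multiplicities.\<close>

lemma homogeneous_system_nontrivial:
  fixes M :: "nat \<Rightarrow> 'i \<Rightarrow> 'f::field"
  assumes "finite I" "n < card I"
  shows "\<exists>c. (\<exists>j\<in>I. c j \<noteq> 0) \<and> (\<forall>i<n. (\<Sum>j\<in>I. M i j * c j) = 0)"
  using assms
proof (induction n arbitrary: I M)
  case 0
  then obtain j where "j \<in> I" by fastforce
  then show ?case by (intro exI[of _ "\<lambda>_. 1"]) auto
next
  case (Suc n)
  show ?case
  proof (cases "\<forall>j\<in>I. M n j = 0")
    case True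
    obtain c where c: "\<exists>j\<in>I. c j \<noteq> 0" "\<forall>i<n. (\<Sum>j\<in>I. M i j * c j) = 0"
      using Suc.IH[of I M] Suc.prems by auto
    have "(\<Sum>j\<in>I. M n j * c j) = 0" using True by (intro sum.neutral) auto
    with c show ?thesis by (intro exI[of _ c]) (auto simp: less_Suc_eq)
  next
    case False
    then obtain p where p: "p \<in> I" "M n p \<noteq> 0" by blast
    define I' where "I' = I - {p}"
    have I': "finite I'" "I = insert p I'" "p \<notin> I'" "n < card I'"
      using p Suc.prems by (auto simp: I'_def)
    obtain c where c: "\<exists>j\<in>I'. c j \<noteq> 0" "\<And>i. i < n \<Longrightarrow> (\<Sum>j\<in>I'. (M i j - M i p * M n j / M n p) * c j) = 0"
      using Suc.IH[OF I'(1) I'(4), of "\<lambda>i j. M i j - M i p * M n j / M n p"] by blast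
    \<comment> \<open>The value at the pivot p is obtained by solving the last equation for it; the
      other equations were reduced by that substitution.\<close>
    define d where "d = c(p := - (\<Sum>j\<in>I'. M n j * c j) / M n p)"
    have d: "(\<Sum>j\<in>I'. M i j * d j) = (\<Sum>j\<in>I'. M i j * c j)" for i
      using I'(3) by (intro sum.cong) (auto simp: d_def)
    have "(\<Sum>j\<in>I. M i j * d j) = 0" if "i < Suc n" for i
    proof (cases "i = n")
      case True
      then show ?thesis using I' p(2) by (simp add: d) (simp add: d_def)
    next
      case False
      then have "0 = (\<Sum>j\<in>I'. (M i j - M i p * M n j / M n p) * c j)" using c(2)[of i] that by simp
      also have "\<dots> = (\<Sum>j\<in>I'. M i j * c j) - (M i p / M n p) * (\<Sum>j\<in>I'. M n j * c j)"
        unfolding sum_distrib_left sum_subtractf[symmetric] by (intro sum.cong refl) (simp add: algebra_simps)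
      finally have eq: "(\<Sum>j\<in>I'. M i j * c j) = (M i p / M n p) * (\<Sum>j\<in>I'. M n j * c j)" by simp
      have dp: "d p = - (\<Sum>j\<in>I'. M n j * c j) / M n p" by (simp add: d_def)
      show ?thesis unfolding I'(2) sum.insert[OF I'(1,3)] d eq dp by simp
    qed
    moreover have "\<exists>j\<in>I. d j \<noteq> 0" using c(1) I' by (auto simp: d_def)
    ultimately show ?thesis by blast
  qed
qed

text \<open>A complex Hilbert space in real terms: J is multiplication by the imaginary unit, and
  the real inner product is the real part of the hermitian one.\<close>

locale complex_structure =
  fixes J :: "'h::{real_inner,complete_space} \<Rightarrow> 'h"
  assumes J_linear: "bounded_linear J" and J_J: "J (J x) = - x" and J_inner: "J x \<bullet> J y = x \<bullet> y"
begin

lemma J_add: "J (x + y) = J x + J y" and J_scaleR: "J (r *\<^sub>R x) = r *\<^sub>R J x"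
  and J_diff: "J (x - y) = J x - J y" and J_minus: "J (- x) = - J x" and J_0: "J 0 = 0"
  using J_linear by (auto simp: bounded_linear.linear linear_add linear_scale linear_diff linear_neg linear_0)

lemma J_left: "J x \<bullet> y = - (x \<bullet> J y)"
  using J_inner[of x "J y"] by (simp add: J_J)

definition cscale :: "complex \<Rightarrow> 'h \<Rightarrow> 'h" where
  "cscale c x = Re c *\<^sub>R x + Im c *\<^sub>R J x"

lemma cscale_add: "cscale c (x + y) = cscale c x + cscale c y"
  by (simp add: cscale_def J_add scaleR_add_right)

lemma cscale_add_left: "cscale (c + d) x = cscale c x + cscale d x"
  by (simp add: cscale_def algebra_simps)

lemma cscale_cscale: "cscale c (cscale d x) = cscale (c * d) x"
  by (simp add: cscale_def J_add J_scaleR J_J algebra_simps)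

lemma cscale_0 [simp]: "cscale 0 x = 0" "cscale c 0 = 0"
  by (simp_all add: cscale_def J_0)

lemma cscale_sum_left: "cscale (\<Sum>i\<in>I. c i) x = (\<Sum>i\<in>I. cscale (c i) x)"
  by (induction I rule: infinite_finite_induct) (auto simp: cscale_add_left)

end

locale complex_subspace = complex_structure J for J :: "'h::{real_inner,complete_space} \<Rightarrow> 'h" +
  fixes V :: "'h set"
  assumes V_subspace: "subspace V" and V_closed: "closed V" and J_V: "x \<in> V \<Longrightarrow> J x \<in> V"
begin

lemma cscale_V: "x \<in> V \<Longrightarrow> cscale c x \<in> V"
  by (simp add: cscale_def V_subspace J_V subspace_add subspace_scale)

end

text \<open>A and B act on the whole space, but the eigenvalue problem lives on V, where coercivity
  and positivity are imposed. Compactness is phrased through Cauchy sequences for the form of B, so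
  weak convergence never enters. Infinite dimension ensures that the list of eigenvalues does not
  stop.\<close>

locale pencil = complex_subspace J V
  for J :: "'h::{real_inner,complete_space} \<Rightarrow> 'h" and V :: "'h set" +
  fixes A B :: "'h \<Rightarrow>\<^sub>L 'h" and \<gamma> :: real
  assumes A_sym: "A x \<bullet> y = x \<bullet> A y" and B_sym: "B x \<bullet> y = x \<bullet> B y"
    and A_J: "A (J x) = J (A x)" and B_J: "B (J x) = J (B x)"
    and coercive: "\<gamma> > 0" "x \<in> V \<Longrightarrow> \<gamma> * (norm x)\<^sup>2 \<le> A x \<bullet> x"
    and B_pos: "x \<in> V \<Longrightarrow> x \<noteq> 0 \<Longrightarrow> B x \<bullet> x > 0"
    and compact: "(\<And>n::nat. u n \<in> V) \<Longrightarrow> bounded (range u) \<Longrightarrow>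
      \<exists>r::nat\<Rightarrow>nat. strict_mono r \<and> (\<forall>\<epsilon>>0. \<exists>N. \<forall>m\<ge>N. \<forall>n\<ge>N. B (u (r m) - u (r n)) \<bullet> (u (r m) - u (r n)) < \<epsilon>)"
    and infinite_dim: "\<exists>f::nat \<Rightarrow> 'h. (\<forall>i<n. f i \<in> V) \<and> (\<forall>c. (\<Sum>i<n. cscale (c i) (f i)) = 0 \<longrightarrow> (\<forall>i<n. c i = 0))"
begin

abbreviation "a x y \<equiv> A x \<bullet> y"
abbreviation "b x y \<equiv> B x \<bullet> y"

lemma a_simps: "a (x + y) z = a x z + a y z" "a (x - y) z = a x z - a y z" "a (r *\<^sub>R x) z = r * a x z"
    "a z (x + y) = a z x + a z y" "a z (x - y) = a z x - a z y" "a z (r *\<^sub>R x) = r * a z x"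
  and b_simps: "b (x + y) z = b x z + b y z" "b (x - y) z = b x z - b y z" "b (r *\<^sub>R x) z = r * b x z"
    "b z (x + y) = b z x + b z y" "b z (x - y) = b z x - b z y" "b z (r *\<^sub>R x) = r * b z x"
  by (auto simp: blinfun.bilinear_simps inner_simps)

lemma a_commute: "a x y = a y x" and b_commute: "b x y = b y x"
  using A_sym B_sym by (auto simp: inner_commute)

lemma a_J: "a (J x) y = - a x (J y)" "a (J x) (J y) = a x y" "a x (J x) = 0"
  and b_J: "b (J x) y = - b x (J y)" "b (J x) (J y) = b x y" "b x (J x) = 0"
proof -
  show *: "a (J x) y = - a x (J y)" "b (J x) y = - b x (J y)" for x y
    by (simp_all add: A_J B_J J_left)
  show "a (J x) (J y) = a x y" "b (J x) (J y) = b x y" by (simp_all add: A_J B_J J_inner)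
  show "a x (J x) = 0" "b x (J x) = 0"
    using *[of x x] a_commute[of "J x" x] b_commute[of "J x" x] by auto
qed

lemma b_nonneg: "x \<in> V \<Longrightarrow> b x x \<ge> 0"
  using B_pos[of x] by (cases "x = 0") (auto simp: blinfun.bilinear_simps)

text \<open>The hermitian form with real part \<open>b\<close>, complex linear in its first
  argument.\<close>

definition bc :: "'h \<Rightarrow> 'h \<Rightarrow> complex" where
  "bc x y = Complex (b x y) (b x (J y))"

lemma bc_add: "bc (x + y) z = bc x z + bc y z" and bc_diff: "bc (x - y) z = bc x z - bc y z"
  by (simp_all add: bc_def b_simps complex_eq_iff)

lemma bc_cscale: "bc (cscale c x) z = c * bc x z"
  by (simp add: bc_def cscale_def b_simps b_J complex_eq_iff J_J)

lemma bc_cnj: "bc y x = cnj (bc x y)"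
  using b_J(1)[of x y] by (simp add: bc_def complex_eq_iff b_commute[of y])

lemma bc_0 [simp]: "bc 0 z = 0"
  by (simp add: bc_def complex_eq_iff blinfun.bilinear_simps)

lemma bc_sum: "bc (\<Sum>i\<in>I. f i) z = (\<Sum>i\<in>I. bc (f i) z)"
  by (induction I rule: infinite_finite_induct) (auto simp: bc_add)

lemma b_cscale: "b (cscale c x) y = Re (c * bc x y)"
  using bc_cscale[of c x y] by (simp add: bc_def complex_eq_iff)

text \<open>The direct method with strong convergence only. For a minimising sequence normalised in
  b, the parallelogram law bounds the a-form of differences by an error plus m times their b-form.
  Compactness makes the latter small along a subsequence, and coercivity turns this into norm
  convergence.\<close>

lemma minimizer_exists:
  assumes X: "subspace X" "closed X" "X \<subseteq> V" and "\<exists>x\<in>X. x \<noteq> 0"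
  obtains e where "e \<in> X" "b e e = 1" "\<And>x. x \<in> X \<Longrightarrow> a e e * b x x \<le> a x x"
proof -
  define S where "S = (\<lambda>x. a x x) ` {x\<in>X. b x x = 1}"
  have a0: "a x x \<ge> 0" if "x \<in> V" for x
    using coercive(2)[OF that] coercive(1) by (meson mult_nonneg_nonneg order_trans less_imp_le zero_le_power2)
  have bdd: "bdd_below S" using a0 X(3) by (auto simp: S_def intro!: bdd_belowI[of _ 0])
  define m where "m = Inf S"
  have normalize: "b ((1 / sqrt (b x x)) *\<^sub>R x) ((1 / sqrt (b x x)) *\<^sub>R x) = 1"
    "a ((1 / sqrt (b x x)) *\<^sub>R x) ((1 / sqrt (b x x)) *\<^sub>R x) = a x x / b x x" if "b x x > 0" for x
    using that by (simp_all add: a_simps b_simps)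
  have m_le: "m * b x x \<le> a x x" if x: "x \<in> X" for x
  proof (cases "x = 0")
    case False
    then have b: "b x x > 0" using B_pos x X(3) by auto
    have "a x x / b x x \<in> S"
      unfolding S_def using normalize[OF b] x X(1)
      by (intro image_eqI[of _ _ "(1 / sqrt (b x x)) *\<^sub>R x"]) (auto simp: subspace_scale)
    then have "m \<le> a x x / b x x" unfolding m_def using bdd by (intro cInf_lower)
    then show ?thesis using b by (simp add: field_simps)
  qed (simp add: blinfun.bilinear_simps)
  have ne: "S \<noteq> {}"
  proof -
    obtain x where x: "x \<in> X" "x \<noteq> 0" using assms(4) by blast
    then have b: "b x x > 0" using B_pos X(3) by auto
    have "a x x / b x x \<in> S"
      unfolding S_def using normalize[OF b] x X(1)
      by (intro image_eqI[of _ _ "(1 / sqrt (b x x)) *\<^sub>R x"]) (auto simp: subspace_scale)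
    then show ?thesis by blast
  qed
  have m0: "m \<ge> 0" unfolding m_def using ne a0 X(3) by (intro cInf_greatest) (auto simp: S_def)
  have "\<exists>u. u \<in> X \<and> b u u = 1 \<and> a u u < m + 1 / Suc n" for n
  proof -
    have "\<exists>y\<in>S. y < m + 1 / Suc n"
      unfolding m_def by (subst cInf_less_iff[OF ne bdd, symmetric]) (auto simp: m_def[symmetric])
    then show ?thesis by (auto simp: S_def)
  qed
  then obtain u where u: "\<And>n. u n \<in> X" "\<And>n. b (u n) (u n) = 1" "\<And>n. a (u n) (u n) < m + 1 / Suc n" by metis
  have uV: "u n \<in> V" for n using u(1) X(3) by auto
  have "bounded (range u)"
  proof (rule boundedI)
    fix x assume "x \<in> range u"
    then obtain n where n: "x = u n" by auto
    have "\<gamma> * (norm (u n))\<^sup>2 \<le> m + 1 / Suc n" using coercive(2)[OF uV[of n]] u(3)[of n] by simp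
    also have "\<dots> \<le> m + 1" by simp
    finally have "(norm (u n))\<^sup>2 \<le> (m + 1) / \<gamma>" using coercive(1) by (simp add: field_simps)
    then show "norm x \<le> sqrt ((m + 1) / \<gamma>)" unfolding n by (rule real_le_rsqrt)
  qed
  then obtain r :: "nat \<Rightarrow> nat" where r: "strict_mono r"
    "\<And>\<epsilon>. \<epsilon> > 0 \<Longrightarrow> \<exists>N. \<forall>m\<ge>N. \<forall>n\<ge>N. b (u (r m) - u (r n)) (u (r m) - u (r n)) < \<epsilon>"
    using compact[of u] uV by blast
  define v where "v = u \<circ> r"
  have v: "v n \<in> X" "b (v n) (v n) = 1" "a (v n) (v n) < m + 1 / Suc n" for n
  proof -
    have "1 / real (Suc (r n)) \<le> 1 / real (Suc n)"
      using strict_mono_imp_increasing[OF r(1), of n] by (simp add: frac_le)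
    then show "a (v n) (v n) < m + 1 / Suc n" using u(3)[of "r n"] by (simp add: v_def)
  qed (auto simp: v_def u)
  have twice: "2 / real (Suc n) = 2 * (1 / Suc n)" for n by simp
  \<comment> \<open>From a(vi - vj) = 2a(vi) + 2a(vj) - a(vi + vj), the bound a >= m b for the sum,
    and b(vi + vj) = 4 - b(vi - vj).\<close>
  have close: "\<gamma> * (norm (v i - v j))\<^sup>2 \<le> 2 / Suc i + 2 / Suc j + m * b (v i - v j) (v i - v j)" for i j
  proof -
    have "v i - v j \<in> V" "v i + v j \<in> X" using v(1) X by (auto simp: subspace_diff subspace_add)
    then have "\<gamma> * (norm (v i - v j))\<^sup>2 \<le> a (v i - v j) (v i - v j)" "m * b (v i + v j) (v i + v j) \<le> a (v i + v j) (v i + v j)"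
      using coercive(2) m_le by auto
    moreover have "a (v i - v j) (v i - v j) = 2 * a (v i) (v i) + 2 * a (v j) (v j) - a (v i + v j) (v i + v j)"
      by (simp add: a_simps)
    moreover have "b (v i + v j) (v i + v j) = 4 - b (v i - v j) (v i - v j)"
      by (simp add: b_simps v(2))
    then have "m * b (v i + v j) (v i + v j) = 4 * m - m * b (v i - v j) (v i - v j)"
      by (simp only: right_diff_distrib mult.commute)
    ultimately show ?thesis using v(3)[of i] v(3)[of j] twice[of i] twice[of j] by linarith
  qed
  have "Cauchy v"
  proof (rule metric_CauchyI)
    fix e :: real assume e: "e > 0"
    define \<epsilon> where "\<epsilon> = \<gamma> * e\<^sup>2"
    have \<epsilon>: "\<epsilon> > 0" using e coercive(1) by (simp add: \<epsilon>_def)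
    obtain N1 where N1: "inverse (real (Suc N1)) < \<epsilon> / 8" using reals_Archimedean[of "\<epsilon> / 8"] \<epsilon> by auto
    \<comment> \<open>The denominator has m + 1 because m is only known to be nonnegative.\<close>
    obtain N2 where N2: "\<And>i j. i \<ge> N2 \<Longrightarrow> j \<ge> N2 \<Longrightarrow> b (v i - v j) (v i - v j) < \<epsilon> / (2 * (m + 1))"
      using r(2)[of "\<epsilon> / (2 * (m + 1))"] m0 \<epsilon> by (auto simp: v_def)
    have "dist (v i) (v j) < e" if ij: "i \<ge> max N1 N2" "j \<ge> max N1 N2" for i j
    proof -
      have "1 / real (Suc i) \<le> inverse (real (Suc N1))" "1 / real (Suc j) \<le> inverse (real (Suc N1))"
        using ij by (auto simp: field_simps)
      moreover have "m * b (v i - v j) (v i - v j) \<le> m * (\<epsilon> / (2 * (m + 1)))"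
        using N2[of i j] ij m0 by (intro mult_left_mono) auto
      moreover have "m * (\<epsilon> / (2 * (m + 1))) \<le> \<epsilon> / 2"
        using m0 \<epsilon> by (simp add: field_simps)
      ultimately have "\<gamma> * (norm (v i - v j))\<^sup>2 < \<gamma> * e\<^sup>2"
        using close[of i j] N1 twice[of i] twice[of j] unfolding \<epsilon>_def[symmetric] by linarith
      then have "(norm (v i - v j))\<^sup>2 < e\<^sup>2" using coercive(1) by simp
      then show ?thesis using e by (auto simp: dist_norm intro: power2_less_imp_less)
    qed
    then show "\<exists>M. \<forall>m\<ge>M. \<forall>n\<ge>M. dist (v m) (v n) < e" by blast
  qed
  then obtain e where e: "v \<longlonglongrightarrow> e" using Cauchy_convergent convergent_def by blast
  have lim: "(\<lambda>n. a (v n) (v n)) \<longlonglongrightarrow> a e e" "(\<lambda>n. b (v n) (v n)) \<longlonglongrightarrow> b e e"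
    by (intro tendsto_inner e blinfun.tendsto tendsto_const)+
  have "b e e = 1" using lim(2) v(2) by (simp add: LIMSEQ_const_iff)
  moreover have eX: "e \<in> X" using closed_sequentially[OF X(2) _ e] v(1) by blast
  moreover have "a e e \<le> m"
  proof -
    have "(\<lambda>n. m + 1 / real (Suc n)) \<longlonglongrightarrow> m + 0"
      by (intro tendsto_add tendsto_const LIMSEQ_Suc[OF lim_1_over_n])
    from LIMSEQ_le[OF lim(1) this] v(3) show ?thesis by (auto intro: less_imp_le)
  qed
  ultimately show thesis
    using that[of e] m_le b_nonneg X(3) by (meson mult_right_mono order_trans subsetD)
qed

text \<open>First variation at the minimiser. Test vectors are limited to X here; the extension to
  all of V takes a separate argument.\<close>

lemma minimizer_eigen:
  assumes X: "subspace X" and e: "e \<in> X" "b e e = 1" "\<And>x. x \<in> X \<Longrightarrow> a e e * b x x \<le> a x x" and x: "x \<in> X"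
  shows "a e x = a e e * b e x"
proof -
  have "2 * t * (a e x - a e e * b e x) + t\<^sup>2 * (a x x - a e e * b x x) \<ge> 0" for t
  proof -
    have "e + t *\<^sub>R x \<in> X" using X e(1) x by (simp add: subspace_add subspace_scale)
    from e(3)[OF this] show ?thesis
      by (simp add: a_simps b_simps e(2) a_commute[of x e] b_commute[of x e] power2_eq_square algebra_simps)
  qed
  then have "a e x - a e e * b e x = 0" by (rule linear_coeff_zero)
  then show ?thesis by simp
qed

end

section \<open>Eigensystems by successive minimisation\<close>

context pencil begin

text \<open>The last condition, the minimum principle for the Rayleigh quotient, makes the eigenvalues
  increasing and the system complete.\<close>

definition eigensystem :: "(nat \<Rightarrow> 'h) \<Rightarrow> (nat \<Rightarrow> real) \<Rightarrow> bool" where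
  "eigensystem e s \<longleftrightarrow> (\<forall>k. e k \<in> V \<and> (\<forall>j. bc (e j) (e k) = (if j = k then 1 else 0)) \<and>
     (\<forall>x\<in>V. a (e k) x = s k * b (e k) x) \<and>
     (\<forall>x\<in>V. (\<forall>j<k. bc x (e j) = 0) \<longrightarrow> s k * b x x \<le> a x x))"

lemma bc_self: "bc x x = complex_of_real (b x x)"
  by (simp add: bc_def complex_eq_iff b_J)

lemma eigen_cscale:
  assumes "\<And>x. x \<in> V \<Longrightarrow> a e x = s * b e x" "x \<in> V"
  shows "a (cscale c e) x = s * b (cscale c e) x"
  using assms(1)[of x] assms(1)[of "J x"] assms(2) J_V
  by (simp add: cscale_def a_simps b_simps a_J b_J algebra_simps)

text \<open>At stage k the Rayleigh quotient is minimised on the b-orthogonal complement X of the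
  vectors found so far. This gives the eigenvalue equation against X only; against the earlier
  eigenvectors both sides vanish, so it holds against V.\<close>

lemma eigensystem_exists: "\<exists>e s. eigensystem e s"
proof -
  \<comment> \<open>The condition at stage k involves only the values of f below k, as the
    well-founded choice principle requires.\<close>
  define P where "P f k r \<longleftrightarrow> r \<in> V \<and> b r r = 1 \<and> (\<forall>j<k. bc r (f j) = 0) \<and>
     (\<forall>x\<in>V. a r x = a r r * b r x) \<and> (\<forall>x\<in>V. (\<forall>j<k. bc x (f j) = 0) \<longrightarrow> a r r * b x x \<le> a x x)"
    for f :: "nat \<Rightarrow> 'h" and k r
  have "\<exists>e. \<forall>k. P e k (e k)"
  proof (rule dependent_wf_choice[of less_than])
    show "P f k r = P g k r" if "\<And>z. (z, k) \<in> less_than \<Longrightarrow> f z = g z" for f g k r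
      using that by (simp add: P_def)
    fix k f assume prev: "\<And>y. (y, k) \<in> less_than \<Longrightarrow> P f y (f y)"
    then have f: "j < k \<Longrightarrow> P f j (f j)" for j by simp
    define X where "X = {x\<in>V. \<forall>j<k. bc x (f j) = 0}"
    have X: "subspace X"
      using V_subspace unfolding X_def bc_def complex_eq_iff
      by (auto simp: subspace_def b_simps blinfun.bilinear_simps inner_add_left)
    have "closed {x. bc x (f j) = 0}" for j
      unfolding bc_def complex_eq_iff by (simp, intro closed_Collect_conj closed_Collect_eq continuous_on_inner continuous_on_const
          linear_continuous_on blinfun.bounded_linear_right)
    then have "closed (V \<inter> (\<Inter>j\<in>{..<k}. {x. bc x (f j) = 0}))"
      using V_closed by (intro closed_Int closed_INT) auto
    also have "V \<inter> (\<Inter>j\<in>{..<k}. {x. bc x (f j) = 0}) = X" by (auto simp: X_def)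
    finally have clX: "closed X" .
    have XV: "X \<subseteq> V" by (auto simp: X_def)
    \<comment> \<open>Among k + 1 independent vectors some nontrivial combination meets the k
      orthogonality conditions, so X is not zero.\<close>
    obtain g where g: "\<forall>i<Suc k. g i \<in> V" "\<And>c. (\<Sum>i<Suc k. cscale (c i) (g i)) = 0 \<Longrightarrow> \<forall>i<Suc k. c i = 0"
      using infinite_dim[of "Suc k"] by blast
    obtain c where c: "\<exists>j<Suc k. c j \<noteq> 0" "\<forall>i<k. (\<Sum>j<Suc k. bc (g j) (f i) * c j) = 0"
      using homogeneous_system_nontrivial[of "{..<Suc k}" k "\<lambda>i j. bc (g j) (f i)"] by auto
    define y where "y = (\<Sum>i<Suc k. cscale (c i) (g i))"
    have "y \<noteq> 0" using g(2)[of c] c(1) unfolding y_def by metis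
    moreover have "y \<in> V" unfolding y_def using g(1) by (intro subspace_sum V_subspace cscale_V) auto
    moreover have "bc y (f i) = 0" if "i < k" for i
      using c(2) that unfolding y_def bc_sum bc_cscale by (simp only: mult.commute)
    ultimately have "\<exists>y\<in>X. y \<noteq> 0" by (auto simp: X_def)
    from minimizer_exists[OF X clX XV this] obtain r where
      r: "r \<in> X" "b r r = 1" "\<And>x. x \<in> X \<Longrightarrow> a r r * b x x \<le> a x x" by blast
    have "a r x = a r r * b r x" if x: "x \<in> V" for x
    proof -
      \<comment> \<open>z is the b-orthogonal projection of x onto the earlier eigenvectors. Then x
        - z lies in X, while z is orthogonal to r for both forms.\<close>
      define z where "z = (\<Sum>j<k. cscale (bc x (f j)) (f j))"
      have orth: "bc (f i) (f j) = (if i = j then 1 else 0)" if "i < k" "j < k" for i j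
      proof -
        consider "i < j" | "j < i" | "i = j" by linarith
        then show ?thesis
        proof cases
          case 1
          then show ?thesis using f[OF that(2)] bc_cnj[of "f i" "f j"] by (auto simp: P_def)
        next
          case 2
          then show ?thesis using f[OF that(1)] by (auto simp: P_def)
        next
          case 3
          then show ?thesis using f[OF that(1)] by (auto simp: P_def bc_self)
        qed
      qed
      have zV: "z \<in> V" unfolding z_def using f by (intro subspace_sum V_subspace cscale_V) (auto simp: P_def)
      have "bc (x - z) (f i) = 0" if "i < k" for i
      proof -
        have "bc z (f i) = (\<Sum>j<k. bc x (f j) * (if j = i then 1 else 0))"
          unfolding z_def bc_sum bc_cscale using orth that by (intro sum.cong) auto
        also have "\<dots> = bc x (f i)" using that by (simp add: if_distrib cong: if_cong)
        finally show ?thesis by (simp add: bc_diff)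
      qed
      then have "x - z \<in> X" using x zV V_subspace by (auto simp: X_def subspace_diff)
      then have "a r (x - z) = a r r * b r (x - z)" using minimizer_eigen[OF X r(1,2) _ ] r(3) by blast
      moreover have zr: "a z r = 0 \<and> b z r = 0"
      proof -
        have "a (cscale (bc x (f j)) (f j)) r = 0 \<and> b (cscale (bc x (f j)) (f j)) r = 0" if "j < k" for j
        proof -
          have "bc (f j) r = 0" using r(1) that bc_cnj[of r "f j"] by (simp add: X_def)
          then have b0: "b (cscale (bc x (f j)) (f j)) r = 0" by (simp add: b_cscale)
          moreover have "a (cscale (bc x (f j)) (f j)) r = a (f j) (f j) * b (cscale (bc x (f j)) (f j)) r"
            using f[OF that] r(1) XV eigen_cscale[of "f j" "a (f j) (f j)" r] unfolding P_def by blast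
          ultimately show ?thesis by simp
        qed
        then show ?thesis
          unfolding z_def by (auto simp: blinfun.sum_right inner_sum_left intro!: sum.neutral)
      qed
      ultimately show ?thesis using a_commute[of r z] b_commute[of r z] by (simp add: a_simps b_simps)
    qed
    with r show "\<exists>r. P f k r" unfolding P_def X_def by blast
  qed simp
  then obtain e where e: "\<And>k. P e k (e k)" by blast
  have "bc (e j) (e k) = (if j = k then 1 else 0)" for j k
  proof -
    consider "k < j" | "j < k" | "j = k" by linarith
    then show ?thesis
    proof cases
      case 1
      then show ?thesis using e[of j] unfolding P_def by auto
    next
      case 2
      then show ?thesis using e[of k] bc_cnj[of "e j" "e k"] unfolding P_def by auto
    next
      case 3
      then show ?thesis using e[of k] by (auto simp: P_def bc_self)
    qed
  qed
  then have "eigensystem e (\<lambda>k. a (e k) (e k))" using e unfolding eigensystem_def P_def by blast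
  then show ?thesis by blast
qed

context
  fixes e s assumes es: "eigensystem e s"
begin

lemma eig_V: "e k \<in> V" and eig_orth: "bc (e j) (e k) = (if j = k then 1 else 0)"
  and eig_eq: "x \<in> V \<Longrightarrow> a (e k) x = s k * b (e k) x"
  and eig_min: "x \<in> V \<Longrightarrow> (\<And>j. j < k \<Longrightarrow> bc x (e j) = 0) \<Longrightarrow> s k * b x x \<le> a x x"
  using es by (auto simp: eigensystem_def)

lemma eig_b: "b (e k) (e k) = 1"
  using eig_orth[of k k] by (simp add: bc_self complex_eq_iff)

lemma eig_a: "a (e k) (e k) = s k"
  using eig_eq[OF eig_V, of k k] eig_b by simp

lemma eig_mono: "j \<le> k \<Longrightarrow> s j \<le> s k"
  using eig_min[of "e k" j] eig_V eig_b eig_a eig_orth by (simp add: less_le_trans)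

lemma eig_pos: "s k > 0"
proof -
  have "e k \<noteq> 0" using eig_b[of k] by (auto simp: blinfun.bilinear_simps)
  then have "\<gamma> * (norm (e k))\<^sup>2 > 0" using coercive(1) by simp
  then show ?thesis using coercive(2)[OF eig_V, of k] eig_a[of k] by simp
qed

text \<open>If the eigenvalues stayed bounded, coercivity would bound the eigenvectors in norm, and
  some subsequence would be Cauchy for b. But for distinct b-orthonormal vectors the b-form of the
  difference is 2.\<close>

lemma eig_at_top: "filterlim s at_top sequentially"
  unfolding filterlim_at_top eventually_sequentially
proof
  fix Z
  show "\<exists>N. \<forall>n\<ge>N. Z \<le> s n"
  proof (rule ccontr)
    assume "\<nexists>N. \<forall>n\<ge>N. Z \<le> s n"
    then have sZ: "s k < Z" for k
    proof -
      obtain n where "n \<ge> k" "\<not> Z \<le> s n" using \<open>\<nexists>N. \<forall>n\<ge>N. Z \<le> s n\<close> by blast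
      with eig_mono[of k n] show ?thesis by linarith
    qed
    have "norm (e k) \<le> sqrt (Z / \<gamma>)" for k
    proof -
      have "\<gamma> * (norm (e k))\<^sup>2 \<le> Z" using coercive(2)[OF eig_V, of k] eig_a[of k] sZ[of k] by simp
      then have "(norm (e k))\<^sup>2 \<le> Z / \<gamma>" using coercive(1) by (simp add: field_simps)
      then show ?thesis by (rule real_le_rsqrt)
    qed
    then have "bounded (range e)" by (auto intro: boundedI)
    then obtain r :: "nat \<Rightarrow> nat" where r: "strict_mono r"
      "\<And>\<epsilon>. \<epsilon> > 0 \<Longrightarrow> \<exists>N. \<forall>m\<ge>N. \<forall>n\<ge>N. b (e (r m) - e (r n)) (e (r m) - e (r n)) < \<epsilon>"
      using compact[of e] eig_V by blast
    obtain N where N: "\<And>m n. m \<ge> N \<Longrightarrow> n \<ge> N \<Longrightarrow> b (e (r m) - e (r n)) (e (r m) - e (r n)) < 1"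
      using r(2)[of 1] by auto
    have "r N \<noteq> r (Suc N)" using r(1) by (simp add: strict_mono_eq)
    then have "b (e (r N)) (e (r (Suc N))) = 0" "b (e (r (Suc N))) (e (r N)) = 0"
      using eig_orth[of "r N" "r (Suc N)"] eig_orth[of "r (Suc N)" "r N"] by (auto simp: bc_def complex_eq_iff)
    then have "b (e (r N) - e (r (Suc N))) (e (r N) - e (r (Suc N))) = 2"
      by (simp add: b_simps eig_b)
    then show False using N[of N "Suc N"] by simp
  qed
qed

lemma eig_finite: "finite {j. s j = \<mu>}"
proof -
  obtain N where N: "\<And>n. n \<ge> N \<Longrightarrow> \<mu> + 1 \<le> s n"
    using eig_at_top unfolding filterlim_at_top eventually_sequentially by blast
  have "{j. s j = \<mu>} \<subseteq> {..<N}"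
  proof
    fix j assume "j \<in> {j. s j = \<mu>}"
    then show "j \<in> {..<N}" using N[of j] by (cases "j < N") auto
  qed
  then show ?thesis using finite_subset by blast
qed

text \<open>The difference between x and the sum is again a solution and is orthogonal to all
  eigenvectors. By the minimum principle its Rayleigh quotient, which is \<mu>, would dominate every
  eigenvalue, but these are unbounded.\<close>

lemma eig_complete:
  assumes x: "x \<in> V" "\<And>y. y \<in> V \<Longrightarrow> a x y = \<mu> * b x y"
  shows "x = (\<Sum>j | s j = \<mu>. cscale (bc x (e j)) (e j))"
proof -
  define z where "z = (\<Sum>j | s j = \<mu>. cscale (bc x (e j)) (e j))"
  have zV: "z \<in> V" unfolding z_def by (intro subspace_sum V_subspace cscale_V eig_V)
  have z_eig: "a z y = \<mu> * b z y" if y: "y \<in> V" for y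
  proof -
    have "a (cscale (bc x (e j)) (e j)) y = s j * b (cscale (bc x (e j)) (e j)) y" for j
      by (rule eigen_cscale[OF eig_eq y])
    then show ?thesis
      unfolding z_def by (simp add: blinfun.sum_right inner_sum_left sum_distrib_left)
  qed
  have "bc (x - z) (e i) = 0" for i
  proof (cases "s i = \<mu>")
    case True
    have "bc z (e i) = (\<Sum>j | s j = \<mu>. if j = i then bc x (e j) else 0)"
      unfolding z_def bc_sum bc_cscale by (intro sum.cong) (auto simp: eig_orth)
    also have "\<dots> = bc x (e i)" using True eig_finite by (simp add: sum.delta)
    finally show ?thesis by (simp add: bc_diff)
  next
    case False
    have "(\<mu> - s i) * b y (e i) = 0" if y: "y \<in> V" "\<And>w. w \<in> V \<Longrightarrow> a y w = \<mu> * b y w" for y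
      using y(2)[OF eig_V, of i] eig_eq[OF y(1), of i] a_commute[of y "e i"] b_commute[of y "e i"] by (auto simp: algebra_simps)
    then have *: "b y (e i) = 0" if y: "y \<in> V" "\<And>w. w \<in> V \<Longrightarrow> a y w = \<mu> * b y w" for y
      using y False by simp
    have xz: "x - z \<in> V" "\<And>w. w \<in> V \<Longrightarrow> a (x - z) w = \<mu> * b (x - z) w"
      using x zV z_eig by (auto simp: subspace_diff V_subspace a_simps b_simps algebra_simps)
    \<comment> \<open>Applying the real statement to J(x - z), which solves the same equation,
      supplies the imaginary part.\<close>
    have "b (J (x - z)) (e i) = 0"
      using xz J_V by (intro *) (auto simp: a_J b_J)
    then show ?thesis using *[OF xz] b_J(1)[of "x - z" "e i"] by (simp add: bc_def complex_eq_iff)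
  qed
  then have le: "s k * b (x - z) (x - z) \<le> a (x - z) (x - z)" for k
    using x(1) zV by (intro eig_min) (auto simp: subspace_diff V_subspace)
  have "x - z = 0"
  proof (rule ccontr)
    assume "x - z \<noteq> 0"
    moreover have xzV: "x - z \<in> V" using x(1) zV by (simp add: subspace_diff V_subspace)
    ultimately have pos: "b (x - z) (x - z) > 0" using B_pos by blast
    have "a (x - z) (x - z) = \<mu> * b (x - z) (x - z)"
      using x(2)[OF xzV] z_eig[OF xzV] by (simp add: a_simps(2) b_simps(2) right_diff_distrib)
    then have "s k \<le> \<mu>" for k using le[of k] pos by simp
    moreover obtain N where "\<mu> + 1 \<le> s N"
      using eig_at_top unfolding filterlim_at_top eventually_sequentially by blast
    ultimately show False by (metis add_le_same_cancel1 not_one_le_zero order_trans)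
  qed
  then show ?thesis by (simp add: z_def)
qed

lemma eig_combination:
  assumes "finite I"
  shows "bc (\<Sum>j\<in>I. cscale (c j) (e j)) (e i) = (if i \<in> I then c i else 0)"
proof -
  have "bc (\<Sum>j\<in>I. cscale (c j) (e j)) (e i) = (\<Sum>j\<in>I. if j = i then c j else 0)"
    unfolding bc_sum bc_cscale by (intro sum.cong) (auto simp: eig_orth)
  then show ?thesis using assms by (simp add: sum.delta)
qed

lemma eig_span_upper:
  assumes x: "x = (\<Sum>j\<le>k. cscale (c j) (e j))"
  shows "a x x \<le> s k * b x x" "b x x = (\<Sum>j\<le>k. (cmod (c j))\<^sup>2)"
proof -
  have xV: "x \<in> V" unfolding x by (intro subspace_sum V_subspace cscale_V eig_V)
  have bj: "b (cscale (c j) (e j)) x = (cmod (c j))\<^sup>2" if "j \<le> k" for j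
  proof -
    have "bc x (e j) = c j" unfolding x using eig_combination[of "{..k}" c j] that by simp
    then have "bc (e j) x = cnj (c j)" using bc_cnj by metis
    then show ?thesis
      by (simp add: b_cscale complex_mult_cnj cmod_power2)
  qed
  show bx: "b x x = (\<Sum>j\<le>k. (cmod (c j))\<^sup>2)"
  proof -
    have "b x x = (\<Sum>j\<le>k. b (cscale (c j) (e j)) x)"
      by (subst x) (simp add: blinfun.sum_right inner_sum_left)
    then show ?thesis using bj by simp
  qed
  have "a x x = (\<Sum>j\<le>k. a (cscale (c j) (e j)) x)"
    by (subst x) (simp add: blinfun.sum_right inner_sum_left)
  also have "\<dots> = (\<Sum>j\<le>k. s j * (cmod (c j))\<^sup>2)"
    using eigen_cscale[OF eig_eq xV] bj by simp
  also have "\<dots> \<le> (\<Sum>j\<le>k. s k * (cmod (c j))\<^sup>2)"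
    using eig_mono by (intro sum_mono mult_right_mono) auto
  finally show "a x x \<le> s k * b x x" by (simp add: bx sum_distrib_left)
qed

end

end

text \<open>The min-max principle in comparative form. The span of the first k + 1 eigenvectors of
  one pencil contains a nonzero vector orthogonal to the first k of the other; evaluating both
  quotients there compares the eigenvalues. The hypothesis on quotients is written with products to
  avoid divisions.\<close>

lemma eigenvalue_comparison:
  fixes A B A' B' :: "'h::{real_inner,complete_space} \<Rightarrow>\<^sub>L 'h"
  assumes "pencil J V A B \<gamma>" "pencil J V A' B' \<gamma>'"
    and e: "pencil.eigensystem J V A B e s" and e': "pencil.eigensystem J V A' B' e' s'"
    and C: "C \<ge> 0" "\<And>x. x \<in> V \<Longrightarrow> (A' x \<bullet> x) * (B x \<bullet> x) \<le> C * (A x \<bullet> x) * (B' x \<bullet> x)"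
  shows "s' k \<le> C * s k"
proof -
  interpret P: pencil J V A B \<gamma> by fact
  interpret P': pencil J V A' B' \<gamma>' by fact
  obtain c where c: "\<exists>j\<le>k. c j \<noteq> 0" "\<forall>i<k. (\<Sum>j\<le>k. P'.bc (e j) (e' i) * c j) = 0"
    using homogeneous_system_nontrivial[of "{..k}" k "\<lambda>i j. P'.bc (e j) (e' i)"] by auto
  define x where "x = (\<Sum>j\<le>k. P.cscale (c j) (e j))"
  have xV: "x \<in> V" unfolding x_def by (intro subspace_sum P.V_subspace P.cscale_V P.eig_V[OF e])
  have "P'.bc x (e' i) = 0" if "i < k" for i
    using c(2) that unfolding x_def P'.bc_sum P'.bc_cscale by (simp only: mult.commute)
  then have 1: "s' k * (B' x \<bullet> x) \<le> A' x \<bullet> x" using P'.eig_min[OF e' xV] by blast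
  have 2: "A x \<bullet> x \<le> s k * (B x \<bullet> x)" and bx: "B x \<bullet> x = (\<Sum>j\<le>k. (cmod (c j))\<^sup>2)"
    using P.eig_span_upper[OF e x_def] by auto
  have pos: "B x \<bullet> x > 0"
    unfolding bx using c(1) by (intro sum_pos2[of _ "SOME j. j \<le> k \<and> c j \<noteq> 0"]) (auto dest!: someI_ex)
  then have "x \<noteq> 0" by (auto simp: blinfun.bilinear_simps)
  then have pos': "B' x \<bullet> x > 0" using P'.B_pos xV by blast
  have "s' k * (B' x \<bullet> x) * (B x \<bullet> x) \<le> (A' x \<bullet> x) * (B x \<bullet> x)"
    using 1 pos by (intro mult_right_mono) auto
  also have "\<dots> \<le> C * (A x \<bullet> x) * (B' x \<bullet> x)" by (rule C(2)[OF xV])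
  also have "\<dots> \<le> C * (s k * (B x \<bullet> x)) * (B' x \<bullet> x)"
    using 2 C(1) pos' by (intro mult_right_mono mult_left_mono) auto
  finally have "(s' k - C * s k) * ((B x \<bullet> x) * (B' x \<bullet> x)) \<le> 0" by (simp add: algebra_simps)
  moreover have "(B x \<bullet> x) * (B' x \<bullet> x) > 0" using pos pos' by simp
  ultimately have "s' k - C * s k \<le> 0" by (meson mult_pos_pos not_le)
  then show ?thesis by simp
qed

text \<open>Existence and continuity of g are given, so only the differentiation step of the
  implicit function theorem remains.\<close>

lemma implicit_has_derivative:
  fixes F :: "'a::real_normed_vector \<times> real \<Rightarrow> real" and g :: "'a \<Rightarrow> real"
  assumes F: "(F has_derivative L) (at (p, g p))" and g: "isCont g p"
    and zero: "\<forall>\<^sub>F q in nhds p. F (q, g q) = 0" and nz: "L (0, 1) \<noteq> 0"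
  shows "(g has_derivative (\<lambda>v. - L (v, 0) / L (0, 1))) (at p)"
proof -
  interpret L: bounded_linear L using F by (rule has_derivative_bounded_linear)
  obtain K where K: "K > 0" "\<And>x. \<bar>L x\<bar> \<le> norm x * K" using L.pos_bounded by auto
  define l where "l = L (0, 1)"
  have l: "\<bar>l\<bar> > 0" using nz by (simp add: l_def)
  have L_split: "L (v, t) = L (v, 0) + l * t" for v t
  proof -
    have "L (v, t) = L ((v, 0) + t *\<^sub>R (0, 1))" by simp
    then show ?thesis unfolding L.add L.scaleR l_def by (simp add: mult.commute)
  qed
  have F0: "F (p, g p) = 0" using zero eventually_nhds_x_imp_x by fast
  have bl: "bounded_linear (\<lambda>v. - L (v, 0) / l)"
  proof -
    have "bounded_linear (\<lambda>v. (v, 0::real))" by (intro bounded_linear_Pair bounded_linear_ident bounded_linear_zero)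
    from bounded_linear_compose[OF L.bounded_linear this] have "bounded_linear (\<lambda>v. (- 1 / l) * L (v, 0))"
      by (rule bounded_linear_const_mult)
    then show ?thesis by simp
  qed
  show ?thesis
    unfolding has_derivative_at_alt l_def[symmetric]
  proof (intro conjI bl allI impI)
    fix e :: real assume e: "e > 0"
    \<comment> \<open>M bounds (|q - p| + |h|)/|q - p|, where h is the increment of g. The first
      entry of \<open>e'\<close> lets the term with |h| be absorbed on the left, which proves this
      bound; the second makes the final error at most e.\<close>
    define M where "M = 1 + (2 / \<bar>l\<bar>) * (K + \<bar>l\<bar>)"
    have M: "M \<ge> 1" using l K by (simp add: M_def)
    define e' where "e' = min (\<bar>l\<bar> / 2) (e * \<bar>l\<bar> / M)"
    have e': "e' > 0" "e' \<le> \<bar>l\<bar> / 2" "e' * M \<le> e * \<bar>l\<bar>"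
    proof -
      show "e' > 0" using l e M by (simp add: e'_def)
      show "e' \<le> \<bar>l\<bar> / 2" unfolding e'_def by (rule min.cobounded1)
      have "e' \<le> e * \<bar>l\<bar> / M" by (simp add: e'_def)
      then show "e' * M \<le> e * \<bar>l\<bar>" using M by (simp add: field_simps)
    qed
    obtain d where d: "d > 0" "\<And>y. norm (y - (p, g p)) < d \<Longrightarrow> norm (F y - F (p, g p) - L (y - (p, g p))) \<le> e' * norm (y - (p, g p))"
      using F e'(1) unfolding has_derivative_at_alt by blast
    have "\<forall>\<^sub>F q in nhds p. dist (g q) (g p) < d / 2"
      using g d(1) unfolding isCont_def tendsto_iff eventually_at_filter
      by (auto elim!: allE[of _ "d / 2"] eventually_mono)
    moreover have "\<forall>\<^sub>F q in nhds p. dist q p < d / 2"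
      unfolding eventually_nhds_metric using d(1) by (intro exI[of _ "d / 2"]) auto
    ultimately have "\<forall>\<^sub>F q in nhds p. norm (g q - g p - - L (q - p, 0) / l) \<le> e * norm (q - p)"
      using zero
    proof eventually_elim
      case (elim q)
      define h where "h = g q - g p"
      define x where "x = norm (q - p)"
      have nrm: "norm ((q, g q) - (p, g p)) \<le> x + \<bar>h\<bar>"
        unfolding x_def h_def using norm_Pair_le[of "q - p" "g q - g p"] by simp
      then have "norm ((q, g q) - (p, g p)) < d" using elim by (simp add: x_def h_def dist_norm)
      from d(2)[OF this] have "\<bar>L (q - p, h)\<bar> \<le> e' * norm ((q, g q) - (p, g p))"
        using elim F0 by (simp add: h_def)
      also have "\<dots> \<le> e' * (x + \<bar>h\<bar>)" using nrm e' by (intro mult_left_mono) auto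
      finally have main: "\<bar>L (q - p, 0) + l * h\<bar> \<le> e' * x + e' * \<bar>h\<bar>"
        unfolding L_split[of _ h] by (simp add: distrib_left)
      have Lx: "\<bar>L (q - p, 0)\<bar> \<le> K * x" using K(2)[of "(q - p, 0)"] by (simp add: x_def norm_Pair mult.commute)
      have x0: "x \<ge> 0" by (simp add: x_def)
      have "\<bar>l\<bar> * \<bar>h\<bar> \<le> \<bar>L (q - p, 0) + l * h\<bar> + \<bar>L (q - p, 0)\<bar>" by (simp add: abs_mult[symmetric])
      also have "\<dots> \<le> e' * x + e' * \<bar>h\<bar> + K * x" using main Lx by simp
      also have "\<dots> \<le> \<bar>l\<bar> * x + \<bar>l\<bar> / 2 * \<bar>h\<bar> + K * x"
        using e'(2) x0 l by (intro add_mono mult_right_mono) auto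
      finally have "\<bar>l\<bar> / 2 * \<bar>h\<bar> \<le> (K + \<bar>l\<bar>) * x" by (simp add: algebra_simps)
      then have "(2 / \<bar>l\<bar>) * (\<bar>l\<bar> / 2 * \<bar>h\<bar>) \<le> (2 / \<bar>l\<bar>) * ((K + \<bar>l\<bar>) * x)"
        by (intro mult_left_mono) auto
      moreover have "(2 / \<bar>l\<bar>) * (\<bar>l\<bar> / 2 * \<bar>h\<bar>) = \<bar>h\<bar>" using l by simp
      ultimately have "\<bar>h\<bar> \<le> (2 / \<bar>l\<bar>) * (K + \<bar>l\<bar>) * x" by (simp only: mult.assoc)
      then have "x + \<bar>h\<bar> \<le> M * x" by (simp add: M_def algebra_simps)
      have "\<bar>l\<bar> * \<bar>h - - L (q - p, 0) / l\<bar> = \<bar>L (q - p, 0) + l * h\<bar>"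
        using l by (simp add: abs_mult[symmetric] field_simps)
      also have "\<dots> \<le> e' * (x + \<bar>h\<bar>)" using main by (simp add: distrib_left)
      also have "\<dots> \<le> e' * (M * x)" using \<open>x + \<bar>h\<bar> \<le> M * x\<close> e'(1) by (intro mult_left_mono) auto
      also have "\<dots> \<le> e * \<bar>l\<bar> * x" using mult_right_mono[OF e'(3) x0] by (simp add: mult.assoc)
      finally have "\<bar>l\<bar> * \<bar>h - - L (q - p, 0) / l\<bar> \<le> \<bar>l\<bar> * (e * x)" by (simp add: ac_simps)
      then have "\<bar>h - - L (q - p, 0) / l\<bar> \<le> e * x" using l by simp
      then show ?case by (simp add: h_def x_def)
    qed
    then show "\<exists>d>0. \<forall>y. norm (y - p) < d \<longrightarrow> norm (g y - g p - - L (y - p, 0) / l) \<le> e * norm (y - p)"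
      unfolding eventually_nhds_metric by (simp add: dist_norm)
  qed
qed

text \<open>Let \<open>w = P B u\<close>, with \<open>P\<close> the projection onto \<open>V\<close> and \<open>u\<close> the eigenvector at \<open>p0\<close>. Bordering
  \<open>A - \<lambda>B\<close> by the projections along \<open>w\<close> and \<open>J w\<close> makes it invertible near \<open>(p0, lam p0)\<close>; if \<open>S\<close> is the
  bordered operator, then \<open>lam\<close> solves the scalar equation \<open>1 - \<langle>S\<^sup>-\<^sup>1 w, w\<rangle> = 0\<close>.\<close>

theorem simple_eigenvalue_smooth:
  fixes A B :: "'p::euclidean_space \<Rightarrow> 'h::{real_inner,complete_space} \<Rightarrow>\<^sub>L 'h" and lam :: "'p \<Rightarrow> real"
  assumes N: "open N" "p0 \<in> N"
    and pen: "\<And>p. p \<in> N \<Longrightarrow> pencil J V (A p) (B p) (\<gamma> p)"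
    and smA: "\<And>n. Ck_on n N A" and smB: "\<And>n. Ck_on n N B"
    and cont: "continuous_on N lam"
    and eig: "\<And>p. p \<in> N \<Longrightarrow> \<exists>x\<in>V. x \<noteq> 0 \<and> (\<forall>y\<in>V. A p x \<bullet> y = lam p * (B p x \<bullet> y))"
    and simple: "\<And>x. x \<in> V \<Longrightarrow> (\<And>y. y \<in> V \<Longrightarrow> A p0 x \<bullet> y = lam p0 * (B p0 x \<bullet> y)) \<Longrightarrow> \<exists>c. x = complex_structure.cscale J c u"
  shows "\<exists>U. open U \<and> p0 \<in> U \<and> U \<subseteq> N \<and> smooth_on U lam"
proof -
  interpret P0: pencil J V "A p0" "B p0" "\<gamma> p0" using pen N by blast
  obtain P :: "'h \<Rightarrow>\<^sub>L 'h" where P: "\<And>x. P x \<in> V" "\<And>x v. v \<in> V \<Longrightarrow> P x \<bullet> v = x \<bullet> v"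
    using orthogonal_projection_ex[OF P0.V_subspace P0.V_closed] by blast
  have P_eq: "P x = y" if "y \<in> V" "\<And>v. v \<in> V \<Longrightarrow> y \<bullet> v = x \<bullet> v" for x y
  proof -
    have "P x - y \<in> V" using that P by (simp add: P0.V_subspace subspace_diff)
    then have "(P x - y) \<bullet> (P x - y) = 0" using that P by (simp add: inner_diff_left)
    then show ?thesis by simp
  qed
  have P_id: "x \<in> V \<Longrightarrow> P x = x" for x by (rule P_eq) auto
  have P_sym: "P x \<bullet> y = x \<bullet> P y" for x y
    using P(2)[OF P(1), of x y] P(2)[OF P(1), of y x] by (simp add: inner_commute)
  have P_J: "P (J x) = J (P x)" for x
    by (rule P_eq) (auto simp: P P0.J_V P0.J_left)
  obtain u1 where u1: "u1 \<in> V" "u1 \<noteq> 0" "\<And>y. y \<in> V \<Longrightarrow> A p0 u1 \<bullet> y = lam p0 * (B p0 u1 \<bullet> y)"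
    using eig N by blast
  \<comment> \<open>The normalisation makes w and J w dual to u0 and J u0 below.\<close>
  define u0 where "u0 = (1 / sqrt (P0.b u1 u1)) *\<^sub>R u1"
  have bu1: "P0.b u1 u1 > 0" using u1 P0.B_pos by blast
  have u0: "u0 \<in> V" "P0.b u0 u0 = 1" "\<And>y. y \<in> V \<Longrightarrow> A p0 u0 \<bullet> y = lam p0 * (B p0 u0 \<bullet> y)"
    using u1 bu1 by (auto simp: u0_def P0.V_subspace subspace_scale P0.b_simps P0.a_simps)
  have simple0: "\<exists>c. x = P0.cscale c u0"
    if x: "x \<in> V" "\<And>y. y \<in> V \<Longrightarrow> A p0 x \<bullet> y = lam p0 * (B p0 x \<bullet> y)" for x
  proof -
    obtain c d where cd: "x = P0.cscale c u" "u0 = P0.cscale d u" using simple[OF x] simple[OF u0(1,3)] by blast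
    have "d \<noteq> 0" using cd u0(2) by (auto simp: blinfun.bilinear_simps)
    then have "x = P0.cscale (c / d) u0" unfolding cd P0.cscale_cscale by simp
    then show ?thesis by blast
  qed
  \<comment> \<open>On V, w represents the functional \<open>P0.b u0\<close>, and J w represents
    \<open>P0.b (J u0)\<close>. Two border vectors are needed because the complex line through u0 is
    a real plane.\<close>
  define w where "w = P (B p0 u0)"
  have wV: "w \<in> V" "J w \<in> V" using P(1) P0.J_V by (auto simp: w_def)
  have w_inner: "v \<bullet> w = P0.b u0 v" if "v \<in> V" for v
    using P(2)[OF that, of "B p0 u0"] by (simp add: w_def inner_commute)
  have Jw_inner: "v \<bullet> J w = P0.b (J u0) v" if "v \<in> V" for v
    using w_inner[OF P0.J_V[OF that]] P0.J_left[of v w] P0.b_J(1)[of u0 v] by simp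
  have bE: "bounded_linear (\<lambda>x. (x \<bullet> w) *\<^sub>R w + (x \<bullet> J w) *\<^sub>R J w)"
    by (intro bounded_linear_add bounded_linear_scaleR_left[THEN bounded_linear_compose] bounded_linear_inner_left)
  define E where "E = Blinfun (\<lambda>x. (x \<bullet> w) *\<^sub>R w + (x \<bullet> J w) *\<^sub>R J w)"
  have E: "E x = (x \<bullet> w) *\<^sub>R w + (x \<bullet> J w) *\<^sub>R J w" for x
    unfolding E_def bounded_linear_Blinfun_apply[OF bE] ..
  \<comment> \<open>The projections compress the pencil to V, and \<open>id_blinfun - P\<close> acts
    as the identity on the orthogonal complement, so that S can be invertible on the whole
    space.\<close>
  define S where "S z = (P o\<^sub>L A (fst z) o\<^sub>L P) - snd z *\<^sub>R (P o\<^sub>L B (fst z) o\<^sub>L P) + (id_blinfun - P) + E" for z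
  have S: "S (p, l) x = P (A p (P x)) - l *\<^sub>R P (B p (P x)) + (x - P x) + ((x \<bullet> w) *\<^sub>R w + (x \<bullet> J w) *\<^sub>R J w)" for p l x
    by (simp add: S_def blinfun.bilinear_simps E)
  have S_sym: "S (p, l) x \<bullet> y = x \<bullet> S (p, l) y" if "p \<in> N" for p l x y
  proof -
    interpret Q: pencil J V "A p" "B p" "\<gamma> p" using pen that by blast
    show ?thesis by (simp add: S inner_simps P_sym Q.A_sym Q.B_sym inner_commute[of _ w] inner_commute[of _ "J w"])
  qed
  have S_J: "S (p, l) (J x) = J (S (p, l) x)" if "p \<in> N" for p l x
  proof -
    interpret Q: pencil J V "A p" "B p" "\<gamma> p" using pen that by blast
    show ?thesis
      by (simp add: S P_J Q.A_J Q.B_J P0.J_add P0.J_diff P0.J_scaleR P0.J_left P0.J_inner P0.J_J)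
  qed
  have S_inj: "x = 0" if x: "S (p0, lam p0) x = 0" for x
  proof -
    have "P (S (p0, lam p0) x) = S (p0, lam p0) x - (x - P x)"
      by (simp add: S blinfun.bilinear_simps P_id P(1) wV)
    then have xP: "x = P x" using x by (simp add: blinfun.bilinear_simps)
    then have xV: "x \<in> V" using P(1) by metis
    have eq: "A p0 x \<bullet> y - lam p0 * (B p0 x \<bullet> y) + (x \<bullet> w) * (w \<bullet> y) + (x \<bullet> J w) * (J w \<bullet> y) = 0" if y: "y \<in> V" for y
    proof -
      have "0 = S (p0, lam p0) x \<bullet> y" by (simp add: x)
      then show ?thesis using y P(2) by (simp add: S P_id xV inner_simps)
    qed
    \<comment> \<open>Since u0 and J u0 are eigenvectors, symmetry removes the pencil from the
      equation tested against them. What is left says that both border coefficients of x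
      vanish.\<close>
    have rl: "A p0 x \<bullet> y - lam p0 * (B p0 x \<bullet> y) = 0" if "y = u0 \<or> y = J u0" for y
    proof -
      have "A p0 y \<bullet> x = lam p0 * (B p0 y \<bullet> x)"
        using that u0(3)[OF xV] u0(3)[OF P0.J_V[OF xV]] by (auto simp: P0.a_J P0.b_J)
      then show ?thesis by (simp add: P0.a_commute[of x y] P0.b_commute[of x y])
    qed
    have uu: "w \<bullet> u0 = 1" "J w \<bullet> u0 = 0" "w \<bullet> J u0 = 0" "J w \<bullet> J u0 = 1"
      unfolding inner_commute[of w] inner_commute[of "J w"]
      by (simp_all only: w_inner Jw_inner u0 P0.J_V P0.b_J(2,3) P0.b_J(1)[of u0 u0] minus_zero)
    have xw: "x \<bullet> w = 0" "x \<bullet> J w = 0"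
      using eq[OF u0(1)] eq[OF P0.J_V[OF u0(1)]] rl uu by simp_all
    then have "A p0 x \<bullet> y = lam p0 * (B p0 x \<bullet> y)" if "y \<in> V" for y using eq[OF that] by simp
    from simple0[OF xV this] obtain c where c: "x = P0.cscale c u0" by blast
    have "Re c = 0" "Im c = 0"
      using xw uu unfolding c P0.cscale_def by (simp_all add: inner_simps inner_commute)
    then show "x = 0" unfolding c by (simp add: P0.cscale_def)
  qed
  \<comment> \<open>A Fredholm argument: if no lower bound existed, a normalised sequence with S x
    tending to 0 would have a convergent subsequence by coercivity and compactness, and its limit
    would be a unit vector in the kernel.\<close>
  obtain c where c: "c > 0" "\<And>x. c * norm x \<le> norm (S (p0, lam p0) x)"
  proof (rule ccontr)
    assume "\<not> thesis"
    then have "\<exists>x. norm (S (p0, lam p0) x) < (1 / real (Suc n)) * norm x" for n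
      using that[of "1 / real (Suc n)"] by (meson not_le zero_less_divide_1_iff of_nat_0_less_iff zero_less_Suc)
    then obtain y where y: "\<And>n. norm (S (p0, lam p0) (y n)) < (1 / real (Suc n)) * norm (y n)" by metis
    have y0: "y n \<noteq> 0" for n using y[of n] by (auto simp: blinfun.bilinear_simps)
    define x where "x n = (1 / norm (y n)) *\<^sub>R y n" for n
    have x1: "norm (x n) = 1" for n using y0 by (simp add: x_def)
    have xS: "norm (S (p0, lam p0) (x n)) \<le> 1 / real (Suc n)" for n
      using y[of n] y0[of n] by (simp add: x_def blinfun.bilinear_simps divide_simps split: if_splits)
    have Sx: "(\<lambda>n. S (p0, lam p0) (x n)) \<longlonglongrightarrow> 0"
      by (rule Lim_null_comparison[OF always_eventually LIMSEQ_Suc[OF lim_1_over_n]]) (use xS in simp)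
    \<comment> \<open>The component of x orthogonal to V passes through S unchanged, hence it tends
      to 0 and only the part in V matters.\<close>
    have Px: "norm (x n - P (x n)) \<le> norm (S (p0, lam p0) (x n))" for n
    proof -
      define q where "q = x n - P (x n)"
      have qV: "v \<bullet> q = 0" if "v \<in> V" for v
        using P(2)[OF that] by (subst inner_commute) (simp add: q_def inner_diff_left)
      have "S (p0, lam p0) (x n) \<bullet> q = q \<bullet> q"
        unfolding S q_def[symmetric] inner_add_left inner_diff_left inner_scaleR_left
        by (simp add: qV[OF P(1)] qV[OF wV(1)] qV[OF wV(2)])
      then have "(norm q)\<^sup>2 \<le> norm (S (p0, lam p0) (x n)) * norm q"
        by (metis norm_cauchy_schwarz power2_norm_eq_inner)
      then show ?thesis unfolding q_def[symmetric] by (cases "q = 0") (auto simp: power2_eq_square)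
    qed
    define v where "v n = P (x n)" for n
    have xv: "(\<lambda>n. x n - v n) \<longlonglongrightarrow> 0"
      unfolding v_def by (rule Lim_null_comparison[OF always_eventually tendsto_norm_zero[OF Sx]]) (use Px in simp)
    have Sv: "(\<lambda>n. S (p0, lam p0) (v n)) \<longlonglongrightarrow> 0"
    proof -
      have "(\<lambda>n. S (p0, lam p0) (x n) - S (p0, lam p0) (x n - v n)) \<longlonglongrightarrow> 0 - S (p0, lam p0) 0"
        by (intro tendsto_diff Sx blinfun.tendsto tendsto_const xv)
      then show ?thesis by (simp add: blinfun.bilinear_simps)
    qed
    have vV: "v n \<in> V" for n by (simp add: v_def P)
    have "norm (v n) \<le> norm P" for n
      using norm_blinfun[of P "x n"] x1 by (simp add: v_def)
    then have bd: "bounded (range v)" by (auto intro: boundedI)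
    obtain r :: "nat \<Rightarrow> nat" where r: "strict_mono r"
      "\<And>\<epsilon>. \<epsilon> > 0 \<Longrightarrow> \<exists>N. \<forall>m\<ge>N. \<forall>n\<ge>N. P0.b (v (r m) - v (r n)) (v (r m) - v (r n)) < \<epsilon>"
      using P0.compact[OF vV bd] by blast
    \<comment> \<open>A Garding inequality: the squares from the border terms are dropped, and the
      part with lam p0 is moved to the right, where compactness controls it.\<close>
    have key: "\<gamma> p0 * (norm d)\<^sup>2 \<le> norm (S (p0, lam p0) d) * norm d + \<bar>lam p0\<bar> * P0.b d d" if d: "d \<in> V" for d
    proof -
      have "S (p0, lam p0) d \<bullet> d = P0.a d d - lam p0 * P0.b d d + (d \<bullet> w)\<^sup>2 + (d \<bullet> J w)\<^sup>2"
        using P(2)[OF d] by (simp add: S P_id d inner_simps power2_eq_square inner_commute)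
      moreover have "S (p0, lam p0) d \<bullet> d \<le> norm (S (p0, lam p0) d) * norm d" by (rule norm_cauchy_schwarz)
      moreover have "lam p0 * P0.b d d \<le> \<bar>lam p0\<bar> * P0.b d d" using P0.b_nonneg[OF d] by (intro mult_right_mono) auto
      moreover have "\<gamma> p0 * (norm d)\<^sup>2 \<le> P0.a d d" by (rule P0.coercive(2)[OF d])
      moreover have "(d \<bullet> w)\<^sup>2 \<ge> 0" "(d \<bullet> J w)\<^sup>2 \<ge> 0" by simp_all
      ultimately show ?thesis by linarith
    qed
    have "Cauchy (v \<circ> r)"
    proof (rule metric_CauchyI)
      fix e :: real assume e: "e > 0"
      define \<epsilon> where "\<epsilon> = \<gamma> p0 * e\<^sup>2"
      have \<epsilon>: "\<epsilon> > 0" using e P0.coercive(1) by (simp add: \<epsilon>_def)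
      define M where "M = 2 * norm P + 1"
      have M: "M > 0" unfolding M_def by (meson add_nonneg_pos mult_nonneg_nonneg norm_ge_zero zero_le_numeral zero_less_one)
      have "Cauchy (\<lambda>n. S (p0, lam p0) (v (r n)))"
        using LIMSEQ_subseq_LIMSEQ[OF Sv r(1)] by (auto simp: o_def intro: LIMSEQ_imp_Cauchy)
      then obtain N1 where N1: "\<And>m n. m \<ge> N1 \<Longrightarrow> n \<ge> N1 \<Longrightarrow> dist (S (p0, lam p0) (v (r m))) (S (p0, lam p0) (v (r n))) < \<epsilon> / (2 * M)"
        using metric_CauchyD[of _ "\<epsilon> / (2 * M)"] \<epsilon> M by (meson divide_pos_pos mult_pos_pos zero_less_numeral)
      have l1: "\<bar>lam p0\<bar> + 1 > 0" by simp
      obtain N2 where N2: "\<And>m n. m \<ge> N2 \<Longrightarrow> n \<ge> N2 \<Longrightarrow> P0.b (v (r m) - v (r n)) (v (r m) - v (r n)) < \<epsilon> / (2 * (\<bar>lam p0\<bar> + 1))"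
        using r(2)[of "\<epsilon> / (2 * (\<bar>lam p0\<bar> + 1))"] \<epsilon> by auto
      have "dist ((v \<circ> r) i) ((v \<circ> r) j) < e" if ij: "i \<ge> max N1 N2" "j \<ge> max N1 N2" for i j
      proof -
        define d where "d = v (r i) - v (r j)"
        have dV: "d \<in> V" unfolding d_def by (intro subspace_diff P0.V_subspace vV)
        have nd: "norm d \<le> M"
          unfolding d_def M_def using norm_triangle_ineq4[of "v (r i)" "v (r j)"] \<open>\<And>n. norm (v n) \<le> norm P\<close>[of "r i"] \<open>\<And>n. norm (v n) \<le> norm P\<close>[of "r j"]
          by linarith
        have "norm (S (p0, lam p0) d) < \<epsilon> / (2 * M)"
          using N1[of i j] ij by (simp add: d_def dist_norm blinfun.bilinear_simps)
        then have "norm (S (p0, lam p0) d) * norm d \<le> \<epsilon> / (2 * M) * M"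
          using nd \<epsilon> M by (intro mult_mono) auto
        then have 1: "norm (S (p0, lam p0) d) * norm d \<le> \<epsilon> / 2" using M by simp
        have "P0.b d d < \<epsilon> / (2 * (\<bar>lam p0\<bar> + 1))" using N2[of i j] ij by (simp add: d_def)
        then have "(\<bar>lam p0\<bar> + 1) * P0.b d d < \<epsilon> / 2" using l1 by (simp add: field_simps)
        then have 2: "\<bar>lam p0\<bar> * P0.b d d < \<epsilon> / 2" using P0.b_nonneg[OF dV] by (simp add: distrib_right)
        have "\<gamma> p0 * (norm d)\<^sup>2 < \<gamma> p0 * e\<^sup>2"
          using key[OF dV] 1 2 by (simp add: \<epsilon>_def)
        then have "(norm d)\<^sup>2 < e\<^sup>2" using P0.coercive(1) by simp
        then have "norm d < e" using e by (auto intro: power2_less_imp_less)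
        then show ?thesis by (simp add: d_def dist_norm)
      qed
      then show "\<exists>M. \<forall>m\<ge>M. \<forall>n\<ge>M. dist ((v \<circ> r) m) ((v \<circ> r) n) < e" by blast
    qed
    then obtain l where l: "(v \<circ> r) \<longlonglongrightarrow> l" using Cauchy_convergent convergent_def by blast
    have "(\<lambda>n. S (p0, lam p0) ((v \<circ> r) n)) \<longlonglongrightarrow> S (p0, lam p0) l" by (intro blinfun.tendsto tendsto_const l)
    moreover have "(\<lambda>n. S (p0, lam p0) ((v \<circ> r) n)) \<longlonglongrightarrow> 0"
      using LIMSEQ_subseq_LIMSEQ[OF Sv r(1)] by (simp add: o_def)
    ultimately have "S (p0, lam p0) l = 0" by (rule LIMSEQ_unique)
    then have "l = 0" by (rule S_inj)
    have "(\<lambda>n. (x (r n) - v (r n)) + v (r n)) \<longlonglongrightarrow> 0 + l"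
      using LIMSEQ_subseq_LIMSEQ[OF xv r(1)] l by (intro tendsto_add) (auto simp: o_def)
    then have "(\<lambda>n. norm (x (r n))) \<longlonglongrightarrow> norm (0 + l)" by (intro tendsto_norm) simp
    then show False using \<open>l = 0\<close> by (simp add: x1 LIMSEQ_const_iff)
  qed
  have open_N: "open (N \<times> (UNIV::real set))" using N by (intro open_Times) auto
  have fst_sm: "Ck_on n (N \<times> (UNIV::real set)) (\<lambda>z. G (fst z))" if "Ck_on n N G" for G :: "'p \<Rightarrow> 'h \<Rightarrow>\<^sub>L 'h" and n
    by (rule Ck_on_compose[OF open_N N(1) _ Ck_on_fst[OF open_N Ck_on_id[OF open_N]] that]) auto
  have S_smooth: "Ck_on n (N \<times> UNIV) S" for n
    unfolding S_def
    by (intro Ck_on_add Ck_on_diff Ck_on_scaleR Ck_on_blinfun_compose Ck_on_const Ck_on_snd Ck_on_id open_N fst_sm smA smB)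
  have contS: "continuous_on (N \<times> UNIV) S" using S_smooth Ck_on_continuous by blast
  \<comment> \<open>In this neighbourhood the lower bound c for S survives as c/2, which also bounds
    the inverses uniformly.\<close>
  define W where "W = {z \<in> N \<times> UNIV. norm (S z - S (p0, lam p0)) < c / 2}"
  have "open W"
  proof -
    have "open ((N \<times> UNIV) \<inter> (\<lambda>z. norm (S z - S (p0, lam p0))) -` {..<c / 2})"
      by (intro continuous_open_preimage continuous_on_norm continuous_on_diff continuous_on_const contS open_N) auto
    also have "(N \<times> UNIV) \<inter> (\<lambda>z. norm (S z - S (p0, lam p0))) -` {..<c / 2} = W" by (auto simp: W_def)
    finally show ?thesis .
  qed
  have z0W: "(p0, lam p0) \<in> W" using N c by (simp add: W_def)
  have "\<exists>R. S z o\<^sub>L R = id_blinfun \<and> R o\<^sub>L S z = id_blinfun \<and> norm R \<le> 1 / (c / 2)" if z: "z \<in> W" for z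
  proof -
    obtain p l where pl: "z = (p, l)" "p \<in> N" using z by (auto simp: W_def)
    have "c / 2 * norm x \<le> norm (S z x)" for x
    proof -
      have "norm ((S z - S (p0, lam p0)) x) \<le> norm (S z - S (p0, lam p0)) * norm x" by (rule norm_blinfun)
      also have "\<dots> \<le> c / 2 * norm x" using z by (intro mult_right_mono) (auto simp: W_def)
      finally have "norm (S z x - S (p0, lam p0) x) \<le> c / 2 * norm x" by (simp add: blinfun.bilinear_simps)
      then show ?thesis using c(2)[of x] norm_triangle_ineq2[of "S (p0, lam p0) x" "S z x"]
        by (simp add: norm_minus_commute)
    qed
    then show ?thesis
      using symmetric_bounded_below_inverse[of "S z" "c / 2"] S_sym[OF pl(2)] c(1) unfolding pl(1) by (metis half_gt_zero)
  qed
  then obtain R where R: "\<And>z. z \<in> W \<Longrightarrow> S z o\<^sub>L R z = id_blinfun" "\<And>z. z \<in> W \<Longrightarrow> R z o\<^sub>L S z = id_blinfun"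
    "\<And>z. z \<in> W \<Longrightarrow> norm (R z) \<le> 1 / (c / 2)" by metis
  have SR: "S z (R z x) = x" "R z (S z x) = x" if "z \<in> W" for z x
    using R(1,2)[OF that] by (metis blinfun_apply_blinfun_compose blinfun_apply_id_blinfun id_apply)+
  have R_sym: "R z x \<bullet> y = x \<bullet> R z y" if z: "z \<in> W" for z x y
  proof -
    obtain p l where pl: "z = (p, l)" "p \<in> N" using z by (auto simp: W_def)
    have "R z x \<bullet> S z (R z y) = S z (R z x) \<bullet> R z y" using S_sym[OF pl(2)] pl(1) by simp
    then show ?thesis using SR z by simp
  qed
  have R_J: "R z (J x) = J (R z x)" if z: "z \<in> W" for z x
  proof -
    obtain p l where pl: "z = (p, l)" "p \<in> N" using z by (auto simp: W_def)
    have "S z (J (R z x)) = J x" using S_J[OF pl(2)] pl(1) SR(1)[OF z] by simp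
    then show ?thesis using SR(2)[OF z] by metis
  qed
  have R_smooth: "Ck_on n W R" for n
    by (rule Ck_on_blinfun_inverse[OF \<open>open W\<close> Ck_on_subset[OF S_smooth] R]) (auto simp: W_def)
  define F where "F z = 1 - R z w \<bullet> w" for z
  have F_smooth: "Ck_on n W F" for n
    unfolding F_def by (intro Ck_on_diff Ck_on_inner Ck_on_blinfun_apply Ck_on_const R_smooth \<open>open W\<close>)
  have F_zero: "F (p, lam p) = 0" if p: "p \<in> N" "(p, lam p) \<in> W" for p
  proof -
    obtain x where x: "x \<in> V" "x \<noteq> 0" "\<And>y. y \<in> V \<Longrightarrow> A p x \<bullet> y = lam p * (B p x \<bullet> y)" using eig p by blast
    let ?z = "(p, lam p)"
    have "P (A p x - lam p *\<^sub>R B p x) = 0"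
      using x(3) by (intro P_eq) (auto simp: P0.V_subspace subspace_0 inner_diff_left)
    then have "S ?z x = (x \<bullet> w) *\<^sub>R w + (x \<bullet> J w) *\<^sub>R J w"
      by (simp add: S P_id x(1) blinfun.bilinear_simps)
    then have "R ?z (S ?z x) = (x \<bullet> w) *\<^sub>R R ?z w + (x \<bullet> J w) *\<^sub>R R ?z (J w)"
      by (simp add: blinfun.bilinear_simps)
    then have xeq: "x = (x \<bullet> w) *\<^sub>R R ?z w + (x \<bullet> J w) *\<^sub>R J (R ?z w)"
      by (simp add: SR p(2) R_J)
    \<comment> \<open>R is symmetric and J antisymmetric, and they commute; hence the matrix of R
      with respect to w and J w is a multiple of the identity. Both coordinates of the bordered
      system thus reduce to the same scalar equation.\<close>
    have "J (R ?z w) \<bullet> w = - (J (R ?z w) \<bullet> w)"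
    proof -
      have "J (R ?z w) \<bullet> w = R ?z (J w) \<bullet> w" by (simp add: R_J p(2))
      also have "\<dots> = J w \<bullet> R ?z w" by (rule R_sym[OF p(2)])
      finally show ?thesis by (simp add: P0.J_left inner_commute)
    qed
    then have cross: "J (R ?z w) \<bullet> w = 0" "R ?z w \<bullet> J w = 0" by (simp_all add: P0.J_left)
    have "x \<bullet> w = (x \<bullet> w) * (R ?z w \<bullet> w)" "x \<bullet> J w = (x \<bullet> J w) * (R ?z w \<bullet> w)"
      by (subst xeq, simp add: inner_simps cross P0.J_inner)+
    moreover have "x \<bullet> w \<noteq> 0 \<or> x \<bullet> J w \<noteq> 0" using xeq x(2) by auto
    ultimately show ?thesis by (auto simp: F_def)
  qed
  define z0 where "z0 = (p0, lam p0)"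
  \<comment> \<open>Along the line p = p0 the equation is explicit: S u0 = (1 - (l - lam p0)) w, so
    R w is a multiple of u0. Its derivative at lam p0 is -1, which makes the zero regular.\<close>
  have F_lin: "F (p0, l) = 1 - 1 / (1 - (l - lam p0))" if l: "(p0, l) \<in> W" for l
  proof -
    let ?z = "(p0, l)"
    have "S z0 u0 = w"
    proof -
      have "P (A p0 u0 - lam p0 *\<^sub>R B p0 u0) = 0"
        using u0(3) by (intro P_eq) (auto simp: P0.V_subspace subspace_0 inner_diff_left)
      moreover have "u0 \<bullet> w = 1" "u0 \<bullet> J w = 0"
        using w_inner[OF u0(1)] Jw_inner[OF u0(1)] u0(2) by (simp_all add: P0.b_J)
      ultimately show ?thesis by (simp add: z0_def S P_id u0(1) blinfun.bilinear_simps)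
    qed
    moreover have "S z0 u0 - S ?z u0 = (l - lam p0) *\<^sub>R w"
      by (simp add: z0_def S P_id u0(1) w_def scaleR_diff_left)
    ultimately have "S ?z u0 = w - (l - lam p0) *\<^sub>R w" by (simp add: algebra_simps)
    then have "u0 = R ?z w - (l - lam p0) *\<^sub>R R ?z w"
      using SR(2)[OF l, of u0] by (simp add: blinfun.bilinear_simps)
    then have "u0 \<bullet> w = (1 - (l - lam p0)) * (R ?z w \<bullet> w)"
      by (metis inner_diff_left inner_scaleR_left left_diff_distrib mult_1)
    then have "(1 - (l - lam p0)) * (R ?z w \<bullet> w) = 1"
      using w_inner[OF u0(1)] u0(2) by simp
    then have "R ?z w \<bullet> w = 1 / (1 - (l - lam p0))"
      by (metis mult_zero_left nonzero_mult_div_cancel_left zero_neq_one)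
    then show ?thesis unfolding F_def by simp
  qed
  define DF where "DF z = frechet_derivative F (at z)" for z
  have F_der: "(F has_derivative DF z) (at z)" if "z \<in> W" for z
    unfolding DF_def using Ck_on_Suc_has_derivative[OF F_smooth that] .
  have DF_smooth: "Ck_on n W (\<lambda>z. DF z v)" for n v
    unfolding DF_def using Ck_on_Suc_frechet[OF F_smooth] .
  have nz0: "DF z0 (0, 1) \<noteq> 0"
  proof -
    have "((\<lambda>l. F (p0, l)) has_derivative (\<lambda>t. DF z0 (0, t))) (at (lam p0))"
    proof (rule has_derivative_compose[of "\<lambda>l. (p0, l)" "\<lambda>t. (0, t)" _ UNIV F "DF z0"])
      show "(F has_derivative DF z0) (at (p0, lam p0))" using F_der z0W by (simp add: z0_def)
    qed (auto intro!: derivative_eq_intros)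
    moreover have "((\<lambda>l. F (p0, l)) has_derivative (\<lambda>t. - t)) (at (lam p0))"
    proof (rule has_derivative_transform_within_open)
      show "((\<lambda>l. 1 - 1 / (1 - (l - lam p0))) has_derivative (\<lambda>t. - t)) (at (lam p0))"
        by (auto intro!: derivative_eq_intros)
      show "open ((\<lambda>l. (p0, l)) -` W)" by (intro open_vimage \<open>open W\<close> continuous_intros)
    qed (use z0W F_lin in auto)
    ultimately have "(\<lambda>t. DF z0 (0, t)) = (\<lambda>t. - t)" by (rule has_derivative_unique)
    then have "DF z0 (0, 1) = - 1" by meson
    then show ?thesis by simp
  qed
  define W' where "W' = {z \<in> W. DF z (0, 1) \<noteq> 0}"
  have "open W'"
  proof -
    have "open (W \<inter> (\<lambda>z. DF z (0, 1)) -` (- {0}))"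
      by (intro continuous_open_preimage Ck_on_continuous[OF DF_smooth] \<open>open W\<close>) auto
    also have "W \<inter> (\<lambda>z. DF z (0, 1)) -` (- {0}) = W'" by (auto simp: W'_def)
    finally show ?thesis .
  qed
  define U where "U = {p \<in> N. (p, lam p) \<in> W'}"
  have "open U"
  proof -
    have "open (N \<inter> (\<lambda>p. (p, lam p)) -` W')"
      by (intro continuous_open_preimage continuous_on_Pair continuous_on_id cont \<open>open W'\<close> N)
    also have "N \<inter> (\<lambda>p. (p, lam p)) -` W' = U" by (auto simp: U_def)
    finally show ?thesis .
  qed
  have "Ck_on n U lam" for n
  proof (rule Ck_on_implicit[OF \<open>open U\<close> \<open>open W'\<close>, where K="\<lambda>v z. - DF z (v, 0) * inverse (DF z (0, 1))"])
    show "continuous_on U lam" by (rule continuous_on_subset[OF cont]) (auto simp: U_def)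
    show "(p, lam p) \<in> W'" if "p \<in> U" for p using that by (simp add: U_def)
    show "(lam has_derivative (\<lambda>v. - DF (p, lam p) (v, 0) * inverse (DF (p, lam p) (0, 1)))) (at p)" if p: "p \<in> U" for p
    proof -
      have "(lam has_derivative (\<lambda>v. - DF (p, lam p) (v, 0) / DF (p, lam p) (0, 1))) (at p)"
      proof (rule implicit_has_derivative)
        show "(F has_derivative DF (p, lam p)) (at (p, lam p))" using p by (intro F_der) (auto simp: U_def W'_def)
        show "isCont lam p" using cont N(1) p by (auto simp: continuous_on_eq_continuous_at U_def)
        show "\<forall>\<^sub>F q in nhds p. F (q, lam q) = 0"
          by (rule eventually_mono[OF eventually_nhds_in_open[OF \<open>open U\<close> p]]) (auto simp: U_def W'_def F_zero)
        show "DF (p, lam p) (0, 1) \<noteq> 0" using p by (simp add: U_def W'_def)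
      qed
      then show ?thesis by (simp add: divide_inverse)
    qed
    show "Ck_on n W' (\<lambda>z. - DF z (v, 0) * inverse (DF z (0, 1)))" for v
      by (intro Ck_on_mult Ck_on_minus Ck_on_inverse \<open>open W'\<close> Ck_on_subset[OF DF_smooth]) (auto simp: W'_def)
  qed
  then have "smooth_on U lam" by (simp add: smooth_on_def)
  moreover have "p0 \<in> U" using N z0W nz0 by (simp add: U_def W'_def z0_def)
  ultimately show ?thesis using \<open>open U\<close> by (auto simp: U_def)
qed

section \<open>Complex dimension and multiplicities\<close>

context complex_structure
begin

definition is_basis :: "nat \<Rightarrow> (nat \<Rightarrow> 'h) \<Rightarrow> 'h set \<Rightarrow> bool" where
  "is_basis m e X \<longleftrightarrow> (\<forall>i<m. e i \<in> X) \<and> (\<forall>c. (\<Sum>i<m. cscale (c i) (e i)) = 0 \<longrightarrow> (\<forall>i<m. c i = 0)) \<and>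
     (\<forall>x\<in>X. \<exists>c. x = (\<Sum>i<m. cscale (c i) (e i)))"

lemma cscale_sum: "cscale c (\<Sum>i\<in>I. f i) = (\<Sum>i\<in>I. cscale c (f i))"
  by (induction I rule: infinite_finite_induct) (auto simp: cscale_add)

text \<open>If m' > m, expanding the second family in the first leaves a linear system with more
  unknowns than equations, and a nontrivial solution contradicts independence.\<close>

lemma is_basis_le:
  assumes "is_basis m e X" "is_basis m' e' X"
  shows "m' \<le> m"
proof (rule ccontr)
  assume "\<not> m' \<le> m"
  then have m: "m < card {..<m'}" by simp
  have "\<forall>j. \<exists>d. j < m' \<longrightarrow> e' j = (\<Sum>i<m. cscale (d i) (e i))" using assms unfolding is_basis_def by blast
  then obtain M where M: "\<And>j. j < m' \<Longrightarrow> e' j = (\<Sum>i<m. cscale (M j i) (e i))" by metis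
  obtain c where c: "\<exists>j<m'. c j \<noteq> 0" "\<forall>i<m. (\<Sum>j<m'. M j i * c j) = 0"
    using homogeneous_system_nontrivial[OF _ m, of "\<lambda>i j. M j i"] by auto
  have "(\<Sum>j<m'. cscale (c j) (e' j)) = (\<Sum>j<m'. \<Sum>i<m. cscale (M j i * c j) (e i))"
    by (intro sum.cong refl) (simp add: M cscale_sum cscale_cscale mult.commute)
  also have "\<dots> = (\<Sum>i<m. cscale (\<Sum>j<m'. M j i * c j) (e i))"
    by (subst sum.swap) (simp add: cscale_sum_left)
  also have "\<dots> = 0" using c(2) by simp
  finally show False using assms(2) c(1) unfolding is_basis_def by blast
qed

lemma is_basis_unique: "is_basis m e X \<Longrightarrow> is_basis m' e' X \<Longrightarrow> m = m'"
  using is_basis_le[of m e X m' e'] is_basis_le[of m' e' X m e] by simp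

end

context pencil
begin

definition ac :: "'h \<Rightarrow> 'h \<Rightarrow> complex" where "ac x y = Complex (a x y) (a x (J y))"

definition eigenspace :: "complex \<Rightarrow> 'h set" where
  "eigenspace \<mu> = {x\<in>V. \<forall>y\<in>V. ac x y = \<mu> * bc x y}"

lemma eigenspace_of_real:
  "x \<in> eigenspace (of_real t) \<longleftrightarrow> x \<in> V \<and> (\<forall>y\<in>V. a x y = t * b x y)"
  using J_V by (auto simp: eigenspace_def ac_def bc_def complex_eq_iff)

text \<open>Testing the equation with x itself gives a real Rayleigh quotient. This settles the
  multiplicities of non-real \<mu>, over which \<open>enumerates_eigenvalues\<close> also
  ranges.\<close>

lemma eigenspace_real:
  assumes "x \<in> eigenspace \<mu>" "x \<noteq> 0"
  shows "\<mu> \<in> \<real>"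
proof -
  have x: "x \<in> V" "ac x x = \<mu> * bc x x" using assms(1) by (auto simp: eigenspace_def)
  have "ac x x = of_real (a x x)" by (simp add: ac_def complex_eq_iff a_J(3))
  moreover have "b x x \<noteq> 0" using B_pos[OF x(1) assms(2)] by simp
  ultimately have "\<mu> = of_real (a x x / b x x)" using x(2) by (simp add: bc_self field_simps)
  then show ?thesis by (metis Reals_of_real)
qed

lemma eigensystem_basis:
  assumes es: "eigensystem e s"
  shows "\<exists>f. is_basis (card {j. complex_of_real (s j) = \<mu>}) f (eigenspace \<mu>)"
proof -
  define I where "I = {j. complex_of_real (s j) = \<mu>}"
  \<comment> \<open>For a non-real \<mu> the index set is empty, matching the zero
    eigenspace.\<close>
  have I: "I = (if \<mu> \<in> \<real> then {j. s j = Re \<mu>} else {})"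
    by (auto simp: I_def complex_eq_iff complex_is_Real_iff)
  then have fin: "finite I" using eig_finite[OF es] by simp
  obtain h where h: "bij_betw h {..<card I} I" using ex_bij_betw_nat_finite[OF fin] by (auto simp: atLeast0LessThan)
  have hI: "h i \<in> I" if "i < card I" for i using h that by (auto simp: bij_betw_def)
  have "is_basis (card I) (\<lambda>i. e (h i)) (eigenspace \<mu>)"
    unfolding is_basis_def
  proof (intro conjI allI impI ballI)
    fix i assume i: "i < card I"
    have "\<mu> = of_real (s (h i))" using hI[OF i] by (simp add: I_def)
    then show "e (h i) \<in> eigenspace \<mu>" using eig_eq[OF es] eig_V[OF es] by (simp add: eigenspace_of_real)
  next
    fix c i assume 0: "(\<Sum>i<card I. cscale (c i) (e (h i))) = 0" and i: "i < card I"
    have "bc (\<Sum>j<card I. cscale (c j) (e (h j))) (e (h i)) = (\<Sum>j<card I. if j = i then c j else 0)"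
      unfolding bc_sum bc_cscale using h i by (intro sum.cong) (auto simp: eig_orth[OF es] bij_betw_def inj_on_def)
    then show "c i = 0" using 0 i by simp
  next
    fix x assume x: "x \<in> eigenspace \<mu>"
    show "\<exists>c. x = (\<Sum>i<card I. cscale (c i) (e (h i)))"
    proof (cases "x = 0")
      case True
      then show ?thesis by (intro exI[of _ "\<lambda>_. 0"]) simp
    next
      case False
      then have \<mu>: "\<mu> \<in> \<real>" "of_real (Re \<mu>) = \<mu>" using eigenspace_real[OF x] by auto
      then have "x \<in> V" "\<And>y. y \<in> V \<Longrightarrow> a x y = Re \<mu> * b x y" using x eigenspace_of_real[of x "Re \<mu>"] by auto
      from eig_complete[OF es this] have "x = (\<Sum>j\<in>I. cscale (bc x (e j)) (e j))" using \<mu>(1) by (simp add: I)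
      also have "\<dots> = (\<Sum>i<card I. cscale (bc x (e (h i))) (e (h i)))"
        by (rule sum.reindex_bij_betw[OF h, symmetric])
      finally show ?thesis by (intro exI[of _ "\<lambda>i. bc x (e (h i))"])
    qed
  qed
  then show ?thesis unfolding I_def by blast
qed

end

text \<open>At the first disagreement, say f k < g k, every index at which g takes the value f k
  lies below k, where f agrees with g, and f takes that value at k once more. Divergence makes the
  counts finite, so they differ.\<close>

lemma mono_sequences_eq:
  fixes s t :: "nat \<Rightarrow> real"
  assumes s: "mono_on {1..} s" "filterlim s at_top sequentially" and t: "mono_on {1..} t" "filterlim t at_top sequentially"
    and card: "\<And>\<mu>. card {j. 1 \<le> j \<and> s j = \<mu>} = card {j. 1 \<le> j \<and> t j = \<mu>}"
    and k: "1 \<le> k"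
  shows "s k = t k"
  using k
proof (induction k rule: less_induct)
  case (less k)
  have fin: "finite {j. 1 \<le> j \<and> f j = \<mu>}" if f: "filterlim f at_top sequentially" for f :: "nat \<Rightarrow> real" and \<mu>
  proof -
    obtain N where N: "\<And>n. n \<ge> N \<Longrightarrow> \<mu> + 1 \<le> f n"
      using f unfolding filterlim_at_top eventually_sequentially by blast
    have "j < N" if "f j = \<mu>" for j using N[of j] that by (cases "j < N") auto
    then have "{j. 1 \<le> j \<and> f j = \<mu>} \<subseteq> {..<N}" by blast
    then show ?thesis by (rule finite_subset) simp
  qed
  have not_less: "\<not> f k < g k" if g: "mono_on {1..} g" and f: "filterlim f at_top sequentially"
    and eq: "\<And>j. 1 \<le> j \<Longrightarrow> j < k \<Longrightarrow> g j = f j" and card: "\<And>\<mu>. card {j. 1 \<le> j \<and> g j = \<mu>} = card {j. 1 \<le> j \<and> f j = \<mu>}"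
    for f g :: "nat \<Rightarrow> real"
  proof
    assume l: "f k < g k"
    have "{j. 1 \<le> j \<and> g j = f k} \<subset> {j. 1 \<le> j \<and> f j = f k}"
    proof (rule psubsetI)
      show "{j. 1 \<le> j \<and> g j = f k} \<subseteq> {j. 1 \<le> j \<and> f j = f k}"
      proof clarify
        fix j assume j: "1 \<le> j" "g j = f k"
        have "j < k"
        proof (rule ccontr)
          assume "\<not> j < k"
          then have "g k \<le> g j" using mono_onD[OF g, of k j] less.prems j(1) by simp
          then show False using l j(2) by simp
        qed
        then show "f j = f k" using eq[OF j(1)] j(2) by simp
      qed
      have "k \<in> {j. 1 \<le> j \<and> f j = f k}" "k \<notin> {j. 1 \<le> j \<and> g j = f k}" using less.prems l by auto
      then show "{j. 1 \<le> j \<and> g j = f k} \<noteq> {j. 1 \<le> j \<and> f j = f k}" by blast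
    qed
    from psubset_card_mono[OF fin[OF f] this] show False using card by simp
  qed
  show ?case
    using not_less[OF s(1) t(2)] not_less[OF t(1) s(2)] less.IH card by fastforce
qed

section \<open>The Hilbert space of square-integrable functions\<close>

definition sqint :: "('a::euclidean_space \<Rightarrow> 'b::euclidean_space) \<Rightarrow> bool" where
  "sqint f \<longleftrightarrow> f \<in> borel_measurable lebesgue \<and> integrable lebesgue (\<lambda>x. (norm (f x))\<^sup>2)"

lemma sqint_measurable [measurable_dest]: "sqint f \<Longrightarrow> f \<in> borel_measurable lebesgue"
  by (simp add: sqint_def)

lemma norm_add_sq_le: "(norm (x + y))\<^sup>2 \<le> 2 * (norm x)\<^sup>2 + 2 * (norm (y::'a::real_normed_vector))\<^sup>2"
proof -
  have "(norm (x + y))\<^sup>2 \<le> (norm x + norm y)\<^sup>2" by (intro power_mono norm_triangle_ineq) auto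
  also have "\<dots> \<le> 2 * (norm x)\<^sup>2 + 2 * (norm y)\<^sup>2"
    using sum_squares_bound[of "norm x" "norm y"] by (simp add: power2_sum)
  finally show ?thesis .
qed

lemma sqint_bound:
  assumes "sqint f" "g \<in> borel_measurable lebesgue" "AE x in lebesgue. norm (g x) \<le> K * norm (f x)"
  shows "sqint g"
proof -
  have [measurable]: "g \<in> borel_measurable lebesgue" by fact
  have "integrable lebesgue (\<lambda>x. (norm (g x))\<^sup>2)"
  proof (rule Bochner_Integration.integrable_bound)
    show "integrable lebesgue (\<lambda>x. K\<^sup>2 * (norm (f x))\<^sup>2)" using assms(1) by (simp add: sqint_def)
    show "AE x in lebesgue. norm ((norm (g x))\<^sup>2) \<le> norm (K\<^sup>2 * (norm (f x))\<^sup>2)"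
      using assms(3) by eventually_elim (auto simp flip: power_mult_distrib intro: power_mono)
  qed measurable
  then show ?thesis using assms by (simp add: sqint_def)
qed

lemma sqint_0 [simp]: "sqint (\<lambda>x. 0)"
  by (simp add: sqint_def)

lemma sqint_add:
  assumes "sqint f" "sqint g" shows "sqint (\<lambda>x. f x + g x)"
proof -
  have [measurable]: "f \<in> borel_measurable lebesgue" "g \<in> borel_measurable lebesgue"
    using assms by (auto simp: sqint_def)
  have "integrable lebesgue (\<lambda>x. (norm (f x + g x))\<^sup>2)"
  proof (rule Bochner_Integration.integrable_bound)
    show "integrable lebesgue (\<lambda>x. 2 * (norm (f x))\<^sup>2 + 2 * (norm (g x))\<^sup>2)"
      using assms by (simp add: sqint_def)
  qed (auto intro: norm_add_sq_le)
  then show ?thesis by (simp add: sqint_def)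
qed

lemma sqint_scaleR: "sqint f \<Longrightarrow> sqint (\<lambda>x. r *\<^sub>R f x)"
  by (rule sqint_bound[where f=f and K="\<bar>r\<bar>"]) (auto simp: sqint_def intro!: borel_measurable_scaleR)

lemma sqint_minus: "sqint f \<Longrightarrow> sqint (\<lambda>x. - f x)"
  using sqint_scaleR[of f "-1"] by simp

lemma sqint_diff: "sqint f \<Longrightarrow> sqint g \<Longrightarrow> sqint (\<lambda>x. f x - g x)"
  using sqint_add[OF _ sqint_minus, of f g] by simp

lemma sqint_inner_integrable:
  assumes "sqint f" "sqint g"
  shows "integrable lebesgue (\<lambda>x. f x \<bullet> g x)"
proof (rule Bochner_Integration.integrable_bound)
  have [measurable]: "f \<in> borel_measurable lebesgue" "g \<in> borel_measurable lebesgue"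
    using assms by (auto simp: sqint_def)
  show "integrable lebesgue (\<lambda>x. (norm (f x))\<^sup>2 + (norm (g x))\<^sup>2)"
    using assms by (simp add: sqint_def)
  show "(\<lambda>x. f x \<bullet> g x) \<in> borel_measurable lebesgue" by measurable
  have "\<bar>u \<bullet> v\<bar> \<le> (norm u)\<^sup>2 + (norm v)\<^sup>2" for u v :: 'b
    using Cauchy_Schwarz_ineq2[of u v] sum_squares_bound[of "norm u" "norm v"]
      mult_nonneg_nonneg[OF norm_ge_zero norm_ge_zero, of u v] by linarith
  then show "AE x in lebesgue. norm (f x \<bullet> g x) \<le> norm ((norm (f x))\<^sup>2 + (norm (g x))\<^sup>2)" by auto
qed

definition l2_rel :: "('a::euclidean_space \<Rightarrow> 'b::euclidean_space) \<Rightarrow> ('a \<Rightarrow> 'b) \<Rightarrow> bool" where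
  "l2_rel f g \<longleftrightarrow> sqint f \<and> sqint g \<and> (AE x in lebesgue. f x = g x)"

\<comment> \<open>Square-integrable functions on the whole space modulo equality almost everywhere;
  functions on \<Omega> enter through extension by 0. The relation is partial because it excludes
  all other functions.\<close>
quotient_type (overloaded) ('a, 'b) l2 = "'a::euclidean_space \<Rightarrow> 'b::euclidean_space" / partial: l2_rel
proof (rule part_equivpI)
  show "\<exists>x. l2_rel x x" by (intro exI[of _ "\<lambda>_. 0"]) (simp add: l2_rel_def)
  show "symp l2_rel" by (auto simp: symp_def l2_rel_def elim: eventually_mono)
  show "transp l2_rel" unfolding transp_def l2_rel_def by (auto elim: eventually_elim2)
qed

instantiation l2 :: (euclidean_space, euclidean_space) real_vector
begin

lift_definition zero_l2 :: "('a, 'b) l2" is "\<lambda>x. 0"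
  by (simp add: l2_rel_def)

lift_definition plus_l2 :: "('a, 'b) l2 \<Rightarrow> ('a, 'b) l2 \<Rightarrow> ('a, 'b) l2" is "\<lambda>f g x. f x + g x"
  unfolding l2_rel_def by (auto intro: sqint_add elim: eventually_elim2)

lift_definition minus_l2 :: "('a, 'b) l2 \<Rightarrow> ('a, 'b) l2 \<Rightarrow> ('a, 'b) l2" is "\<lambda>f g x. f x - g x"
  unfolding l2_rel_def by (auto intro: sqint_diff elim: eventually_elim2)

lift_definition uminus_l2 :: "('a, 'b) l2 \<Rightarrow> ('a, 'b) l2" is "\<lambda>f x. - f x"
  unfolding l2_rel_def by (auto intro: sqint_minus elim: eventually_mono)

lift_definition scaleR_l2 :: "real \<Rightarrow> ('a, 'b) l2 \<Rightarrow> ('a, 'b) l2" is "\<lambda>r f x. r *\<^sub>R f x"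
  unfolding l2_rel_def by (auto intro: sqint_scaleR elim: eventually_mono)

instance
proof
  fix u v w :: "('a, 'b) l2" and r s :: real
  show "u + v + w = u + (v + w)"
    by transfer (auto simp: l2_rel_def add.assoc intro: sqint_add)
  show "u + v = v + u"
    by transfer (auto simp: l2_rel_def add.commute intro: sqint_add)
  show "0 + u = u"
    by transfer (auto simp: l2_rel_def)
  show "- u + u = 0"
    by transfer (auto simp: l2_rel_def)
  show "u - v = u + - v"
    by transfer (auto simp: l2_rel_def intro: sqint_diff)
  show "r *\<^sub>R (u + v) = r *\<^sub>R u + r *\<^sub>R v"
    by transfer (auto simp: l2_rel_def scaleR_add_right intro!: sqint_add sqint_scaleR)
  show "(r + s) *\<^sub>R u = r *\<^sub>R u + s *\<^sub>R u"
    by transfer (auto simp: l2_rel_def scaleR_add_left intro!: sqint_add sqint_scaleR)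
  show "r *\<^sub>R s *\<^sub>R u = (r * s) *\<^sub>R u"
    by transfer (auto simp: l2_rel_def intro!: sqint_scaleR)
  show "1 *\<^sub>R u = u"
    by transfer (auto simp: l2_rel_def)
qed

end

instantiation l2 :: (euclidean_space, euclidean_space) real_inner
begin

lift_definition inner_l2 :: "('a, 'b) l2 \<Rightarrow> ('a, 'b) l2 \<Rightarrow> real" is "\<lambda>f g. \<integral>x. f x \<bullet> g x \<partial>lebesgue"
  unfolding l2_rel_def
  by (intro integral_cong_AE) (auto elim: eventually_elim2 simp: sqint_def)

definition norm_l2 :: "('a, 'b) l2 \<Rightarrow> real" where "norm_l2 u = sqrt (u \<bullet> u)"
definition dist_l2 :: "('a, 'b) l2 \<Rightarrow> ('a, 'b) l2 \<Rightarrow> real" where "dist_l2 u v = norm (u - v)"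
definition sgn_l2 :: "('a, 'b) l2 \<Rightarrow> ('a, 'b) l2" where "sgn_l2 u = u /\<^sub>R norm u"
definition uniformity_l2 :: "(('a, 'b) l2 \<times> ('a, 'b) l2) filter" where
  "uniformity_l2 = (INF e\<in>{0 <..}. principal {(x, y). dist x y < e})"
definition open_l2 :: "('a, 'b) l2 set \<Rightarrow> bool" where
  "open_l2 U \<longleftrightarrow> (\<forall>x\<in>U. eventually (\<lambda>(x', y). x' = x \<longrightarrow> y \<in> U) uniformity)"

instance
proof
  fix u v w :: "('a, 'b) l2" and r s :: real
  show "dist u v = norm (u - v)" by (simp add: dist_l2_def)
  show "sgn u = u /\<^sub>R norm u" by (simp add: sgn_l2_def)
  show "(uniformity :: (('a, 'b) l2 \<times> ('a, 'b) l2) filter) = (INF e\<in>{0 <..}. principal {(x, y). dist x y < e})"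
    by (simp add: uniformity_l2_def)
  show "open U \<longleftrightarrow> (\<forall>x\<in>U. eventually (\<lambda>(x', y). x' = x \<longrightarrow> y \<in> U) uniformity)" for U :: "('a, 'b) l2 set"
    by (simp add: open_l2_def)
  show "norm u = sqrt (u \<bullet> u)" by (simp add: norm_l2_def)
  show "u \<bullet> v = v \<bullet> u"
    by transfer (simp add: inner_commute)
  show "(u + v) \<bullet> w = u \<bullet> w + v \<bullet> w"
    by transfer (simp add: l2_rel_def inner_add_left sqint_inner_integrable)
  show "r *\<^sub>R u \<bullet> v = r * (u \<bullet> v)"
    by transfer simp
  show "0 \<le> u \<bullet> u"
    by transfer (rule Bochner_Integration.integral_nonneg, simp)
  show "u \<bullet> u = 0 \<longleftrightarrow> u = 0"
  proof (transfer)
    fix f :: "'a \<Rightarrow> 'b" assume "l2_rel f f"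
    then have f: "sqint f" by (simp add: l2_rel_def)
    then have "(\<integral>x. f x \<bullet> f x \<partial>lebesgue) = 0 \<longleftrightarrow> (AE x in lebesgue. f x \<bullet> f x = 0)"
      by (intro integral_nonneg_eq_0_iff_AE sqint_inner_integrable) auto
    then show "(\<integral>x. f x \<bullet> f x \<partial>lebesgue) = 0 \<longleftrightarrow> l2_rel f (\<lambda>x. 0)"
      using f by (simp add: l2_rel_def)
  qed
qed

end

lemma rep_l2: "sqint (rep_l2 u)"
  using Quotient3_rep_reflp[OF Quotient3_l2, of u] by (simp add: l2_rel_def)

lemma abs_rep_l2 [simp]: "abs_l2 (rep_l2 u) = u"
  using Quotient3_abs_rep[OF Quotient3_l2] .

lemma abs_l2_eq_iff: "sqint f \<Longrightarrow> sqint g \<Longrightarrow> abs_l2 f = abs_l2 g \<longleftrightarrow> (AE x in lebesgue. f x = g x)"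
  using Quotient3_rel[OF Quotient3_l2, of f g] by (auto simp: l2_rel_def)

lemma rep_abs_l2: "sqint f \<Longrightarrow> AE x in lebesgue. rep_l2 (abs_l2 f) x = f x"
  using abs_l2_eq_iff[OF rep_l2, of f "abs_l2 f"] by simp

lemma abs_l2_0: "abs_l2 (\<lambda>x. 0) = 0" by (simp add: zero_l2.abs_eq)

lemma abs_l2_add: "sqint f \<Longrightarrow> sqint g \<Longrightarrow> abs_l2 (\<lambda>x. f x + g x) = abs_l2 f + abs_l2 g"
  and abs_l2_diff: "sqint f \<Longrightarrow> sqint g \<Longrightarrow> abs_l2 (\<lambda>x. f x - g x) = abs_l2 f - abs_l2 g"
  and abs_l2_scaleR: "sqint f \<Longrightarrow> abs_l2 (\<lambda>x. r *\<^sub>R f x) = r *\<^sub>R abs_l2 f"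
  and inner_abs_l2: "sqint f \<Longrightarrow> sqint g \<Longrightarrow> abs_l2 f \<bullet> abs_l2 g = (\<integral>x. f x \<bullet> g x \<partial>lebesgue)"
  by (simp_all add: plus_l2.abs_eq minus_l2.abs_eq scaleR_l2.abs_eq inner_l2.abs_eq eq_onp_def l2_rel_def)

lemma norm_abs_l2: "sqint f \<Longrightarrow> (norm (abs_l2 f))\<^sup>2 = (\<integral>x. (norm (f x))\<^sup>2 \<partial>lebesgue)"
  by (simp add: power2_norm_eq_inner inner_abs_l2)

lemma nn_norm_abs_l2: "sqint f \<Longrightarrow> (\<integral>\<^sup>+x. ennreal ((norm (f x))\<^sup>2) \<partial>lebesgue) = ennreal ((norm (abs_l2 f))\<^sup>2)"
  by (simp add: norm_abs_l2 nn_integral_eq_integral sqint_def)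

lemma l2_cases: obtains f where "sqint f" "u = abs_l2 f"
  using that[OF rep_l2, of u] by simp

lemma sqint_nn_integral:
  assumes "f \<in> borel_measurable lebesgue" "(\<integral>\<^sup>+x. ennreal ((norm (f x))\<^sup>2) \<partial>lebesgue) < \<infinity>"
  shows "sqint f"
  unfolding sqint_def using assms by (auto intro!: integrableI_nonneg)

text \<open>The core of the Riesz-Fischer theorem. The sum of 2^k |F (k+1) - F k|^2 has finite
  integral since 2^k / 16^k = 8^(-k), so almost everywhere the increments are at most a constant
  times 2^(-k/2) and the functions converge pointwise. Fatou's lemma identifies this limit as the
  limit in the norm.\<close>

lemma l2_rapid_Cauchy_convergent:
  fixes u :: "nat \<Rightarrow> ('a::euclidean_space, 'b::euclidean_space) l2"
  assumes rapid: "\<And>k. norm (u (Suc k) - u k) \<le> (1/4)^k"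
  shows "convergent u"
proof -
  define F where "F k = rep_l2 (u k)" for k
  have F: "sqint (F k)" "abs_l2 (F k) = u k" for k by (simp_all add: F_def rep_l2)
  have Fm [measurable]: "F k \<in> borel_measurable lebesgue" for k using F(1) by (simp add: sqint_def)
  have nF: "(\<integral>\<^sup>+x. ennreal ((norm (F j x - F k x))\<^sup>2) \<partial>lebesgue) = ennreal ((norm (u j - u k))\<^sup>2)" for j k
    using nn_norm_abs_l2[OF sqint_diff[OF F(1) F(1), of j k]] by (simp add: abs_l2_diff F)
  have "(\<integral>\<^sup>+x. (\<Sum>k. ennreal (2^k * (norm (F (Suc k) x - F k x))\<^sup>2)) \<partial>lebesgue)
      = (\<Sum>k. \<integral>\<^sup>+x. ennreal (2^k * (norm (F (Suc k) x - F k x))\<^sup>2) \<partial>lebesgue)"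
    by (rule nn_integral_suminf) measurable
  also have "\<dots> \<le> (\<Sum>k. ennreal ((1/8)^k))"
  proof (intro suminf_le summableI)
    fix k
    have "(\<integral>\<^sup>+x. ennreal (2^k * (norm (F (Suc k) x - F k x))\<^sup>2) \<partial>lebesgue) = ennreal (2^k) * ennreal ((norm (u (Suc k) - u k))\<^sup>2)"
      by (simp add: ennreal_mult nn_integral_cmult nF)
    also have "\<dots> = ennreal (2^k * (norm (u (Suc k) - u k))\<^sup>2)" by (simp add: ennreal_mult)
    also have "\<dots> \<le> ennreal ((1/8)^k)"
    proof (rule ennreal_leI)
      have "2^k * (norm (u (Suc k) - u k))\<^sup>2 \<le> 2^k * ((1/4)^k)\<^sup>2"
        by (intro mult_left_mono power_mono rapid) auto
      also have "\<dots> = (2 * ((1/4)^2))^k" by (simp only: power_mult_distrib power_mult[symmetric] mult.commute[of 2 k])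
      also have "\<dots> = (1/8::real)^k" by (simp add: power2_eq_square)
      finally show "2^k * (norm (u (Suc k) - u k))\<^sup>2 \<le> (1/8)^k" .
    qed
    finally show "(\<integral>\<^sup>+x. ennreal (2^k * (norm (F (Suc k) x - F k x))\<^sup>2) \<partial>lebesgue) \<le> ennreal ((1/8)^k)" .
  qed
  also have "\<dots> < \<infinity>"
  proof -
    have "summable (\<lambda>k. (1/8::real)^k)" by (rule summable_geometric) simp
    then have "(\<Sum>k. ennreal ((1/8)^k)) = ennreal (\<Sum>k. (1/8)^k)" by (rule suminf_ennreal2[rotated]) simp
    then show ?thesis by (simp only: ennreal_less_top infinity_ennreal_def)
  qed
  finally have fin: "(\<integral>\<^sup>+x. (\<Sum>k. ennreal (2^k * (norm (F (Suc k) x - F k x))\<^sup>2)) \<partial>lebesgue) < \<infinity>" .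
  have "AE x in lebesgue. (\<Sum>k. ennreal (2^k * (norm (F (Suc k) x - F k x))\<^sup>2)) \<noteq> \<infinity>"
    using fin by (intro nn_integral_noteq_infinite) auto
  then have conv: "AE x in lebesgue. convergent (\<lambda>k. F k x)"
  proof eventually_elim
    case (elim x)
    have "summable (\<lambda>k. 2^k * (norm (F (Suc k) x - F k x))\<^sup>2)"
      using elim by (intro summable_suminf_not_top) auto
    then have "Bseq (\<lambda>k. 2^k * (norm (F (Suc k) x - F k x))\<^sup>2)" by (rule summable_imp_Bseq)
    then obtain M where M: "\<And>k. norm (2^k * (norm (F (Suc k) x - F k x))\<^sup>2) \<le> M" by (elim BseqE) blast
    have "norm (F (Suc k) x - F k x) \<le> sqrt M * (1 / sqrt 2)^k" for k
    proof -
      have "(norm (F (Suc k) x - F k x))\<^sup>2 \<le> M / 2^k" using M[of k] by (simp add: field_simps)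
      then have "norm (F (Suc k) x - F k x) \<le> sqrt (M / 2^k)" by (rule real_le_rsqrt)
      then show ?thesis by (simp add: real_sqrt_divide real_sqrt_power power_divide)
    qed
    moreover have "summable (\<lambda>k. sqrt M * (1 / sqrt 2)^k)"
      by (intro summable_mult summable_geometric) (simp add: real_less_rsqrt)
    ultimately have "summable (\<lambda>k. F (Suc k) x - F k x)"
      by (rule summable_comparison_test'[where N=0, rotated])
    then have "convergent (\<lambda>n. \<Sum>k<n. F (Suc k) x - F k x)" by (simp only: summable_iff_convergent)
    then have "convergent (\<lambda>n. F n x - F 0 x)" by (simp only: sum_lessThan_telescope[of "\<lambda>k. F k x"])
    then have "convergent (\<lambda>n. (F n x - F 0 x) + F 0 x)" by (intro convergent_add convergent_const)
    then show ?case by simp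
  qed
  define f where "f x = lim (\<lambda>k. F k x)" for x
  have fm [measurable]: "f \<in> borel_measurable lebesgue"
    unfolding f_def by (rule borel_measurable_lim_metric) measurable
  have "summable (\<lambda>k. (1/4::real)^k)" by (rule summable_geometric) simp
  have dist_u: "norm (u (m + n) - u m) \<le> 2 * (1/4)^m" for m n
  proof -
    have "norm (u (m + n) - u m) = norm (\<Sum>i<n. u (m + Suc i) - u (m + i))"
      by (simp only: sum_lessThan_telescope[of "\<lambda>i. u (m + i)"] add_0_right)
    also have "\<dots> \<le> (\<Sum>i<n. (1/4)^(m + i))" by (intro sum_norm_le) (use rapid in auto)
    also have "\<dots> = (1/4)^m * (\<Sum>i<n. (1/4)^i)" by (simp add: power_add sum_distrib_left)
    also have "(\<Sum>i<n. (1/4)^i) \<le> (\<Sum>i. (1/4::real)^i)"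
      using \<open>summable (\<lambda>k. (1/4::real)^k)\<close> by (intro sum_le_suminf) auto
    also have "(\<Sum>i. (1/4::real)^i) \<le> 2" by (subst suminf_geometric) auto
    finally show ?thesis by simp
  qed
  have fatou: "(\<integral>\<^sup>+x. ennreal ((norm (f x - F m x))\<^sup>2) \<partial>lebesgue) \<le> ennreal ((2 * (1/4)^m)\<^sup>2)" for m
  proof -
    have "(\<integral>\<^sup>+x. ennreal ((norm (f x - F m x))\<^sup>2) \<partial>lebesgue)
      = (\<integral>\<^sup>+x. liminf (\<lambda>n. ennreal ((norm (F n x - F m x))\<^sup>2)) \<partial>lebesgue)"
    proof (intro nn_integral_cong_AE)
      show "AE x in lebesgue. ennreal ((norm (f x - F m x))\<^sup>2) = liminf (\<lambda>n. ennreal ((norm (F n x - F m x))\<^sup>2))"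
        using conv
      proof eventually_elim
        case (elim x)
        then have "(\<lambda>n. F n x) \<longlonglongrightarrow> f x" unfolding f_def by (simp add: convergent_LIMSEQ_iff)
        then have "(\<lambda>n. ennreal ((norm (F n x - F m x))\<^sup>2)) \<longlonglongrightarrow> ennreal ((norm (f x - F m x))\<^sup>2)"
          by (intro tendsto_ennrealI tendsto_power tendsto_norm tendsto_diff tendsto_const)
        then show ?case by (intro lim_imp_Liminf[symmetric]) auto
      qed
    qed
    also have "\<dots> \<le> liminf (\<lambda>n. \<integral>\<^sup>+x. ennreal ((norm (F n x - F m x))\<^sup>2) \<partial>lebesgue)"
      by (rule nn_integral_liminf) measurable
    also have "\<dots> = liminf (\<lambda>n. ennreal ((norm (u n - u m))\<^sup>2))" by (simp add: nF)
    also have "\<dots> \<le> liminf (\<lambda>n. ennreal ((2 * (1/4)^m)\<^sup>2))"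
    proof (intro Liminf_mono eventually_sequentiallyI[of m] ennreal_leI power_mono)
      fix n assume "n \<ge> m"
      then show "norm (u n - u m) \<le> 2 * (1/4)^m" using dist_u[of m "n - m"] by simp
    qed simp
    also have "\<dots> = ennreal ((2 * (1/4)^m)\<^sup>2)" by (simp add: Liminf_const)
    finally show ?thesis .
  qed
  have sq: "sqint (\<lambda>x. f x - F m x)" for m
    using fatou[of m] by (intro sqint_nn_integral) (auto simp: le_less_trans)
  have "sqint f" using sqint_add[OF sq[of 0] F(1)[of 0]] by simp
  have "norm (u m - abs_l2 f) \<le> 2 * (1/4)^m" for m
  proof -
    have "ennreal ((norm (abs_l2 f - u m))\<^sup>2) \<le> ennreal ((2 * (1/4)^m)\<^sup>2)"
      using fatou[of m] nn_norm_abs_l2[OF sq[of m]] by (simp add: abs_l2_diff F \<open>sqint f\<close>)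
    then have "(norm (abs_l2 f - u m))\<^sup>2 \<le> (2 * (1/4)^m)\<^sup>2" by (simp add: ennreal_le_iff)
    then have "norm (abs_l2 f - u m) \<le> 2 * (1/4)^m" by (rule power2_le_imp_le) simp
    then show ?thesis by (simp add: norm_minus_commute)
  qed
  moreover have "(\<lambda>m. 2 * (1/4::real)^m) \<longlonglongrightarrow> 2 * 0" by (intro tendsto_mult tendsto_const LIMSEQ_power_zero) simp
  ultimately have "(\<lambda>m. u m - abs_l2 f) \<longlonglongrightarrow> 0"
    by (intro Lim_null_comparison[of "\<lambda>m. u m - abs_l2 f" "\<lambda>m. 2 * (1/4::real)^m"]) auto
  then have "u \<longlonglongrightarrow> abs_l2 f" by (rule LIM_zero_cancel)
  then show ?thesis by (auto simp: convergent_def)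
qed

instance l2 :: (euclidean_space, euclidean_space) complete_space
proof
  fix X :: "nat \<Rightarrow> ('a, 'b) l2" assume X: "Cauchy X"
  have "\<exists>N. \<forall>m\<ge>N. \<forall>n\<ge>N. norm (X m - X n) < (1/4)^k" for k
    using metric_CauchyD[OF X, of "(1/4)^k"] by (simp add: dist_norm)
  then obtain N where N: "\<And>k m n. m \<ge> N k \<Longrightarrow> n \<ge> N k \<Longrightarrow> norm (X m - X n) < (1/4)^k" by metis
  \<comment> \<open>Partial sums keep r k above N k, and adding k makes r strictly
    increasing.\<close>
  define r where "r k = (\<Sum>i\<le>k. N i) + k" for k
  have r: "strict_mono r" unfolding strict_mono_Suc_iff by (simp add: r_def)
  have rN: "r k \<ge> N k" for k
    unfolding r_def using member_le_sum[of k "{..k}" N] by simp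
  have "norm (X (r (Suc k)) - X (r k)) \<le> (1/4)^k" for k
    using N[of k "r (Suc k)" "r k"] rN[of k] strict_mono_less_eq[OF r, of k "Suc k"] by simp
  then have "convergent (X \<circ> r)" by (intro l2_rapid_Cauchy_convergent) simp
  then obtain L where "(X \<circ> r) \<longlonglongrightarrow> L" by (auto simp: convergent_def)
  then have "X \<longlonglongrightarrow> L" by (rule Cauchy_converges_subseq[OF X r])
  then show "convergent X" by (auto simp: convergent_def)
qed

section \<open>Multiplication operators with matrix-valued symbols\<close>

definition l2_symbol :: "('a::euclidean_space \<Rightarrow> 'b::euclidean_space \<Rightarrow> 'c::euclidean_space) \<Rightarrow> bool" where
  "l2_symbol m \<longleftrightarrow> (\<forall>x. linear (m x)) \<and> (\<exists>K. \<forall>x v. norm (m x v) \<le> K * norm v) \<and>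
     (\<forall>f\<in>borel_measurable lebesgue. (\<lambda>x. m x (f x)) \<in> borel_measurable lebesgue)"

lemma l2_symbol_sqint:
  assumes "l2_symbol m" "sqint f"
  shows "sqint (\<lambda>x. m x (f x))"
proof -
  obtain K where "\<And>x v. norm (m x v) \<le> K * norm v" using assms(1) by (auto simp: l2_symbol_def)
  then show ?thesis
    using assms by (intro sqint_bound[OF assms(2), of _ K]) (auto simp: sqint_def l2_symbol_def)
qed

definition l2_mult :: "('a::euclidean_space \<Rightarrow> 'b::euclidean_space \<Rightarrow> 'c::euclidean_space) \<Rightarrow> ('a, 'b) l2 \<Rightarrow>\<^sub>L ('a, 'c) l2" where
  "l2_mult m = Blinfun (\<lambda>u. abs_l2 (\<lambda>x. m x (rep_l2 u x)))"

lemma l2_mult: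
  assumes m: "l2_symbol m"
  shows "sqint f \<Longrightarrow> l2_mult m (abs_l2 f) = abs_l2 (\<lambda>x. m x (f x))"
proof -
  have lin: "linear (m x)" for x using m by (simp add: l2_symbol_def)
  obtain K where K: "\<And>x v. norm (m x v) \<le> K * norm v" using m by (auto simp: l2_symbol_def)
  define T where "T u = abs_l2 (\<lambda>x. m x (rep_l2 u x))" for u
  have T: "T (abs_l2 f) = abs_l2 (\<lambda>x. m x (f x))" if f: "sqint f" for f
    unfolding T_def using rep_abs_l2[OF f]
    by (subst abs_l2_eq_iff) (auto intro!: l2_symbol_sqint[OF m] rep_l2 f elim!: eventually_mono)
  have "bounded_linear T"
  proof (rule bounded_linear_intro[where K="\<bar>K\<bar>"])
    fix u v :: "('a, 'b) l2" and r :: real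
    obtain f g where fg: "sqint f" "u = abs_l2 f" "sqint g" "v = abs_l2 g" by (metis l2_cases)
    show "T (u + v) = T u + T v"
      using fg by (simp add: T abs_l2_add[symmetric] sqint_add l2_symbol_sqint[OF m] linear_add[OF lin])
    show "T (r *\<^sub>R u) = r *\<^sub>R T u"
      using fg by (simp add: T abs_l2_scaleR[symmetric] sqint_scaleR l2_symbol_sqint[OF m] linear_scale[OF lin])
    have "(norm (T u))\<^sup>2 \<le> (\<bar>K\<bar> * norm u)\<^sup>2"
    proof -
      have "(norm (T u))\<^sup>2 = (\<integral>x. (norm (m x (f x)))\<^sup>2 \<partial>lebesgue)"
        using fg by (simp add: T norm_abs_l2 l2_symbol_sqint[OF m])
      also have "\<dots> \<le> (\<integral>x. K\<^sup>2 * (norm (f x))\<^sup>2 \<partial>lebesgue)"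
      proof (rule integral_mono)
        show "integrable lebesgue (\<lambda>x. (norm (m x (f x)))\<^sup>2)" using l2_symbol_sqint[OF m fg(1)] by (simp add: sqint_def)
        show "integrable lebesgue (\<lambda>x. K\<^sup>2 * (norm (f x))\<^sup>2)" using fg(1) by (simp add: sqint_def)
        show "(norm (m x (f x)))\<^sup>2 \<le> K\<^sup>2 * (norm (f x))\<^sup>2" for x
          unfolding power_mult_distrib[symmetric] by (intro power_mono K) auto
      qed
      also have "\<dots> = (\<bar>K\<bar> * norm u)\<^sup>2" using fg by (simp add: norm_abs_l2 power_mult_distrib)
      finally show ?thesis .
    qed
    then have "norm (T u) \<le> \<bar>K\<bar> * norm u" by (rule power2_le_imp_le) simp
    then show "norm (T u) \<le> norm u * \<bar>K\<bar>" by (simp only: mult.commute)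
  qed
  then show "sqint f \<Longrightarrow> l2_mult m (abs_l2 f) = abs_l2 (\<lambda>x. m x (f x))"
    using T by (simp add: l2_mult_def T_def[abs_def] bounded_linear_Blinfun_apply)
qed

section \<open>Rellich compactness and the Hardy inequality\<close>

text \<open>For a Lebesgue measurable set, continuity of g alone would not be enough; the preimage
  under g is the image under the differentiable map h, and such images are measurable.\<close>

lemma lebesgue_measurable_diffeo:
  fixes g h :: "'a::euclidean_space \<Rightarrow> 'a"
  assumes h: "\<And>x. h differentiable (at x)" and inv: "\<And>x. g (h x) = x" "\<And>x. h (g x) = x"
  shows "g \<in> lebesgue \<rightarrow>\<^sub>M lebesgue"
proof (rule measurableI)
  fix A :: "'a set" assume A: "A \<in> sets lebesgue"
  have "h ` A \<in> sets lebesgue"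
    by (rule differentiable_image_in_sets_lebesgue[OF A])
       (use h in \<open>auto simp: differentiable_on_def intro: differentiable_at_withinI\<close>)
  also have "h ` A = g -` A"
  proof
    show "h ` A \<subseteq> g -` A" using inv by auto
    show "g -` A \<subseteq> h ` A" using inv(2) by (metis image_eqI subsetI vimageE)
  qed
  finally show "g -` A \<inter> space lebesgue \<in> sets lebesgue" by simp
qed simp

text \<open>The change of variables as an identity of measures, from which the versions for
  nonnegative and for vector-valued integrals both follow.\<close>

lemma lebesgue_distr_diffeo:
  fixes g h :: "real^'n::{finite,wellorder} \<Rightarrow> real^'n::_"
  assumes g: "\<And>x. (g has_derivative g' x) (at x)" and h: "\<And>x. h differentiable (at x)"
    and inv: "\<And>x. g (h x) = x" "\<And>x. h (g x) = x"
    and D: "D \<in> borel_measurable lebesgue" "\<And>x. D x = \<bar>det (matrix (g' x))\<bar>"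
  shows "distr (density lebesgue (\<lambda>x. ennreal (D x))) lebesgue g = lebesgue" (is "?M = _")
proof (rule measure_eqI)
  show "sets ?M = sets lebesgue" by simp
  have gm: "g \<in> lebesgue \<rightarrow>\<^sub>M lebesgue" by (rule lebesgue_measurable_diffeo[OF h inv])
  have bounded_case: "emeasure ?M A = emeasure lebesgue A" if A: "A \<in> lmeasurable" for A
  proof -
    have Am: "A \<in> sets lebesgue" using A by (rule fmeasurableD)
    have Bm: "g -` A \<in> sets lebesgue" using measurable_sets[OF gm Am] by simp
    have img: "g ` (g -` A) = A" using inv(1) by (metis surj_def surj_image_vimage_eq)
    have "((\<lambda>x. \<bar>det (matrix (g' x))\<bar>) has_integral measure lebesgue A) (g -` A)"
      using has_measure_differentiable_image[of "g -` A" g g' "measure lebesgue A"] Bm g inv(2) A img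
      by (metis has_derivative_at_withinI inj_on_def)
    then have int: "(D has_integral measure lebesgue A) (g -` A)" by (simp add: D(2)[abs_def])
    have "emeasure ?M A = emeasure (density lebesgue (\<lambda>x. ennreal (D x))) (g -` A)"
      using gm Am by (subst emeasure_distr) auto
    also have "\<dots> = (\<integral>\<^sup>+x. ennreal (D x) * indicator (g -` A) x \<partial>lebesgue)"
      using D(1) Bm by (intro emeasure_density) auto
    also have "\<dots> = ennreal (measure lebesgue A)"
    proof -
      have "(\<integral>\<^sup>+x. ennreal (D x) * indicator (g -` A) x \<partial>lebesgue) = (\<integral>\<^sup>+x. ennreal (indicator (g -` A) x * D x) \<partial>lebesgue)"
        by (intro nn_integral_cong) (simp split: split_indicator)
      also have "\<dots> = (\<integral>\<^sup>+x. ennreal (indicator (g -` A) x * D x) \<partial>lborel)"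
        by (simp add: nn_integral_completion)
      also have "\<dots> = ennreal (measure lebesgue A)"
        by (rule nn_integral_has_integral_lebesgue[OF _ int]) (simp add: D(2))
      finally show ?thesis .
    qed
    also have "\<dots> = emeasure lebesgue A" using A by (simp add: emeasure_eq_measure2)
    finally show ?thesis .
  qed
  fix A assume "A \<in> sets ?M"
  then have Am: "A \<in> sets lebesgue" by simp
  \<comment> \<open>The formula is known for sets of finite measure; balls exhaust the general
    case.\<close>
  define A' where "A' n = A \<inter> cball 0 (real n)" for n
  have A': "A' n \<in> lmeasurable" for n
    unfolding A'_def using Am by (intro bounded_set_imp_lmeasurable) (auto intro: bounded_subset[OF bounded_cball])
  have "incseq A'" by (auto simp: A'_def incseq_def)
  have un: "(\<Union>n. A' n) = A"
    using real_arch_simple by (auto simp: A'_def)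
  have "emeasure ?M A = (SUP n. emeasure ?M (A' n))"
    unfolding un[symmetric] using A' \<open>incseq A'\<close>
    by (intro SUP_emeasure_incseq[symmetric]) (auto intro: fmeasurableD)
  also have "\<dots> = (SUP n. emeasure lebesgue (A' n))" using bounded_case[OF A'] by simp
  also have "\<dots> = emeasure lebesgue A"
    unfolding un[symmetric] using A' \<open>incseq A'\<close>
    by (intro SUP_emeasure_incseq) (auto intro: fmeasurableD)
  finally show "emeasure ?M A = emeasure lebesgue A" .
qed

text \<open>Cauchy-Schwarz on an interval, obtained by integrating the square of w' minus its mean.
  It is applied to segments for the translation estimate and to circles for the Hardy
  inequality.\<close>

lemma norm_diff_sq_le_integral:
  fixes w :: "real \<Rightarrow> 'a::euclidean_space"
  assumes ab: "a < b" and w: "\<And>t. (w has_vector_derivative w' t) (at t)" and w': "continuous_on UNIV w'"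
  shows "ennreal ((norm (w b - w a))\<^sup>2) \<le> ennreal (b - a) * (\<integral>\<^sup>+t. ennreal ((norm (w' t))\<^sup>2) * indicator {a..b} t \<partial>lborel)"
proof -
  define c where "c = w b - w a"
  have w'ab: "continuous_on {a..b} w'" using w' continuous_on_subset by blast
  have "(w' has_integral c) {a..b}"
    unfolding c_def using ab w by (intro fundamental_theorem_of_calculus) (auto intro: has_vector_derivative_at_within)
  then have i1: "((\<lambda>t. w' t \<bullet> c) has_integral c \<bullet> c) {a..b}"
    using has_integral_linear[OF _ bounded_linear_inner_left, of w' c _ c] by (simp add: o_def)
  obtain I where I: "((\<lambda>t. (norm (w' t))\<^sup>2) has_integral I) {a..b}"
    using integrable_continuous_interval[OF continuous_on_power[OF continuous_on_norm[OF w'ab], of 2]]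
    unfolding integrable_on_def by blast
  have i2: "((\<lambda>t. (c \<bullet> c) / (b - a)\<^sup>2) has_integral (b - a) *\<^sub>R ((c \<bullet> c) / (b - a)\<^sup>2)) {a..b}"
    using has_integral_const_real[of "(c \<bullet> c) / (b - a)\<^sup>2" a b] ab by (simp only: content_real[OF less_imp_le])
  have "((\<lambda>t. (norm (w' t))\<^sup>2 - (2 / (b - a)) * (w' t \<bullet> c) + (c \<bullet> c) / (b - a)\<^sup>2) has_integral
      I - (2 / (b - a)) * (c \<bullet> c) + (b - a) *\<^sub>R ((c \<bullet> c) / (b - a)\<^sup>2)) {a..b}"
    by (intro has_integral_add has_integral_diff has_integral_mult_right I i1 i2)
  moreover have "(norm (w' t))\<^sup>2 - (2 / (b - a)) * (w' t \<bullet> c) + (c \<bullet> c) / (b - a)\<^sup>2 \<ge> 0" for t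
  proof -
    have "0 \<le> (norm (w' t - (1 / (b - a)) *\<^sub>R c))\<^sup>2" by simp
    also have "\<dots> = (norm (w' t))\<^sup>2 - (2 / (b - a)) * (w' t \<bullet> c) + (c \<bullet> c) / (b - a)\<^sup>2"
      unfolding power2_norm_eq_inner by (simp add: inner_simps inner_commute power2_eq_square)
    finally show ?thesis .
  qed
  ultimately have "0 \<le> I - (2 / (b - a)) * (c \<bullet> c) + (b - a) *\<^sub>R ((c \<bullet> c) / (b - a)\<^sup>2)"
    by (rule has_integral_nonneg)
  also have "\<dots> = I - (c \<bullet> c) / (b - a)"
  proof -
    have "I - (2 / L) * z + L *\<^sub>R (z / L\<^sup>2) = I - z / L" if "L > 0" for L z :: real
      using that by (simp add: field_simps power2_eq_square)
    then show ?thesis using ab by simp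
  qed
  finally have "c \<bullet> c \<le> (b - a) * I" using ab by (simp add: field_simps)
  then have "(norm (w b - w a))\<^sup>2 \<le> (b - a) * I" by (simp add: power2_norm_eq_inner c_def)
  then have "ennreal ((norm (w b - w a))\<^sup>2) \<le> ennreal (b - a) * ennreal I"
    using ab has_integral_nonneg[OF I] by (simp flip: ennreal_mult add: ennreal_leI)
  moreover have "(\<integral>\<^sup>+t. ennreal ((norm (w' t))\<^sup>2) * indicator {a..b} t \<partial>lborel) = ennreal I"
    by (rule nn_integral_has_integral_lebesgue'[OF _ I]) simp
  ultimately show ?thesis by simp
qed

lemma norm_vec2_sq: "(norm (x :: 'a::real_normed_vector^2))\<^sup>2 = (norm (x$1))\<^sup>2 + (norm (x$2))\<^sup>2"
  by (simp add: norm_vec_def L2_set_def sum_2)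

lemma two_dim_Cauchy_Schwarz:
  fixes g1 g2 :: "'a::real_normed_vector"
  shows "(norm (s *\<^sub>R g1 + t *\<^sub>R g2))\<^sup>2 \<le> (s\<^sup>2 + t\<^sup>2) * ((norm g1)\<^sup>2 + (norm g2)\<^sup>2)"
proof -
  have "norm (s *\<^sub>R g1 + t *\<^sub>R g2) \<le> \<bar>s\<bar> * norm g1 + \<bar>t\<bar> * norm g2"
    using norm_triangle_ineq[of "s *\<^sub>R g1" "t *\<^sub>R g2"] by simp
  then have "(norm (s *\<^sub>R g1 + t *\<^sub>R g2))\<^sup>2 \<le> (\<bar>s\<bar> * norm g1 + \<bar>t\<bar> * norm g2)\<^sup>2"
    by (intro power_mono) auto
  also have "\<dots> = (s\<^sup>2 + t\<^sup>2) * ((norm g1)\<^sup>2 + (norm g2)\<^sup>2) - (\<bar>s\<bar> * norm g2 - \<bar>t\<bar> * norm g1)\<^sup>2"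
    by (simp add: power2_eq_square algebra_simps)
  also have "\<dots> \<le> (s\<^sup>2 + t\<^sup>2) * ((norm g1)\<^sup>2 + (norm g2)\<^sup>2)" by simp
  finally show ?thesis .
qed

lemma vec2_axis: "(v :: real^2) = v$1 *\<^sub>R axis 1 1 + v$2 *\<^sub>R axis 2 1"
  by (simp add: vec_eq_iff forall_2 axis_def)

lemma frechet_derivative_grad:
  assumes "f differentiable (at x)"
  shows "frechet_derivative f (at x) v = v$1 *\<^sub>R grad f x $ 1 + v$2 *\<^sub>R grad f x $ 2"
proof -
  have "linear (frechet_derivative f (at x))" using assms by (rule linear_frechet_derivative)
  then have "frechet_derivative f (at x) (v$1 *\<^sub>R axis 1 1 + v$2 *\<^sub>R axis 2 1) =
      v$1 *\<^sub>R frechet_derivative f (at x) (axis 1 1) + v$2 *\<^sub>R frechet_derivative f (at x) (axis 2 1)"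
    by (simp only: linear_add linear_scale)
  then show ?thesis by (simp add: grad_def vec2_axis[symmetric])
qed

lemma norm_frechet_derivative_grad:
  assumes "f differentiable (at x)"
  shows "(norm (frechet_derivative f (at x) v))\<^sup>2 \<le> (norm v)\<^sup>2 * (norm (grad f x))\<^sup>2"
  unfolding frechet_derivative_grad[OF assms] norm_vec2_sq[of "grad f x"] norm_vec2_sq[of v]
  using two_dim_Cauchy_Schwarz[of "v$1" "grad f x $ 1" "v$2" "grad f x $ 2"] by simp

lemma Ck_on_1_grad:
  assumes "Ck_on 1 UNIV f"
  shows "f differentiable (at x)" "continuous_on UNIV f" "continuous_on UNIV (grad f)"
    "f \<in> borel_measurable borel" "grad f \<in> borel_measurable borel"
proof -
  have 1: "Ck_on (Suc 0) UNIV f" using assms by simp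
  show "f differentiable (at x)" using Ck_on_Suc_has_derivative[OF 1] by (auto simp: differentiable_def)
  show f: "continuous_on UNIV f" using Ck_on_continuous[OF assms] .
  have "continuous_on UNIV (\<lambda>x. frechet_derivative f (at x) v)" for v
    using Ck_on_Suc_frechet[OF 1] by simp
  then show g: "continuous_on UNIV (grad f)"
    unfolding grad_def[abs_def] by (intro continuous_on_vec_lambda)
  show "f \<in> borel_measurable borel" "grad f \<in> borel_measurable borel"
    using f g by (auto intro: borel_measurable_continuous_onI)
qed

lemma nn_integral_lborel_translation:
  fixes f :: "'a::euclidean_space \<Rightarrow> ennreal"
  assumes [measurable]: "f \<in> borel_measurable borel"
  shows "(\<integral>\<^sup>+x. f (c + x) \<partial>lborel) = (\<integral>\<^sup>+x. f x \<partial>lborel)"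
  by (subst lborel_distr_plus[of c, symmetric]) (simp add: nn_integral_distr)

text \<open>Integrate along the segments from x to x + h, then exchange the integrals: for each t
  the x-integral of the gradient term is translation invariant.\<close>

lemma translation_inequality:
  assumes f: "Ck_on 1 UNIV f"
  shows "(\<integral>\<^sup>+x. ennreal ((norm (f (x + h) - f x))\<^sup>2) \<partial>lborel)
     \<le> ennreal ((norm h)\<^sup>2) * (\<integral>\<^sup>+x. ennreal ((norm (grad f x))\<^sup>2) \<partial>lborel)"
proof -
  note fd = Ck_on_1_grad[OF f]
  have [measurable]: "f \<in> borel_measurable borel" "grad f \<in> borel_measurable borel" by (rule fd)+
  define q where "q x = ennreal ((norm (grad f x))\<^sup>2)" for x
  have [measurable]: "q \<in> borel_measurable borel" unfolding q_def by measurable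
  have pointwise: "ennreal ((norm (f (x + h) - f x))\<^sup>2) \<le> (\<integral>\<^sup>+t. ennreal ((norm h)\<^sup>2) * (q (x + t *\<^sub>R h) * indicator {0..1} t) \<partial>lborel)" for x
  proof -
    define w where "w t = f (x + t *\<^sub>R h)" for t
    define w' where "w' t = frechet_derivative f (at (x + t *\<^sub>R h)) h" for t
    have der: "(w has_vector_derivative w' t) (at t)" for t
    proof -
      have "(f has_derivative frechet_derivative f (at (x + t *\<^sub>R h))) (at (x + t *\<^sub>R h))"
        using fd(1) frechet_derivative_works by blast
      moreover have "((\<lambda>t. x + t *\<^sub>R h) has_derivative (\<lambda>s. s *\<^sub>R h)) (at t)"
        by (auto intro!: derivative_eq_intros)
      ultimately have "(w has_derivative (\<lambda>s. frechet_derivative f (at (x + t *\<^sub>R h)) (s *\<^sub>R h))) (at t)"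
        unfolding w_def by (rule has_derivative_compose[rotated])
      then show ?thesis
        unfolding has_vector_derivative_def w'_def
        using linear_scale[OF linear_frechet_derivative[OF fd(1)]] by simp
    qed
    have "continuous_on UNIV w'"
      unfolding w'_def frechet_derivative_grad[OF fd(1)]
      by (intro continuous_intros continuous_on_compose2[OF fd(3)]) auto
    from norm_diff_sq_le_integral[OF zero_less_one der this]
    have "ennreal ((norm (f (x + h) - f x))\<^sup>2) \<le> (\<integral>\<^sup>+t. ennreal ((norm (w' t))\<^sup>2) * indicator {0..1} t \<partial>lborel)"
      by (simp add: w_def)
    also have "\<dots> \<le> (\<integral>\<^sup>+t. ennreal ((norm h)\<^sup>2) * (q (x + t *\<^sub>R h) * indicator {0..1} t) \<partial>lborel)"
    proof (intro nn_integral_mono)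
      fix t
      have "ennreal ((norm (w' t))\<^sup>2) \<le> ennreal ((norm h)\<^sup>2 * (norm (grad f (x + t *\<^sub>R h)))\<^sup>2)"
        unfolding w'_def by (intro ennreal_leI norm_frechet_derivative_grad fd(1))
      also have "\<dots> = ennreal ((norm h)\<^sup>2) * q (x + t *\<^sub>R h)" by (simp add: q_def ennreal_mult)
      finally have "ennreal ((norm (w' t))\<^sup>2) * indicator {0..1} t \<le> (ennreal ((norm h)\<^sup>2) * q (x + t *\<^sub>R h)) * indicator {0..1} t"
        by (rule mult_right_mono) simp
      then show "ennreal ((norm (w' t))\<^sup>2) * indicator {0..1} t \<le> ennreal ((norm h)\<^sup>2) * (q (x + t *\<^sub>R h) * indicator {0..1} t)"
        by (simp add: mult.assoc)
    qed
    finally show ?thesis .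
  qed
  have "(\<integral>\<^sup>+x. ennreal ((norm (f (x + h) - f x))\<^sup>2) \<partial>lborel)
      \<le> (\<integral>\<^sup>+x. (\<integral>\<^sup>+t. ennreal ((norm h)\<^sup>2) * (q (x + t *\<^sub>R h) * indicator {0..1} t) \<partial>lborel) \<partial>lborel)"
    by (intro nn_integral_mono pointwise)
  also have "\<dots> = (\<integral>\<^sup>+t. (\<integral>\<^sup>+x. ennreal ((norm h)\<^sup>2) * (q (x + t *\<^sub>R h) * indicator {0..1} t) \<partial>lborel) \<partial>(lborel::real measure))"
    by (rule lborel_pair.Fubini'[symmetric]) measurable
  also have "\<dots> = (\<integral>\<^sup>+t. ennreal ((norm h)\<^sup>2) * (\<integral>\<^sup>+x. q x \<partial>lborel) * indicator {0..1} t \<partial>(lborel::real measure))"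
  proof (intro nn_integral_cong)
    fix t :: real
    have "(\<integral>\<^sup>+x. ennreal ((norm h)\<^sup>2) * (q (x + t *\<^sub>R h) * indicator {0..1} t) \<partial>lborel)
       = ennreal ((norm h)\<^sup>2) * ((\<integral>\<^sup>+x. q (x + t *\<^sub>R h) \<partial>lborel) * indicator {0..1} t)"
      by (simp add: nn_integral_cmult nn_integral_multc)
    also have "(\<integral>\<^sup>+x. q (x + t *\<^sub>R h) \<partial>lborel) = (\<integral>\<^sup>+x. q x \<partial>lborel)"
      using nn_integral_lborel_translation[of q "t *\<^sub>R h"] by (simp add: add.commute)
    finally show "(\<integral>\<^sup>+x. ennreal ((norm h)\<^sup>2) * (q (x + t *\<^sub>R h) * indicator {0..1} t) \<partial>lborel)
        = ennreal ((norm h)\<^sup>2) * (\<integral>\<^sup>+x. q x \<partial>lborel) * indicator {0..1} t" by (simp add: mult.assoc)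
  qed
  also have "\<dots> = ennreal ((norm h)\<^sup>2) * (\<integral>\<^sup>+x. q x \<partial>lborel)"
    by (subst nn_integral_cmult_indicator) auto
  finally show ?thesis by (simp add: q_def)
qed

text \<open>The variance as a double integral of differences. It replaces a Poincare inequality on
  small squares, as differences can be handled by translations.\<close>

lemma (in finite_measure) variance_identity:
  fixes f :: "'a \<Rightarrow> 'b::euclidean_space"
  assumes [measurable]: "f \<in> borel_measurable M" and K: "\<And>x. norm (f x) \<le> K"
  shows "(\<integral>x. (\<integral>y. (norm (f x - f y))\<^sup>2 \<partial>M) \<partial>M) = 2 * measure M (space M) * (\<integral>x. (norm (f x))\<^sup>2 \<partial>M) - 2 * (norm (\<integral>x. f x \<partial>M))\<^sup>2"
proof -
  have f: "integrable M f" by (rule integrable_const_bound[of _ K]) (auto simp: K)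
  have f2: "integrable M (\<lambda>x. (norm (f x))\<^sup>2)"
    by (rule integrable_const_bound[of _ "K\<^sup>2"]) (auto intro!: power_mono K)
  have fi: "integrable M (\<lambda>y. v \<bullet> f y)" "integrable M (\<lambda>y. f y \<bullet> v)" for v using f by auto
  define S where "S = (\<integral>x. (norm (f x))\<^sup>2 \<partial>M)"
  define I where "I = (\<integral>x. f x \<partial>M)"
  have "(\<integral>y. (norm (f x - f y))\<^sup>2 \<partial>M) = measure M (space M) * (norm (f x))\<^sup>2 - 2 * (f x \<bullet> I) + S" for x
  proof -
    have "(\<integral>y. (norm (f x - f y))\<^sup>2 \<partial>M) = (\<integral>y. (norm (f x))\<^sup>2 - 2 * (f x \<bullet> f y) + (norm (f y))\<^sup>2 \<partial>M)"
      by (simp add: power2_norm_eq_inner inner_diff_left inner_diff_right inner_commute algebra_simps)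
    also have "\<dots> = measure M (space M) * (norm (f x))\<^sup>2 - 2 * (f x \<bullet> I) + S"
      using f f2 fi by (simp add: S_def I_def)
    finally show ?thesis .
  qed
  moreover have "(\<integral>x. measure M (space M) * (norm (f x))\<^sup>2 - 2 * (f x \<bullet> I) + S \<partial>M) =
      measure M (space M) * S - 2 * (I \<bullet> I) + measure M (space M) * S"
    using f f2 fi by (simp add: S_def I_def)
  ultimately show ?thesis by (simp add: S_def I_def power2_norm_eq_inner)
qed

section \<open>Rellich's theorem on a grid of squares\<close>

definition cell :: "real \<Rightarrow> int \<times> int \<Rightarrow> (real^2) set" where
  "cell \<delta> p = {x. \<lfloor>x$1 / \<delta>\<rfloor> = fst p \<and> \<lfloor>x$2 / \<delta>\<rfloor> = snd p}"

lemma cell_measurable [measurable]: "cell \<delta> p \<in> sets borel"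
proof -
  have "cell \<delta> p = {x \<in> space borel. \<lfloor>x$1 / \<delta>\<rfloor> = fst p \<and> \<lfloor>x$2 / \<delta>\<rfloor> = snd p}" by (simp add: cell_def)
  also have "\<dots> \<in> sets borel" by measurable
  finally show ?thesis .
qed

lemma cell_coord:
  assumes "\<delta> > 0" "x \<in> cell \<delta> p"
  shows "\<delta> * fst p \<le> x$1" "x$1 < \<delta> * fst p + \<delta>" "\<delta> * snd p \<le> x$2" "x$2 < \<delta> * snd p + \<delta>"
proof -
  have "real_of_int (fst p) \<le> x$1 / \<delta>" "x$1 / \<delta> < real_of_int (fst p) + 1"
    "real_of_int (snd p) \<le> x$2 / \<delta>" "x$2 / \<delta> < real_of_int (snd p) + 1"
    using assms(2) by (auto simp: cell_def floor_eq_iff)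
  then show "\<delta> * fst p \<le> x$1" "x$1 < \<delta> * fst p + \<delta>" "\<delta> * snd p \<le> x$2" "x$2 < \<delta> * snd p + \<delta>"
    using assms(1) by (simp_all add: field_simps)
qed

lemma cell_diam:
  assumes "\<delta> > 0" "x \<in> cell \<delta> p" "y \<in> cell \<delta> p"
  shows "norm (x - y) \<le> 2 * \<delta>"
proof -
  have "norm (x - y) \<le> (\<Sum>i\<in>UNIV. \<bar>(x - y)$i\<bar>)" by (rule norm_le_l1_cart)
  also have "\<dots> \<le> 2 * \<delta>"
    using cell_coord[OF assms(1,2)] cell_coord[OF assms(1,3)] by (simp add: sum_2)
  finally show ?thesis .
qed

lemma Basis_inner_One: "b \<in> Basis \<Longrightarrow> (\<Sum>i\<in>Basis. i) \<bullet> (b::'a::euclidean_space) = 1"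
  by (simp add: inner_sum_left inner_Basis if_distrib cong: if_cong)

lemma emeasure_cell:
  assumes "\<delta> > 0"
  shows "ennreal (\<delta>\<^sup>2) \<le> emeasure lborel (cell \<delta> p)" "emeasure lborel (cell \<delta> p) < \<infinity>"
proof -
  define l :: "real^2" where "l = vector [\<delta> * fst p, \<delta> * snd p]"
  define One2 :: "real^2" where "One2 = (\<Sum>i\<in>Basis. i)"
  have One2: "One2 $ i = 1" for i
    using Basis_inner_One[of "axis i (1::real) :: real^2"] by (simp add: One2_def inner_axis)
  have "box l (l + \<delta> *\<^sub>R One2) \<subseteq> cell \<delta> p"
  proof
    fix x assume "x \<in> box l (l + \<delta> *\<^sub>R One2)"
    then have "\<delta> * fst p < x$1" "x$1 < \<delta> * fst p + \<delta>" "\<delta> * snd p < x$2" "x$2 < \<delta> * snd p + \<delta>"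
      by (simp_all add: mem_box_cart forall_2 l_def One2 vector_2)
    then show "x \<in> cell \<delta> p" using assms by (simp add: cell_def floor_eq_iff field_simps)
  qed
  then have "emeasure lborel (box l (l + \<delta> *\<^sub>R One2)) \<le> emeasure lborel (cell \<delta> p)"
    by (intro emeasure_mono) auto
  moreover have "emeasure lborel (box l (l + \<delta> *\<^sub>R One2)) = ennreal (\<delta>\<^sup>2)"
  proof -
    have "emeasure lborel (box l (l + \<delta> *\<^sub>R One2)) = (\<Prod>b\<in>Basis. (l + \<delta> *\<^sub>R One2 - l) \<bullet> b)"
      using assms Basis_inner_One by (intro emeasure_lborel_box) (auto simp: One2_def inner_add_left)
    also have "(\<Prod>b\<in>Basis. (l + \<delta> *\<^sub>R One2 - l) \<bullet> b) = (\<Prod>b\<in>(Basis :: (real^2) set). \<delta>)"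
      using Basis_inner_One by (intro prod.cong) (auto simp: One2_def)
    finally show ?thesis by simp
  qed
  ultimately show "ennreal (\<delta>\<^sup>2) \<le> emeasure lborel (cell \<delta> p)" by simp
  have "bounded (cell \<delta> p)"
    unfolding bounded_def using cell_diam[OF assms] by (metis dist_norm)
  then show "emeasure lborel (cell \<delta> p) < \<infinity>" by (rule emeasure_bounded_finite)
qed

text \<open>Both estimates come from the variance identity on one cell. The first uses that the cell
  has measure at least \<delta>^2; the second is Cauchy-Schwarz, that is, nonnegativity of the
  variance.\<close>

lemma cell_estimate:
  fixes f :: "real^2 \<Rightarrow> 'b::euclidean_space"
  assumes \<delta>: "\<delta> > 0" and [measurable]: "f \<in> borel_measurable borel" and K: "\<And>x. norm (f x) \<le> K"
  shows "(\<integral>\<^sup>+x. ennreal ((norm (f x))\<^sup>2) * indicator (cell \<delta> p) x \<partial>lborel) \<le>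
    ennreal ((norm (\<integral>x. f x \<partial>restrict_space lborel (cell \<delta> p)))\<^sup>2 / \<delta>\<^sup>2) +
    ennreal (1 / (2 * \<delta>\<^sup>2)) * (\<integral>\<^sup>+x. (\<integral>\<^sup>+y. ennreal ((norm (f x - f y))\<^sup>2) * indicator (cell \<delta> p) y \<partial>lborel) * indicator (cell \<delta> p) x \<partial>lborel)"
    and "(norm (\<integral>x. f x \<partial>restrict_space lborel (cell \<delta> p)))\<^sup>2 \<le> measure lborel (cell \<delta> p) * enn2real (\<integral>\<^sup>+x. ennreal ((norm (f x))\<^sup>2) * indicator (cell \<delta> p) x \<partial>lborel)"
    and "integrable (restrict_space lborel (cell \<delta> p)) f"
proof -
  define M where "M = restrict_space lborel (cell \<delta> p)"
  have spM: "space M = cell \<delta> p" by (simp add: M_def space_restrict_space)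
  have eM: "emeasure M (space M) = emeasure lborel (cell \<delta> p)"
    unfolding spM by (simp add: M_def emeasure_restrict_space)
  interpret finite_measure M
    by (rule finite_measureI) (use emeasure_cell(2)[OF \<delta>, of p] eM in simp)
  have fM [measurable]: "f \<in> borel_measurable M" unfolding M_def by (rule measurable_restrict_space1) simp
  have K0: "K \<ge> 0" using K norm_ge_zero order_trans by blast
  have f2: "integrable M (\<lambda>x. (norm (f x))\<^sup>2)"
    by (rule integrable_const_bound[of _ "K\<^sup>2"]) (auto intro!: power_mono K)
  show "integrable (restrict_space lborel (cell \<delta> p)) f"
    unfolding M_def[symmetric] by (rule integrable_const_bound[of _ K]) (auto simp: K)
  define S where "S = (\<integral>x. (norm (f x))\<^sup>2 \<partial>M)"
  define I where "I = (\<integral>x. f x \<partial>M)"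
  define D where "D = (\<integral>x. (\<integral>y. (norm (f x - f y))\<^sup>2 \<partial>M) \<partial>M)"
  define \<mu> where "\<mu> = measure M (space M)"
  have \<mu>: "\<delta>\<^sup>2 \<le> \<mu>"
  proof -
    have "ennreal (\<delta>\<^sup>2) \<le> ennreal \<mu>"
      unfolding \<mu>_def emeasure_eq_measure[symmetric] eM by (rule emeasure_cell(1)[OF \<delta>])
    then show ?thesis by (subst (asm) ennreal_le_iff) (auto simp: \<mu>_def)
  qed
  have \<delta>2: "\<delta>\<^sup>2 > 0" using \<delta> by simp
  have S0: "S \<ge> 0" unfolding S_def by simp
  have D0: "D \<ge> 0" unfolding D_def by simp
  have var: "D = 2 * \<mu> * S - 2 * (norm I)\<^sup>2"
    unfolding D_def \<mu>_def S_def I_def by (rule variance_identity[OF fM K])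
  have "\<delta>\<^sup>2 * S \<le> \<mu> * S" using \<mu> S0 by (rule mult_right_mono)
  then have "S \<le> ((norm I)\<^sup>2 + D / 2) / \<delta>\<^sup>2" using var \<delta>2 by (simp add: field_simps)
  then have main: "S \<le> (norm I)\<^sup>2 / \<delta>\<^sup>2 + 1 / (2 * \<delta>\<^sup>2) * D" by (simp add: add_divide_distrib)
  have nnS: "(\<integral>\<^sup>+x. ennreal ((norm (f x))\<^sup>2) * indicator (cell \<delta> p) x \<partial>lborel) = ennreal S"
  proof -
    have "(\<integral>\<^sup>+x. ennreal ((norm (f x))\<^sup>2) * indicator (cell \<delta> p) x \<partial>lborel) = (\<integral>\<^sup>+x. ennreal ((norm (f x))\<^sup>2) \<partial>M)"
      unfolding M_def by (simp add: nn_integral_restrict_space)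
    also have "\<dots> = ennreal S" unfolding S_def using f2 by (intro nn_integral_eq_integral) auto
    finally show ?thesis .
  qed
  have inner: "integrable M (\<lambda>y. (norm (f x - f y))\<^sup>2)" for x
  proof (rule integrable_const_bound[of _ "(2 * K)\<^sup>2"])
    show "AE y in M. norm ((norm (f x - f y))\<^sup>2) \<le> (2 * K)\<^sup>2"
    proof (rule AE_I2)
      fix y
      have "norm (f x - f y) \<le> 2 * K" using norm_triangle_ineq4[of "f x" "f y"] K[of x] K[of y] by linarith
      then show "norm ((norm (f x - f y))\<^sup>2) \<le> (2 * K)\<^sup>2" using power_mono[of "norm (f x - f y)" "2 * K" 2] by simp
    qed
  qed measurable
  have outer: "integrable M (\<lambda>x. (\<integral>y. (norm (f x - f y))\<^sup>2 \<partial>M))"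
  proof (rule integrable_const_bound[of _ "\<mu> * (2 * K)\<^sup>2"])
    show "AE x in M. norm (\<integral>y. (norm (f x - f y))\<^sup>2 \<partial>M) \<le> \<mu> * (2 * K)\<^sup>2"
    proof (rule AE_I2)
      fix x
      have "(\<integral>y. (norm (f x - f y))\<^sup>2 \<partial>M) \<le> (\<integral>y. (2 * K)\<^sup>2 \<partial>M)"
      proof (rule integral_mono[OF inner])
        fix y
        have "norm (f x - f y) \<le> 2 * K" using norm_triangle_ineq4[of "f x" "f y"] K[of x] K[of y] by linarith
        then show "(norm (f x - f y))\<^sup>2 \<le> (2 * K)\<^sup>2" by (intro power_mono) auto
      qed simp
      then show "norm (\<integral>y. (norm (f x - f y))\<^sup>2 \<partial>M) \<le> \<mu> * (2 * K)\<^sup>2" by (simp add: \<mu>_def)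
    qed
  qed measurable
  have nnD: "(\<integral>\<^sup>+x. (\<integral>\<^sup>+y. ennreal ((norm (f x - f y))\<^sup>2) * indicator (cell \<delta> p) y \<partial>lborel) * indicator (cell \<delta> p) x \<partial>lborel) = ennreal D"
  proof -
    have "(\<integral>\<^sup>+x. (\<integral>\<^sup>+y. ennreal ((norm (f x - f y))\<^sup>2) * indicator (cell \<delta> p) y \<partial>lborel) * indicator (cell \<delta> p) x \<partial>lborel)
        = (\<integral>\<^sup>+x. (\<integral>\<^sup>+y. ennreal ((norm (f x - f y))\<^sup>2) \<partial>M) \<partial>M)"
      unfolding M_def by (simp add: nn_integral_restrict_space)
    also have "\<dots> = (\<integral>\<^sup>+x. ennreal (\<integral>y. (norm (f x - f y))\<^sup>2 \<partial>M) \<partial>M)"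
      using inner by (intro nn_integral_cong nn_integral_eq_integral) auto
    also have "\<dots> = ennreal D" unfolding D_def using outer by (intro nn_integral_eq_integral) auto
    finally show ?thesis .
  qed
  show "(\<integral>\<^sup>+x. ennreal ((norm (f x))\<^sup>2) * indicator (cell \<delta> p) x \<partial>lborel) \<le>
    ennreal ((norm (\<integral>x. f x \<partial>restrict_space lborel (cell \<delta> p)))\<^sup>2 / \<delta>\<^sup>2) +
    ennreal (1 / (2 * \<delta>\<^sup>2)) * (\<integral>\<^sup>+x. (\<integral>\<^sup>+y. ennreal ((norm (f x - f y))\<^sup>2) * indicator (cell \<delta> p) y \<partial>lborel) * indicator (cell \<delta> p) x \<partial>lborel)"
    unfolding nnS nnD M_def[symmetric] I_def[symmetric]
    using main D0 \<delta>2 by (simp flip: ennreal_mult ennreal_plus add: ennreal_leI)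
  have "(norm I)\<^sup>2 \<le> \<mu> * S" using var D0 by simp
  moreover have "\<mu> = measure lborel (cell \<delta> p)"
    using eM by (simp add: \<mu>_def measure_def)
  ultimately show "(norm (\<integral>x. f x \<partial>restrict_space lborel (cell \<delta> p)))\<^sup>2 \<le> measure lborel (cell \<delta> p) * enn2real (\<integral>\<^sup>+x. ennreal ((norm (f x))\<^sup>2) * indicator (cell \<delta> p) x \<partial>lborel)"
    unfolding nnS M_def[symmetric] I_def[symmetric] using S0 by simp
qed

text \<open>Two points of a cell differ by some h with |h| <= 2\<delta>, so all double integrals
  together are at most the integral over such h of the translation estimate. This is bounded by
  4\<delta>^2 times the area 16\<delta>^2 of a square containing the disc, giving 64\<delta>^4; the
  factor 1/(2\<delta>^2) turns it into 32\<delta>^2.\<close>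

lemma cells_estimate:
  fixes f :: "real^2 \<Rightarrow> complex"
  assumes \<delta>: "\<delta> > 0" and f: "Ck_on 1 UNIV f" and K: "\<And>x. norm (f x) \<le> K"
    and F: "finite F" "\<And>x. f x \<noteq> 0 \<Longrightarrow> \<exists>p\<in>F. x \<in> cell \<delta> p"
  shows "(\<integral>\<^sup>+x. ennreal ((norm (f x))\<^sup>2) \<partial>lborel) \<le>
    ennreal (\<Sum>p\<in>F. (norm (\<integral>x. f x \<partial>restrict_space lborel (cell \<delta> p)))\<^sup>2 / \<delta>\<^sup>2) +
    ennreal (32 * \<delta>\<^sup>2) * (\<integral>\<^sup>+x. ennreal ((norm (grad f x))\<^sup>2) \<partial>lborel)"
proof -
  have fm [measurable]: "f \<in> borel_measurable borel" by (rule Ck_on_1_grad(4)[OF f])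
  let ?Q = "cell \<delta>"
  let ?B = "{h::real^2. norm h \<le> 2 * \<delta>}"
  have Bm [measurable]: "?B \<in> sets borel" by measurable
  define G where "G = (\<integral>\<^sup>+x. ennreal ((norm (grad f x))\<^sup>2) \<partial>lborel)"
  have unique: "p = q" if "x \<in> ?Q p" "x \<in> ?Q q" for x p q
    using that by (auto simp: cell_def prod_eq_iff)
  have sum_ind: "(\<Sum>p\<in>F. indicator (?Q p) x * c) \<le> (c::ennreal)" for x c
  proof (cases "\<exists>p\<in>F. x \<in> ?Q p")
    case True
    then obtain p where p: "p \<in> F" "x \<in> ?Q p" by blast
    have "(\<Sum>q\<in>F. indicator (?Q q) x * c) = (\<Sum>q\<in>F. if q = p then c else 0)"
    proof (intro sum.cong refl)
      fix q assume "q \<in> F"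
      show "indicator (?Q q) x * c = (if q = p then c else 0)"
        using p(2) unique[of x q p] by (cases "x \<in> ?Q q") auto
    qed
    then show ?thesis using p F(1) by simp
  next
    case False
    then have "(\<Sum>p\<in>F. indicator (?Q p) x * c) = 0" by (intro sum.neutral) auto
    then show ?thesis by simp
  qed
  have "(\<integral>\<^sup>+x. ennreal ((norm (f x))\<^sup>2) \<partial>lborel) \<le> (\<integral>\<^sup>+x. (\<Sum>p\<in>F. ennreal ((norm (f x))\<^sup>2) * indicator (?Q p) x) \<partial>lborel)"
  proof (intro nn_integral_mono)
    fix x
    show "ennreal ((norm (f x))\<^sup>2) \<le> (\<Sum>p\<in>F. ennreal ((norm (f x))\<^sup>2) * indicator (?Q p) x)"
    proof (cases "f x = 0")
      case False
      then obtain p where p: "p \<in> F" "x \<in> ?Q p" using F(2) by blast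
      then show ?thesis using member_le_sum[of p F "\<lambda>p. ennreal ((norm (f x))\<^sup>2) * indicator (?Q p) x"] F(1) by simp
    qed simp
  qed
  also have "\<dots> = (\<Sum>p\<in>F. \<integral>\<^sup>+x. ennreal ((norm (f x))\<^sup>2) * indicator (?Q p) x \<partial>lborel)"
    by (rule nn_integral_sum) measurable
  also have "\<dots> \<le> (\<Sum>p\<in>F. ennreal ((norm (\<integral>x. f x \<partial>restrict_space lborel (?Q p)))\<^sup>2 / \<delta>\<^sup>2) +
      ennreal (1 / (2 * \<delta>\<^sup>2)) * (\<integral>\<^sup>+x. (\<integral>\<^sup>+y. ennreal ((norm (f x - f y))\<^sup>2) * indicator (?Q p) y \<partial>lborel) * indicator (?Q p) x \<partial>lborel))"
    by (intro sum_mono cell_estimate(1)[OF \<delta> fm K])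
  also have "\<dots> = ennreal (\<Sum>p\<in>F. (norm (\<integral>x. f x \<partial>restrict_space lborel (?Q p)))\<^sup>2 / \<delta>\<^sup>2) +
      ennreal (1 / (2 * \<delta>\<^sup>2)) * (\<Sum>p\<in>F. \<integral>\<^sup>+x. (\<integral>\<^sup>+y. ennreal ((norm (f x - f y))\<^sup>2) * indicator (?Q p) y \<partial>lborel) * indicator (?Q p) x \<partial>lborel)"
    by (simp add: sum.distrib sum_distrib_left sum_ennreal)
  also have "(\<Sum>p\<in>F. \<integral>\<^sup>+x. (\<integral>\<^sup>+y. ennreal ((norm (f x - f y))\<^sup>2) * indicator (?Q p) y \<partial>lborel) * indicator (?Q p) x \<partial>lborel)
      \<le> ennreal (64 * \<delta>^4) * G"
  proof -
    have "(\<Sum>p\<in>F. \<integral>\<^sup>+x. (\<integral>\<^sup>+y. ennreal ((norm (f x - f y))\<^sup>2) * indicator (?Q p) y \<partial>lborel) * indicator (?Q p) x \<partial>lborel)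
      \<le> (\<Sum>p\<in>F. \<integral>\<^sup>+x. indicator (?Q p) x * (\<integral>\<^sup>+y. ennreal ((norm (f x - f y))\<^sup>2) * indicator ?B (y - x) \<partial>lborel) \<partial>lborel)"
    proof (intro sum_mono nn_integral_mono)
      fix p and x :: "real^2"
      show "(\<integral>\<^sup>+y. ennreal ((norm (f x - f y))\<^sup>2) * indicator (?Q p) y \<partial>lborel) * indicator (?Q p) x
        \<le> indicator (?Q p) x * (\<integral>\<^sup>+y. ennreal ((norm (f x - f y))\<^sup>2) * indicator ?B (y - x) \<partial>lborel)"
        using cell_diam[OF \<delta>, of _ p x]
        by (auto split: split_indicator intro!: nn_integral_mono)
    qed
    also have "\<dots> = (\<integral>\<^sup>+x. (\<Sum>p\<in>F. indicator (?Q p) x * (\<integral>\<^sup>+y. ennreal ((norm (f x - f y))\<^sup>2) * indicator ?B (y - x) \<partial>lborel)) \<partial>lborel)"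
      by (rule nn_integral_sum[symmetric]) measurable
    also have "\<dots> \<le> (\<integral>\<^sup>+x. (\<integral>\<^sup>+y. ennreal ((norm (f x - f y))\<^sup>2) * indicator ?B (y - x) \<partial>lborel) \<partial>lborel)"
      by (intro nn_integral_mono sum_ind)
    also have "\<dots> = (\<integral>\<^sup>+x. (\<integral>\<^sup>+h. ennreal ((norm (f (x + h) - f x))\<^sup>2) * indicator ?B h \<partial>lborel) \<partial>lborel)"
    proof (rule nn_integral_cong)
      fix x :: "real^2"
      show "(\<integral>\<^sup>+y. ennreal ((norm (f x - f y))\<^sup>2) * indicator ?B (y - x) \<partial>lborel) = (\<integral>\<^sup>+h. ennreal ((norm (f (x + h) - f x))\<^sup>2) * indicator ?B h \<partial>lborel)"
        using nn_integral_lborel_translation[of "\<lambda>y. ennreal ((norm (f x - f y))\<^sup>2) * indicator ?B (y - x)" x]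
        by (simp add: norm_minus_commute)
    qed
    also have "\<dots> = (\<integral>\<^sup>+h. (\<integral>\<^sup>+x. ennreal ((norm (f (x + h) - f x))\<^sup>2) * indicator ?B h \<partial>lborel) \<partial>lborel)"
      by (rule lborel_pair.Fubini'[symmetric]) measurable
    also have "\<dots> \<le> (\<integral>\<^sup>+h. (ennreal ((2 * \<delta>)\<^sup>2) * G) * indicator ?B h \<partial>lborel)"
    proof (intro nn_integral_mono)
      fix h :: "real^2"
      have "(\<integral>\<^sup>+x. ennreal ((norm (f (x + h) - f x))\<^sup>2) * indicator ?B h \<partial>lborel) = (\<integral>\<^sup>+x. ennreal ((norm (f (x + h) - f x))\<^sup>2) \<partial>lborel) * indicator ?B h"
        by (rule nn_integral_multc) measurable
      also have "\<dots> \<le> (ennreal ((norm h)\<^sup>2) * G) * indicator ?B h"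
        unfolding G_def by (intro mult_right_mono translation_inequality f) simp
      also have "\<dots> \<le> (ennreal ((2 * \<delta>)\<^sup>2) * G) * indicator ?B h"
        using power_mono[of "norm h" "2 * \<delta>" 2]
        by (auto split: split_indicator intro!: mult_right_mono ennreal_leI)
      finally show "(\<integral>\<^sup>+x. ennreal ((norm (f (x + h) - f x))\<^sup>2) * indicator ?B h \<partial>lborel) \<le> (ennreal ((2 * \<delta>)\<^sup>2) * G) * indicator ?B h" .
    qed
    also have "\<dots> = (ennreal ((2 * \<delta>)\<^sup>2) * G) * emeasure lborel ?B"
      by (rule nn_integral_cmult_indicator) simp
    also have "\<dots> \<le> (ennreal ((2 * \<delta>)\<^sup>2) * G) * ennreal (16 * \<delta>\<^sup>2)"
    proof (intro mult_left_mono)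
      define One2 :: "real^2" where "One2 = (\<Sum>i\<in>Basis. i)"
      have "?B \<subseteq> cbox (- ((2 * \<delta>) *\<^sub>R One2)) ((2 * \<delta>) *\<^sub>R One2)"
      proof
        fix x assume "x \<in> ?B"
        then have "\<bar>x \<bullet> b\<bar> \<le> 2 * \<delta>" if "b \<in> Basis" for b using Basis_le_norm[OF that, of x] by simp
        then show "x \<in> cbox (- ((2 * \<delta>) *\<^sub>R One2)) ((2 * \<delta>) *\<^sub>R One2)"
          using Basis_inner_One by (auto simp: mem_box One2_def abs_le_iff minus_le_iff)
      qed
      then have "emeasure lborel ?B \<le> emeasure lborel (cbox (- ((2 * \<delta>) *\<^sub>R One2)) ((2 * \<delta>) *\<^sub>R One2))"
        by (intro emeasure_mono) auto
      also have "\<dots> = (\<Prod>b\<in>Basis. ((2 * \<delta>) *\<^sub>R One2 - (- ((2 * \<delta>) *\<^sub>R One2))) \<bullet> b)"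
        using \<delta> Basis_inner_One by (intro emeasure_lborel_cbox) (auto simp: One2_def)
      also have "(\<Prod>b\<in>Basis. ((2 * \<delta>) *\<^sub>R One2 - (- ((2 * \<delta>) *\<^sub>R One2))) \<bullet> b) = (\<Prod>b\<in>(Basis :: (real^2) set). 4 * \<delta>)"
        by (intro prod.cong refl)
           (simp only: One2_def inner_diff_left inner_minus_left inner_scaleR_left Basis_inner_One)
      also have "\<dots> = 16 * \<delta>\<^sup>2" by (simp add: power_mult_distrib)
      finally show "emeasure lborel ?B \<le> ennreal (16 * \<delta>\<^sup>2)" .
    qed simp
    also have "\<dots> = (ennreal ((2 * \<delta>)\<^sup>2) * ennreal (16 * \<delta>\<^sup>2)) * G" by (simp only: mult.assoc mult.commute mult.left_commute)
    also have "ennreal ((2 * \<delta>)\<^sup>2) * ennreal (16 * \<delta>\<^sup>2) = ennreal (64 * \<delta>^4)"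
      by (simp flip: ennreal_mult add: power_mult_distrib power2_eq_square power4_eq_xxxx mult.assoc)
    finally show ?thesis .
  qed
  finally have "(\<integral>\<^sup>+x. ennreal ((norm (f x))\<^sup>2) \<partial>lborel) \<le>
    ennreal (\<Sum>p\<in>F. (norm (\<integral>x. f x \<partial>restrict_space lborel (?Q p)))\<^sup>2 / \<delta>\<^sup>2) + ennreal (1 / (2 * \<delta>\<^sup>2)) * (ennreal (64 * \<delta>^4) * G)"
    by (simp add: mult_left_mono)
  also have "ennreal (1 / (2 * \<delta>\<^sup>2)) * (ennreal (64 * \<delta>^4) * G) = ennreal (32 * \<delta>\<^sup>2) * G"
  proof -
    have "1 / (2 * \<delta>\<^sup>2) * (64 * \<delta>^4) = 32 * \<delta>\<^sup>2" using \<delta> by (simp add: field_simps power2_eq_square power4_eq_xxxx)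
    then show ?thesis by (simp flip: mult.assoc ennreal_mult)
  qed
  finally show ?thesis by (simp add: G_def)
qed

lemma grad_eqI:
  assumes "(f has_derivative D) (at x)"
  shows "grad f x = (\<chi> j. D (axis j 1))"
  using frechet_derivative_at[OF assms] by (simp add: grad_def)

lemma grad_diff:
  assumes "f differentiable (at x)" "g differentiable (at x)"
  shows "grad (\<lambda>x. f x - g x) x = grad f x - grad g x"
  using grad_eqI[OF has_derivative_diff[OF assms[unfolded frechet_derivative_works]]]
  by (simp add: grad_def vec_eq_iff)

text \<open>The integrals over the cells of all grids of mesh 1/(k + 1) are countably many bounded
  scalar sequences. A diagonal subsequence makes all of them converge; for fine meshes they control
  the norm of differences up to a small multiple of the gradient bound.\<close>

lemma rellich_smooth:
  fixes f :: "nat \<Rightarrow> real^2 \<Rightarrow> complex"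
  assumes f: "\<And>n. Ck_on 1 UNIV (f n)" and \<Omega>: "bounded \<Omega>" "\<And>n x. x \<notin> \<Omega> \<Longrightarrow> f n x = 0"
    and K: "K \<ge> 0" "\<And>n. (\<integral>\<^sup>+x. ennreal ((norm (f n x))\<^sup>2) \<partial>lborel) \<le> ennreal K"
      "\<And>n. (\<integral>\<^sup>+x. ennreal ((norm (grad (f n) x))\<^sup>2) \<partial>lborel) \<le> ennreal K"
  obtains r :: "nat \<Rightarrow> nat" where "strict_mono r"
    "\<And>\<epsilon>. \<epsilon> > 0 \<Longrightarrow> \<exists>N. \<forall>m\<ge>N. \<forall>n\<ge>N. (\<integral>\<^sup>+x. ennreal ((norm (f (r m) x - f (r n) x))\<^sup>2) \<partial>lborel) < ennreal \<epsilon>"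
proof -
  have fd: "f n differentiable (at x)" and fm [measurable]: "f n \<in> borel_measurable borel"
    and gm [measurable]: "grad (f n) \<in> borel_measurable borel" for n x
    using Ck_on_1_grad[OF f] by blast+
  have "\<exists>B. \<forall>x. norm (f n x) \<le> B" for n
  proof -
    have "compact (f n ` closure \<Omega>)"
      using \<Omega>(1) Ck_on_1_grad(2)[OF f] by (intro compact_continuous_image) (auto intro: continuous_on_subset)
    then obtain B where B: "\<And>y. y \<in> f n ` closure \<Omega> \<Longrightarrow> norm y \<le> B" using compact_imp_bounded bounded_iff by metis
    have "norm (f n x) \<le> \<bar>B\<bar>" for x
      using B[of "f n x"] \<Omega>(2)[of x n] closure_subset by (cases "x \<in> \<Omega>") fastforce+
    then show ?thesis by blast
  qed
  then obtain B where B: "\<And>n x. norm (f n x) \<le> B n" by metis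
  define c where "c k p n = (\<integral>x. f n x \<partial>restrict_space lborel (cell (1 / Suc k) p))" for k p n
  have c_bounded: "(norm (c k p n))\<^sup>2 \<le> measure lborel (cell (1 / Suc k) p) * K" for k p n
  proof -
    have "(\<integral>\<^sup>+x. ennreal ((norm (f n x))\<^sup>2) * indicator (cell (1 / Suc k) p) x \<partial>lborel) \<le> (\<integral>\<^sup>+x. ennreal ((norm (f n x))\<^sup>2) \<partial>lborel)"
      by (intro nn_integral_mono) (auto split: split_indicator)
    also have "\<dots> \<le> ennreal K" by (rule K(2))
    finally have "enn2real (\<integral>\<^sup>+x. ennreal ((norm (f n x))\<^sup>2) * indicator (cell (1 / Suc k) p) x \<partial>lborel) \<le> K"
      using K(1) by (rule enn2real_leI[rotated])
    then show ?thesis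
      unfolding c_def
      by (intro order_trans[OF cell_estimate(2)[OF _ fm B]] mult_left_mono) auto
  qed
  \<comment> \<open>The pairs of a mesh and a cell are coded by natural numbers for the diagonal
    argument.\<close>
  define d where "d j = (case from_nat j of (k :: nat, p) \<Rightarrow> c k p)" for j
  have "bounded (range (d j \<circ> s))" for j and s :: "nat \<Rightarrow> nat"
  proof -
    obtain k :: nat and p where kp: "from_nat j = (k, p :: int \<times> int)" by (metis surj_pair)
    have "norm (d j n) \<le> sqrt (measure lborel (cell (1 / Suc k) p) * K)" for n
      using c_bounded[of k p n] by (intro real_le_rsqrt) (simp add: d_def kp)
    then show ?thesis by (intro boundedI[of _ "sqrt (measure lborel (cell (1 / Suc k) p) * K)"]) auto
  qed
  then interpret subseqs "\<lambda>j s. convergent (\<lambda>i. d j (s i))"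
  proof unfold_locales
    fix j and s :: "nat \<Rightarrow> nat"
    obtain l r where "strict_mono r" "((d j \<circ> s) \<circ> r) \<longlonglongrightarrow> l"
      using bounded_imp_convergent_subsequence[OF \<open>\<And>j s. bounded (range (d j \<circ> s))\<close>, of j s] by blast
    then show "\<exists>r'. strict_mono r' \<and> convergent (\<lambda>i. d j ((s \<circ> r') i))"
      unfolding convergent_def o_def by blast
  qed
  define r where "r = diagseq"
  have r: "strict_mono r" unfolding r_def by (rule subseq_diagseq)
  have "convergent (\<lambda>i. d j (r i))" for j
  proof -
    have "convergent (\<lambda>i. d j ((diagseq \<circ> (+) (Suc j)) i))"
    proof (rule diagseq_holds)
      fix r s :: "nat \<Rightarrow> nat" and n
      assume "strict_mono r" "convergent (\<lambda>i. d n (s i))"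
      then show "convergent (\<lambda>i. d n ((s \<circ> r) i))"
        using LIMSEQ_subseq_LIMSEQ[of "\<lambda>i. d n (s i)" _ r] unfolding convergent_def o_def by blast
    qed
    then have "convergent (\<lambda>i. d j (r (i + Suc j)))" by (simp add: r_def o_def add.commute)
    then show ?thesis using convergent_ignore_initial_segment[of "\<lambda>i. d j (r i)" "Suc j"] by blast
  qed
  then have conv: "Cauchy (\<lambda>i. c k p (r i))" for k p
    using convergent_Cauchy[OF \<open>\<And>j. convergent (\<lambda>i. d j (r i))\<close>, of "to_nat (k, p)"] by (simp add: d_def)
  have "\<exists>N. \<forall>m\<ge>N. \<forall>n\<ge>N. (\<integral>\<^sup>+x. ennreal ((norm (f (r m) x - f (r n) x))\<^sup>2) \<partial>lborel) < ennreal \<epsilon>" if \<epsilon>: "\<epsilon> > 0" for \<epsilon>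
  proof -
    \<comment> \<open>Differences have gradient bound 4K, so the gradient part is 32\<delta>^2 * 4K,
      at most 128(K + 1)\<delta>; the constant 256 makes this less than half of \<epsilon>.\<close>
    obtain k :: nat where k: "inverse (real (Suc k)) < \<epsilon> / (256 * (K + 1))" using reals_Archimedean[of "\<epsilon> / (256 * (K + 1))"] \<epsilon> K(1) by auto
    define \<delta> where "\<delta> = 1 / real (Suc k)"
    have \<delta>: "\<delta> > 0" "\<delta> \<le> 1" by (auto simp: \<delta>_def)
    have "128 * (K + 1) * \<delta> < \<epsilon> / 2" using k K(1) by (simp add: \<delta>_def field_simps)
    moreover have "32 * \<delta>\<^sup>2 * (4 * K) \<le> 128 * (K + 1) * \<delta>"
      using \<delta> K(1) mult_mono[of "\<delta>" 1 "\<delta> * K" "\<delta> * (K + 1)"] by (simp add: power2_eq_square algebra_simps)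
    ultimately have small: "32 * \<delta>\<^sup>2 * (4 * K) < \<epsilon> / 2" by linarith
    define F where "F = (\<lambda>x. (\<lfloor>x$1 / \<delta>\<rfloor>, \<lfloor>x$2 / \<delta>\<rfloor>)) ` \<Omega>"
    have "finite F"
    proof -
      obtain R where R: "\<And>x. x \<in> \<Omega> \<Longrightarrow> norm x \<le> R" using \<Omega>(1) bounded_iff by metis
      have "F \<subseteq> {\<lfloor>- R / \<delta>\<rfloor>..\<lfloor>R / \<delta>\<rfloor>} \<times> {\<lfloor>- R / \<delta>\<rfloor>..\<lfloor>R / \<delta>\<rfloor>}"
      proof
        fix p assume "p \<in> F"
        then obtain x where x: "x \<in> \<Omega>" "p = (\<lfloor>x$1 / \<delta>\<rfloor>, \<lfloor>x$2 / \<delta>\<rfloor>)" by (auto simp: F_def)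
        have "\<bar>x$i\<bar> \<le> R" for i using R[OF x(1)] component_le_norm_cart[of x i] by linarith
        then have xR: "- R \<le> x$i" "x$i \<le> R" for i by (auto simp: abs_le_iff minus_le_iff)
        have "- R / \<delta> \<le> x$i / \<delta>" "x$i / \<delta> \<le> R / \<delta>" for i
          by (rule divide_right_mono[OF xR(1) less_imp_le[OF \<delta>(1)]], rule divide_right_mono[OF xR(2) less_imp_le[OF \<delta>(1)]])
        then show "p \<in> {\<lfloor>- R / \<delta>\<rfloor>..\<lfloor>R / \<delta>\<rfloor>} \<times> {\<lfloor>- R / \<delta>\<rfloor>..\<lfloor>R / \<delta>\<rfloor>}"
          unfolding x(2) by (auto intro: floor_mono)
      qed
      then show ?thesis by (rule finite_subset) auto
    qed
    \<comment> \<open>Each of the \<open>card F\<close> cells contributes at most \<eta>/\<delta>^2,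
      so that their sum stays below half of \<epsilon>. The +1 covers an empty F.\<close>
    define \<eta> where "\<eta> = \<epsilon> * \<delta>\<^sup>2 / (2 * (card F + 1))"
    have \<eta>: "\<eta> > 0" using \<epsilon> \<delta> by (simp add: \<eta>_def add_pos_nonneg)
    have "\<exists>N. \<forall>m\<ge>N. \<forall>n\<ge>N. dist (c k p (r m)) (c k p (r n)) < sqrt \<eta>" for p
      using metric_CauchyD[OF conv, of "sqrt \<eta>" k p] \<eta> by simp
    then obtain N where N: "\<And>p m n. m \<ge> N p \<Longrightarrow> n \<ge> N p \<Longrightarrow> dist (c k p (r m)) (c k p (r n)) < sqrt \<eta>" by metis
    define N0 where "N0 = Max (insert 0 (N ` F))"
    have N0: "N p \<le> N0" if "p \<in> F" for p
      unfolding N0_def using \<open>finite F\<close> that by (intro Max_ge) auto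
    show ?thesis
    proof (intro exI[of _ N0] allI impI)
      fix m n assume mn: "m \<ge> N0" "n \<ge> N0"
      let ?g = "\<lambda>x. f (r m) x - f (r n) x"
      have g: "Ck_on 1 UNIV ?g" by (intro Ck_on_diff f open_UNIV)
      have gK: "norm (?g x) \<le> B (r m) + B (r n)" for x
        using norm_triangle_ineq4[of "f (r m) x" "f (r n) x"] B[of "r m" x] B[of "r n" x] by linarith
      have gF: "\<exists>p\<in>F. x \<in> cell \<delta> p" if "?g x \<noteq> 0" for x
      proof -
        have "x \<in> \<Omega>" using \<Omega>(2)[of x "r m"] \<Omega>(2)[of x "r n"] that by fastforce
        then show ?thesis unfolding F_def by (auto simp: cell_def)
      qed
      have int: "(\<integral>x. ?g x \<partial>restrict_space lborel (cell \<delta> p)) = c k p (r m) - c k p (r n)" for p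
        unfolding c_def \<delta>_def[symmetric]
        by (intro Bochner_Integration.integral_diff cell_estimate(3)[OF \<delta>(1) fm B])
      have grad_g: "grad ?g x = grad (f (r m)) x - grad (f (r n)) x" for x
        by (rule grad_diff[OF fd fd])
      have "(\<integral>\<^sup>+x. ennreal ((norm (grad ?g x))\<^sup>2) \<partial>lborel) \<le> (\<integral>\<^sup>+x. 2 * ennreal ((norm (grad (f (r m)) x))\<^sup>2) + 2 * ennreal ((norm (grad (f (r n)) x))\<^sup>2) \<partial>lborel)"
      proof (intro nn_integral_mono)
        fix x
        have "ennreal ((norm (grad ?g x))\<^sup>2) \<le> ennreal (2 * (norm (grad (f (r m)) x))\<^sup>2 + 2 * (norm (grad (f (r n)) x))\<^sup>2)"
          unfolding grad_g using norm_add_sq_le[of "grad (f (r m)) x" "- grad (f (r n)) x"] by (intro ennreal_leI) simp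
        then show "ennreal ((norm (grad ?g x))\<^sup>2) \<le> 2 * ennreal ((norm (grad (f (r m)) x))\<^sup>2) + 2 * ennreal ((norm (grad (f (r n)) x))\<^sup>2)"
          by (simp add: ennreal_mult)
      qed
      also have "\<dots> = 2 * (\<integral>\<^sup>+x. ennreal ((norm (grad (f (r m)) x))\<^sup>2) \<partial>lborel) + 2 * (\<integral>\<^sup>+x. ennreal ((norm (grad (f (r n)) x))\<^sup>2) \<partial>lborel)"
        by (simp add: nn_integral_add nn_integral_cmult)
      also have "\<dots> \<le> 2 * ennreal K + 2 * ennreal K" by (intro add_mono mult_left_mono K) auto
      also have "\<dots> = ennreal (4 * K)"
        using K(1) by (simp add: ennreal_mult flip: distrib_right)
      finally have G: "(\<integral>\<^sup>+x. ennreal ((norm (grad ?g x))\<^sup>2) \<partial>lborel) \<le> ennreal (4 * K)" .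
      have "(\<integral>\<^sup>+x. ennreal ((norm (?g x))\<^sup>2) \<partial>lborel) \<le>
        ennreal (\<Sum>p\<in>F. (norm (c k p (r m) - c k p (r n)))\<^sup>2 / \<delta>\<^sup>2) + ennreal (32 * \<delta>\<^sup>2) * (\<integral>\<^sup>+x. ennreal ((norm (grad ?g x))\<^sup>2) \<partial>lborel)"
        using cells_estimate[OF \<delta>(1) g gK \<open>finite F\<close> gF] unfolding int .
      also have "\<dots> \<le> ennreal (\<epsilon> / 2) + ennreal (32 * \<delta>\<^sup>2) * ennreal (4 * K)"
      proof (intro add_mono mult_left_mono G ennreal_leI)
        have "(\<Sum>p\<in>F. (norm (c k p (r m) - c k p (r n)))\<^sup>2 / \<delta>\<^sup>2) \<le> (\<Sum>p\<in>F. \<eta> / \<delta>\<^sup>2)"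
        proof (intro sum_mono divide_right_mono)
          fix p assume "p \<in> F"
          then have "norm (c k p (r m) - c k p (r n)) < sqrt \<eta>" using N[of p m n] N0[of p] mn by (simp add: dist_norm)
          then have "(norm (c k p (r m) - c k p (r n)))\<^sup>2 \<le> (sqrt \<eta>)\<^sup>2" by (intro power_mono) auto
          then show "(norm (c k p (r m) - c k p (r n)))\<^sup>2 \<le> \<eta>" using \<eta> by simp
        qed simp
        also have "\<dots> = (card F / (card F + 1)) * (\<epsilon> / 2)"
        proof -
          have "\<eta> / \<delta>\<^sup>2 = \<epsilon> / (2 * (real (card F) + 1))" using \<delta> by (simp add: \<eta>_def)
          then show ?thesis by (simp add: mult.commute)
        qed
        also have "\<dots> \<le> 1 * (\<epsilon> / 2)" using \<epsilon> by (intro mult_right_mono) auto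
        finally show "(\<Sum>p\<in>F. (norm (c k p (r m) - c k p (r n)))\<^sup>2 / \<delta>\<^sup>2) \<le> \<epsilon> / 2" by simp
      qed simp
      also have "\<dots> = ennreal (\<epsilon> / 2 + 32 * \<delta>\<^sup>2 * (4 * K))" using \<epsilon> K(1) by (simp flip: ennreal_mult ennreal_plus)
      also have "\<dots> < ennreal \<epsilon>" using small \<epsilon> by (intro ennreal_lessI) auto
      finally show "(\<integral>\<^sup>+x. ennreal ((norm (?g x))\<^sup>2) \<partial>lborel) < ennreal \<epsilon>" .
    qed
  qed
  then show thesis using r that by blast
qed

lemma borel_measurable_vec_lambda [measurable (raw)]:
  fixes f :: "'i::finite \<Rightarrow> 'a \<Rightarrow> 'b::euclidean_space"
  assumes "\<And>j. f j \<in> borel_measurable M"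
  shows "(\<lambda>x. \<chi> j. f j x) \<in> borel_measurable M"
  using assms by (subst borel_measurable_euclidean_space) (auto simp: Basis_vec_def inner_axis)

lemma borel_measurable_vec_nth [measurable (raw)]:
  fixes f :: "'a \<Rightarrow> 'b::euclidean_space ^ 'i"
  assumes "f \<in> borel_measurable M"
  shows "(\<lambda>x. f x $ j) \<in> borel_measurable M"
  using assms by (rule measurable_compose) (intro borel_measurable_continuous_onI continuous_intros)

section \<open>Rotations and the Hardy inequality\<close>

definition rot :: "real^2 \<Rightarrow> real \<Rightarrow> real^2 \<Rightarrow> real^2" where
  "rot a t x = (\<chi> j. if j = 1 then a$1 + (cos t * (x$1 - a$1) - sin t * (x$2 - a$2))
     else a$2 + (sin t * (x$1 - a$1) + cos t * (x$2 - a$2)))"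

lemma rot_nth: "rot a t x $ 1 = a$1 + (cos t * (x$1 - a$1) - sin t * (x$2 - a$2))"
  "rot a t x $ 2 = a$2 + (sin t * (x$1 - a$1) + cos t * (x$2 - a$2))"
  by (simp_all add: rot_def)

lemma rot_neg: "rot a t (rot a (- t) x) = x" "rot a (- t) (rot a t x) = x"
  unfolding vec_eq_iff forall_2 rot_nth cos_minus sin_minus
  by (intro conjI; use sin_cos_squared_add[of t] in algebra)+

lemma norm_rot: "norm (rot a t x - a) = norm (x - a)"
proof -
  have "(norm (rot a t x - a))\<^sup>2 = (rot a t x $ 1 - a$1)\<^sup>2 + (rot a t x $ 2 - a$2)\<^sup>2"
    unfolding norm_vec2_sq by simp
  also have "\<dots> = (x$1 - a$1)\<^sup>2 + (x$2 - a$2)\<^sup>2"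
    unfolding rot_nth using sin_cos_squared_add[of t] by algebra
  also have "\<dots> = (norm (x - a))\<^sup>2" unfolding norm_vec2_sq by simp
  finally show ?thesis by simp
qed

lemma rot_has_derivative: "(rot a t has_derivative (\<lambda>v. rot 0 t v)) (at x)"
proof -
  have lin: "linear (rot 0 t)"
    by (rule linearI) (simp_all add: vec_eq_iff forall_2 rot_nth algebra_simps)
  have "rot a t = (\<lambda>x. rot 0 t (x - a) + a)"
    by (auto simp: fun_eq_iff vec_eq_iff forall_2 rot_nth)
  moreover have "((\<lambda>x. rot 0 t (x - a) + a) has_derivative (\<lambda>v. rot 0 t v)) (at x)"
    using linear_imp_has_derivative[OF lin]
    by (auto intro!: derivative_eq_intros has_derivative_compose[of "\<lambda>x. x - a" "\<lambda>v. v" x UNIV "rot 0 t"])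
  ultimately show ?thesis by simp
qed

lemma distr_rot: "distr lebesgue lebesgue (rot a t) = lebesgue"
proof -
  have "matrix (rot 0 t) $ i $ j = (if i = 1 then (if j = 1 then cos t else - sin t) else (if j = 1 then sin t else cos t))" for i j
    using exhaust_2[of i] exhaust_2[of j] by (auto simp: matrix_def rot_nth axis_def)
  then have "det (matrix (rot 0 t)) = 1"
    by (simp add: det_2 sin_cos_squared_add3)
  moreover have "rot a (- t) differentiable at x" for x
    using rot_has_derivative by (auto simp: differentiable_def)
  ultimately have "distr (density lebesgue (\<lambda>x. ennreal 1)) lebesgue (rot a t) = lebesgue"
    using rot_neg by (intro lebesgue_distr_diffeo[OF rot_has_derivative, where h="rot a (- t)"]) auto
  then show ?thesis by (simp add: density_1)
qed

lemma nn_integral_rot: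
  assumes [measurable]: "f \<in> borel_measurable borel"
  shows "(\<integral>\<^sup>+x. f (rot a t x) \<partial>lborel) = (\<integral>\<^sup>+x. f x \<partial>lborel)"
proof -
  have [measurable]: "rot a t \<in> borel_measurable borel"
    by (intro borel_measurable_continuous_onI continuous_at_imp_continuous_on ballI has_derivative_continuous[OF rot_has_derivative])
  have rm: "rot a t \<in> lebesgue \<rightarrow>\<^sub>M lebesgue"
    using rot_has_derivative rot_neg by (intro lebesgue_measurable_diffeo[where h="rot a (- t)"]) (auto simp: differentiable_def)
  have "(\<integral>\<^sup>+x. f x \<partial>lborel) = (\<integral>\<^sup>+x. f x \<partial>lebesgue)" by (simp add: nn_integral_completion)
  also have "\<dots> = (\<integral>\<^sup>+x. f x \<partial>distr lebesgue lebesgue (rot a t))" by (simp add: distr_rot)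
  also have "\<dots> = (\<integral>\<^sup>+x. f (rot a t x) \<partial>lebesgue)"
    using rm by (subst nn_integral_distr) (auto intro: measurable_completion)
  also have "\<dots> = (\<integral>\<^sup>+x. f (rot a t x) \<partial>lborel)" by (simp add: nn_integral_completion)
  finally show ?thesis by simp
qed

lemma AB_potential_nth:
  "AB_potential a \<alpha> x $ 1 = - \<alpha> * (x$2 - a$2) / (norm (x - a))\<^sup>2"
  "AB_potential a \<alpha> x $ 2 = \<alpha> * (x$1 - a$1) / (norm (x - a))\<^sup>2"
  by (simp_all add: AB_potential_def norm_vec2_sq vector_2 del: minus_diff_eq)

lemma magnetic_grad_nth:
  "magnetic_grad a \<alpha> u G x $ 1 = \<i> * G x $ 1 - of_real (\<alpha> * (x$2 - a$2) / (norm (x - a))\<^sup>2) * u x"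
  "magnetic_grad a \<alpha> u G x $ 2 = \<i> * G x $ 2 + of_real (\<alpha> * (x$1 - a$1) / (norm (x - a))\<^sup>2) * u x"
  by (simp_all add: magnetic_grad_def AB_potential_nth)

lemma magnetic_grad_measurable [measurable]:
  assumes [measurable]: "u \<in> borel_measurable M" "G \<in> borel_measurable M" "(\<lambda>x. x) \<in> borel_measurable M"
  shows "(\<lambda>x. magnetic_grad a \<alpha> u G x) \<in> borel_measurable M"
proof -
  have "(\<lambda>x. magnetic_grad a \<alpha> u G x) = (\<lambda>x. \<chi> j. if j = 1 then \<i> * G x $ 1 - of_real (\<alpha> * (x$2 - a$2) / (norm (x - a))\<^sup>2) * u x
      else \<i> * G x $ 2 + of_real (\<alpha> * (x$1 - a$1) / (norm (x - a))\<^sup>2) * u x)"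
    by (auto simp: fun_eq_iff vec_eq_iff forall_2 magnetic_grad_nth)
  also have "\<dots> \<in> borel_measurable M" by measurable
  finally show ?thesis .
qed

text \<open>The angular component of \<open>(i\<nabla> + A)u\<close> is \<open>(i/r)(\<partial>\<^sub>\<theta>u - i\<alpha>u)\<close>.\<close>

lemma angular_derivative_bound:
  assumes f: "f differentiable (at y)" and y: "y \<noteq> a"
  shows "(cmod (frechet_derivative f (at y) (\<chi> j. if j = 1 then - (y$2 - a$2) else y$1 - a$1) - \<i> * of_real \<alpha> * f y))\<^sup>2
    \<le> (norm (y - a))\<^sup>2 * (norm (magnetic_grad a \<alpha> f (grad f) y))\<^sup>2"
proof -
  define z1 z2 where "z1 = y$1 - a$1" and "z2 = y$2 - a$2"
  define M where "M = magnetic_grad a \<alpha> f (grad f) y"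
  define \<rho> where "\<rho> = (norm (y - a))\<^sup>2"
  have \<rho>: "\<rho> = z1\<^sup>2 + z2\<^sup>2" by (simp add: \<rho>_def z1_def z2_def norm_vec2_sq)
  have \<rho>0: "\<rho> \<noteq> 0" using y by (simp add: \<rho>_def)
  have fd: "frechet_derivative f (at y) (\<chi> j. if j = 1 then - z2 else z1) = (- z2) *\<^sub>R grad f y $ 1 + z1 *\<^sub>R grad f y $ 2"
    by (simp add: frechet_derivative_grad[OF f])
  have "(- z2) *\<^sub>R M $ 1 + z1 *\<^sub>R M $ 2 = \<i> * ((- z2) *\<^sub>R grad f y $ 1 + z1 *\<^sub>R grad f y $ 2) + of_real (\<alpha> * ((z1\<^sup>2 + z2\<^sup>2) / \<rho>)) * f y"
    unfolding M_def magnetic_grad_nth \<rho>_def[symmetric] z1_def[symmetric] z2_def[symmetric]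
    by (simp add: scaleR_conv_of_real power2_eq_square algebra_simps add_divide_distrib)
  also have "\<dots> = \<i> * (frechet_derivative f (at y) (\<chi> j. if j = 1 then - z2 else z1) - \<i> * of_real \<alpha> * f y)"
    unfolding fd \<rho>[symmetric] using \<rho>0 by (simp add: algebra_simps)
  finally have "cmod (frechet_derivative f (at y) (\<chi> j. if j = 1 then - z2 else z1) - \<i> * of_real \<alpha> * f y) = cmod ((- z2) *\<^sub>R M $ 1 + z1 *\<^sub>R M $ 2)"
    by (simp add: norm_mult)
  then have "(cmod (frechet_derivative f (at y) (\<chi> j. if j = 1 then - z2 else z1) - \<i> * of_real \<alpha> * f y))\<^sup>2 \<le> ((- z2)\<^sup>2 + z1\<^sup>2) * ((cmod (M $ 1))\<^sup>2 + (cmod (M $ 2))\<^sup>2)"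
    using two_dim_Cauchy_Schwarz[of "- z2" "M $ 1" z1 "M $ 2"] by simp
  also have "\<dots> = \<rho> * (norm M)\<^sup>2" by (simp add: \<rho> norm_vec2_sq[of M] add.commute)
  finally show ?thesis unfolding M_def \<rho>_def z1_def z2_def .
qed

text \<open>Along a circle of radius \<open>|x - a|\<close>, the function \<open>t \<mapsto> exp (-i\<alpha>t) f(R\<^sub>t x)\<close> changes by the factor
  \<open>exp (-2\<pi>i\<alpha>)\<close> over a full turn, and its derivative is controlled by the magnetic gradient. Integrating over
  \<open>x\<close> turns this into the inequality, since rotations preserve the measure.\<close>

theorem hardy_inequality:
  assumes f: "Ck_on 1 UNIV f"
  shows "ennreal ((cmod (cis (- (2 * pi * \<alpha>)) - 1))\<^sup>2) * (\<integral>\<^sup>+x. ennreal ((norm (f x) / norm (x - a))\<^sup>2) \<partial>lborel)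
    \<le> ennreal ((2 * pi)\<^sup>2) * (\<integral>\<^sup>+x. ennreal ((norm (magnetic_grad a \<alpha> f (grad f) x))\<^sup>2) \<partial>lborel)"
proof -
  note fd = Ck_on_1_grad[OF f]
  have [measurable]: "f \<in> borel_measurable borel" "grad f \<in> borel_measurable borel" by (rule fd)+
  define q where "q x = ennreal ((norm (magnetic_grad a \<alpha> f (grad f) x))\<^sup>2)" for x
  have [measurable]: "q \<in> borel_measurable borel" unfolding q_def by measurable
  have [measurable]: "(\<lambda>(x, t). rot a t x) \<in> borel_measurable (borel \<Otimes>\<^sub>M borel)"
    unfolding rot_def by measurable
  define \<kappa> where "\<kappa> = (cmod (cis (- (2 * pi * \<alpha>)) - 1))\<^sup>2"
  \<comment> \<open>At x = a the quotient on the left is 0 by the convention for division by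
    zero.\<close>
  have pointwise: "ennreal (\<kappa> * (norm (f x) / norm (x - a))\<^sup>2) \<le> ennreal (2 * pi) * (\<integral>\<^sup>+t. q (rot a t x) * indicator {0..2 * pi} t \<partial>lborel)" for x
  proof (cases "x = a")
    case False
    define y where "y t = rot a t x" for t
    define tang where "tang t = (\<chi> j. if j = 1 then - (y t $ 2 - a$2) else y t $ 1 - a$1 :: real^2)" for t
    define D where "D t = frechet_derivative f (at (y t)) (tang t)" for t
    define w where "w t = cis (- (\<alpha> * t)) * f (y t)" for t
    define w' where "w' t = cis (- (\<alpha> * t)) * (D t - \<i> * of_real \<alpha> * f (y t))" for t
    have ya: "norm (y t - a) = norm (x - a)" for t by (simp add: y_def norm_rot)
    \<comment> \<open>In this form the curve and its velocity are trigonometric in t with constant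
      vectors, so derivatives and continuity are immediate.\<close>
    have y_eq: "y t = a + cos t *\<^sub>R (x - a) + sin t *\<^sub>R (\<chi> j. if j = 1 then - (x$2 - a$2) else x$1 - a$1)" for t
      by (simp add: y_def vec_eq_iff forall_2 rot_nth algebra_simps)
    have tang_eq: "tang t = (- sin t) *\<^sub>R (x - a) + cos t *\<^sub>R (\<chi> j. if j = 1 then - (x$2 - a$2) else x$1 - a$1)" for t
      by (simp add: tang_def vec_eq_iff forall_2 y_def rot_nth algebra_simps)
    have yd: "(y has_vector_derivative tang t) (at t)" for t
      unfolding y_eq[abs_def] tang_eq has_vector_derivative_def
      by (auto intro!: derivative_eq_intros simp: algebra_simps)
    have D_eq: "D t = tang t $ 1 *\<^sub>R grad f (y t) $ 1 + tang t $ 2 *\<^sub>R grad f (y t) $ 2" for t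
      unfolding D_def by (rule frechet_derivative_grad[OF fd(1)])
    have fy: "((\<lambda>t. f (y t)) has_vector_derivative D t) (at t)" for t
    proof -
      have "(f has_derivative frechet_derivative f (at (y t))) (at (y t))"
        using fd(1) frechet_derivative_works by blast
      from has_derivative_compose[OF yd[unfolded has_vector_derivative_def] this]
      show ?thesis
        unfolding has_vector_derivative_def D_def
        using linear_scale[OF linear_frechet_derivative[OF fd(1)]] by simp
    qed
    have cisd: "((\<lambda>t. cis (- (\<alpha> * t))) has_vector_derivative - \<i> * of_real \<alpha> * cis (- (\<alpha> * t))) (at t)" for t
      unfolding has_vector_derivative_complex_iff
      by (auto intro!: derivative_eq_intros)
    have der: "(w has_vector_derivative w' t) (at t)" for t
      unfolding w_def w'_def
      by (rule has_vector_derivative_eq_rhs[OF has_vector_derivative_mult[OF cisd fy]]) (simp add: algebra_simps)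
    have "continuous_on UNIV y"
      unfolding y_eq[abs_def] by (intro continuous_intros)
    moreover have "continuous_on UNIV tang"
      unfolding tang_eq[abs_def] by (intro continuous_intros)
    ultimately have cont: "continuous_on UNIV w'"
      unfolding w'_def D_eq
      by (intro continuous_intros continuous_on_compose2[OF fd(2)] continuous_on_compose2[OF fd(3)]) auto
    \<comment> \<open>The circle closes after a full turn, so only the phase factor differs. It
      differs from 1 exactly when \<alpha> is not an integer.\<close>
    have "w (2 * pi) - w 0 = (cis (- (2 * pi * \<alpha>)) - 1) * f x"
      by (simp add: w_def y_eq algebra_simps)
    then have "\<kappa> * (norm (f x))\<^sup>2 = (norm (w (2 * pi) - w 0))\<^sup>2"
      by (simp add: \<kappa>_def norm_mult power_mult_distrib)
    then have "ennreal (\<kappa> * (norm (f x))\<^sup>2) \<le> ennreal (2 * pi) * (\<integral>\<^sup>+t. ennreal ((norm (w' t))\<^sup>2) * indicator {0..2 * pi} t \<partial>lborel)"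
      using norm_diff_sq_le_integral[OF _ der cont, of 0 "2 * pi"] by simp
    also have "\<dots> \<le> ennreal (2 * pi) * (\<integral>\<^sup>+t. ennreal ((norm (x - a))\<^sup>2) * (q (rot a t x) * indicator {0..2 * pi} t) \<partial>lborel)"
    proof (intro mult_left_mono nn_integral_mono)
      fix t
      have "y t \<noteq> a" using ya[of t] False by auto
      have "(norm (w' t))\<^sup>2 \<le> (norm (x - a))\<^sup>2 * (norm (magnetic_grad a \<alpha> f (grad f) (y t)))\<^sup>2"
        using angular_derivative_bound[OF fd(1), of "y t" a \<alpha>] ya[of t] \<open>y t \<noteq> a\<close>
        by (auto simp: w'_def norm_mult D_def tang_def)
      then have "ennreal ((norm (w' t))\<^sup>2) \<le> ennreal ((norm (x - a))\<^sup>2) * q (rot a t x)"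
        by (simp add: q_def y_def flip: ennreal_mult) 
      from mult_right_mono[OF this, of "indicator {0..2 * pi} t"]
      show "ennreal ((norm (w' t))\<^sup>2) * indicator {0..2 * pi} t \<le> ennreal ((norm (x - a))\<^sup>2) * (q (rot a t x) * indicator {0..2 * pi} t)"
        by (simp add: mult.assoc)
    qed simp
    also have "\<dots> = ennreal ((norm (x - a))\<^sup>2) * (ennreal (2 * pi) * (\<integral>\<^sup>+t. q (rot a t x) * indicator {0..2 * pi} t \<partial>lborel))"
      by (subst nn_integral_cmult) (auto simp: ac_simps)
    finally have le: "ennreal (1 / (norm (x - a))\<^sup>2) * ennreal (\<kappa> * (norm (f x))\<^sup>2) \<le>
        ennreal (1 / (norm (x - a))\<^sup>2) * (ennreal ((norm (x - a))\<^sup>2) * (ennreal (2 * pi) * (\<integral>\<^sup>+t. q (rot a t x) * indicator {0..2 * pi} t \<partial>lborel)))"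
      by (rule mult_left_mono) simp
    have "ennreal (1 / (norm (x - a))\<^sup>2) * ennreal ((norm (x - a))\<^sup>2) = 1"
      using False by (simp flip: ennreal_mult)
    then show ?thesis
      using le by (simp flip: mult.assoc ennreal_mult add: \<kappa>_def power_divide)
  qed simp
  have "ennreal \<kappa> * (\<integral>\<^sup>+x. ennreal ((norm (f x) / norm (x - a))\<^sup>2) \<partial>lborel) = (\<integral>\<^sup>+x. ennreal (\<kappa> * (norm (f x) / norm (x - a))\<^sup>2) \<partial>lborel)"
    by (subst nn_integral_cmult[symmetric]) (auto simp: ennreal_mult \<kappa>_def)
  also have "\<dots> \<le> (\<integral>\<^sup>+x. ennreal (2 * pi) * (\<integral>\<^sup>+t. q (rot a t x) * indicator {0..2 * pi} t \<partial>lborel) \<partial>lborel)"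
    by (rule nn_integral_mono) (rule pointwise)
  also have "\<dots> = ennreal (2 * pi) * (\<integral>\<^sup>+x. (\<integral>\<^sup>+t. q (rot a t x) * indicator {0..2 * pi} t \<partial>lborel) \<partial>lborel)"
    by (rule nn_integral_cmult) measurable
  also have "(\<integral>\<^sup>+x. (\<integral>\<^sup>+t. q (rot a t x) * indicator {0..2 * pi} t \<partial>lborel) \<partial>lborel) = (\<integral>\<^sup>+t. (\<integral>\<^sup>+x. q (rot a t x) * indicator {0..2 * pi} t \<partial>lborel) \<partial>(lborel :: real measure))"
    by (rule lborel_pair.Fubini'[symmetric]) measurable
  also have "\<dots> = (\<integral>\<^sup>+t. (\<integral>\<^sup>+x. q x \<partial>lborel) * indicator {0..2 * pi} t \<partial>(lborel :: real measure))"
  proof (rule nn_integral_cong)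
    fix t :: real
    have "(\<integral>\<^sup>+x. q (rot a t x) * indicator {0..2 * pi} t \<partial>lborel) = (\<integral>\<^sup>+x. q (rot a t x) \<partial>lborel) * indicator {0..2 * pi} t"
      by (rule nn_integral_multc) (simp add: rot_def)
    then show "(\<integral>\<^sup>+x. q (rot a t x) * indicator {0..2 * pi} t \<partial>lborel) = (\<integral>\<^sup>+x. q x \<partial>lborel) * indicator {0..2 * pi} t"
      by (simp add: nn_integral_rot)
  qed
  also have "\<dots> = (\<integral>\<^sup>+x. q x \<partial>lborel) * ennreal (2 * pi)"
    by (subst nn_integral_cmult_indicator) auto
  also have "ennreal (2 * pi) * ((\<integral>\<^sup>+x. q x \<partial>lborel) * ennreal (2 * pi)) = ennreal ((2 * pi)\<^sup>2) * (\<integral>\<^sup>+x. q x \<partial>lborel)"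
  proof -
    have "ennreal (2 * pi) * ((\<integral>\<^sup>+x. q x \<partial>lborel) * ennreal (2 * pi)) = (ennreal (2 * pi) * ennreal (2 * pi)) * (\<integral>\<^sup>+x. q x \<partial>lborel)"
      by (simp only: ac_simps)
    also have "ennreal (2 * pi) * ennreal (2 * pi) = ennreal ((2 * pi)\<^sup>2)"
      by (simp add: power2_eq_square flip: ennreal_mult)
    finally show ?thesis .
  qed
  finally show ?thesis unfolding \<kappa>_def q_def .
qed

section \<open>Moving the pole\<close>

lemma cutoff_bounds: "0 < r \<Longrightarrow> r < R \<Longrightarrow> 0 \<le> cutoff c r R x \<and> cutoff c r R x \<le> 1"
  using cutoff_denom_pos[of r R c x] bump_nonneg[of c R x] flat_exp_0(1)[of "(norm (x - c))\<^sup>2 - r\<^sup>2"]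
  unfolding cutoff_def by (simp add: field_simps)

text \<open>The new support lies in the image of the old compact support under the continuous left
  inverse \<Psi>, so it is compact and inside S.\<close>

lemma test_functions_compose:
  assumes \<phi>: "\<phi> \<in> test_functions S'" and \<Phi>: "\<And>n. Ck_on n UNIV \<Phi>" and \<Psi>: "continuous_on UNIV \<Psi>"
    and inv: "\<And>x. \<Psi> (\<Phi> x) = x" and S: "\<Psi> ` S' \<subseteq> S"
  shows "(\<lambda>x. \<phi> (\<Phi> x)) \<in> test_functions S"
proof -
  let ?K = "closure {x. \<phi> x \<noteq> 0}"
  have K: "compact ?K" "?K \<subseteq> S'" and sm: "\<And>n. Ck_on n UNIV \<phi>"
    using \<phi> by (auto simp: test_functions_def smooth_on_def)
  have cK: "compact (\<Psi> ` ?K)" using K \<Psi> by (intro compact_continuous_image) (auto intro: continuous_on_subset)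
  have "{x. \<phi> (\<Phi> x) \<noteq> 0} \<subseteq> \<Psi> ` ?K"
  proof
    fix x assume "x \<in> {x. \<phi> (\<Phi> x) \<noteq> 0}"
    then have "\<Phi> x \<in> ?K" using closure_subset by fastforce
    then show "x \<in> \<Psi> ` ?K" using inv[of x] by (metis imageI)
  qed
  then have sub: "closure {x. \<phi> (\<Phi> x) \<noteq> 0} \<subseteq> \<Psi> ` ?K"
    using cK by (intro closure_minimal compact_imp_closed)
  then have "compact (closure {x. \<phi> (\<Phi> x) \<noteq> 0})"
    using cK by (metis bounded_subset closed_closure compact_eq_bounded_closed)
  moreover have "closure {x. \<phi> (\<Phi> x) \<noteq> 0} \<subseteq> S" using sub K(2) S by blast
  moreover have "Ck_on n UNIV (\<lambda>x. \<phi> (\<Phi> x))" for n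
    by (rule Ck_on_compose[OF open_UNIV open_UNIV subset_UNIV \<Phi> sm])
  ultimately show ?thesis by (simp add: test_functions_def smooth_on_def)
qed

text \<open>\<open>\<Phi> d\<close> moves the pole from \<open>a0\<close> to \<open>a0 + d\<close> and is the identity outside \<open>\<Omega>\<close>; it is a
  diffeomorphism of \<open>\<Omega>\<close> for small \<open>d\<close>.\<close>

locale ab_domain =
  fixes \<Omega> :: "(real^2) set" and a0 :: "real^2" and r R :: real
  assumes \<Omega>_open: "open \<Omega>" and \<Omega>_bounded: "bounded \<Omega>" and rR: "0 < r" "r < R" and ball_\<Omega>: "cball a0 R \<subseteq> \<Omega>"
begin

definition \<eta> :: "real^2 \<Rightarrow> real" where "\<eta> = cutoff a0 r R"
definition D\<eta> :: "real^2 \<Rightarrow> real^2" where "D\<eta> x = (\<chi> j. frechet_derivative \<eta> (at x) (axis j 1))"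
definition \<Phi> :: "real^2 \<Rightarrow> real^2 \<Rightarrow> real^2" where "\<Phi> d x = x + \<eta> x *\<^sub>R d"
definition Jac :: "real^2 \<Rightarrow> real^2 \<Rightarrow> real" where "Jac d x = 1 + d \<bullet> D\<eta> x"
definition lip where "lip = (SOME L. L > 0 \<and> (\<forall>x. norm (D\<eta> x) \<le> L))"
text \<open>The first condition makes \<open>\<Phi> d\<close> minus the identity a contraction with
  factor 1/2 and keeps the Jacobian between 1/2 and 3/2. The second, with |\<kappa>| <= 1/r, keeps
  e0 + \<kappa> d away from 0 when the potential is pulled back.\<close>

definition small :: "real^2 \<Rightarrow> bool" where "small d \<longleftrightarrow> norm d * lip \<le> 1/2 \<and> norm d \<le> r/2"

lemma a0_\<Omega>: "a0 \<in> \<Omega>" using ball_\<Omega> rR by (meson centre_in_cball less_imp_le less_trans subsetD)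

lemma \<eta>_smooth: "Ck_on n UNIV \<eta>" unfolding \<eta>_def using rR by (rule Ck_on_cutoff)
lemma \<eta>_1: "norm (x - a0) \<le> r \<Longrightarrow> \<eta> x = 1" unfolding \<eta>_def using rR by (rule cutoff_eq_1)
lemma \<eta>_0: "norm (x - a0) \<ge> R \<Longrightarrow> \<eta> x = 0" unfolding \<eta>_def using rR by (rule cutoff_eq_0)
lemma \<eta>_bounds: "0 \<le> \<eta> x" "\<eta> x \<le> 1" using cutoff_bounds[OF rR] by (auto simp: \<eta>_def)
lemma \<eta>_outside:
  assumes "x \<notin> \<Omega>"
  shows "\<eta> x = 0"
proof -
  have "x \<notin> cball a0 R" using assms ball_\<Omega> by blast
  then show ?thesis by (intro \<eta>_0) (simp add: dist_norm norm_minus_commute)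
qed

lemma \<eta>_differentiable: "\<eta> differentiable (at x)"
  using Ck_on_Suc_has_derivative[OF \<eta>_smooth, of x] by (auto simp: differentiable_def)

lemma D\<eta>: "frechet_derivative \<eta> (at x) v = v \<bullet> D\<eta> x"
proof -
  have "linear (frechet_derivative \<eta> (at x))" using \<eta>_differentiable by (rule linear_frechet_derivative)
  then have "frechet_derivative \<eta> (at x) (v$1 *\<^sub>R axis 1 1 + v$2 *\<^sub>R axis 2 1) =
      v$1 *\<^sub>R frechet_derivative \<eta> (at x) (axis 1 1) + v$2 *\<^sub>R frechet_derivative \<eta> (at x) (axis 2 1)"
    by (simp only: linear_add linear_scale)
  then show ?thesis by (simp add: D\<eta>_def vec2_axis[symmetric] inner_vec_def sum_2)
qed

lemma \<eta>_has_derivative: "(\<eta> has_derivative (\<lambda>v. v \<bullet> D\<eta> x)) (at x)"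
  using \<eta>_differentiable[of x] by (simp add: frechet_derivative_works D\<eta>[abs_def])

lemma D\<eta>_smooth: "Ck_on n UNIV (\<lambda>x. v \<bullet> D\<eta> x)"
  using Ck_on_Suc_frechet[OF \<eta>_smooth, of n v] by (simp add: D\<eta>)

lemma D\<eta>_continuous: "continuous_on UNIV D\<eta>"
  unfolding D\<eta>_def[abs_def] by (intro continuous_on_vec_lambda Ck_on_continuous[OF Ck_on_Suc_frechet[OF \<eta>_smooth]])

lemma lip: "lip > 0" "norm (D\<eta> x) \<le> lip"
proof -
  have "compact (D\<eta> ` cball a0 R)"
    by (intro compact_continuous_image compact_cball continuous_on_subset[OF D\<eta>_continuous]) simp
  then have "bounded (D\<eta> ` cball a0 R)" by (rule compact_imp_bounded)
  then obtain L where "\<forall>y\<in>D\<eta> ` cball a0 R. norm y \<le> L" unfolding bounded_iff by blast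
  then have L: "\<And>x. x \<in> cball a0 R \<Longrightarrow> norm (D\<eta> x) \<le> L" by blast
  have out: "D\<eta> x = 0" if "x \<notin> cball a0 R" for x
  proof -
    have "(\<eta> has_derivative (\<lambda>v. 0)) (at x)"
      by (rule has_derivative_transform_within_open[OF has_derivative_const, of "- cball a0 R"])
         (use that in \<open>auto simp: \<eta>_0 dist_norm norm_minus_commute\<close>)
    then have "frechet_derivative \<eta> (at x) = (\<lambda>v. 0)" using frechet_derivative_at by metis
    then show ?thesis by (simp add: D\<eta>_def vec_eq_iff)
  qed
  have "norm (D\<eta> x) \<le> max 1 L" for x using L[of x] out[of x] by (cases "x \<in> cball a0 R") auto
  then have "\<exists>L. L > 0 \<and> (\<forall>x. norm (D\<eta> x) \<le> L)" by (intro exI[of _ "max 1 L"]) auto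
  from someI_ex[OF this] show "lip > 0" "norm (D\<eta> x) \<le> lip" unfolding lip_def by auto
qed

lemma \<eta>_lipschitz: "\<bar>\<eta> x - \<eta> y\<bar> \<le> lip * norm (x - y)"
proof -
  have "norm (\<eta> x - \<eta> y) \<le> lip * norm (x - y)"
  proof (rule differentiable_bound[of UNIV \<eta> "\<lambda>x v. v \<bullet> D\<eta> x"])
    show "onorm (\<lambda>v. v \<bullet> D\<eta> x) \<le> lip" for x
    proof (rule onorm_bound)
      fix v
      have "norm (v \<bullet> D\<eta> x) \<le> norm v * norm (D\<eta> x)" using Cauchy_Schwarz_ineq2 by simp
      also have "\<dots> \<le> norm v * lip" by (intro mult_left_mono lip) simp
      finally show "norm (v \<bullet> D\<eta> x) \<le> lip * norm v" by (simp add: mult.commute)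
    qed (use lip in simp)
  qed (auto intro: \<eta>_has_derivative)
  then show ?thesis by simp
qed

lemma \<Phi>_has_derivative: "(\<Phi> d has_derivative (\<lambda>v. v + (v \<bullet> D\<eta> x) *\<^sub>R d)) (at x)"
  unfolding \<Phi>_def[abs_def] by (auto intro!: derivative_eq_intros \<eta>_has_derivative)

lemma \<Phi>_smooth: "Ck_on n UNIV (\<Phi> d)"
  unfolding \<Phi>_def[abs_def] by (intro Ck_on_add Ck_on_scaleR Ck_on_id Ck_on_const \<eta>_smooth open_UNIV)

lemma \<Phi>_outside: "x \<notin> \<Omega> \<Longrightarrow> \<Phi> d x = x" by (simp add: \<Phi>_def \<eta>_outside)

lemma \<Phi>_a0: "\<Phi> d a0 = a0 + d" using rR by (simp add: \<Phi>_def \<eta>_1)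

lemma \<Phi>_0: "\<Phi> 0 x = x" by (simp add: \<Phi>_def)

lemma Jac_smooth: "Ck_on n UNIV (Jac d)"
  unfolding Jac_def[abs_def] by (intro Ck_on_add Ck_on_const D\<eta>_smooth open_UNIV)

lemma det_\<Phi>: "det (matrix (\<lambda>v. v + (v \<bullet> D\<eta> x) *\<^sub>R d)) = Jac d x"
  by (simp add: det_2 matrix_def Jac_def axis_def inner_vec_def sum_2 algebra_simps)

context
  fixes d :: "real^2" assumes d: "small d"
begin

lemma Jac_bounds: "1/2 \<le> Jac d x" "Jac d x \<le> 3/2" "\<bar>Jac d x - 1\<bar> \<le> norm d * lip"
proof -
  have "\<bar>d \<bullet> D\<eta> x\<bar> \<le> norm d * norm (D\<eta> x)" by (rule Cauchy_Schwarz_ineq2)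
  also have "\<dots> \<le> norm d * lip" by (intro mult_left_mono lip) simp
  finally have *: "\<bar>d \<bullet> D\<eta> x\<bar> \<le> norm d * lip" .
  then show "1/2 \<le> Jac d x" "Jac d x \<le> 3/2" "\<bar>Jac d x - 1\<bar> \<le> norm d * lip"
    using d unfolding small_def Jac_def by auto
qed

lemma Jac_pos: "0 < Jac d x" "0 \<le> Jac d x"
  using Jac_bounds(1)[of x] by auto

lemma \<Phi>_expand: "norm (x - y) \<le> 2 * norm (\<Phi> d x - \<Phi> d y)"
proof -
  have "x - y = (\<Phi> d x - \<Phi> d y) - (\<eta> x - \<eta> y) *\<^sub>R d" by (simp add: \<Phi>_def algebra_simps)
  then have "norm (x - y) \<le> norm (\<Phi> d x - \<Phi> d y) + \<bar>\<eta> x - \<eta> y\<bar> * norm d"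
    by (metis norm_scaleR norm_triangle_ineq4)
  moreover have "\<bar>\<eta> x - \<eta> y\<bar> * norm d \<le> 1/2 * norm (x - y)"
  proof -
    have "\<bar>\<eta> x - \<eta> y\<bar> * norm d \<le> (lip * norm (x - y)) * norm d" by (intro mult_right_mono \<eta>_lipschitz) simp
    also have "\<dots> = (norm d * lip) * norm (x - y)" by simp
    also have "\<dots> \<le> 1/2 * norm (x - y)" using d by (intro mult_right_mono) (auto simp: small_def)
    finally show ?thesis .
  qed
  ultimately show ?thesis by simp
qed

lemma \<Phi>_inj: "\<Phi> d x = \<Phi> d y \<Longrightarrow> x = y" using \<Phi>_expand[of x y] by simp

text \<open>Solving \<open>\<Phi> d x = y\<close> means finding a fixed point of x \<mapsto> y -
  \<eta> x d, a contraction with factor 1/2.\<close>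

lemma \<Phi>_surj: "\<exists>x. \<Phi> d x = y"
proof -
  have "\<exists>!x. y - \<eta> x *\<^sub>R d = x"
  proof (rule banach_fix_type)
    show "\<forall>x z. dist (y - \<eta> x *\<^sub>R d) (y - \<eta> z *\<^sub>R d) \<le> 1/2 * dist x z"
    proof (intro allI)
      fix x z
      have "dist (y - \<eta> x *\<^sub>R d) (y - \<eta> z *\<^sub>R d) = \<bar>\<eta> z - \<eta> x\<bar> * norm d"
        by (simp add: dist_norm flip: scaleR_diff_left)
      also have "\<dots> \<le> (lip * norm (z - x)) * norm d" by (intro mult_right_mono \<eta>_lipschitz) simp
      also have "\<dots> = (norm d * lip) * norm (z - x)" by simp
      also have "\<dots> \<le> 1/2 * norm (z - x)" using d by (intro mult_right_mono) (auto simp: small_def)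
      finally show "dist (y - \<eta> x *\<^sub>R d) (y - \<eta> z *\<^sub>R d) \<le> 1/2 * dist x z" by (simp add: dist_norm norm_minus_commute)
    qed
  qed auto
  then obtain x where "y - \<eta> x *\<^sub>R d = x" by blast
  then have "\<Phi> d x = y" by (simp add: \<Phi>_def) (metis diff_add_cancel)
  then show ?thesis by blast
qed

definition \<Psi> :: "real^2 \<Rightarrow> real^2" where "\<Psi> = inv (\<Phi> d)"

lemma \<Phi>_\<Psi>: "\<Phi> d (\<Psi> y) = y" and \<Psi>_\<Phi>: "\<Psi> (\<Phi> d x) = x"
proof -
  have "inj (\<Phi> d)" by (rule injI) (rule \<Phi>_inj)
  moreover have "\<exists>x. y = \<Phi> d x" for y using \<Phi>_surj[of y] by blast
  then have "surj (\<Phi> d)" unfolding surj_def by blast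
  ultimately show "\<Phi> d (\<Psi> y) = y" "\<Psi> (\<Phi> d x) = x" by (simp_all add: \<Psi>_def surj_f_inv_f inv_f_f)
qed

lemma \<Phi>_\<Omega>: "\<Phi> d x \<in> \<Omega> \<longleftrightarrow> x \<in> \<Omega>"
proof
  show "\<Phi> d x \<in> \<Omega> \<Longrightarrow> x \<in> \<Omega>" using \<Phi>_outside by metis
  show "x \<in> \<Omega> \<Longrightarrow> \<Phi> d x \<in> \<Omega>" using \<Phi>_outside[of "\<Phi> d x" d] \<Phi>_inj[of "\<Phi> d x" x] by metis
qed

lemma \<Psi>_\<Omega>: "\<Psi> y \<in> \<Omega> \<longleftrightarrow> y \<in> \<Omega>" using \<Phi>_\<Omega>[of "\<Psi> y"] by (simp add: \<Phi>_\<Psi>)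

lemma \<Psi>_continuous: "continuous_on UNIV \<Psi>"
proof -
  have "2-lipschitz_on UNIV \<Psi>"
    using \<Phi>_expand[of "\<Psi> x" "\<Psi> y" for x y] by (intro lipschitz_onI) (simp_all add: dist_norm \<Phi>_\<Psi>)
  then show ?thesis by (rule lipschitz_on_continuous_on)
qed

text \<open>The Sherman-Morrison formula: the derivative of \<Phi> is the identity plus a rank-one
  map, and the denominator of its inverse is the Jacobian determinant.\<close>

lemma \<Psi>_has_derivative:
  "(\<Psi> has_derivative (\<lambda>v. v - ((v \<bullet> D\<eta> (\<Psi> y)) * inverse (Jac d (\<Psi> y))) *\<^sub>R d)) (at y)"
proof (rule has_derivative_inverse_basic[where f="\<Phi> d" and T=UNIV])
  show "(\<Phi> d has_derivative (\<lambda>v. v + (v \<bullet> D\<eta> (\<Psi> y)) *\<^sub>R d)) (at (\<Psi> y))" by (rule \<Phi>_has_derivative)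
  have "bounded_linear (\<lambda>v. (v \<bullet> D\<eta> (\<Psi> y)) * inverse (Jac d (\<Psi> y)))"
    by (intro bounded_linear_mult_const bounded_linear_inner_left)
  then show "bounded_linear (\<lambda>v. v - ((v \<bullet> D\<eta> (\<Psi> y)) * inverse (Jac d (\<Psi> y))) *\<^sub>R d)"
    by (intro bounded_linear_sub bounded_linear_ident bounded_linear_scaleR_left[THEN bounded_linear_compose])
  have J: "Jac d (\<Psi> y) \<noteq> 0" using Jac_bounds(1)[of "\<Psi> y"] by auto
  have "(v + (v \<bullet> D\<eta> (\<Psi> y)) *\<^sub>R d) \<bullet> D\<eta> (\<Psi> y) = (v \<bullet> D\<eta> (\<Psi> y)) * Jac d (\<Psi> y)" for v
    by (simp add: Jac_def inner_simps algebra_simps)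
  then show "(\<lambda>v. v - ((v \<bullet> D\<eta> (\<Psi> y)) * inverse (Jac d (\<Psi> y))) *\<^sub>R d) \<circ> (\<lambda>v. v + (v \<bullet> D\<eta> (\<Psi> y)) *\<^sub>R d) = id"
    using J by (auto simp: fun_eq_iff)
  show "continuous (at y) \<Psi>" using \<Psi>_continuous by (simp add: continuous_on_eq_continuous_at)
qed (auto simp: \<Phi>_\<Psi>)

text \<open>The derivative of \<Psi> at y is a smooth function of the value \<Psi> y, so the
  bootstrapping lemma applies.\<close>

lemma \<Psi>_smooth: "Ck_on n UNIV \<Psi>"
proof (rule Ck_on_implicit[OF open_UNIV open_UNIV \<Psi>_continuous, where K="\<lambda>v z. v - ((v \<bullet> D\<eta> (snd z)) * inverse (Jac d (snd z))) *\<^sub>R d"])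
  fix v
  have sn: "Ck_on n UNIV (\<lambda>z::(real^2) \<times> (real^2). snd z)" by (intro Ck_on_snd Ck_on_id open_UNIV)
  have J: "Jac d x \<noteq> 0" for x using Jac_bounds(1)[of x] by auto
  show "Ck_on n UNIV (\<lambda>z::(real^2) \<times> (real^2). v - ((v \<bullet> D\<eta> (snd z)) * inverse (Jac d (snd z))) *\<^sub>R d)"
    by (intro Ck_on_diff Ck_on_scaleR Ck_on_mult Ck_on_inverse Ck_on_const open_UNIV J
        Ck_on_compose[OF open_UNIV open_UNIV subset_UNIV sn D\<eta>_smooth] Ck_on_compose[OF open_UNIV open_UNIV subset_UNIV sn Jac_smooth])
qed (auto intro: \<Psi>_has_derivative[simplified])

lemma lebesgue_\<Phi>: "\<Phi> d \<in> lebesgue \<rightarrow>\<^sub>M lebesgue" and lebesgue_\<Psi>: "\<Psi> \<in> lebesgue \<rightarrow>\<^sub>M lebesgue"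
  using \<Phi>_has_derivative \<Psi>_has_derivative \<Phi>_\<Psi> \<Psi>_\<Phi>
  by (intro lebesgue_measurable_diffeo[where h=\<Psi>] lebesgue_measurable_diffeo[where h="\<Phi> d"]; auto simp: differentiable_def)+

lemma Jac_measurable: "Jac d \<in> borel_measurable lebesgue"
  using Ck_on_continuous[OF Jac_smooth] by (intro measurable_completion) (simp add: borel_measurable_continuous_onI)

lemma distr_\<Phi>: "distr (density lebesgue (\<lambda>x. ennreal (Jac d x))) lebesgue (\<Phi> d) = lebesgue"
  using \<Psi>_has_derivative
  by (intro lebesgue_distr_diffeo[OF \<Phi>_has_derivative, where h=\<Psi>])
     (auto simp: differentiable_def \<Phi>_\<Psi> \<Psi>_\<Phi> det_\<Phi> Jac_measurable Jac_pos)

lemma nn_integral_\<Phi>: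
  assumes "f \<in> borel_measurable lebesgue"
  shows "(\<integral>\<^sup>+x. f x \<partial>lebesgue) = (\<integral>\<^sup>+x. ennreal (Jac d x) * f (\<Phi> d x) \<partial>lebesgue)"
proof -
  have [measurable]: "(\<lambda>x. f (\<Phi> d x)) \<in> borel_measurable lebesgue" using lebesgue_\<Phi> assms by (rule measurable_compose)
  note Jac_measurable[measurable]
  have "(\<integral>\<^sup>+x. f x \<partial>lebesgue) = (\<integral>\<^sup>+x. f x \<partial>distr (density lebesgue (\<lambda>x. ennreal (Jac d x))) lebesgue (\<Phi> d))"
    by (simp add: distr_\<Phi>)
  also have "\<dots> = (\<integral>\<^sup>+x. f (\<Phi> d x) \<partial>density lebesgue (\<lambda>x. ennreal (Jac d x)))"
    using lebesgue_\<Phi> assms by (intro nn_integral_distr) auto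
  also have "\<dots> = (\<integral>\<^sup>+x. ennreal (Jac d x) * f (\<Phi> d x) \<partial>lebesgue)"
    by (rule nn_integral_density) measurable
  finally show ?thesis .
qed

lemma integral_\<Phi>:
  fixes f :: "real^2 \<Rightarrow> 'b::euclidean_space"
  assumes "f \<in> borel_measurable lebesgue"
  shows "(\<integral>x. f x \<partial>lebesgue) = (\<integral>x. Jac d x *\<^sub>R f (\<Phi> d x) \<partial>lebesgue)"
proof -
  have [measurable]: "(\<lambda>x. f (\<Phi> d x)) \<in> borel_measurable lebesgue" using lebesgue_\<Phi> assms by (rule measurable_compose)
  note Jac_measurable[measurable]
  have "(\<integral>x. f x \<partial>lebesgue) = (\<integral>x. f x \<partial>distr (density lebesgue (\<lambda>x. ennreal (Jac d x))) lebesgue (\<Phi> d))"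
    by (simp add: distr_\<Phi>)
  also have "\<dots> = (\<integral>x. f (\<Phi> d x) \<partial>density lebesgue (\<lambda>x. ennreal (Jac d x)))"
    using lebesgue_\<Phi> assms by (intro integral_distr) auto
  also have "\<dots> = (\<integral>x. Jac d x *\<^sub>R f (\<Phi> d x) \<partial>lebesgue)"
    by (rule integral_density) (auto simp: Jac_pos)
  finally show ?thesis .
qed

end

end

section \<open>The transported operators\<close>

lemma l2_symbolI:
  assumes "\<And>x. linear (m x)" "\<And>x v. norm (m x v) \<le> K * norm v"
    and "\<And>f. f \<in> borel_measurable lebesgue \<Longrightarrow> (\<lambda>x. m x (f x)) \<in> borel_measurable lebesgue"
  shows "l2_symbol m"
  using assms by (auto simp: l2_symbol_def)

lemma l2_symbol_add:
  assumes "l2_symbol m" "l2_symbol m'"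
  shows "l2_symbol (\<lambda>x v. m x v + m' x v)"
proof -
  obtain K K' where K: "\<And>x v. norm (m x v) \<le> K * norm v" "\<And>x v. norm (m' x v) \<le> K' * norm v"
    using assms by (auto simp: l2_symbol_def)
  show ?thesis
  proof (rule l2_symbolI[of _ "K + K'"])
    show "norm (m x v + m' x v) \<le> (K + K') * norm v" for x v
      using norm_triangle_ineq[of "m x v" "m' x v"] K[of x v] by (simp add: distrib_right)
  qed (use assms in \<open>auto simp: l2_symbol_def intro: linear_compose_add borel_measurable_add\<close>)
qed

lemma l2_symbol_compose:
  assumes "l2_symbol m" "l2_symbol m'"
  shows "l2_symbol (\<lambda>x v. m x (m' x v))"
proof -
  obtain K K' where K: "\<And>x v. norm (m x v) \<le> K * norm v" "\<And>x v. norm (m' x v) \<le> K' * norm v"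
    using assms by (auto simp: l2_symbol_def)
  show ?thesis
  proof (rule l2_symbolI[of _ "\<bar>K\<bar> * K'"])
    fix x v
    have "norm (m x (m' x v)) \<le> \<bar>K\<bar> * norm (m' x v)"
      using K(1)[of x "m' x v"] mult_right_mono[OF abs_ge_self norm_ge_zero, of K "m' x v"] by linarith
    also have "\<dots> \<le> \<bar>K\<bar> * (K' * norm v)" by (intro mult_left_mono K) simp
    finally show "norm (m x (m' x v)) \<le> \<bar>K\<bar> * K' * norm v" by (simp add: mult.assoc)
  next
    fix x
    show "linear (\<lambda>v. m x (m' x v))"
      using linear_compose[of "m' x" "m x"] assms by (simp add: l2_symbol_def o_def)
  qed (use assms in \<open>auto simp: l2_symbol_def\<close>)
qed

lemma l2_symbol_const: "bounded_linear T \<Longrightarrow> l2_symbol (\<lambda>x. T)"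
  by (rule l2_symbolI[of _ "onorm T"])
     (auto intro: bounded_linear.linear onorm borel_measurable_continuous_onI linear_continuous_on measurable_compose)

lemma l2_symbol_scaleR:
  assumes [measurable]: "c \<in> borel_measurable lebesgue" and K: "\<And>x. \<bar>c x\<bar> \<le> K"
  shows "l2_symbol (\<lambda>x (v::'b::euclidean_space). c x *\<^sub>R v)"
  by (rule l2_symbolI[of _ K]) (auto simp: K mult_right_mono intro!: linear_compose_scale_right linear_ident)

lemma l2_symbol_scale_const: "l2_symbol m \<Longrightarrow> l2_symbol (\<lambda>x v. r *\<^sub>R m x v)"
  using l2_symbol_compose[OF l2_symbol_const[OF bounded_linear_scaleR_right, of r]] .

lemma l2_mult_add:
  fixes m m' :: "'a::euclidean_space \<Rightarrow> 'b::euclidean_space \<Rightarrow> 'c::euclidean_space"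
  assumes m: "l2_symbol m" "l2_symbol m'"
  shows "l2_mult m + l2_mult m' = l2_mult (\<lambda>x v. m x v + m' x v)"
proof (rule blinfun_eqI)
  fix u :: "('a, 'b) l2"
  obtain f where f: "sqint f" "u = abs_l2 f" by (rule l2_cases)
  show "(l2_mult m + l2_mult m') u = l2_mult (\<lambda>x v. m x v + m' x v) u"
    using f by (simp add: blinfun.bilinear_simps l2_mult m l2_mult[OF l2_symbol_add[OF m]] abs_l2_add l2_symbol_sqint)
qed

lemma l2_mult_scaleR:
  fixes m :: "'a::euclidean_space \<Rightarrow> 'b::euclidean_space \<Rightarrow> 'c::euclidean_space"
  assumes m: "l2_symbol m"
  shows "r *\<^sub>R l2_mult m = l2_mult (\<lambda>x v. r *\<^sub>R m x v)"
proof (rule blinfun_eqI)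
  fix u :: "('a, 'b) l2"
  obtain f where f: "sqint f" "u = abs_l2 f" by (rule l2_cases)
  show "(r *\<^sub>R l2_mult m) u = l2_mult (\<lambda>x v. r *\<^sub>R m x v) u"
    using f by (simp add: blinfun.bilinear_simps l2_mult[OF m] l2_mult[OF l2_symbol_scale_const[OF m]] abs_l2_scaleR l2_symbol_sqint[OF m])
qed

lemma l2_mult_compose:
  fixes m' :: "'a::euclidean_space \<Rightarrow> 'b::euclidean_space \<Rightarrow> 'c::euclidean_space"
    and m :: "'a \<Rightarrow> 'c \<Rightarrow> 'd::euclidean_space"
  assumes m: "l2_symbol m" "l2_symbol m'"
  shows "l2_mult m o\<^sub>L l2_mult m' = l2_mult (\<lambda>x v. m x (m' x v))"
proof (rule blinfun_eqI)
  fix u :: "('a, 'b) l2"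
  obtain f where f: "sqint f" "u = abs_l2 f" by (rule l2_cases)
  show "(l2_mult m o\<^sub>L l2_mult m') u = l2_mult (\<lambda>x v. m x (m' x v)) u"
    using f by (simp add: l2_mult m l2_mult[OF l2_symbol_compose[OF m]] l2_symbol_sqint)
qed

lemma l2_mult_id: "l2_mult (\<lambda>x v. v) = (id_blinfun :: ('a::euclidean_space, 'b::euclidean_space) l2 \<Rightarrow>\<^sub>L _)"
proof (rule blinfun_eqI)
  fix u :: "('a, 'b) l2"
  obtain f where f: "sqint f" "u = abs_l2 f" by (rule l2_cases)
  show "l2_mult (\<lambda>x v. v) u = id_blinfun u"
    unfolding f(2) l2_mult[OF l2_symbol_const[OF bounded_linear_ident] f(1)] by simp
qed

lemma inner_l2_mult_real:
  assumes "l2_symbol (\<lambda>x (v::'b::euclidean_space). c x *\<^sub>R v)"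
  shows "l2_mult (\<lambda>x v. c x *\<^sub>R v) u \<bullet> w = (u::('a::euclidean_space,'b) l2) \<bullet> l2_mult (\<lambda>x v. c x *\<^sub>R v) w"
proof -
  obtain f g where f: "sqint f" "u = abs_l2 f" and g: "sqint g" "w = abs_l2 g" by (metis l2_cases)
  show ?thesis
    using f g assms by (simp add: l2_mult inner_abs_l2 l2_symbol_sqint[OF assms])
qed

lemma norm_l2_mult_le:
  fixes m :: "'a::euclidean_space \<Rightarrow> 'b::euclidean_space \<Rightarrow> 'c::euclidean_space"
  assumes m: "l2_symbol m" and K: "K \<ge> 0" "\<And>x v. norm (m x v) \<le> K * norm v"
  shows "norm (l2_mult m) \<le> K"
proof (rule norm_blinfun_bound[OF K(1)])
  fix u :: "('a, 'b) l2"
  obtain f where f: "sqint f" "u = abs_l2 f" by (rule l2_cases)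
  have "(norm (l2_mult m u))\<^sup>2 = (\<integral>x. (norm (m x (f x)))\<^sup>2 \<partial>lebesgue)"
    using m f by (simp add: l2_mult norm_abs_l2 l2_symbol_sqint)
  also have "\<dots> \<le> (\<integral>x. K\<^sup>2 * (norm (f x))\<^sup>2 \<partial>lebesgue)"
  proof (rule integral_mono)
    show "integrable lebesgue (\<lambda>x. (norm (m x (f x)))\<^sup>2)" using l2_symbol_sqint[OF m f(1)] by (simp add: sqint_def)
    show "integrable lebesgue (\<lambda>x. K\<^sup>2 * (norm (f x))\<^sup>2)" using f(1) by (simp add: sqint_def)
    show "(norm (m x (f x)))\<^sup>2 \<le> K\<^sup>2 * (norm (f x))\<^sup>2" for x
      unfolding power_mult_distrib[symmetric] by (intro power_mono K) auto
  qed
  also have "\<dots> = (K * norm u)\<^sup>2" using f by (simp add: norm_abs_l2 power_mult_distrib)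
  finally show "norm (l2_mult m u) \<le> K * norm u" by (rule power2_le_imp_le) (use K in simp)
qed

section \<open>Symbols of the pulled-back operators\<close>

type_synonym ab_space = "(real^2, (complex^2) \<times> complex) l2"

text \<open>A quarter turn; the Aharonov-Bohm potential is \<alpha> perp(x - a)/|x - a|^2.\<close>

definition perp :: "real^2 \<Rightarrow> real^2" where "perp w = (\<chi> j. if j = 1 then - (w$2) else w$1)"

lemma norm_perp: "norm (perp w) = norm w"
proof -
  have "(norm (perp w))\<^sup>2 = (norm w)\<^sup>2" by (simp add: norm_vec2_sq perp_def)
  then show ?thesis by simp
qed

definition vec_cmult :: "real^2 \<Rightarrow> complex \<Rightarrow> complex^2" where "vec_cmult w z = (\<chi> j. of_real (w$j) * z)"

lemma norm_vec_cmult: "norm (vec_cmult w z) = norm w * cmod z"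
proof -
  have "(norm (vec_cmult w z))\<^sup>2 = (norm w * cmod z)\<^sup>2"
    unfolding norm_vec2_sq power_mult_distrib by (simp add: vec_cmult_def norm_mult power_mult_distrib distrib_right)
  then show ?thesis by (simp add: power2_eq_iff_nonneg)
qed

lemma vec_cmult_add: "vec_cmult w (z + z') = vec_cmult w z + vec_cmult w z'"
  "vec_cmult (w + w') z = vec_cmult w z + vec_cmult w' z"
  "vec_cmult w (r *\<^sub>R z) = r *\<^sub>R vec_cmult w z" "vec_cmult (r *\<^sub>R w) z = r *\<^sub>R vec_cmult w z"
  by (simp_all add: vec_cmult_def vec_eq_iff algebra_simps scaleR_conv_of_real[where 'a=complex])

lemma vec_cmult_of_real: "vec_cmult w (of_real c * z) = c *\<^sub>R vec_cmult w z"
  using vec_cmult_add(3)[of w c z] by (simp only: scaleR_conv_of_real[of c z])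

lemma vec_cmult_measurable [measurable]:
  "w \<in> borel_measurable M \<Longrightarrow> z \<in> borel_measurable M \<Longrightarrow> (\<lambda>x. vec_cmult (w x) (z x)) \<in> borel_measurable M"
  unfolding vec_cmult_def by measurable

text \<open>Building blocks of the pulled-back magnetic gradient. The zero second component keeps
  domain and range equal, so all operators live in one algebra.\<close>

definition sym_fst :: "2 \<Rightarrow> (real^2 \<Rightarrow> real^2) \<Rightarrow> real^2 \<Rightarrow> (complex^2) \<times> complex \<Rightarrow> (complex^2) \<times> complex" where
  "sym_fst i w x v = (vec_cmult (w x) (fst v $ i), 0)"

definition sym_snd :: "(real^2 \<Rightarrow> real^2) \<Rightarrow> real^2 \<Rightarrow> (complex^2) \<times> complex \<Rightarrow> (complex^2) \<times> complex" where
  "sym_snd w x v = (vec_cmult (w x) (snd v), 0)"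

lemma borel_measurable_fst_snd [measurable (raw)]:
  fixes f :: "'a \<Rightarrow> 'b::second_countable_topology \<times> 'c::second_countable_topology"
  assumes "f \<in> borel_measurable M"
  shows "(\<lambda>x. fst (f x)) \<in> borel_measurable M" "(\<lambda>x. snd (f x)) \<in> borel_measurable M"
  by (rule measurable_compose[OF assms borel_measurable_continuous_onI], intro continuous_intros)+

lemma l2_symbol_sym_fst:
  assumes [measurable]: "w \<in> borel_measurable lebesgue" and K: "\<And>x. norm (w x) \<le> K"
  shows "l2_symbol (sym_fst i w)"
proof (rule l2_symbolI[of _ K])
  show "linear (sym_fst i w x)" for x
    by (rule linearI) (simp_all add: sym_fst_def vec_cmult_add)
  show "norm (sym_fst i w x v) \<le> K * norm v" for x v
  proof -
    have "norm (sym_fst i w x v) = norm (w x) * cmod (fst v $ i)" by (simp add: sym_fst_def norm_vec_cmult norm_Pair)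
    also have "\<dots> \<le> K * norm v"
      using order_trans[OF Finite_Cartesian_Product.norm_nth_le norm_fst_le, of "fst v" i "snd v"] K[of x] order_trans[OF norm_ge_zero K]
      by (intro mult_mono) auto
    finally show ?thesis .
  qed
qed (simp add: sym_fst_def)

lemma l2_symbol_sym_snd:
  assumes [measurable]: "w \<in> borel_measurable lebesgue" and K: "\<And>x. norm (w x) \<le> K"
  shows "l2_symbol (sym_snd w)"
proof (rule l2_symbolI[of _ K])
  show "linear (sym_snd w x)" for x
    by (rule linearI) (simp_all add: sym_snd_def vec_cmult_add)
  show "norm (sym_snd w x v) \<le> K * norm v" for x v
  proof -
    have "norm (sym_snd w x v) = norm (w x) * cmod (snd v)" by (simp add: sym_snd_def norm_vec_cmult norm_Pair)
    also have "\<dots> \<le> K * norm v"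
      using norm_snd_le[of "snd v" "fst v"] K[of x] order_trans[OF norm_ge_zero K] by (intro mult_mono) auto
    finally show ?thesis .
  qed
qed (simp add: sym_snd_def)

definition cmul :: "complex \<Rightarrow> (complex^2) \<times> complex \<Rightarrow> (complex^2) \<times> complex" where
  "cmul c v = ((\<chi> j. c * fst v $ j), c * snd v)"

lemma cmul_linear: "bounded_linear (cmul c)"
proof -
  have "linear (cmul c)" by (rule linearI) (simp_all add: cmul_def vec_eq_iff algebra_simps)
  then show ?thesis by (simp add: linear_conv_bounded_linear)
qed

lemma cmul_symbol: "l2_symbol (\<lambda>x. cmul c)" by (rule l2_symbol_const[OF cmul_linear])

definition Jc :: "ab_space \<Rightarrow> ab_space" where "Jc u = l2_mult (\<lambda>x. cmul \<i>) u"

lemma inner_cmul_i: "cmul \<i> v \<bullet> cmul \<i> w = v \<bullet> w"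
  by (simp add: cmul_def inner_prod_def inner_vec_def inner_complex_def add.commute)

interpretation Jc: complex_structure Jc
proof (rule complex_structure.intro)
  show "bounded_linear Jc" unfolding Jc_def[abs_def] by (rule blinfun.bounded_linear_right)
  fix u v :: ab_space
  obtain f g where f: "sqint f" "u = abs_l2 f" and g: "sqint g" "v = abs_l2 g" by (metis l2_cases)
  have "cmul \<i> (cmul \<i> z) = - z" for z by (simp add: cmul_def prod_eq_iff vec_eq_iff)
  then show "Jc (Jc u) = - u"
    using f by (simp add: Jc_def l2_mult[OF cmul_symbol] l2_symbol_sqint[OF cmul_symbol] uminus_l2.abs_eq eq_onp_def l2_rel_def)
  show "Jc u \<bullet> Jc v = u \<bullet> v"
    using f g by (simp add: Jc_def l2_mult[OF cmul_symbol] l2_symbol_sqint[OF cmul_symbol] inner_abs_l2 inner_cmul_i)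
qed

lemma Jc_abs: "sqint f \<Longrightarrow> Jc (abs_l2 f) = abs_l2 (\<lambda>x. cmul \<i> (f x))"
  by (simp add: Jc_def l2_mult[OF cmul_symbol])

lemma cscale_abs: "sqint f \<Longrightarrow> Jc.cscale c (abs_l2 f) = abs_l2 (\<lambda>x. cmul c (f x))"
proof -
  assume f: "sqint f"
  have "cmul c v = Re c *\<^sub>R v + Im c *\<^sub>R cmul \<i> v" for v
    by (simp add: cmul_def prod_eq_iff vec_eq_iff complex_eq_iff)
  then show ?thesis
    using f by (simp add: Jc.cscale_def Jc_abs abs_l2_add abs_l2_scaleR sqint_scaleR l2_symbol_sqint[OF cmul_symbol])
qed

lemma Jc_commute:
  assumes m: "l2_symbol m" and c: "\<And>x v. m x (cmul \<i> v) = cmul \<i> (m x v)"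
  shows "l2_mult m (Jc u) = Jc (l2_mult m u)"
proof -
  obtain f where f: "sqint f" "u = abs_l2 f" by (rule l2_cases)
  show ?thesis using f m by (simp add: Jc_abs l2_mult l2_symbol_sqint[OF cmul_symbol] l2_symbol_sqint[OF m] c)
qed

lemma borel_imp_lebesgue_measurable: "f \<in> borel_measurable borel \<Longrightarrow> f \<in> borel_measurable lebesgue"
  by (intro measurable_completion) simp

context ab_domain
begin

definition e0 :: "real^2 \<Rightarrow> real^2" where "e0 x = (1 / norm (x - a0)) *\<^sub>R (x - a0)"
text \<open>The numerator vanishes near a0, where \<eta> = 1, so this function is bounded by 1/r
  despite the denominator.\<close>

definition \<kappa> :: "real^2 \<Rightarrow> real" where "\<kappa> x = (\<eta> x - 1) / norm (x - a0)"
text \<open>Away from a0 this is |e0 x + \<kappa> x d|^2. Written out, it is a polynomial in d with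
  bounded coefficients, and at a0 it takes the harmless value 1.\<close>

definition q :: "real^2 \<Rightarrow> real^2 \<Rightarrow> real" where "q d x = 1 + 2 * \<kappa> x * (d \<bullet> e0 x) + (\<kappa> x)\<^sup>2 * (d \<bullet> d)"
text \<open>The weight that recovers |v|^2 on \<Omega> from the second component v/|x - a0|.\<close>

definition \<beta> :: "real^2 \<Rightarrow> real" where "\<beta> x = (if x \<in> \<Omega> then (norm (x - a0))\<^sup>2 else 0)"

text \<open>The symbol of \<open>i\<nabla> + A\<close> after pulling back by \<open>\<Phi> d\<close>. Its argument is the pair
  \<open>(i\<nabla>v, v / |x - a\<^sub>0|)\<close>, and \<open>\<Phi> d x - (a\<^sub>0 + d) = |x - a\<^sub>0| (e0 x + \<kappa> x d)\<close>.\<close>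

definition Lsym :: "real^2 \<Rightarrow> real \<Rightarrow> real^2 \<Rightarrow> (complex^2) \<times> complex \<Rightarrow> (complex^2) \<times> complex" where
  "Lsym d \<alpha> x v = (fst v - vec_cmult ((1 / Jac d x) *\<^sub>R D\<eta> x) (of_real (d$1) * fst v $ 1 + of_real (d$2) * fst v $ 2)
     + vec_cmult ((\<alpha> / q d x) *\<^sub>R perp (e0 x + \<kappa> x *\<^sub>R d)) (snd v), 0)"

lemma e0_norm: "norm (e0 x) \<le> 1" by (simp add: e0_def)

lemma \<kappa>_bound: "\<bar>\<kappa> x\<bar> \<le> 1 / r"
proof (cases "norm (x - a0) \<le> r")
  case True
  then show ?thesis using \<eta>_1[of x] rR by (simp add: \<kappa>_def)
next
  case False
  then have "\<bar>\<eta> x - 1\<bar> / norm (x - a0) \<le> 1 / r" using \<eta>_bounds[of x] rR by (intro frac_le) auto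
  then show ?thesis by (simp add: \<kappa>_def abs_divide)
qed

lemma measurable_basics [measurable]:
  "D\<eta> \<in> borel_measurable borel" "\<eta> \<in> borel_measurable borel" "e0 \<in> borel_measurable borel" "\<kappa> \<in> borel_measurable borel"
  "Jac d \<in> borel_measurable borel" "q d \<in> borel_measurable borel" "\<beta> \<in> borel_measurable borel"
proof -
  show D[measurable]: "D\<eta> \<in> borel_measurable borel" using D\<eta>_continuous by (rule borel_measurable_continuous_onI)
  show [measurable]: "\<eta> \<in> borel_measurable borel" using Ck_on_continuous[OF \<eta>_smooth] by (rule borel_measurable_continuous_onI)
  show [measurable]: "e0 \<in> borel_measurable borel" unfolding e0_def[abs_def] by measurable
  show [measurable]: "\<kappa> \<in> borel_measurable borel" unfolding \<kappa>_def[abs_def] by measurable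
  show "Jac d \<in> borel_measurable borel" unfolding Jac_def[abs_def] by measurable
  show "q d \<in> borel_measurable borel" unfolding q_def[abs_def] by measurable
  have "\<Omega> \<in> sets borel" using \<Omega>_open by auto
  then show "\<beta> \<in> borel_measurable borel" unfolding \<beta>_def[abs_def] by measurable
qed

lemma perp_measurable [measurable]:
  assumes [measurable]: "w \<in> borel_measurable M"
  shows "(\<lambda>x. perp (w x)) \<in> borel_measurable M"
  unfolding perp_def
proof (rule borel_measurable_vec_lambda)
  show "(\<lambda>x. if j = 1 then - (w x $ 2) else w x $ 1) \<in> borel_measurable M" for j :: 2
    by (cases "j = 1") auto
qed

lemma \<beta>_bound: "\<exists>K. \<forall>x. 0 \<le> \<beta> x \<and> \<beta> x \<le> K"
proof -
  obtain b where b: "\<And>x. x \<in> \<Omega> \<Longrightarrow> norm x \<le> b" using \<Omega>_bounded bounded_iff by metis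
  have "\<beta> x \<le> (b + norm a0)\<^sup>2" for x
  proof (cases "x \<in> \<Omega>")
    case True
    have "norm (x - a0) \<le> b + norm a0" using b[OF True] norm_triangle_ineq4[of x a0] by linarith
    then show ?thesis using True by (simp add: \<beta>_def power_mono)
  qed (simp add: \<beta>_def)
  then show ?thesis by (intro exI[of _ "(b + norm a0)\<^sup>2"]) (simp add: \<beta>_def)
qed

lemma q_lower:
  assumes "small d"
  shows "1/4 \<le> q d x" "x \<noteq> a0 \<Longrightarrow> q d x = (norm (e0 x + \<kappa> x *\<^sub>R d))\<^sup>2"
proof -
  show eq: "q d x = (norm (e0 x + \<kappa> x *\<^sub>R d))\<^sup>2" if "x \<noteq> a0" for x
  proof -
    have "e0 x \<bullet> e0 x = 1" using that by (simp add: e0_def dot_square_norm power2_eq_square)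
    then show ?thesis
      unfolding power2_norm_eq_inner by (simp add: q_def inner_simps inner_commute power2_eq_square algebra_simps)
  qed
  show "1/4 \<le> q d x"
  proof (cases "x = a0")
    case False
    have "norm (e0 x) = 1" using False by (simp add: e0_def)
    moreover have "norm (\<kappa> x *\<^sub>R d) \<le> 1/2"
    proof -
      have "\<bar>\<kappa> x\<bar> * norm d \<le> (1 / r) * (r / 2)" using \<kappa>_bound assms rR by (intro mult_mono) (auto simp: small_def)
      then show ?thesis using rR by simp
    qed
    ultimately have "1/2 \<le> norm (e0 x + \<kappa> x *\<^sub>R d)" using norm_diff_ineq[of "e0 x" "\<kappa> x *\<^sub>R d"] by linarith
    then have "(1/2)\<^sup>2 \<le> (norm (e0 x + \<kappa> x *\<^sub>R d))\<^sup>2" by (intro power_mono) auto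
    then show ?thesis using eq[OF False] by (simp add: power2_eq_square)
  qed (simp add: q_def e0_def \<kappa>_def)
qed

definition Jop :: "real^2 \<Rightarrow> ab_space \<Rightarrow>\<^sub>L ab_space" where "Jop d = l2_mult (\<lambda>x v. Jac d x *\<^sub>R v)"
definition Lop :: "real^2 \<Rightarrow> real \<Rightarrow> ab_space \<Rightarrow>\<^sub>L ab_space" where "Lop d \<alpha> = l2_mult (Lsym d \<alpha>)"
text \<open>Its quadratic form is the integral of the Jacobian times the squared pulled-back
  magnetic gradient; the adjoint makes the operator symmetric by construction.\<close>

definition Aop :: "real^2 \<Rightarrow> real \<Rightarrow> ab_space \<Rightarrow>\<^sub>L ab_space" where
  "Aop d \<alpha> = adjoint_blinfun (Lop d \<alpha>) o\<^sub>L Jop d o\<^sub>L Lop d \<alpha>"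
definition \<beta>sym :: "real^2 \<Rightarrow> (complex^2) \<times> complex \<Rightarrow> (complex^2) \<times> complex" where
  "\<beta>sym x v = (0, \<beta> x *\<^sub>R snd v)"
definition Bop :: "real^2 \<Rightarrow> ab_space \<Rightarrow>\<^sub>L ab_space" where "Bop d = l2_mult (\<lambda>x v. Jac d x *\<^sub>R \<beta>sym x v)"

lemma scaleR_symbol:
  fixes c :: "real^2 \<Rightarrow> real"
  assumes "c \<in> borel_measurable borel" "\<And>x. \<bar>c x\<bar> \<le> K"
  shows "l2_symbol (\<lambda>x (v::(complex^2) \<times> complex). c x *\<^sub>R v)"
  using assms by (intro l2_symbol_scaleR borel_imp_lebesgue_measurable)

lemma D\<eta>_component: "\<bar>D\<eta> x $ i\<bar> \<le> lip" using component_le_norm_cart[of "D\<eta> x" i] lip(2)[of x] by linarith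

lemma Jac_symbol: "l2_symbol (\<lambda>x (v::(complex^2) \<times> complex). Jac d x *\<^sub>R v)"
proof (rule scaleR_symbol[where K="1 + norm d * lip"])
  show "\<bar>Jac d x\<bar> \<le> 1 + norm d * lip" for x
  proof -
    have "\<bar>d \<bullet> D\<eta> x\<bar> \<le> norm d * norm (D\<eta> x)" by (rule Cauchy_Schwarz_ineq2)
    also have "\<dots> \<le> norm d * lip" by (intro mult_left_mono lip) simp
    finally show ?thesis unfolding Jac_def by linarith
  qed
qed measurable

lemma \<beta>sym_symbol: "l2_symbol \<beta>sym"
proof -
  obtain K where K: "\<And>x. 0 \<le> \<beta> x" "\<And>x. \<beta> x \<le> K" using \<beta>_bound by blast
  have [measurable]: "\<beta> \<in> borel_measurable lebesgue" by (intro borel_imp_lebesgue_measurable) measurable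
  show ?thesis
  proof (rule l2_symbolI[of _ K])
    show "linear (\<beta>sym x)" for x by (rule linearI) (simp_all add: \<beta>sym_def scaleR_add_right)
    show "norm (\<beta>sym x v) \<le> K * norm v" for x v
    proof -
      have "norm (\<beta>sym x v) = \<beta> x * norm (snd v)" using K by (simp add: \<beta>sym_def norm_Pair)
      also have "\<dots> \<le> K * norm v" using K order_trans[OF K] norm_snd_le[of "snd v" "fst v"] by (intro mult_mono) auto
      finally show ?thesis .
    qed
    show "(\<lambda>x. \<beta>sym x (f x)) \<in> borel_measurable lebesgue" if [measurable]: "f \<in> borel_measurable lebesgue" for f
      unfolding \<beta>sym_def by measurable
  qed
qed

lemma Bop_eq: "Bop d = Jop d o\<^sub>L l2_mult \<beta>sym"
  unfolding Bop_def Jop_def by (rule l2_mult_compose[OF Jac_symbol \<beta>sym_symbol, symmetric])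

lemma Bop_symbol: "l2_symbol (\<lambda>x v. Jac d x *\<^sub>R \<beta>sym x v)"
  by (rule l2_symbol_compose[OF Jac_symbol \<beta>sym_symbol])

definition Jinv :: "real^2 \<Rightarrow> ab_space \<Rightarrow>\<^sub>L ab_space" where "Jinv d = l2_mult (\<lambda>x v. (1 / Jac d x) *\<^sub>R v)"
definition Qop :: "real^2 \<Rightarrow> ab_space \<Rightarrow>\<^sub>L ab_space" where "Qop d = l2_mult (\<lambda>x v. q d x *\<^sub>R v)"
definition Qinv :: "real^2 \<Rightarrow> ab_space \<Rightarrow>\<^sub>L ab_space" where "Qinv d = l2_mult (\<lambda>x v. (1 / q d x) *\<^sub>R v)"

lemma Jinv_symbol: "small d \<Longrightarrow> l2_symbol (\<lambda>x (v::(complex^2) \<times> complex). (1 / Jac d x) *\<^sub>R v)"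
  and Jinv_bound: "small d \<Longrightarrow> \<bar>1 / Jac d x\<bar> \<le> 2"
proof -
  show *: "small d \<Longrightarrow> \<bar>1 / Jac d x\<bar> \<le> 2" for x
    using Jac_bounds(1)[of d x] Jac_pos(1)[of d x] by (simp add: field_simps abs_divide)
  show "small d \<Longrightarrow> l2_symbol (\<lambda>x (v::(complex^2) \<times> complex). (1 / Jac d x) *\<^sub>R v)"
    by (rule scaleR_symbol[where K=2]) (measurable, rule *)
qed

lemma Qinv_symbol: "small d \<Longrightarrow> l2_symbol (\<lambda>x (v::(complex^2) \<times> complex). (1 / q d x) *\<^sub>R v)"
  and Qinv_bound: "small d \<Longrightarrow> \<bar>1 / q d x\<bar> \<le> 4"
proof -
  show *: "small d \<Longrightarrow> \<bar>1 / q d x\<bar> \<le> 4" for x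
    using q_lower(1)[of d x] by (simp add: field_simps abs_divide)
  show "small d \<Longrightarrow> l2_symbol (\<lambda>x (v::(complex^2) \<times> complex). (1 / q d x) *\<^sub>R v)"
    by (rule scaleR_symbol[where K=4]) (measurable, rule *)
qed

lemma \<kappa>e_bound: "\<bar>2 * \<kappa> x * e0 x $ i\<bar> \<le> 2 / r" "\<bar>(\<kappa> x)\<^sup>2\<bar> \<le> (1 / r)\<^sup>2"
proof -
  have "\<bar>\<kappa> x\<bar> * \<bar>e0 x $ i\<bar> \<le> (1 / r) * 1"
    using \<kappa>_bound rR component_le_norm_cart[of "e0 x" i] e0_norm[of x] by (intro mult_mono) auto
  then show "\<bar>2 * \<kappa> x * e0 x $ i\<bar> \<le> 2 / r" by (simp add: abs_mult)
  show "\<bar>(\<kappa> x)\<^sup>2\<bar> \<le> (1 / r)\<^sup>2" using power_mono[OF \<kappa>_bound[of x] abs_ge_zero, of 2] by simp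
qed

definition MD :: "2 \<Rightarrow> ab_space \<Rightarrow>\<^sub>L ab_space" where "MD i = l2_mult (\<lambda>x v. D\<eta> x $ i *\<^sub>R v)"
definition ME :: "2 \<Rightarrow> ab_space \<Rightarrow>\<^sub>L ab_space" where "ME i = l2_mult (\<lambda>x v. (2 * \<kappa> x * e0 x $ i) *\<^sub>R v)"
definition MK :: "ab_space \<Rightarrow>\<^sub>L ab_space" where "MK = l2_mult (\<lambda>x v. (\<kappa> x)\<^sup>2 *\<^sub>R v)"

lemma basic_symbols:
  "l2_symbol (\<lambda>x (v::(complex^2) \<times> complex). D\<eta> x $ i *\<^sub>R v)"
  "l2_symbol (\<lambda>x (v::(complex^2) \<times> complex). (2 * \<kappa> x * e0 x $ i) *\<^sub>R v)"
  "l2_symbol (\<lambda>x (v::(complex^2) \<times> complex). (\<kappa> x)\<^sup>2 *\<^sub>R v)"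
proof -
  show "l2_symbol (\<lambda>x (v::(complex^2) \<times> complex). D\<eta> x $ i *\<^sub>R v)"
    by (rule scaleR_symbol[OF _ D\<eta>_component]) measurable
  show "l2_symbol (\<lambda>x (v::(complex^2) \<times> complex). (2 * \<kappa> x * e0 x $ i) *\<^sub>R v)"
    by (rule scaleR_symbol[OF _ \<kappa>e_bound(1)]) measurable
  show "l2_symbol (\<lambda>x (v::(complex^2) \<times> complex). (\<kappa> x)\<^sup>2 *\<^sub>R v)"
    by (rule scaleR_symbol[OF _ \<kappa>e_bound(2)]) measurable
qed

text \<open>Affine in d with constant operator coefficients, hence smooth in operator norm with no
  derivative of the symbol taken.\<close>

lemma Jop_expand: "Jop d = id_blinfun + d$1 *\<^sub>R MD 1 + d$2 *\<^sub>R MD 2"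
proof -
  have s0: "l2_symbol (\<lambda>x (v::(complex^2) \<times> complex). v)" by (rule l2_symbol_const[OF bounded_linear_ident])
  have "id_blinfun + d$1 *\<^sub>R MD 1 + d$2 *\<^sub>R MD 2 = l2_mult (\<lambda>x v. v + d$1 *\<^sub>R (D\<eta> x $ 1 *\<^sub>R v) + d$2 *\<^sub>R (D\<eta> x $ 2 *\<^sub>R v))"
    unfolding MD_def l2_mult_id[symmetric]
    by (simp only: l2_mult_scaleR[OF basic_symbols(1)] l2_mult_add[OF s0 l2_symbol_scale_const[OF basic_symbols(1)]]
      l2_mult_add[OF l2_symbol_add[OF s0 l2_symbol_scale_const[OF basic_symbols(1)]] l2_symbol_scale_const[OF basic_symbols(1)]])
  moreover have "v + d$1 *\<^sub>R (D\<eta> x $ 1 *\<^sub>R v) + d$2 *\<^sub>R (D\<eta> x $ 2 *\<^sub>R v) = Jac d x *\<^sub>R v" for x and v :: "(complex^2) \<times> complex"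
    unfolding Jac_def by (simp add: inner_vec_def sum_2 scaleR_add_left)
  ultimately show ?thesis unfolding Jop_def by simp
qed

lemma q_eq: "q d x = 1 + d$1 * (2 * \<kappa> x * e0 x $ 1) + d$2 * (2 * \<kappa> x * e0 x $ 2) + (d \<bullet> d) * (\<kappa> x)\<^sup>2"
proof -
  have "d \<bullet> e0 x = d$1 * e0 x $ 1 + d$2 * e0 x $ 2" by (simp add: inner_vec_def sum_2)
  then show ?thesis unfolding q_def by (simp add: algebra_simps)
qed

lemma Qop_expand: "Qop d = id_blinfun + d$1 *\<^sub>R ME 1 + d$2 *\<^sub>R ME 2 + (d \<bullet> d) *\<^sub>R MK"
proof -
  have s0: "l2_symbol (\<lambda>x (v::(complex^2) \<times> complex). v)" by (rule l2_symbol_const[OF bounded_linear_ident])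
  note s1 = l2_symbol_add[OF s0 l2_symbol_scale_const[OF basic_symbols(2)]]
  note s2 = l2_symbol_add[OF s1 l2_symbol_scale_const[OF basic_symbols(2)]]
  have "id_blinfun + d$1 *\<^sub>R ME 1 + d$2 *\<^sub>R ME 2 + (d \<bullet> d) *\<^sub>R MK =
      l2_mult (\<lambda>x v. v + d$1 *\<^sub>R ((2 * \<kappa> x * e0 x $ 1) *\<^sub>R v) + d$2 *\<^sub>R ((2 * \<kappa> x * e0 x $ 2) *\<^sub>R v) + (d \<bullet> d) *\<^sub>R ((\<kappa> x)\<^sup>2 *\<^sub>R v))"
    unfolding ME_def MK_def l2_mult_id[symmetric]
    by (simp only: l2_mult_scaleR[OF basic_symbols(2)] l2_mult_scaleR[OF basic_symbols(3)] l2_mult_add[OF s0 l2_symbol_scale_const[OF basic_symbols(2)]]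
      l2_mult_add[OF s1 l2_symbol_scale_const[OF basic_symbols(2)]] l2_mult_add[OF s2 l2_symbol_scale_const[OF basic_symbols(3)]])
  moreover have "v + d$1 *\<^sub>R ((2 * \<kappa> x * e0 x $ 1) *\<^sub>R v) + d$2 *\<^sub>R ((2 * \<kappa> x * e0 x $ 2) *\<^sub>R v) + (d \<bullet> d) *\<^sub>R ((\<kappa> x)\<^sup>2 *\<^sub>R v) = q d x *\<^sub>R v"
    for x and v :: "(complex^2) \<times> complex"
    by (simp only: q_eq scaleR_add_left scaleR_scaleR scaleR_one)
  ultimately show ?thesis unfolding Qop_def by simp
qed

text \<open>Division by the Jacobian is not polynomial in d. Exhibited as a uniformly bounded
  two-sided inverse of a smooth operator family, it is smooth all the same; \<open>q\<close> is
  treated likewise.\<close>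

lemma Jinv_inverse: assumes "small d" shows "Jop d o\<^sub>L Jinv d = id_blinfun" "Jinv d o\<^sub>L Jop d = id_blinfun" "norm (Jinv d) \<le> 2"
proof -
  have J: "Jac d x \<noteq> 0" for x using Jac_pos(1)[OF assms, of x] by simp
  show "Jop d o\<^sub>L Jinv d = id_blinfun" "Jinv d o\<^sub>L Jop d = id_blinfun"
    unfolding Jop_def Jinv_def l2_mult_compose[OF Jac_symbol Jinv_symbol[OF assms]] l2_mult_compose[OF Jinv_symbol[OF assms] Jac_symbol]
    using J by (simp_all add: l2_mult_id)
  show "norm (Jinv d) \<le> 2"
    unfolding Jinv_def using Jinv_bound[OF assms]
    by (intro norm_l2_mult_le[OF Jinv_symbol[OF assms]]) (simp_all add: mult_right_mono del: abs_divide)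
qed

lemma Qinv_inverse: assumes "small d" shows "Qop d o\<^sub>L Qinv d = id_blinfun" "Qinv d o\<^sub>L Qop d = id_blinfun" "norm (Qinv d) \<le> 4"
proof -
  have J: "q d x \<noteq> 0" for x using q_lower(1)[OF assms, of x] by auto
  have b: "\<bar>q d x\<bar> \<le> 1 + \<bar>d$1\<bar> * (2 / r) + \<bar>d$2\<bar> * (2 / r) + \<bar>d \<bullet> d\<bar> * (1 / r)\<^sup>2" for x
  proof -
    have "\<bar>1 + d$1 * (2 * \<kappa> x * e0 x $ 1) + d$2 * (2 * \<kappa> x * e0 x $ 2) + (d \<bullet> d) * (\<kappa> x)\<^sup>2\<bar> \<le> 1 + \<bar>d$1\<bar> * \<bar>2 * \<kappa> x * e0 x $ 1\<bar> + \<bar>d$2\<bar> * \<bar>2 * \<kappa> x * e0 x $ 2\<bar> + \<bar>d \<bullet> d\<bar> * \<bar>(\<kappa> x)\<^sup>2\<bar>"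
      unfolding abs_mult[symmetric] by linarith
    also have "\<dots> \<le> 1 + \<bar>d$1\<bar> * (2 / r) + \<bar>d$2\<bar> * (2 / r) + \<bar>d \<bullet> d\<bar> * (1 / r)\<^sup>2"
      by (intro add_mono mult_left_mono \<kappa>e_bound) auto
    finally show ?thesis unfolding q_eq .
  qed
  have s: "l2_symbol (\<lambda>x (v::(complex^2) \<times> complex). q d x *\<^sub>R v)"
    by (rule scaleR_symbol[OF _ b]) measurable
  show "Qop d o\<^sub>L Qinv d = id_blinfun" "Qinv d o\<^sub>L Qop d = id_blinfun"
    unfolding Qop_def Qinv_def l2_mult_compose[OF s Qinv_symbol[OF assms]] l2_mult_compose[OF Qinv_symbol[OF assms] s]
    using J by (simp_all add: l2_mult_id)
  show "norm (Qinv d) \<le> 4"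
    unfolding Qinv_def using Qinv_bound[OF assms]
    by (intro norm_l2_mult_le[OF Qinv_symbol[OF assms]]) (simp_all add: mult_right_mono del: abs_divide)
qed

definition P1 :: "ab_space \<Rightarrow>\<^sub>L ab_space" where "P1 = l2_mult (\<lambda>x v. (fst v, 0))"
definition CD :: "2 \<Rightarrow> ab_space \<Rightarrow>\<^sub>L ab_space" where "CD i = l2_mult (sym_fst i D\<eta>)"
definition N0 :: "ab_space \<Rightarrow>\<^sub>L ab_space" where "N0 = l2_mult (sym_snd (\<lambda>x. perp (e0 x)))"
definition NK :: "2 \<Rightarrow> ab_space \<Rightarrow>\<^sub>L ab_space" where "NK i = l2_mult (sym_snd (\<lambda>x. \<kappa> x *\<^sub>R perp (axis i 1)))"

lemma L_symbols:
  "l2_symbol (\<lambda>(x::real^2) (v::(complex^2) \<times> complex). (fst v, 0::complex))" "l2_symbol (sym_fst i D\<eta>)"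
  "l2_symbol (sym_snd (\<lambda>x. perp (e0 x)))" "l2_symbol (sym_snd (\<lambda>x. \<kappa> x *\<^sub>R perp (axis i 1)))"
proof -
  show "l2_symbol (\<lambda>(x::real^2) (v::(complex^2) \<times> complex). (fst v, 0::complex))"
    by (intro l2_symbol_const bounded_linear_Pair bounded_linear_fst bounded_linear_zero)
  show "l2_symbol (sym_fst i D\<eta>)"
    by (rule l2_symbol_sym_fst[OF _ lip(2)], rule borel_imp_lebesgue_measurable) measurable
  show "l2_symbol (sym_snd (\<lambda>x. perp (e0 x)))"
    by (rule l2_symbol_sym_snd[where K=1], rule borel_imp_lebesgue_measurable) (measurable, simp add: norm_perp e0_norm)
  show "l2_symbol (sym_snd (\<lambda>x. \<kappa> x *\<^sub>R perp (axis i 1)))"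
    by (rule l2_symbol_sym_snd[where K="1/r"], rule borel_imp_lebesgue_measurable) (measurable, simp add: norm_perp \<kappa>_bound)
qed

text \<open>The last equation separates parameters from functions: d and \<alpha> occur only as
  scalar factors and inside the two inverse operators. The brackets follow the sum rules for
  symbols.\<close>

lemma Lop_expand:
  assumes "small d"
  shows "Lsym d \<alpha> = (\<lambda>x v. ((fst v, 0) + (- 1) *\<^sub>R ((1 / Jac d x) *\<^sub>R (d$1 *\<^sub>R sym_fst 1 D\<eta> x v + d$2 *\<^sub>R sym_fst 2 D\<eta> x v)))
      + \<alpha> *\<^sub>R ((1 / q d x) *\<^sub>R ((sym_snd (\<lambda>x. perp (e0 x)) x v + d$1 *\<^sub>R sym_snd (\<lambda>x. \<kappa> x *\<^sub>R perp (axis 1 1)) x v) + d$2 *\<^sub>R sym_snd (\<lambda>x. \<kappa> x *\<^sub>R perp (axis 2 1)) x v)))"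
    "l2_symbol (Lsym d \<alpha>)"
    "Lop d \<alpha> = (P1 + (- 1) *\<^sub>R (Jinv d o\<^sub>L (d$1 *\<^sub>R CD 1 + d$2 *\<^sub>R CD 2))) + \<alpha> *\<^sub>R (Qinv d o\<^sub>L ((N0 + d$1 *\<^sub>R NK 1) + d$2 *\<^sub>R NK 2))"
proof -
  have perp_lin: "perp (u + w) = perp u + perp w" "perp (c *\<^sub>R u) = c *\<^sub>R perp u" for u w c
    by (simp_all add: perp_def vec_eq_iff)
  have dd: "perp d = d$1 *\<^sub>R perp (axis 1 1) + d$2 *\<^sub>R perp (axis 2 1)"
    by (subst vec2_axis[of d]) (simp add: perp_lin)
  show eq: "Lsym d \<alpha> = (\<lambda>x v. ((fst v, 0) + (- 1) *\<^sub>R ((1 / Jac d x) *\<^sub>R (d$1 *\<^sub>R sym_fst 1 D\<eta> x v + d$2 *\<^sub>R sym_fst 2 D\<eta> x v)))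
      + \<alpha> *\<^sub>R ((1 / q d x) *\<^sub>R ((sym_snd (\<lambda>x. perp (e0 x)) x v + d$1 *\<^sub>R sym_snd (\<lambda>x. \<kappa> x *\<^sub>R perp (axis 1 1)) x v) + d$2 *\<^sub>R sym_snd (\<lambda>x. \<kappa> x *\<^sub>R perp (axis 2 1)) x v)))"
    by (intro ext)
       (simp add: Lsym_def sym_fst_def sym_snd_def perp_lin dd vec_cmult_add vec_cmult_of_real scaleR_add_right mult.commute[of "\<kappa> _"])
  note j1 = l2_symbol_scale_const[OF L_symbols(2)[of 1], of "d$1"] and j2 = l2_symbol_scale_const[OF L_symbols(2)[of 2], of "d$2"]
  note j = l2_symbol_compose[OF Jinv_symbol[OF assms] l2_symbol_add[OF j1 j2]]
  note n1 = l2_symbol_scale_const[OF L_symbols(4)[of 1], of "d$1"] and n2 = l2_symbol_scale_const[OF L_symbols(4)[of 2], of "d$2"]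
  note n = l2_symbol_compose[OF Qinv_symbol[OF assms] l2_symbol_add[OF l2_symbol_add[OF L_symbols(3) n1] n2]]
  note pj = l2_symbol_add[OF L_symbols(1) l2_symbol_scale_const[OF j, of "- 1"]]
  note all = l2_symbol_add[OF pj l2_symbol_scale_const[OF n, of \<alpha>]]
  show "l2_symbol (Lsym d \<alpha>)" unfolding eq by (rule all)
  show "Lop d \<alpha> = (P1 + (- 1) *\<^sub>R (Jinv d o\<^sub>L (d$1 *\<^sub>R CD 1 + d$2 *\<^sub>R CD 2))) + \<alpha> *\<^sub>R (Qinv d o\<^sub>L ((N0 + d$1 *\<^sub>R NK 1) + d$2 *\<^sub>R NK 2))"
    unfolding Lop_def eq P1_def Jinv_def CD_def Qinv_def N0_def NK_def
    by (simp only: l2_mult_scaleR[OF L_symbols(2)] l2_mult_add[OF j1 j2] l2_mult_compose[OF Jinv_symbol[OF assms] l2_symbol_add[OF j1 j2]]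
       l2_mult_scaleR[OF j] l2_mult_add[OF L_symbols(1) l2_symbol_scale_const[OF j]]
       l2_mult_scaleR[OF L_symbols(4)] l2_mult_add[OF L_symbols(3) n1] l2_mult_add[OF l2_symbol_add[OF L_symbols(3) n1] n2]
       l2_mult_compose[OF Qinv_symbol[OF assms] l2_symbol_add[OF l2_symbol_add[OF L_symbols(3) n1] n2]]
       l2_mult_scaleR[OF n] l2_mult_add[OF pj l2_symbol_scale_const[OF n]])
qed

section \<open>Smooth dependence on pole and circulation\<close>

definition \<delta> :: real where "\<delta> = min (1 / (2 * lip)) (r / 2)"

lemma \<delta>: "\<delta> > 0" "norm d < \<delta> \<Longrightarrow> small d" "norm d < \<delta> \<Longrightarrow> a0 + d \<in> \<Omega>"
proof -
  show "\<delta> > 0" using lip(1) rR by (simp add: \<delta>_def)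
  assume d: "norm d < \<delta>"
  then have "norm d < 1 / (2 * lip)" "norm d < r / 2" by (auto simp: \<delta>_def)
  then show "small d" using lip(1) by (simp add: small_def field_simps)
  have "a0 + d \<in> cball a0 R" using \<open>norm d < r / 2\<close> rR by (simp add: dist_norm)
  then show "a0 + d \<in> \<Omega>" using ball_\<Omega> by blast
qed

definition N :: "((real^2) \<times> real) set" where "N = ball a0 \<delta> \<times> UNIV"

lemma N_open: "open N" unfolding N_def by (intro open_Times) auto
lemma N_small: "p \<in> N \<Longrightarrow> small (fst p - a0)" using \<delta>(2) by (auto simp: N_def dist_norm norm_minus_commute)

lemma d_smooth: "Ck_on n N (\<lambda>p. (fst p - a0) $ i)" "Ck_on n N (\<lambda>p. (fst p - a0) \<bullet> (fst p - a0))" "Ck_on n N (\<lambda>p. snd p)"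
proof -
  have *: "Ck_on n N (\<lambda>p. fst p - a0)" by (intro Ck_on_diff Ck_on_fst Ck_on_id Ck_on_const N_open)
  show "Ck_on n N (\<lambda>p. (fst p - a0) $ i)" by (rule Ck_on_bounded_linear[OF N_open bounded_linear_vec_nth *])
  show "Ck_on n N (\<lambda>p. (fst p - a0) \<bullet> (fst p - a0))" by (intro Ck_on_inner N_open *)
  show "Ck_on n N (\<lambda>p. snd p)" by (intro Ck_on_snd Ck_on_id N_open)
qed

lemma Jop_smooth: "Ck_on n N (\<lambda>p. Jop (fst p - a0))"
  unfolding Jop_expand by (intro Ck_on_add Ck_on_scaleR Ck_on_const d_smooth N_open)

lemma Jinv_smooth: "Ck_on n N (\<lambda>p. Jinv (fst p - a0))"
  by (rule Ck_on_blinfun_inverse[OF N_open Jop_smooth]) (use Jinv_inverse[OF N_small] in auto)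

lemma Qinv_smooth: "Ck_on n N (\<lambda>p. Qinv (fst p - a0))"
proof (rule Ck_on_blinfun_inverse[OF N_open])
  show "Ck_on n N (\<lambda>p. Qop (fst p - a0))"
    unfolding Qop_expand by (intro Ck_on_add Ck_on_scaleR Ck_on_const d_smooth N_open)
qed (use Qinv_inverse[OF N_small] in auto)

lemma Lop_smooth: "Ck_on n N (\<lambda>p. Lop (fst p - a0) (snd p))"
proof (rule Ck_on_cong[OF N_open])
  show "Ck_on n N (\<lambda>p. (P1 + (- 1) *\<^sub>R (Jinv (fst p - a0) o\<^sub>L ((fst p - a0)$1 *\<^sub>R CD 1 + (fst p - a0)$2 *\<^sub>R CD 2)))
     + snd p *\<^sub>R (Qinv (fst p - a0) o\<^sub>L ((N0 + (fst p - a0)$1 *\<^sub>R NK 1) + (fst p - a0)$2 *\<^sub>R NK 2)))"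
    by (intro Ck_on_add Ck_on_scaleR Ck_on_const Ck_on_blinfun_compose d_smooth N_open Jinv_smooth Qinv_smooth)
qed (simp add: Lop_expand(3)[OF N_small])

lemma Aop_smooth: "Ck_on n N (\<lambda>p. Aop (fst p - a0) (snd p))"
  unfolding Aop_def
  by (intro Ck_on_blinfun_compose Ck_on_bounded_linear[OF _ bounded_linear_adjoint] N_open Lop_smooth Jop_smooth)

lemma Bop_smooth: "Ck_on n N (\<lambda>p. Bop (fst p - a0))"
  unfolding Bop_eq by (intro Ck_on_blinfun_compose Ck_on_const N_open Jop_smooth)

lemma Aop_inner: "Aop d \<alpha> u \<bullet> v = Jop d (Lop d \<alpha> u) \<bullet> Lop d \<alpha> v"
  by (simp add: Aop_def adjoint_blinfun)

lemma Jop_sym: "Jop d u \<bullet> v = u \<bullet> Jop d v"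
  unfolding Jop_def by (rule inner_l2_mult_real[OF Jac_symbol])

lemma Aop_sym: "Aop d \<alpha> u \<bullet> v = u \<bullet> Aop d \<alpha> v"
  using Aop_inner[of d \<alpha> u v] Aop_inner[of d \<alpha> v u] Jop_sym by (metis inner_commute)

lemma Bop_sym: "Bop d u \<bullet> v = u \<bullet> Bop d v"
proof -
  obtain f g where f: "sqint f" "u = abs_l2 f" and g: "sqint g" "v = abs_l2 g" by (metis l2_cases)
  have "\<beta>sym x (f x) \<bullet> g x = f x \<bullet> \<beta>sym x (g x)" for x
    by (simp add: \<beta>sym_def inner_prod_def)
  then show ?thesis
    unfolding Bop_def f(2) g(2) l2_mult[OF Bop_symbol f(1)] l2_mult[OF Bop_symbol g(1)]
    using f g by (simp add: inner_abs_l2 l2_symbol_sqint[OF Bop_symbol])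
qed

lemma Bop_Jc: "Bop d (Jc u) = Jc (Bop d u)"
  unfolding Bop_def by (rule Jc_commute[OF Bop_symbol]) (simp add: \<beta>sym_def cmul_def vec_eq_iff)

lemma Jop_Jc: "Jop d (Jc u) = Jc (Jop d u)"
  unfolding Jop_def by (rule Jc_commute[OF Jac_symbol]) (simp add: cmul_def vec_eq_iff)

lemma Lop_Jc: "small d \<Longrightarrow> Lop d \<alpha> (Jc u) = Jc (Lop d \<alpha> u)"
  unfolding Lop_def by (rule Jc_commute[OF Lop_expand(2)]) (simp_all add: Lsym_def cmul_def vec_cmult_def vec_eq_iff algebra_simps)

lemma Aop_Jc: "small d \<Longrightarrow> Aop d \<alpha> (Jc u) = Jc (Aop d \<alpha> u)"
proof (rule inner_eqI)
  fix v assume d: "small d"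
  have "Aop d \<alpha> (Jc u) \<bullet> v = - (Jop d (Lop d \<alpha> u) \<bullet> Lop d \<alpha> (Jc v))"
    by (simp add: Aop_inner Lop_Jc[OF d] Jop_Jc Jc.J_left)
  also have "\<dots> = Jc (Aop d \<alpha> u) \<bullet> v" by (simp add: Aop_inner[symmetric] Jc.J_left)
  finally show "Aop d \<alpha> (Jc u) \<bullet> v = Jc (Aop d \<alpha> u) \<bullet> v" .
qed

end

section \<open>Transport of the form domain\<close>

definition hdot :: "(complex^2) \<times> complex \<Rightarrow> (complex^2) \<times> complex \<Rightarrow> complex" where
  "hdot v w = (\<Sum>j\<in>UNIV. fst v $ j * cnj (fst w $ j)) + snd v * cnj (snd w)"

lemma Re_hdot: "Re (hdot v w) = v \<bullet> w" and Im_hdot: "Im (hdot v w) = v \<bullet> cmul \<i> w"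
  by (simp_all add: hdot_def inner_prod_def inner_vec_def inner_complex_def cmul_def sum_2 algebra_simps)

text \<open>A complex integral is recorded by two real pairings, the imaginary part being the
  pairing with J applied to the second argument.\<close>

lemma integral_hdot:
  assumes f: "sqint f" and g: "sqint g"
  shows "integrable lebesgue (\<lambda>x. hdot (f x) (g x))"
    and "(\<integral>x. hdot (f x) (g x) \<partial>lebesgue) = Complex (abs_l2 f \<bullet> abs_l2 g) (abs_l2 f \<bullet> Jc (abs_l2 g))"
proof -
  have g': "sqint (\<lambda>x. cmul \<i> (g x))" by (rule l2_symbol_sqint[OF cmul_symbol g])
  have eq: "hdot (f x) (g x) = of_real (f x \<bullet> g x) + \<i> * of_real (f x \<bullet> cmul \<i> (g x))" for x
    by (simp add: complex_eq_iff Re_hdot Im_hdot)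
  show "integrable lebesgue (\<lambda>x. hdot (f x) (g x))"
    unfolding eq using sqint_inner_integrable[OF f g] sqint_inner_integrable[OF f g'] by simp
  show "(\<integral>x. hdot (f x) (g x) \<partial>lebesgue) = Complex (abs_l2 f \<bullet> abs_l2 g) (abs_l2 f \<bullet> Jc (abs_l2 g))"
    unfolding eq using sqint_inner_integrable[OF f g] sqint_inner_integrable[OF f g'] f g g'
    by (simp add: Jc_abs inner_abs_l2 complex_eq_iff)
qed

definition ivec :: "complex^2 \<Rightarrow> complex^2" where "ivec z = (\<chi> j. \<i> * z $ j)"
text \<open>The derivative in direction d of a function with gradient z.\<close>

definition dG :: "real^2 \<Rightarrow> complex^2 \<Rightarrow> complex" where "dG d z = of_real (d$1) * z $ 1 + of_real (d$2) * z $ 2"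

lemma norm_ivec: "norm (ivec z) = norm z"
proof -
  have "(norm (ivec z))\<^sup>2 = (norm z)\<^sup>2" by (simp add: norm_vec2_sq ivec_def norm_mult)
  then show ?thesis by simp
qed

lemma norm_dG: "cmod (dG d z) \<le> norm d * norm z"
proof -
  have "(cmod (dG d z))\<^sup>2 \<le> (norm d * norm z)\<^sup>2"
    unfolding power_mult_distrib norm_vec2_sq dG_def
    using two_dim_Cauchy_Schwarz[of "d$1" "z$1" "d$2" "z$2"] by (simp add: scaleR_conv_of_real)
  then show ?thesis by (rule power2_le_imp_le) simp
qed

lemma dG_simps: "dG d (z + z') = dG d z + dG d z'" "dG d (z - z') = dG d z - dG d z'" "dG d (vec_cmult w c) = of_real (d \<bullet> w) * c"
  "dG d (ivec z) = \<i> * dG d z" "ivec (vec_cmult w c) = vec_cmult w (\<i> * c)" "ivec (z + z') = ivec z + ivec z'"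
  "ivec (z - z') = ivec z - ivec z'"
  by (simp_all add: dG_def ivec_def vec_cmult_def vec_eq_iff inner_vec_def sum_2 algebra_simps)

lemma magnetic_grad_vec: "magnetic_grad a \<alpha> u G y = ivec (G y) + vec_cmult ((\<alpha> / (norm (y - a))\<^sup>2) *\<^sub>R perp (y - a)) (u y)"
  unfolding vec_eq_iff forall_2 magnetic_grad_nth vector_add_component by (simp add: ivec_def vec_cmult_def perp_def right_diff_distrib left_diff_distrib diff_divide_distrib)

lemma measurable_ivec_dG [measurable (raw)]:
  assumes [measurable]: "z \<in> borel_measurable M"
  shows "(\<lambda>x. ivec (z x)) \<in> borel_measurable M" "(\<lambda>x. dG d (z x)) \<in> borel_measurable M"
  unfolding ivec_def dG_def by measurable

lemma AE_neq_point: "AE x in lebesgue. x \<noteq> (a::real^2)"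
proof (rule AE_I')
  show "{a} \<in> null_sets lebesgue" by (simp add: negligible_iff_null_sets[symmetric])
qed auto

context ab_domain
begin

lemma \<Omega>_lebesgue [measurable, simp]: "\<Omega> \<in> sets lebesgue"
  using \<Omega>_open by (simp add: borel_open)

text \<open>For \<open>v = u \<circ> \<Phi> d\<close>, whose gradient is given by the chain rule, this is the pair
  \<open>(i\<nabla>v, v / |x - a\<^sub>0|)\<close>. By boundedness of \<open>\<Omega>\<close> its \<open>L\<^sup>2\<close>-norm is equivalent to the norm of
  \<open>H\<^sub>0\<^sup>1\<^sup>,\<^sup>a\<close> with \<open>a = a\<^sub>0 + d\<close>, so that \<open>V\<close> represents all these spaces at once.\<close>

definition Up :: "real^2 \<Rightarrow> (real^2 \<Rightarrow> complex) \<Rightarrow> (real^2 \<Rightarrow> complex^2) \<Rightarrow> real^2 \<Rightarrow> (complex^2) \<times> complex" where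
  "Up d u G x = (if x \<in> \<Omega> then (ivec (G (\<Phi> d x) + vec_cmult (D\<eta> x) (dG d (G (\<Phi> d x)))), u (\<Phi> d x) / of_real (norm (x - a0))) else 0)"

definition V :: "ab_space set" where
  "V = closure {abs_l2 (Up 0 \<psi> (grad \<psi>)) | \<psi>. \<psi> \<in> test_functions (\<Omega> - {a0})}"

lemma Up_diff: "Up d (\<lambda>x. u x - v x) (\<lambda>x. G x - H x) x = Up d u G x - Up d v H x"
  by (simp add: Up_def dG_simps vec_cmult_def vec_eq_iff ivec_def algebra_simps diff_divide_distrib)

lemma Up_add: "Up d (\<lambda>x. u x + v x) (\<lambda>x. G x + H x) x = Up d u G x + Up d v H x"
  by (simp add: Up_def dG_simps vec_cmult_def vec_eq_iff ivec_def algebra_simps add_divide_distrib)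

lemma Up_cmul: "Up d (\<lambda>x. c * u x) (\<lambda>x. \<chi> j. c * G x $ j) x = cmul c (Up d u G x)"
  by (simp add: Up_def cmul_def dG_def vec_cmult_def vec_eq_iff ivec_def algebra_simps zero_prod_def)

lemma test_function_smooth:
  assumes "\<psi> \<in> test_functions S"
  shows "Ck_on n UNIV \<psi>" "\<psi> differentiable (at x)" "Ck_on 1 UNIV \<psi>"
  using assms Ck_on_1_grad(1)[of \<psi> x] by (auto simp: test_functions_def smooth_on_def)

lemma grad_compose_\<Phi>:
  assumes "\<phi> \<in> test_functions S"
  shows "grad (\<lambda>x. \<phi> (\<Phi> d x)) x = grad \<phi> (\<Phi> d x) + vec_cmult (D\<eta> x) (dG d (grad \<phi> (\<Phi> d x)))"
proof -
  have f: "\<phi> differentiable (at (\<Phi> d x))" by (rule test_function_smooth(2)[OF assms])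
  then have "(\<phi> has_derivative frechet_derivative \<phi> (at (\<Phi> d x))) (at (\<Phi> d x))" by (simp add: frechet_derivative_works)
  from has_derivative_compose[OF \<Phi>_has_derivative this]
  have "grad (\<lambda>x. \<phi> (\<Phi> d x)) x = (\<chi> j. frechet_derivative \<phi> (at (\<Phi> d x)) (axis j 1 + (axis j 1 \<bullet> D\<eta> x) *\<^sub>R d))"
    by (rule grad_eqI)
  also have "\<dots> = grad \<phi> (\<Phi> d x) + vec_cmult (D\<eta> x) (dG d (grad \<phi> (\<Phi> d x)))"
    unfolding frechet_derivative_grad[OF f]
    by (simp add: vec_eq_iff forall_2 vec_cmult_def dG_def axis_def inner_vec_def sum_2 scaleR_conv_of_real[where 'a=complex] algebra_simps)
  finally show ?thesis .
qed

text \<open>By the chain rule, pulling back a test function by \<open>\<Phi> d\<close> gives the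
  pair of another test function for the fixed pole. Therefore one space V serves all d.\<close>

lemma Up_test:
  assumes "\<phi> \<in> test_functions S"
  shows "Up d \<phi> (grad \<phi>) = Up 0 (\<lambda>x. \<phi> (\<Phi> d x)) (grad (\<lambda>x. \<phi> (\<Phi> d x)))"
proof -
  have "dG 0 z = 0" "vec_cmult w 0 = 0" for z w by (simp_all add: dG_def vec_cmult_def vec_eq_iff)
  then show ?thesis by (simp add: fun_eq_iff Up_def grad_compose_\<Phi>[OF assms] \<Phi>_0)
qed

lemma test_\<Phi>:
  assumes "small d"
  shows "\<phi> \<in> test_functions (\<Omega> - {a0 + d}) \<Longrightarrow> (\<lambda>x. \<phi> (\<Phi> d x)) \<in> test_functions (\<Omega> - {a0})"
    and "\<psi> \<in> test_functions (\<Omega> - {a0}) \<Longrightarrow> (\<lambda>x. \<psi> (\<Psi> d x)) \<in> test_functions (\<Omega> - {a0 + d})"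
proof -
  have 1: "\<Psi> d ` (\<Omega> - {a0 + d}) \<subseteq> \<Omega> - {a0}"
    using \<Psi>_\<Omega>[OF assms] \<Phi>_a0[of d] \<Phi>_\<Psi>[OF assms] by (auto, metis)
  have 2: "\<Phi> d ` (\<Omega> - {a0}) \<subseteq> \<Omega> - {a0 + d}"
    using \<Phi>_\<Omega>[OF assms] \<Phi>_a0[of d] \<Phi>_inj[OF assms] by auto
  show "\<phi> \<in> test_functions (\<Omega> - {a0 + d}) \<Longrightarrow> (\<lambda>x. \<phi> (\<Phi> d x)) \<in> test_functions (\<Omega> - {a0})"
    using test_functions_compose[OF _ \<Phi>_smooth \<Psi>_continuous[OF assms] \<Psi>_\<Phi>[OF assms] 1] .
  show "\<psi> \<in> test_functions (\<Omega> - {a0}) \<Longrightarrow> (\<lambda>x. \<psi> (\<Psi> d x)) \<in> test_functions (\<Omega> - {a0 + d})"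
    using test_functions_compose[OF _ \<Psi>_smooth[OF assms] Ck_on_continuous[OF \<Phi>_smooth[of 0 d]] \<Phi>_\<Psi>[OF assms] 2] .
qed

lemma sqint_bounded_support:
  fixes f :: "real^2 \<Rightarrow> 'b::euclidean_space"
  assumes "f \<in> borel_measurable lebesgue" "\<And>x. norm (f x) \<le> K" "\<And>x. x \<notin> \<Omega> \<Longrightarrow> f x = 0"
  shows "sqint f"
proof (rule sqint_nn_integral[OF assms(1)])
  have "(\<integral>\<^sup>+x. ennreal ((norm (f x))\<^sup>2) \<partial>lebesgue) \<le> (\<integral>\<^sup>+x. ennreal (K\<^sup>2) * indicator \<Omega> x \<partial>lebesgue)"
    using assms(2,3) by (intro nn_integral_mono) (auto split: split_indicator intro!: ennreal_leI power_mono)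
  also have "\<dots> = ennreal (K\<^sup>2) * emeasure lebesgue \<Omega>" by (rule nn_integral_cmult_indicator) simp
  also have "\<dots> < \<infinity>"
    using emeasure_bounded_finite[OF \<Omega>_bounded] \<Omega>_open by (simp add: ennreal_mult_less_top borel_open)
  finally show "(\<integral>\<^sup>+x. ennreal ((norm (f x))\<^sup>2) \<partial>lebesgue) < \<infinity>" .
qed

lemma test_function_away:
  assumes "\<psi> \<in> test_functions (\<Omega> - {a0})"
  obtains \<epsilon> where "\<epsilon> > 0" "\<And>x. norm (x - a0) < \<epsilon> \<Longrightarrow> \<psi> x = 0"
proof -
  have "a0 \<notin> closure {x. \<psi> x \<noteq> 0}" using assms by (auto simp: test_functions_def)
  then obtain \<epsilon> where \<epsilon>: "\<epsilon> > 0" "ball a0 \<epsilon> \<subseteq> - closure {x. \<psi> x \<noteq> 0}"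
    using openE[OF open_Compl[OF closed_closure], of a0 "{x. \<psi> x \<noteq> 0}"] by blast
  show thesis
  proof (rule that[OF \<epsilon>(1)])
    fix x assume "norm (x - a0) < \<epsilon>"
    then have "x \<in> - closure {x. \<psi> x \<noteq> 0}" using \<epsilon>(2) by (auto simp: dist_norm norm_minus_commute)
    then show "\<psi> x = 0" using closure_subset[of "{x. \<psi> x \<noteq> 0}"] by blast
  qed
qed

lemma Up0: "Up 0 \<psi> G x = (if x \<in> \<Omega> then (ivec (G x), \<psi> x / of_real (norm (x - a0))) else 0)"
proof -
  have "dG 0 z = 0" "vec_cmult w 0 = 0" for z w by (simp_all add: dG_def vec_cmult_def vec_eq_iff)
  then show ?thesis by (simp add: Up_def \<Phi>_0)
qed

text \<open>A test function vanishes near the pole, so division by |x - a0| leaves it bounded, and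
  \<Omega> has finite measure.\<close>

lemma sqint_Up_test:
  assumes "\<psi> \<in> test_functions (\<Omega> - {a0})"
  shows "sqint (Up 0 \<psi> (grad \<psi>))"
proof -
  note s = Ck_on_1_grad[OF test_function_smooth(3)[OF assms]]
  obtain \<epsilon> where \<epsilon>: "\<epsilon> > 0" "\<And>x. norm (x - a0) < \<epsilon> \<Longrightarrow> \<psi> x = 0" using test_function_away[OF assms] by blast
  have cpt: "compact (closure \<Omega>)" using \<Omega>_bounded by simp
  have "bounded (\<psi> ` closure \<Omega>)" "bounded (grad \<psi> ` closure \<Omega>)"
    using s(2,3) by (auto intro!: compact_imp_bounded compact_continuous_image cpt intro: continuous_on_subset)
  then obtain K1 K2 where "\<forall>y\<in>\<psi> ` closure \<Omega>. norm y \<le> K1" "\<forall>y\<in>grad \<psi> ` closure \<Omega>. norm y \<le> K2" unfolding bounded_iff by blast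
  then have K: "x \<in> \<Omega> \<Longrightarrow> norm (\<psi> x) \<le> K1" "x \<in> \<Omega> \<Longrightarrow> norm (grad \<psi> x) \<le> K2" for x using closure_subset[of \<Omega>] by auto
  have K0: "K1 \<ge> 0" "K2 \<ge> 0" using K[OF a0_\<Omega>] norm_ge_zero order_trans by blast+
  have [measurable]: "\<psi> \<in> borel_measurable lebesgue" "grad \<psi> \<in> borel_measurable lebesgue"
    using s(4,5) by (auto intro: borel_imp_lebesgue_measurable)
  have [measurable]: "(\<lambda>x::real^2. norm (x - a0)) \<in> borel_measurable lebesgue" by (intro borel_imp_lebesgue_measurable) measurable
  show ?thesis
  proof (rule sqint_bounded_support)
    show "Up 0 \<psi> (grad \<psi>) \<in> borel_measurable lebesgue" unfolding Up0[abs_def] by measurable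
    show "norm (Up 0 \<psi> (grad \<psi>) x) \<le> K2 + K1 / \<epsilon>" for x
    proof (cases "x \<in> \<Omega>")
      case True
      have "cmod (\<psi> x) / norm (x - a0) \<le> K1 / \<epsilon>"
      proof (cases "norm (x - a0) < \<epsilon>")
        case False
        then show ?thesis using K(1)[OF True] \<epsilon>(1) by (intro frac_le) (auto intro: order_trans[OF norm_ge_zero])
      qed (use \<epsilon> K0 in simp)
      then show ?thesis using K(2)[OF True] True
        norm_Pair_le[of "ivec (grad \<psi> x)" "\<psi> x / of_real (norm (x - a0))"] by (simp add: Up0 norm_ivec norm_divide)
    qed (use K0 \<epsilon>(1) in \<open>simp add: Up0\<close>)
  qed (simp add: Up0)
qed

lemma extension_measurable:
  fixes f :: "real^2 \<Rightarrow> 'b::euclidean_space"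
  shows "f \<in> borel_measurable (lebesgue_on \<Omega>) \<longleftrightarrow> (\<lambda>x. if x \<in> \<Omega> then f x else 0) \<in> borel_measurable lebesgue"
  using borel_measurable_if[of \<Omega> f] by simp

lemma Up_measurable:
  assumes d: "small d" and "u \<in> borel_measurable (lebesgue_on \<Omega>)" "G \<in> borel_measurable (lebesgue_on \<Omega>)"
  shows "Up d u G \<in> borel_measurable lebesgue"
proof -
  define u' where "u' x = (if x \<in> \<Omega> then u x else 0)" for x
  define G' where "G' x = (if x \<in> \<Omega> then G x else 0)" for x
  have "u' \<in> borel_measurable lebesgue" "G' \<in> borel_measurable lebesgue"
    using assms extension_measurable[of u] extension_measurable[of G] by (auto simp: u'_def[abs_def] G'_def[abs_def])
  then have [measurable]: "(\<lambda>x. u' (\<Phi> d x)) \<in> borel_measurable lebesgue" "(\<lambda>x. G' (\<Phi> d x)) \<in> borel_measurable lebesgue"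
    using lebesgue_\<Phi>[OF d] by (auto intro: measurable_compose)
  have [measurable]: "(\<lambda>x::real^2. norm (x - a0)) \<in> borel_measurable lebesgue" "D\<eta> \<in> borel_measurable lebesgue"
    by (intro borel_imp_lebesgue_measurable, measurable)+
  have "Up d u G = (\<lambda>x. if x \<in> \<Omega> then (ivec (G' (\<Phi> d x) + vec_cmult (D\<eta> x) (dG d (G' (\<Phi> d x)))), u' (\<Phi> d x) / of_real (norm (x - a0))) else 0)"
    using \<Phi>_\<Omega>[OF d] by (auto simp: Up_def fun_eq_iff u'_def G'_def)
  also have "\<dots> \<in> borel_measurable lebesgue" by measurable
  finally show ?thesis .
qed

lemma \<Phi>_displacement: "x \<noteq> a0 \<Longrightarrow> \<Phi> d x - (a0 + d) = norm (x - a0) *\<^sub>R (e0 x + \<kappa> x *\<^sub>R d)"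
  by (simp add: \<Phi>_def e0_def \<kappa>_def scaleR_add_right scaleR_diff_left algebra_simps(1-4))

lemma \<Phi>_displacement_norm:
  assumes "small d" "x \<noteq> a0"
  shows "norm (x - a0) / 2 \<le> norm (\<Phi> d x - (a0 + d))" "norm (\<Phi> d x - (a0 + d)) \<le> 3/2 * norm (x - a0)"
proof -
  have 1: "norm (e0 x) = 1" using assms by (simp add: e0_def)
  have 2: "norm (\<kappa> x *\<^sub>R d) \<le> 1/2"
  proof -
    have "\<bar>\<kappa> x\<bar> * norm d \<le> (1 / r) * (r / 2)" using \<kappa>_bound assms rR by (intro mult_mono) (auto simp: small_def)
    then show ?thesis using rR by simp
  qed
  have "1/2 \<le> norm (e0 x + \<kappa> x *\<^sub>R d)" "norm (e0 x + \<kappa> x *\<^sub>R d) \<le> 3/2"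
    using norm_diff_ineq[of "e0 x" "\<kappa> x *\<^sub>R d"] norm_triangle_ineq[of "e0 x" "\<kappa> x *\<^sub>R d"] 1 2 by linarith+
  then show "norm (x - a0) / 2 \<le> norm (\<Phi> d x - (a0 + d))" "norm (\<Phi> d x - (a0 + d)) \<le> 3/2 * norm (x - a0)"
    unfolding \<Phi>_displacement[OF assms(2)] using mult_left_mono[of _ _ "norm (x - a0)"] by fastforce+
qed

lemma pull_vector_bounds:
  assumes "small d"
  shows "norm (z + vec_cmult (D\<eta> x) (dG d z)) \<le> 3/2 * norm z" "norm z \<le> 2 * norm (z + vec_cmult (D\<eta> x) (dG d z))"
proof -
  have "norm (vec_cmult (D\<eta> x) (dG d z)) \<le> 1/2 * norm z"
  proof -
    have "norm (vec_cmult (D\<eta> x) (dG d z)) \<le> lip * (norm d * norm z)"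
      unfolding norm_vec_cmult using lip by (intro mult_mono norm_dG) auto
    also have "\<dots> = (norm d * lip) * norm z" by simp
    also have "\<dots> \<le> 1/2 * norm z" using assms by (intro mult_right_mono) (auto simp: small_def)
    finally show ?thesis .
  qed
  then show "norm (z + vec_cmult (D\<eta> x) (dG d z)) \<le> 3/2 * norm z" "norm z \<le> 2 * norm (z + vec_cmult (D\<eta> x) (dG d z))"
    using norm_triangle_ineq[of z "vec_cmult (D\<eta> x) (dG d z)"] norm_diff_ineq[of z "vec_cmult (D\<eta> x) (dG d z)"] by linarith+
qed

text \<open>The reason for the pair representation: the magnetic gradient at the moved pole becomes
  a bounded pointwise linear map of the pair, since the factor 1/|x - a0| of the potential is
  already contained in the second component.\<close>

lemma Up_nth:
  assumes "small d" "x \<in> \<Omega>" "x \<noteq> a0"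
  shows "snd (Up d u G x) * of_real (norm (x - a0)) = u (\<Phi> d x)"
    and "fst (Lsym d \<alpha> x (Up d u G x)) = magnetic_grad (a0 + d) \<alpha> u G (\<Phi> d x)"
proof -
  define z where "z = G (\<Phi> d x)"
  define \<rho> where "\<rho> = norm (x - a0)"
  define w where "w = e0 x + \<kappa> x *\<^sub>R d"
  have \<rho>: "\<rho> \<noteq> 0" using assms by (simp add: \<rho>_def)
  show s: "snd (Up d u G x) * of_real (norm (x - a0)) = u (\<Phi> d x)" using assms by (simp add: Up_def)
  have J: "Jac d x \<noteq> 0" using Jac_pos(1)[OF assms(1), of x] by simp
  have fstU: "fst (Up d u G x) = ivec z + vec_cmult (D\<eta> x) (\<i> * dG d z)" using assms by (simp add: Up_def z_def dG_simps)
  \<comment> \<open>Contracting the transformed gradient with d multiplies by the Jacobian, so the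
    correction in \<open>Lsym\<close> undoes the chain rule.\<close>
  have "dG d (fst (Up d u G x)) = \<i> * of_real (Jac d x) * dG d z"
    unfolding fstU dG_simps by (simp add: Jac_def algebra_simps)
  then have "vec_cmult ((1 / Jac d x) *\<^sub>R D\<eta> x) (dG d (fst (Up d u G x))) = vec_cmult (D\<eta> x) (\<i> * dG d z)"
    using J by (simp add: vec_cmult_def vec_eq_iff)
  then have 1: "fst (Up d u G x) - vec_cmult ((1 / Jac d x) *\<^sub>R D\<eta> x) (dG d (fst (Up d u G x))) = ivec z"
    by (simp add: fstU)
  have q: "q d x = (norm w)\<^sup>2" "q d x \<noteq> 0" using q_lower[OF assms(1), of x] assms(3) by (auto simp: w_def)
  have disp: "\<Phi> d x - (a0 + d) = \<rho> *\<^sub>R w" using \<Phi>_displacement[OF assms(3)] by (simp add: \<rho>_def w_def)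
  have "perp (\<rho> *\<^sub>R w) = \<rho> *\<^sub>R perp w" by (simp add: perp_def vec_eq_iff)
  then have "(\<alpha> / (norm (\<Phi> d x - (a0 + d)))\<^sup>2) *\<^sub>R perp (\<Phi> d x - (a0 + d)) = (1 / \<rho>) *\<^sub>R ((\<alpha> / q d x) *\<^sub>R perp w)"
    unfolding disp q(1) using \<rho> by (simp add: power_mult_distrib power2_eq_square \<rho>_def)
  then have 2: "vec_cmult ((\<alpha> / (norm (\<Phi> d x - (a0 + d)))\<^sup>2) *\<^sub>R perp (\<Phi> d x - (a0 + d))) (u (\<Phi> d x)) = vec_cmult ((\<alpha> / q d x) *\<^sub>R perp w) (snd (Up d u G x))"
    unfolding s[symmetric] \<rho>_def[symmetric] using \<rho>
    by (simp add: vec_cmult_def vec_eq_iff field_simps)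
  show "fst (Lsym d \<alpha> x (Up d u G x)) = magnetic_grad (a0 + d) \<alpha> u G (\<Phi> d x)"
    unfolding magnetic_grad_vec 2 z_def[symmetric] 1[symmetric] Lsym_def dG_def w_def by simp
qed

lemma H1a_norm_sq_eq:
  assumes [measurable]: "u \<in> borel_measurable (lebesgue_on \<Omega>)" "G \<in> borel_measurable (lebesgue_on \<Omega>)"
  defines "h \<equiv> \<lambda>a x. ennreal ((norm (G x))\<^sup>2 + (norm (u x))\<^sup>2 + (norm (u x) / norm (x - a))\<^sup>2) * indicator \<Omega> x"
  shows "H1a_norm_sq \<Omega> a u G = (\<integral>\<^sup>+x. h a x \<partial>lebesgue)" "h a \<in> borel_measurable lebesgue"
proof -
  have [measurable]: "(\<lambda>x. norm (x - a)) \<in> borel_measurable (lebesgue_on \<Omega>)"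
    by (intro measurable_restrict_space1 borel_imp_lebesgue_measurable) measurable
  show "H1a_norm_sq \<Omega> a u G = (\<integral>\<^sup>+x. h a x \<partial>lebesgue)"
    by (simp add: H1a_norm_sq_def h_def nn_integral_add[symmetric] ennreal_plus[symmetric] nn_integral_restrict_space[symmetric] del: ennreal_plus)
  show "h a \<in> borel_measurable lebesgue"
    unfolding h_def by (subst borel_measurable_restrict_space_iff_ennreal[symmetric]) simp_all
qed

text \<open>The gradients and the distances to the pole each change by factors between 1/2 and 3/2.
  In the first estimate 9/4 is rounded up to 3; in the second, |u|^2 is \<beta> times the squared
  second component, whence the term \<beta> x.\<close>

lemma Up_norm:
  assumes d: "small d" and x: "x \<in> \<Omega>" "x \<noteq> a0"
  defines "y \<equiv> \<Phi> d x"
  shows "(norm (Up d u G x))\<^sup>2 \<le> 3 * ((norm (G y))\<^sup>2 + (norm (u y))\<^sup>2 + (norm (u y) / norm (y - (a0 + d)))\<^sup>2)"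
    and "(norm (G y))\<^sup>2 + (norm (u y))\<^sup>2 + (norm (u y) / norm (y - (a0 + d)))\<^sup>2 \<le> (4 + \<beta> x) * (norm (Up d u G x))\<^sup>2"
proof -
  define \<rho> where "\<rho> = norm (x - a0)"
  define t where "t = norm (y - (a0 + d))"
  define w where "w = G y + vec_cmult (D\<eta> x) (dG d (G y))"
  have \<rho>: "\<rho> > 0" using x by (simp add: \<rho>_def)
  have t: "\<rho> / 2 \<le> t" "t \<le> 3/2 * \<rho>" using \<Phi>_displacement_norm[OF d x(2)] by (auto simp: \<rho>_def t_def y_def)
  have U: "(norm (Up d u G x))\<^sup>2 = (norm w)\<^sup>2 + (cmod (u y) / \<rho>)\<^sup>2"
    using x by (simp add: Up_def norm_Pair w_def y_def norm_ivec norm_divide \<rho>_def)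
  define A where "A = cmod (u y) / \<rho>"
  define B where "B = cmod (u y) / t"
  have w: "(norm w)\<^sup>2 \<le> 9/4 * (norm (G y))\<^sup>2" "(norm (G y))\<^sup>2 \<le> 4 * (norm w)\<^sup>2"
    using pull_vector_bounds[OF d, of "G y" x] power_mono[of "norm w" "3/2 * norm (G y)" 2] power_mono[of "norm (G y)" "2 * norm w" 2]
    unfolding w_def by (simp_all add: power_mult_distrib power_divide)
  have "A \<le> 3/2 * B" using \<rho> t frac_le[of "3/2 * cmod (u y)" "3/2 * cmod (u y)" t "3/2 * \<rho>"] by (simp add: A_def B_def)
  moreover have "B \<le> 2 * A" using \<rho> t frac_le[of "cmod (u y)" "cmod (u y)" "\<rho> / 2" t] by (simp add: A_def B_def mult.commute)
  moreover have "A \<ge> 0" "B \<ge> 0" using \<rho> t by (simp_all add: A_def B_def)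
  ultimately have v: "A\<^sup>2 \<le> 9/4 * B\<^sup>2" "B\<^sup>2 \<le> 4 * A\<^sup>2"
    using power_mono[of A "3/2 * B" 2] power_mono[of B "2 * A" 2] by (simp_all add: power_mult_distrib power_divide)
  have v3: "(cmod (u y))\<^sup>2 = \<beta> x * A\<^sup>2" using x \<rho> by (simp add: \<beta>_def \<rho>_def A_def power_divide)
  have \<beta>: "\<beta> x \<ge> 0" using \<beta>_bound by blast
  have p: "(norm (G y))\<^sup>2 \<ge> 0" "B\<^sup>2 \<ge> 0" "(cmod (u y))\<^sup>2 \<ge> 0" "\<beta> x * (norm w)\<^sup>2 \<ge> 0" using \<beta> by auto
  show "(norm (Up d u G x))\<^sup>2 \<le> 3 * ((norm (G y))\<^sup>2 + (norm (u y))\<^sup>2 + (norm (u y) / norm (y - (a0 + d)))\<^sup>2)"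
    using w(1) v(1) p(1-3) unfolding U t_def[symmetric] A_def[symmetric] B_def[symmetric] distrib_left by linarith
  have "(4 + \<beta> x) * ((norm w)\<^sup>2 + A\<^sup>2) = 4 * (norm w)\<^sup>2 + \<beta> x * (norm w)\<^sup>2 + 4 * A\<^sup>2 + \<beta> x * A\<^sup>2" by (simp add: algebra_simps)
  then show "(norm (G y))\<^sup>2 + (norm (u y))\<^sup>2 + (norm (u y) / norm (y - (a0 + d)))\<^sup>2 \<le> (4 + \<beta> x) * (norm (Up d u G x))\<^sup>2"
    using w(2) v(2) v3 p unfolding U t_def[symmetric] A_def[symmetric] B_def[symmetric] by linarith
qed

lemma Up_norm_upper:
  assumes d: "small d" and m: "u \<in> borel_measurable (lebesgue_on \<Omega>)" "G \<in> borel_measurable (lebesgue_on \<Omega>)"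
  shows "(\<integral>\<^sup>+x. ennreal ((norm (Up d u G x))\<^sup>2) \<partial>lebesgue) \<le> ennreal 6 * H1a_norm_sq \<Omega> (a0 + d) u G"
proof -
  define h where "h x = ennreal ((norm (G x))\<^sup>2 + (norm (u x))\<^sup>2 + (norm (u x) / norm (x - (a0 + d)))\<^sup>2) * indicator \<Omega> x" for x
  have h: "H1a_norm_sq \<Omega> (a0 + d) u G = (\<integral>\<^sup>+x. h x \<partial>lebesgue)" and [measurable]: "h \<in> borel_measurable lebesgue"
    unfolding h_def[abs_def] by (rule H1a_norm_sq_eq[OF m])+
  have [measurable]: "(\<lambda>x. h (\<Phi> d x)) \<in> borel_measurable lebesgue" by (rule measurable_compose[OF lebesgue_\<Phi>[OF d]]) measurable
  note Jac_measurable[measurable]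
  have "(\<integral>\<^sup>+x. ennreal ((norm (Up d u G x))\<^sup>2) \<partial>lebesgue) \<le> (\<integral>\<^sup>+x. ennreal 6 * (ennreal (Jac d x) * h (\<Phi> d x)) \<partial>lebesgue)"
  proof (rule nn_integral_mono_AE, rule AE_mp[OF AE_neq_point[of a0]], rule AE_I2, rule impI)
    fix x assume x: "x \<noteq> a0"
    show "ennreal ((norm (Up d u G x))\<^sup>2) \<le> ennreal 6 * (ennreal (Jac d x) * h (\<Phi> d x))"
    proof (cases "x \<in> \<Omega>")
      case True
      define h' where "h' = (norm (G (\<Phi> d x)))\<^sup>2 + (norm (u (\<Phi> d x)))\<^sup>2 + (norm (u (\<Phi> d x)) / norm (\<Phi> d x - (a0 + d)))\<^sup>2"
      have h': "h (\<Phi> d x) = ennreal h'" "h' \<ge> 0" using True \<Phi>_\<Omega>[OF d, of x] by (simp_all add: h_def h'_def)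
      have "(norm (Up d u G x))\<^sup>2 \<le> 3 * h'" using Up_norm(1)[OF d True x] by (simp add: h'_def)
      \<comment> \<open>The Jacobian is at least 1/2, so 3 is at most 6 times the Jacobian.\<close>
      also have "\<dots> \<le> 6 * Jac d x * h'" using Jac_bounds(1)[OF d, of x] h'(2) by (intro mult_right_mono) auto
      finally have "ennreal ((norm (Up d u G x))\<^sup>2) \<le> ennreal (6 * (Jac d x * h'))" by (simp add: mult.assoc ennreal_leI)
      then show ?thesis using h' Jac_pos(2)[OF d, of x] by (simp add: ennreal_mult)
    qed (simp add: Up_def)
  qed
  also have "\<dots> = ennreal 6 * H1a_norm_sq \<Omega> (a0 + d) u G"
    unfolding h nn_integral_\<Phi>[OF d \<open>h \<in> borel_measurable lebesgue\<close>]
    by (intro nn_integral_cmult borel_measurable_times_ennreal measurable_compose[OF Jac_measurable measurable_ennreal] measurable_compose[OF lebesgue_\<Phi>[OF d]]) fact+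
  finally show ?thesis .
qed

lemma Up_norm_lower:
  obtains C where "C > 0" "\<And>d u G. small d \<Longrightarrow> u \<in> borel_measurable (lebesgue_on \<Omega>) \<Longrightarrow> G \<in> borel_measurable (lebesgue_on \<Omega>) \<Longrightarrow>
    H1a_norm_sq \<Omega> (a0 + d) u G \<le> ennreal C * (\<integral>\<^sup>+x. ennreal ((norm (Up d u G x))\<^sup>2) \<partial>lebesgue)"
proof -
  obtain K where K: "\<And>x. 0 \<le> \<beta> x" "\<And>x. \<beta> x \<le> K" using \<beta>_bound by blast
  have K0: "K \<ge> 0" using K[of a0] by linarith
  show thesis
  proof (rule that[of "3/2 * (4 + K)"])
    show "3/2 * (4 + K) > 0" using K0 by simp
    fix d :: "real^2" and u :: "real^2 \<Rightarrow> complex" and G :: "real^2 \<Rightarrow> complex^2"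
    assume d: "small d" and m: "u \<in> borel_measurable (lebesgue_on \<Omega>)" "G \<in> borel_measurable (lebesgue_on \<Omega>)"
    define h where "h x = ennreal ((norm (G x))\<^sup>2 + (norm (u x))\<^sup>2 + (norm (u x) / norm (x - (a0 + d)))\<^sup>2) * indicator \<Omega> x" for x
    have h: "H1a_norm_sq \<Omega> (a0 + d) u G = (\<integral>\<^sup>+x. h x \<partial>lebesgue)" and [measurable]: "h \<in> borel_measurable lebesgue"
      unfolding h_def[abs_def] by (rule H1a_norm_sq_eq[OF m])+
    note [measurable] = Up_measurable[OF d m]
    have "H1a_norm_sq \<Omega> (a0 + d) u G = (\<integral>\<^sup>+x. ennreal (Jac d x) * h (\<Phi> d x) \<partial>lebesgue)"
      unfolding h by (rule nn_integral_\<Phi>[OF d]) measurable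
    also have "\<dots> \<le> (\<integral>\<^sup>+x. ennreal (3/2 * (4 + K)) * ennreal ((norm (Up d u G x))\<^sup>2) \<partial>lebesgue)"
    proof (rule nn_integral_mono_AE, rule AE_mp[OF AE_neq_point[of a0]], rule AE_I2, rule impI)
      fix x assume x: "x \<noteq> a0"
      show "ennreal (Jac d x) * h (\<Phi> d x) \<le> ennreal (3/2 * (4 + K)) * ennreal ((norm (Up d u G x))\<^sup>2)"
      proof (cases "x \<in> \<Omega>")
        case True
        define h' where "h' = (norm (G (\<Phi> d x)))\<^sup>2 + (norm (u (\<Phi> d x)))\<^sup>2 + (norm (u (\<Phi> d x)) / norm (\<Phi> d x - (a0 + d)))\<^sup>2"
        have h': "h (\<Phi> d x) = ennreal h'" "h' \<ge> 0" using True \<Phi>_\<Omega>[OF d, of x] by (simp_all add: h_def h'_def)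
        have "h' \<le> (4 + \<beta> x) * (norm (Up d u G x))\<^sup>2" using Up_norm(2)[OF d True x] by (simp add: h'_def)
        also have "\<dots> \<le> (4 + K) * (norm (Up d u G x))\<^sup>2" using K by (intro mult_right_mono) auto
        finally have "Jac d x * h' \<le> 3/2 * ((4 + K) * (norm (Up d u G x))\<^sup>2)"
          using Jac_bounds(2)[OF d, of x] h'(2) Jac_pos(2)[OF d, of x] by (intro mult_mono) auto
        then have "ennreal (Jac d x * h') \<le> ennreal (3/2 * (4 + K) * (norm (Up d u G x))\<^sup>2)" unfolding mult.assoc by (rule ennreal_leI)
        then show ?thesis unfolding h'(1) ennreal_mult[OF Jac_pos(2)[OF d] h'(2)] ennreal_mult''[OF zero_le_power2] .
      next
        case False
        then show ?thesis using \<Phi>_\<Omega>[OF d, of x] by (simp add: h_def)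
      qed
    qed
    also have "\<dots> = ennreal (3/2 * (4 + K)) * (\<integral>\<^sup>+x. ennreal ((norm (Up d u G x))\<^sup>2) \<partial>lebesgue)" by (rule nn_integral_cmult) measurable
    finally show "H1a_norm_sq \<Omega> (a0 + d) u G \<le> ennreal (3/2 * (4 + K)) * (\<integral>\<^sup>+x. ennreal ((norm (Up d u G x))\<^sup>2) \<partial>lebesgue)" .
  qed
qed

lemma test_function_measurable:
  assumes "\<phi> \<in> test_functions S"
  shows "\<phi> \<in> borel_measurable (lebesgue_on \<Omega>)" "grad \<phi> \<in> borel_measurable (lebesgue_on \<Omega>)"
  using Ck_on_1_grad(4,5)[OF test_function_smooth(3)[OF assms]]
  by (auto intro!: measurable_restrict_space1 borel_imp_lebesgue_measurable)

lemma Up_test_diff: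
  assumes d: "small d" and \<phi>: "\<phi> \<in> test_functions (\<Omega> - {a0 + d})"
  defines "\<psi> \<equiv> \<lambda>x. \<phi> (\<Phi> d x)"
  shows "Up d (\<lambda>x. \<phi> x - u x) (\<lambda>x. grad \<phi> x - G x) x = Up 0 \<psi> (grad \<psi>) x - Up d u G x"
    and "\<psi> \<in> test_functions (\<Omega> - {a0})"
  using test_\<Phi>(1)[OF d \<phi>] by (simp_all add: Up_diff Up_test[OF \<phi>] \<psi>_def)

text \<open>Both sides are closures of test functions: \<open>\<Phi> d\<close> maps the two classes
  bijectively onto each other, and the two norms are equivalent.\<close>

lemma in_H10_iff:
  assumes d: "small d" and m: "u \<in> borel_measurable (lebesgue_on \<Omega>)" "G \<in> borel_measurable (lebesgue_on \<Omega>)"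
  shows "in_H10 \<Omega> (a0 + d) u G \<longleftrightarrow> sqint (Up d u G) \<and> abs_l2 (Up d u G) \<in> V"
proof
  assume "in_H10 \<Omega> (a0 + d) u G"
  then obtain \<phi> where \<phi>: "\<And>n. \<phi> n \<in> test_functions (\<Omega> - {a0 + d})"
    and lim: "(\<lambda>n. H1a_norm_sq \<Omega> (a0 + d) (\<lambda>x. \<phi> n x - u x) (\<lambda>x. grad (\<phi> n) x - G x)) \<longlonglongrightarrow> 0"
    unfolding in_H10_def by blast
  define \<psi> where "\<psi> n x = \<phi> n (\<Phi> d x)" for n x
  have \<psi>: "\<psi> n \<in> test_functions (\<Omega> - {a0})" for n using Up_test_diff(2)[OF d \<phi>] by (simp add: \<psi>_def[abs_def])
  have le: "(\<integral>\<^sup>+x. ennreal ((norm (Up 0 (\<psi> n) (grad (\<psi> n)) x - Up d u G x))\<^sup>2) \<partial>lebesgue) \<le>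
      ennreal 6 * H1a_norm_sq \<Omega> (a0 + d) (\<lambda>x. \<phi> n x - u x) (\<lambda>x. grad (\<phi> n) x - G x)" for n
    using Up_norm_upper[OF d borel_measurable_diff[OF test_function_measurable(1)[OF \<phi>[of n]] m(1)] borel_measurable_diff[OF test_function_measurable(2)[OF \<phi>[of n]] m(2)]]
    unfolding Up_test_diff(1)[OF d \<phi>] \<psi>_def[abs_def] .
  have lim6: "(\<lambda>n. ennreal 6 * H1a_norm_sq \<Omega> (a0 + d) (\<lambda>x. \<phi> n x - u x) (\<lambda>x. grad (\<phi> n) x - G x)) \<longlonglongrightarrow> 0"
    using ennreal_tendsto_cmult[OF _ lim, of "ennreal 6"] by simp
  have lim': "(\<lambda>n. \<integral>\<^sup>+x. ennreal ((norm (Up 0 (\<psi> n) (grad (\<psi> n)) x - Up d u G x))\<^sup>2) \<partial>lebesgue) \<longlonglongrightarrow> 0"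
    by (rule tendsto_sandwich[OF always_eventually always_eventually tendsto_const lim6]; intro allI; (rule zero_le | rule le))
  note [measurable] = Up_measurable[OF d m] sqint_measurable[OF sqint_Up_test[OF \<psi>]]
  \<comment> \<open>One approximant at finite distance is enough to make \<open>Up d u G\<close>
    square-integrable.\<close>
  have "\<exists>n. (\<integral>\<^sup>+x. ennreal ((norm (Up 0 (\<psi> n) (grad (\<psi> n)) x - Up d u G x))\<^sup>2) \<partial>lebesgue) < \<infinity>"
    using eventually_happens[OF order_tendstoD(2)[OF lim', of \<infinity>]] by simp
  then obtain n where n: "(\<integral>\<^sup>+x. ennreal ((norm (Up 0 (\<psi> n) (grad (\<psi> n)) x - Up d u G x))\<^sup>2) \<partial>lebesgue) < \<infinity>" ..
  have "sqint (\<lambda>x. Up 0 (\<psi> n) (grad (\<psi> n)) x - Up d u G x)" by (rule sqint_nn_integral[OF _ n]) measurable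
  from sqint_diff[OF sqint_Up_test[OF \<psi>[of n]] this] have sq: "sqint (Up d u G)" by simp
  have "(\<lambda>n. ennreal ((norm (abs_l2 (Up 0 (\<psi> n) (grad (\<psi> n))) - abs_l2 (Up d u G)))\<^sup>2)) \<longlonglongrightarrow> 0"
    using lim' unfolding abs_l2_diff[OF sqint_Up_test[OF \<psi>] sq, symmetric] nn_norm_abs_l2[OF sqint_diff[OF sqint_Up_test[OF \<psi>] sq]] .
  then have "((\<lambda>n. ennreal ((norm (abs_l2 (Up 0 (\<psi> n) (grad (\<psi> n))) - abs_l2 (Up d u G)))\<^sup>2)) \<longlongrightarrow> ennreal 0) sequentially" by simp
  then have "(\<lambda>n. (norm (abs_l2 (Up 0 (\<psi> n) (grad (\<psi> n))) - abs_l2 (Up d u G)))\<^sup>2) \<longlonglongrightarrow> 0"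
    by (rule tendsto_ennrealD) (auto intro: always_eventually)
  then have "(\<lambda>n. norm (abs_l2 (Up 0 (\<psi> n) (grad (\<psi> n))) - abs_l2 (Up d u G))) \<longlonglongrightarrow> 0" by simp
  then have "(\<lambda>n. abs_l2 (Up 0 (\<psi> n) (grad (\<psi> n)))) \<longlonglongrightarrow> abs_l2 (Up d u G)"
    by (rule LIM_zero_cancel[OF tendsto_norm_zero_cancel])
  moreover have "abs_l2 (Up 0 (\<psi> n) (grad (\<psi> n))) \<in> {abs_l2 (Up 0 \<psi> (grad \<psi>)) | \<psi>. \<psi> \<in> test_functions (\<Omega> - {a0})}" for n using \<psi> by blast
  ultimately have "abs_l2 (Up d u G) \<in> V"
    unfolding V_def closure_sequential by (intro exI[of _ "\<lambda>n. abs_l2 (Up 0 (\<psi> n) (grad (\<psi> n)))"] conjI allI)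
  with sq show "sqint (Up d u G) \<and> abs_l2 (Up d u G) \<in> V" by blast
next
  assume A: "sqint (Up d u G) \<and> abs_l2 (Up d u G) \<in> V"
  then obtain v where v: "\<And>n. v n \<in> {abs_l2 (Up 0 \<psi> (grad \<psi>)) | \<psi>. \<psi> \<in> test_functions (\<Omega> - {a0})}" "v \<longlonglongrightarrow> abs_l2 (Up d u G)"
    unfolding V_def closure_sequential by blast
  from v(1) have "\<forall>n. \<exists>\<psi>. \<psi> \<in> test_functions (\<Omega> - {a0}) \<and> v n = abs_l2 (Up 0 \<psi> (grad \<psi>))" by blast
  then obtain \<psi> where \<psi>: "\<And>n. \<psi> n \<in> test_functions (\<Omega> - {a0})" "\<And>n. v n = abs_l2 (Up 0 (\<psi> n) (grad (\<psi> n)))" by metis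
  obtain C where C: "C > 0" "\<And>d u G. small d \<Longrightarrow> u \<in> borel_measurable (lebesgue_on \<Omega>) \<Longrightarrow> G \<in> borel_measurable (lebesgue_on \<Omega>) \<Longrightarrow>
    H1a_norm_sq \<Omega> (a0 + d) u G \<le> ennreal C * (\<integral>\<^sup>+x. ennreal ((norm (Up d u G x))\<^sup>2) \<partial>lebesgue)" using Up_norm_lower by blast
  define \<phi> where "\<phi> n y = \<psi> n (\<Psi> d y)" for n y
  have \<phi>: "\<phi> n \<in> test_functions (\<Omega> - {a0 + d})" for n using test_\<Phi>(2)[OF d \<psi>(1)] by (simp add: \<phi>_def[abs_def])
  have \<phi>\<psi>: "(\<lambda>x. \<phi> n (\<Phi> d x)) = \<psi> n" for n by (simp add: \<phi>_def \<Psi>_\<Phi>[OF d])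
  have le: "H1a_norm_sq \<Omega> (a0 + d) (\<lambda>x. \<phi> n x - u x) (\<lambda>x. grad (\<phi> n) x - G x) \<le> ennreal C * ennreal ((norm (v n - abs_l2 (Up d u G)))\<^sup>2)" for n
  proof -
    have "(\<integral>\<^sup>+x. ennreal ((norm (Up d (\<lambda>x. \<phi> n x - u x) (\<lambda>x. grad (\<phi> n) x - G x) x))\<^sup>2) \<partial>lebesgue) = ennreal ((norm (v n - abs_l2 (Up d u G)))\<^sup>2)"
      unfolding Up_test_diff(1)[OF d \<phi>] \<phi>\<psi> \<psi>(2) using A sqint_Up_test[OF \<psi>(1)]
      by (simp add: abs_l2_diff[symmetric] nn_norm_abs_l2 sqint_diff)
    then show ?thesis
      using C(2)[OF d borel_measurable_diff[OF test_function_measurable(1)[OF \<phi>[of n]] m(1)] borel_measurable_diff[OF test_function_measurable(2)[OF \<phi>[of n]] m(2)]] by simp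
  qed
  have "(\<lambda>n. norm (v n - abs_l2 (Up d u G))) \<longlonglongrightarrow> 0" using v(2) by (intro tendsto_norm_zero LIM_zero)
  then have "(\<lambda>n. (norm (v n - abs_l2 (Up d u G)))\<^sup>2) \<longlonglongrightarrow> 0\<^sup>2" by (rule tendsto_power)
  then have "(\<lambda>n. C * (norm (v n - abs_l2 (Up d u G)))\<^sup>2) \<longlonglongrightarrow> C * 0\<^sup>2" by (intro tendsto_mult tendsto_const)
  then have "(\<lambda>n. ennreal (C * (norm (v n - abs_l2 (Up d u G)))\<^sup>2)) \<longlonglongrightarrow> 0" using tendsto_ennrealI by fastforce
  then have lim6: "(\<lambda>n. ennreal C * ennreal ((norm (v n - abs_l2 (Up d u G)))\<^sup>2)) \<longlonglongrightarrow> 0" using C(1) by (simp add: ennreal_mult)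
  have "(\<lambda>n. H1a_norm_sq \<Omega> (a0 + d) (\<lambda>x. \<phi> n x - u x) (\<lambda>x. grad (\<phi> n) x - G x)) \<longlonglongrightarrow> 0"
    by (rule tendsto_sandwich[OF always_eventually always_eventually tendsto_const lim6]; intro allI; (rule zero_le | rule le))
  then show "in_H10 \<Omega> (a0 + d) u G" unfolding in_H10_def using m \<phi> by blast
qed

section \<open>The closed complex subspace V\<close>

lemma grad_add_cmul:
  assumes "f differentiable (at x)" "g differentiable (at x)"
  shows "grad (\<lambda>x. f x + g x) x = grad f x + grad g x" and "grad (\<lambda>x. c * f x) x = (\<chi> j. c * grad f x $ j)"
  using grad_eqI[OF has_derivative_add[OF assms[unfolded frechet_derivative_works]]]
    grad_eqI[OF has_derivative_mult_right[OF assms(1)[unfolded frechet_derivative_works], of c]]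
  by (simp_all add: grad_def vec_eq_iff)

lemma test_functions_add_cmul:
  assumes "\<phi> \<in> test_functions S" "\<psi> \<in> test_functions S"
  shows "(\<lambda>x. \<phi> x + \<psi> x) \<in> test_functions S" and "(\<lambda>x. c * \<phi> x) \<in> test_functions S"
proof -
  let ?K = "closure {x. \<phi> x \<noteq> 0}" and ?L = "closure {x. \<psi> x \<noteq> 0}"
  have K: "compact ?K" "?K \<subseteq> S" "compact ?L" "?L \<subseteq> S" using assms by (auto simp: test_functions_def)
  have 1: "closure {x. \<phi> x + \<psi> x \<noteq> 0} \<subseteq> ?K \<union> ?L" unfolding closure_Un[symmetric] by (rule closure_mono) auto
  have 2: "closure {x. c * \<phi> x \<noteq> 0} \<subseteq> ?K" by (rule closure_mono) auto
  have "compact (closure {x. \<phi> x + \<psi> x \<noteq> 0})" "compact (closure {x. c * \<phi> x \<noteq> 0})"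
    using bounded_subset[OF _ 1] bounded_subset[OF _ 2] K by (auto simp: compact_eq_bounded_closed)
  moreover have "Ck_on n UNIV (\<lambda>x. \<phi> x + \<psi> x)" "Ck_on n UNIV (\<lambda>x. c * \<phi> x)" for n
    by (intro Ck_on_add Ck_on_mult Ck_on_const open_UNIV test_function_smooth(1)[OF assms(1)] test_function_smooth(1)[OF assms(2)])+
  moreover have "closure {x. \<phi> x + \<psi> x \<noteq> 0} \<subseteq> S" "closure {x. c * \<phi> x \<noteq> 0} \<subseteq> S" using 1 2 K by blast+
  ultimately show "(\<lambda>x. \<phi> x + \<psi> x) \<in> test_functions S" "(\<lambda>x. c * \<phi> x) \<in> test_functions S"
    unfolding test_functions_def smooth_on_def by blast+
qed

lemma test_function_0: "(\<lambda>x. 0) \<in> test_functions S"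
  by (simp add: test_functions_def smooth_on_def Ck_on_const)

definition D :: "ab_space set" where "D = {abs_l2 (Up 0 \<psi> (grad \<psi>)) | \<psi>. \<psi> \<in> test_functions (\<Omega> - {a0})}"

lemma V_eq: "V = closure D" by (simp add: V_def D_def)

lemma D_add: "U \<in> D \<Longrightarrow> U' \<in> D \<Longrightarrow> U + U' \<in> D"
proof -
  assume "U \<in> D" "U' \<in> D"
  then obtain \<phi> \<psi> where t: "\<phi> \<in> test_functions (\<Omega> - {a0})" "\<psi> \<in> test_functions (\<Omega> - {a0})"
    and U: "U = abs_l2 (Up 0 \<phi> (grad \<phi>))" "U' = abs_l2 (Up 0 \<psi> (grad \<psi>))" unfolding D_def by blast
  have "grad (\<lambda>x. \<phi> x + \<psi> x) = (\<lambda>x. grad \<phi> x + grad \<psi> x)"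
    by (simp add: fun_eq_iff grad_add_cmul(1)[OF test_function_smooth(2)[OF t(1)] test_function_smooth(2)[OF t(2)]])
  then have "Up 0 (\<lambda>x. \<phi> x + \<psi> x) (grad (\<lambda>x. \<phi> x + \<psi> x)) = (\<lambda>x. Up 0 \<phi> (grad \<phi>) x + Up 0 \<psi> (grad \<psi>) x)"
    by (simp only: Up_add[abs_def])
  then have "U + U' = abs_l2 (Up 0 (\<lambda>x. \<phi> x + \<psi> x) (grad (\<lambda>x. \<phi> x + \<psi> x)))"
    unfolding U by (simp add: abs_l2_add[OF sqint_Up_test[OF t(1)] sqint_Up_test[OF t(2)]])
  then show ?thesis unfolding D_def using test_functions_add_cmul(1)[OF t] by blast
qed

lemma D_cscale: "U \<in> D \<Longrightarrow> Jc.cscale c U \<in> D"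
proof -
  assume "U \<in> D"
  then obtain \<phi> where t: "\<phi> \<in> test_functions (\<Omega> - {a0})" and U: "U = abs_l2 (Up 0 \<phi> (grad \<phi>))" unfolding D_def by blast
  have "grad (\<lambda>x. c * \<phi> x) = (\<lambda>x. \<chi> j. c * grad \<phi> x $ j)"
    by (simp add: fun_eq_iff grad_add_cmul(2)[OF test_function_smooth(2)[OF t] test_function_smooth(2)[OF t]])
  then have "Up 0 (\<lambda>x. c * \<phi> x) (grad (\<lambda>x. c * \<phi> x)) = (\<lambda>x. cmul c (Up 0 \<phi> (grad \<phi>) x))"
    by (simp only: Up_cmul[abs_def])
  then have "Jc.cscale c U = abs_l2 (Up 0 (\<lambda>x. c * \<phi> x) (grad (\<lambda>x. c * \<phi> x)))"
    unfolding U by (simp add: cscale_abs[OF sqint_Up_test[OF t]])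
  then show ?thesis unfolding D_def using test_functions_add_cmul(2)[OF t t] by blast
qed

lemma D_V: "U \<in> D \<Longrightarrow> U \<in> V" using closure_subset by (auto simp: V_eq)

lemma V_closed: "closed V" by (simp add: V_def)

lemma D_nonempty: "0 \<in> D"
proof -
  have "Up 0 (\<lambda>x. 0) (grad (\<lambda>x. 0)) = (\<lambda>x. 0)"
    by (simp add: fun_eq_iff Up0 grad_def ivec_def vec_eq_iff zero_prod_def)
  then have "0 = abs_l2 (Up 0 (\<lambda>x. 0) (grad (\<lambda>x. 0)))" by (simp add: abs_l2_0)
  then show ?thesis unfolding D_def using test_function_0 by blast
qed

lemma V_add: "U \<in> V \<Longrightarrow> U' \<in> V \<Longrightarrow> U + U' \<in> V"
proof -
  assume "U \<in> V" "U' \<in> V"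
  then obtain f g where f: "\<And>n. f n \<in> D" "f \<longlonglongrightarrow> U" and g: "\<And>n. g n \<in> D" "g \<longlonglongrightarrow> U'"
    unfolding V_eq closure_sequential by blast
  show ?thesis unfolding V_eq closure_sequential
    by (rule exI[of _ "\<lambda>n. f n + g n"]) (use f g in \<open>simp add: D_add tendsto_add\<close>)
qed

lemma cscale_bounded_linear: "bounded_linear (Jc.cscale c)"
  unfolding Jc.cscale_def[abs_def]
  by (intro bounded_linear_add bounded_linear_const_scaleR bounded_linear_ident bounded_linear_compose[OF bounded_linear_scaleR_right Jc.J_linear])

lemma V_cscale: "U \<in> V \<Longrightarrow> Jc.cscale c U \<in> V"
proof -
  assume "U \<in> V"
  then obtain f where f: "\<And>n. f n \<in> D" "f \<longlonglongrightarrow> U" unfolding V_eq closure_sequential by blast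
  show ?thesis unfolding V_eq closure_sequential
    by (rule exI[of _ "\<lambda>n. Jc.cscale c (f n)"]) (use f in \<open>simp add: D_cscale bounded_linear.tendsto[OF cscale_bounded_linear]\<close>)
qed

lemma V_complex_subspace: "complex_subspace Jc V"
proof unfold_locales
  have "0 \<in> V" using D_V[OF D_nonempty] .
  moreover have "r *\<^sub>R U \<in> V" if "U \<in> V" for r U
    using V_cscale[OF that, of "of_real r"] by (simp add: Jc.cscale_def)
  ultimately show "subspace V" using V_add by (auto simp: subspace_def)
  show "Jc U \<in> V" if "U \<in> V" for U using V_cscale[OF that, of \<i>] by (simp add: Jc.cscale_def)
qed (rule V_closed)

text \<open>Multiplication by the indicator of the complement is a bounded operator that kills the
  dense set D, hence all of V.\<close>

lemma V_vanish:
  assumes "U \<in> V"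
  shows "AE x in lebesgue. x \<notin> \<Omega> \<longrightarrow> rep_l2 U x = 0"
proof -
  define m where "m x v = indicat_real (- \<Omega>) x *\<^sub>R v" for x and v :: "(complex^2) \<times> complex"
  have [measurable]: "- \<Omega> \<in> sets lebesgue" using \<Omega>_lebesgue by (metis Compl_in_sets_lebesgue)
  have m: "l2_symbol m" unfolding m_def[abs_def] by (rule l2_symbol_scaleR[where K=1]) (auto simp: indicator_def)
  have "m x (Up 0 \<psi> G x) = 0" for x \<psi> G by (simp add: m_def Up_def)
  then have "D \<subseteq> {U. l2_mult m U = 0}"
    using m sqint_Up_test by (auto simp: D_def l2_mult abs_l2_0)
  moreover have "closed {U. l2_mult m U = 0}" by (intro closed_Collect_eq continuous_intros)
  ultimately have "V \<subseteq> {U. l2_mult m U = 0}" unfolding V_eq by (rule closure_minimal)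
  then have "l2_mult m (abs_l2 (rep_l2 U)) = abs_l2 (\<lambda>x. 0)" using assms by (auto simp: abs_l2_0)
  then have "AE x in lebesgue. m x (rep_l2 U x) = 0"
    unfolding l2_mult[OF m rep_l2] using abs_l2_eq_iff[OF l2_symbol_sqint[OF m rep_l2] sqint_0] by simp
  then show ?thesis by eventually_elim (auto simp: m_def indicator_def split: if_splits)
qed

end

lemma cnj_measurable [measurable]: "cnj \<in> borel_measurable borel"
  by (intro borel_measurable_continuous_onI continuous_intros)

context ab_domain
begin

text \<open>Tests against the form domain thus amount to tests against all of V. The pullback is
  inverted explicitly, up to the null set consisting of the pole and the exceptional set outside
  \<Omega>.\<close>

lemma V_total:
  assumes d: "small d" and U: "U \<in> V"
  obtains u G where "in_H10 \<Omega> (a0 + d) u G" "abs_l2 (Up d u G) = U"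
proof -
  define f where "f = rep_l2 U"
  define u where "u y = of_real (norm (\<Psi> d y - a0)) * snd (f (\<Psi> d y))" for y
  define z where "z x = - ivec (fst (f x))" for x
  \<comment> \<open>The inverse of the map z \<mapsto> z + D\<eta> (d . z), by the Sherman-Morrison
    formula again.\<close>
  define G where "G y = z (\<Psi> d y) - vec_cmult ((1 / Jac d (\<Psi> d y)) *\<^sub>R D\<eta> (\<Psi> d y)) (dG d (z (\<Psi> d y)))" for y
  have f: "sqint f" "abs_l2 f = U" by (simp_all add: f_def rep_l2)
  note [measurable] = sqint_measurable[OF f(1)]
  have [measurable]: "(\<lambda>x::real^2. norm (x - a0)) \<in> borel_measurable lebesgue" "D\<eta> \<in> borel_measurable lebesgue" "Jac d \<in> borel_measurable lebesgue"
    by (intro borel_imp_lebesgue_measurable, measurable)+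
  have zm [measurable]: "z \<in> borel_measurable lebesgue" unfolding z_def[abs_def] by measurable
  have "(\<lambda>x. of_real (norm (x - a0)) * snd (f x)) \<in> borel_measurable lebesgue" by measurable
  from measurable_compose[OF lebesgue_\<Psi>[OF d] this] have um: "u \<in> borel_measurable (lebesgue_on \<Omega>)"
    unfolding u_def[abs_def] by (rule measurable_restrict_space1)
  have "(\<lambda>x. z x - vec_cmult ((1 / Jac d x) *\<^sub>R D\<eta> x) (dG d (z x))) \<in> borel_measurable lebesgue" by measurable
  from measurable_compose[OF lebesgue_\<Psi>[OF d] this] have Gm: "G \<in> borel_measurable (lebesgue_on \<Omega>)"
    unfolding G_def[abs_def] by (rule measurable_restrict_space1)
  have eq: "Up d u G x = f x" if x: "x \<in> \<Omega>" "x \<noteq> a0" for x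
  proof -
    have J: "Jac d x \<noteq> 0" using Jac_pos(1)[OF d, of x] by simp
    have G: "G (\<Phi> d x) = z x - vec_cmult ((1 / Jac d x) *\<^sub>R D\<eta> x) (dG d (z x))" by (simp add: G_def \<Psi>_\<Phi>[OF d])
    have "dG d (G (\<Phi> d x)) = dG d (z x) - of_real ((Jac d x - 1) / Jac d x) * dG d (z x)"
      unfolding G dG_simps by (simp add: Jac_def)
    also have "\<dots> = of_real (1 / Jac d x) * dG d (z x)" using J by (simp add: field_simps)
    finally have "vec_cmult (D\<eta> x) (dG d (G (\<Phi> d x))) = vec_cmult ((1 / Jac d x) *\<^sub>R D\<eta> x) (dG d (z x))"
      by (simp add: vec_cmult_def vec_eq_iff)
    then have "G (\<Phi> d x) + vec_cmult (D\<eta> x) (dG d (G (\<Phi> d x))) = z x" by (simp add: G)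
    moreover have "ivec (z x) = fst (f x)" by (simp add: z_def ivec_def vec_eq_iff mult.assoc[symmetric])
    ultimately show ?thesis using x by (simp add: Up_def u_def \<Psi>_\<Phi>[OF d] prod_eq_iff)
  qed
  have ae: "AE x in lebesgue. Up d u G x = f x"
    using V_vanish[OF U] AE_neq_point[of a0]
  proof eventually_elim
    case (elim x)
    then show ?case by (cases "x \<in> \<Omega>") (simp_all add: eq, simp add: Up_def f_def)
  qed
  have sq: "sqint (Up d u G)"
  proof (rule sqint_bound[OF f(1) Up_measurable[OF d um Gm], of 1])
    show "AE x in lebesgue. norm (Up d u G x) \<le> 1 * norm (f x)" using ae by eventually_elim simp
  qed
  have "abs_l2 (Up d u G) = U" using abs_l2_eq_iff[OF sq f(1)] ae f(2) by simp
  moreover from this have "in_H10 \<Omega> (a0 + d) u G" using in_H10_iff[OF d um Gm] sq U by simp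
  ultimately show thesis by (rule that[rotated])
qed

lemma in_H10_D:
  assumes d: "small d" and h: "in_H10 \<Omega> (a0 + d) u G"
  shows "u \<in> borel_measurable (lebesgue_on \<Omega>)" "G \<in> borel_measurable (lebesgue_on \<Omega>)"
    "sqint (Up d u G)" "abs_l2 (Up d u G) \<in> V"
proof -
  show m: "u \<in> borel_measurable (lebesgue_on \<Omega>)" "G \<in> borel_measurable (lebesgue_on \<Omega>)"
    using h unfolding in_H10_def by blast+
  show "sqint (Up d u G)" "abs_l2 (Up d u G) \<in> V" using in_H10_iff[OF d m] h by blast+
qed

lemma integral_on_\<Phi>:
  fixes f :: "real^2 \<Rightarrow> complex"
  assumes d: "small d" and f: "f \<in> borel_measurable (lebesgue_on \<Omega>)"
  shows "(\<integral>x. f x \<partial>lebesgue_on \<Omega>) = (\<integral>x. Jac d x *\<^sub>R (if x \<in> \<Omega> then f (\<Phi> d x) else 0) \<partial>lebesgue)"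
proof -
  have "(\<integral>x. f x \<partial>lebesgue_on \<Omega>) = (\<integral>x. (if x \<in> \<Omega> then f x else 0) \<partial>lebesgue)"
    by (subst integral_restrict_space) (auto intro!: Bochner_Integration.integral_cong simp: indicator_def)
  also have "\<dots> = (\<integral>x. Jac d x *\<^sub>R (if \<Phi> d x \<in> \<Omega> then f (\<Phi> d x) else 0) \<partial>lebesgue)"
    using f extension_measurable[of f] by (intro integral_\<Phi>[OF d]) simp
  finally show ?thesis by (simp only: \<Phi>_\<Omega>[OF d])
qed

text \<open>Change of variables by \<open>\<Phi> d\<close> on both sides of the weak equation. The
  real and imaginary parts become pairings with W and with J W.\<close>

lemma form_identities:
  assumes d: "small d" and u: "in_H10 \<Omega> (a0 + d) u G" and v: "in_H10 \<Omega> (a0 + d) v H"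
  defines "U \<equiv> abs_l2 (Up d u G)" and "W \<equiv> abs_l2 (Up d v H)"
  shows "(\<integral>x. u x * cnj (v x) \<partial>lebesgue_on \<Omega>) = Complex (Bop d U \<bullet> W) (Bop d U \<bullet> Jc W)"
    and "(\<integral>x. (\<Sum>j\<in>UNIV. magnetic_grad (a0 + d) \<alpha> u G x $ j * cnj (magnetic_grad (a0 + d) \<alpha> v H x $ j)) \<partial>lebesgue_on \<Omega>)
       = Complex (Aop d \<alpha> U \<bullet> W) (Aop d \<alpha> U \<bullet> Jc W)"
proof -
  note u = in_H10_D[OF d u] and v = in_H10_D[OF d v]
  note [measurable] = u(1,2) v(1,2)
  note [measurable] = sqint_measurable[OF u(3)] sqint_measurable[OF v(3)]
  let ?f = "\<lambda>x. Jac d x *\<^sub>R \<beta>sym x (Up d u G x)"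
  have 1: "AE x in lebesgue. Jac d x *\<^sub>R (if x \<in> \<Omega> then u (\<Phi> d x) * cnj (v (\<Phi> d x)) else 0) = hdot (?f x) (Up d v H x)"
    using AE_neq_point[of a0]
  proof eventually_elim
    case (elim x)
    then show ?case
      using Up_nth(1)[OF d _ elim, of u G, symmetric] Up_nth(1)[OF d _ elim, of v H, symmetric]
      by (auto simp: hdot_def \<beta>sym_def \<beta>_def scaleR_conv_of_real power2_eq_square)
  qed
  have f: "sqint ?f" by (rule l2_symbol_sqint[OF Bop_symbol u(3)])
  note [measurable] = sqint_measurable[OF f]
  have [measurable]: "(\<lambda>x. x) \<in> borel_measurable (lebesgue_on \<Omega>)"
    by (intro measurable_restrict_space1 borel_imp_lebesgue_measurable) measurable
  have uvm: "(\<lambda>x. u x * cnj (v x)) \<in> borel_measurable (lebesgue_on \<Omega>)" by measurable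
  have "(\<integral>x. u x * cnj (v x) \<partial>lebesgue_on \<Omega>) = (\<integral>x. hdot (?f x) (Up d v H x) \<partial>lebesgue)"
    unfolding integral_on_\<Phi>[OF d uvm]
  proof (rule integral_cong_AE[OF _ _ 1])
    have "(\<lambda>x. if \<Phi> d x \<in> \<Omega> then u (\<Phi> d x) * cnj (v (\<Phi> d x)) else 0) \<in> borel_measurable lebesgue"
      using measurable_compose[OF lebesgue_\<Phi>[OF d] uvm[unfolded extension_measurable]] .
    then show "(\<lambda>x. Jac d x *\<^sub>R (if x \<in> \<Omega> then u (\<Phi> d x) * cnj (v (\<Phi> d x)) else 0)) \<in> borel_measurable lebesgue"
      unfolding \<Phi>_\<Omega>[OF d] by (rule borel_measurable_scaleR[OF Jac_measurable[OF d]])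
    show "(\<lambda>x. hdot (?f x) (Up d v H x)) \<in> borel_measurable lebesgue"
      using integral_hdot(1)[OF f v(3)] by (rule borel_measurable_integrable)
  qed
  also have "\<dots> = Complex (Bop d U \<bullet> W) (Bop d U \<bullet> Jc W)"
    unfolding integral_hdot(2)[OF f v(3)] Bop_def U_def W_def l2_mult[OF Bop_symbol u(3)] ..
  finally show "(\<integral>x. u x * cnj (v x) \<partial>lebesgue_on \<Omega>) = Complex (Bop d U \<bullet> W) (Bop d U \<bullet> Jc W)" .
next
  note u = in_H10_D[OF d u] and v = in_H10_D[OF d v]
  let ?m = "\<lambda>u G x. magnetic_grad (a0 + d) \<alpha> u G x"
  let ?L = "\<lambda>u G x. Lsym d \<alpha> x (Up d u G x)"
  let ?f = "\<lambda>x. Jac d x *\<^sub>R ?L u G x"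
  have 1: "AE x in lebesgue. Jac d x *\<^sub>R (if x \<in> \<Omega> then (\<Sum>j\<in>UNIV. ?m u G (\<Phi> d x) $ j * cnj (?m v H (\<Phi> d x) $ j)) else 0) = hdot (?f x) (?L v H x)"
    using AE_neq_point[of a0]
  proof eventually_elim
    case (elim x)
    have "snd (?L u G x) = 0" by (simp add: Lsym_def)
    moreover have "Lsym d \<alpha> x 0 = 0" by (simp add: Lsym_def vec_cmult_def vec_eq_iff prod_eq_iff)
    ultimately show ?case
      using Up_nth(2)[OF d _ elim, of \<alpha> u G] Up_nth(2)[OF d _ elim, of \<alpha> v H]
      by (cases "x \<in> \<Omega>") (simp_all add: hdot_def Up_def[of _ _ _ x] scaleR_right.sum)
  qed
  have L: "sqint (?L u G)" "sqint (?L v H)" by (rule l2_symbol_sqint[OF Lop_expand(2)[OF d]]; fact u(3) v(3))+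
  have f: "sqint ?f" by (rule l2_symbol_sqint[OF Jac_symbol L(1)])
  have [measurable]: "(\<lambda>x. x) \<in> borel_measurable (lebesgue_on \<Omega>)"
    by (intro measurable_restrict_space1 borel_imp_lebesgue_measurable) measurable
  have [measurable]: "?m u G \<in> borel_measurable (lebesgue_on \<Omega>)" "?m v H \<in> borel_measurable (lebesgue_on \<Omega>)"
    using u(1,2) v(1,2) by (intro magnetic_grad_measurable; measurable)+
  have mm: "(\<lambda>x. \<Sum>j\<in>UNIV. ?m u G x $ j * cnj (?m v H x $ j)) \<in> borel_measurable (lebesgue_on \<Omega>)" by measurable
  have "(\<integral>x. (\<Sum>j\<in>UNIV. ?m u G x $ j * cnj (?m v H x $ j)) \<partial>lebesgue_on \<Omega>) = (\<integral>x. hdot (?f x) (?L v H x) \<partial>lebesgue)"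
    unfolding integral_on_\<Phi>[OF d mm]
  proof (rule integral_cong_AE[OF _ _ 1])
    have "(\<lambda>x. if \<Phi> d x \<in> \<Omega> then (\<Sum>j\<in>UNIV. ?m u G (\<Phi> d x) $ j * cnj (?m v H (\<Phi> d x) $ j)) else 0) \<in> borel_measurable lebesgue"
      using measurable_compose[OF lebesgue_\<Phi>[OF d] mm[unfolded extension_measurable]] .
    then show "(\<lambda>x. Jac d x *\<^sub>R (if x \<in> \<Omega> then (\<Sum>j\<in>UNIV. ?m u G (\<Phi> d x) $ j * cnj (?m v H (\<Phi> d x) $ j)) else 0)) \<in> borel_measurable lebesgue"
      unfolding \<Phi>_\<Omega>[OF d] by (rule borel_measurable_scaleR[OF Jac_measurable[OF d]])
    show "(\<lambda>x. hdot (?f x) (?L v H x)) \<in> borel_measurable lebesgue"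
      using integral_hdot(1)[OF f L(2)] by (rule borel_measurable_integrable)
  qed
  also have "\<dots> = Complex (Aop d \<alpha> U \<bullet> W) (Aop d \<alpha> U \<bullet> Jc W)"
    unfolding integral_hdot(2)[OF f L(2)] Aop_inner Lop_Jc[OF d] unfolding Jop_def Lop_def U_def W_def
      l2_mult[OF Lop_expand(2)[OF d] u(3)] l2_mult[OF Lop_expand(2)[OF d] v(3)] l2_mult[OF Jac_symbol L(1)] ..
  finally show "(\<integral>x. (\<Sum>j\<in>UNIV. ?m u G x $ j * cnj (?m v H x $ j)) \<partial>lebesgue_on \<Omega>) = Complex (Aop d \<alpha> U \<bullet> W) (Aop d \<alpha> U \<bullet> Jc W)" .
qed

end

section \<open>Coercivity and compactness\<close>

lemma frechet_derivative_zero_open: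
  assumes "open W" "x \<in> W" "\<And>y. y \<in> W \<Longrightarrow> f y = 0"
  shows "frechet_derivative f (at x) v = 0"
proof -
  have "(f has_derivative (\<lambda>v. 0)) (at x)"
    by (rule has_derivative_transform_within_open[OF has_derivative_const assms(1,2)]) (simp add: assms(3))
  then show ?thesis using frechet_derivative_at by metis
qed

text \<open>Difference quotients in direction v have integral 0 by translation invariance. They
  converge to the derivative and are dominated by a constant on a fixed ball, so the limit has
  integral 0 too.\<close>

lemma integral_directional_derivative_zero:
  fixes F :: "'a::euclidean_space \<Rightarrow> real"
  assumes der: "\<And>x. (F has_derivative F' x) (at x)" and cont: "continuous_on UNIV (\<lambda>x. F' x v)"
    and S: "bounded S" "\<And>x. x \<notin> S \<Longrightarrow> F x = 0"
  shows "integrable lborel (\<lambda>x. F' x v)" "(\<integral>x. F' x v \<partial>lborel) = 0"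
proof -
  obtain b where b: "\<And>x. x \<in> S \<Longrightarrow> norm x \<le> b" using S(1) bounded_iff by metis
  have F0: "F x = 0" if "norm x > b" for x using b[of x] S(2)[of x] that by fastforce
  have F'0: "F' x v = 0" if "norm x > b" for x
  proof -
    have "open {x::'a. norm x > b}" by (intro open_Collect_less continuous_intros)
    then have "frechet_derivative F (at x) v = 0" using frechet_derivative_zero_open[of "{x. norm x > b}" x F] that F0 by auto
    then show ?thesis using frechet_derivative_at[OF der] by metis
  qed
  \<comment> \<open>The radius is enlarged by norm v to contain every difference quotient with step
    at most 1.\<close>
  define K where "K = cball (0::'a) (b + norm v)"
  have Km: "K \<in> sets lborel" "emeasure lborel K < \<infinity>"
    unfolding K_def by (simp, rule emeasure_bounded_finite[OF bounded_cball])
  have "compact ((\<lambda>x. F' x v) ` K)" unfolding K_def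
    by (intro compact_continuous_image continuous_on_subset[OF cont] compact_cball) simp
  then obtain M where M: "\<And>x. x \<in> K \<Longrightarrow> \<bar>F' x v\<bar> \<le> M" using compact_imp_bounded[THEN bounded_iff[THEN iffD1]] by fastforce
  have M': "\<bar>F' x v\<bar> \<le> \<bar>M\<bar>" for x
  proof (cases "x \<in> K")
    case True then show ?thesis using M[OF True] by linarith
  next
    case False
    then have "\<not> norm x \<le> b + norm v" by (simp add: K_def)
    then have "norm x > b" using norm_ge_zero[of v] by linarith
    then show ?thesis by (simp add: F'0)
  qed
  have contF: "continuous_on UNIV F" using der by (meson continuous_at_imp_continuous_on has_derivative_continuous)
  then have [measurable]: "F \<in> borel_measurable borel" "(\<lambda>x. F' x v) \<in> borel_measurable borel"
    using cont by (auto intro: borel_measurable_continuous_onI)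
  have line: "((\<lambda>t. F (x + t *\<^sub>R v)) has_real_derivative F' (x + t *\<^sub>R v) v) (at t)" for x t
  proof -
    have "((\<lambda>t. x + t *\<^sub>R v) has_derivative (\<lambda>t. t *\<^sub>R v)) (at t)" by (auto intro!: derivative_eq_intros)
    from has_derivative_compose[OF this der] have "((\<lambda>t. F (x + t *\<^sub>R v)) has_derivative (\<lambda>s. F' (x + t *\<^sub>R v) (s *\<^sub>R v))) (at t)" by simp
    moreover have "F' (x + t *\<^sub>R v) (s *\<^sub>R v) = F' (x + t *\<^sub>R v) v * s" for s using linear_scale[OF has_derivative_linear[OF der]] by simp
    ultimately show ?thesis by (simp add: has_field_derivative_def)
  qed
  define s where "s n x = real (Suc n) * (F (x + (1 / real (Suc n)) *\<^sub>R v) - F x)" for n x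
  have lim: "(\<lambda>n. s n x) \<longlonglongrightarrow> F' x v" for x
  proof -
    have "((\<lambda>t. F (x + t *\<^sub>R v)) has_real_derivative F' x v) (at 0)" using line[of x 0] by simp
    then have *: "((\<lambda>h. (F (x + h *\<^sub>R v) - F x) / h) \<longlongrightarrow> F' x v) (at 0)" by (simp add: DERIV_def)
    have "filterlim (\<lambda>n. 1 / real (Suc n)) (at 0) sequentially"
      unfolding filterlim_at using LIMSEQ_Suc[OF lim_1_over_n] by (auto intro: always_eventually)
    from filterlim_compose[OF * this] show ?thesis by (simp add: s_def divide_inverse mult.commute)
  qed
  have bnd: "norm (s n x) \<le> \<bar>M\<bar> * indicator K x" for n x
  proof (cases "x \<in> K")
    case True
    define h where "h = 1 / real (Suc n)"
    have h: "h > 0" by (simp add: h_def)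
    from MVT2[OF h line] obtain z where z: "F (x + h *\<^sub>R v) - F (x + 0 *\<^sub>R v) = (h - 0) * F' (x + z *\<^sub>R v) v" by blast
    have "s n x = F' (x + z *\<^sub>R v) v" using z h by (simp add: s_def h_def[symmetric]) (simp add: h_def)
    then show ?thesis using M'[of "x + z *\<^sub>R v"] True by simp
  next
    case False
    then have x: "norm x > b + norm v" by (simp add: K_def)
    have "norm ((1 / real (Suc n)) *\<^sub>R v) \<le> 1 * norm v" unfolding norm_scaleR by (intro mult_right_mono) auto
    then have "norm (x + (1 / real (Suc n)) *\<^sub>R v) > b" using x norm_diff_ineq[of x "(1 / real (Suc n)) *\<^sub>R v"] by linarith
    moreover have "norm x > b" using x norm_ge_zero[of v] by linarith
    ultimately show ?thesis by (simp add: s_def F0)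
  qed
  have K: "integrable lborel (\<lambda>x. \<bar>M\<bar> * indicator K x)"
    by (intro integrable_mult_right integrable_real_indicator Km)
  have sm: "s n \<in> borel_measurable lborel" for n unfolding s_def by measurable
  show "integrable lborel (\<lambda>x. F' x v)"
    by (rule integrable_dominated_convergence[OF _ sm K AE_I2 AE_I2]) (measurable, rule lim, rule bnd)
  have intF: "integrable lborel F"
  proof -
    have "compact (F ` K)" unfolding K_def by (intro compact_continuous_image continuous_on_subset[OF contF] compact_cball) simp
    then obtain L where L: "\<And>x. x \<in> K \<Longrightarrow> \<bar>F x\<bar> \<le> L" using compact_imp_bounded[THEN bounded_iff[THEN iffD1]] by fastforce
    have *: "norm (F x) \<le> norm (L * indicator K x)" for x
    proof (cases "x \<in> K")
      case False
      then have "\<not> norm x \<le> b + norm v" by (simp add: K_def)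
      then have "norm x > b" using norm_ge_zero[of v] by linarith
      then show ?thesis by (simp add: F0)
    qed (use L[of x] in simp)
    have "integrable lborel (\<lambda>x. L * indicator K x)"
      by (intro integrable_mult_right integrable_real_indicator Km)
    then show ?thesis by (rule Bochner_Integration.integrable_bound) (measurable, rule AE_I2, rule *)
  qed
  have "(\<integral>x. s n x \<partial>lborel) = 0" for n
  proof -
    let ?c = "(1 / real (Suc n)) *\<^sub>R v"
    have "integrable (distr lborel borel ((+) ?c)) F" using intF by (simp add: lborel_distr_plus)
    then have i: "integrable lborel (\<lambda>x. F (?c + x))" by (simp add: integrable_distr_eq)
    have "(\<integral>x. F x \<partial>lborel) = (\<integral>x. F x \<partial>distr lborel borel ((+) ?c))" by (simp add: lborel_distr_plus)
    also have "\<dots> = (\<integral>x. F (?c + x) \<partial>lborel)" by (rule integral_distr) measurable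
    finally have "(\<integral>x. F (?c + x) - F x \<partial>lborel) = 0" using i intF by simp
    then show ?thesis unfolding s_def add.commute[of _ ?c] by simp
  qed
  then have s0: "(\<lambda>n. \<integral>x. s n x \<partial>lborel) \<longlonglongrightarrow> 0" by simp
  have "(\<lambda>n. \<integral>x. s n x \<partial>lborel) \<longlonglongrightarrow> (\<integral>x. F' x v \<partial>lborel)"
    by (rule integral_dominated_convergence[OF _ sm K AE_I2 AE_I2]) (measurable, rule lim, rule bnd)
  then show "(\<integral>x. F' x v \<partial>lborel) = 0" by (rule LIMSEQ_unique) (rule s0)
qed

definition laplacian :: "(real^2 \<Rightarrow> complex) \<Rightarrow> real^2 \<Rightarrow> complex" where
  "laplacian \<psi> x = (\<Sum>j\<in>UNIV. frechet_derivative (\<lambda>x. frechet_derivative \<psi> (at x) (axis j 1)) (at x) (axis j 1))"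

text \<open>The integrand is the divergence of \<phi> times the gradient of \<psi>, which has
  compact support; products are real inner products of complex values.\<close>

lemma integration_by_parts:
  assumes \<phi>: "\<phi> \<in> test_functions S" and \<psi>: "Ck_on 2 UNIV \<psi>"
  shows "(\<integral>x. grad \<phi> x \<bullet> grad \<psi> x + \<phi> x \<bullet> laplacian \<psi> x \<partial>lborel) = 0"
proof -
  define g where "g j x = frechet_derivative \<psi> (at x) (axis j 1)" for j x
  have g: "Ck_on (Suc 0) UNIV (g j)" for j
    unfolding g_def[abs_def] using Ck_on_Suc_frechet[of "Suc 0" UNIV \<psi>] \<psi> by (simp add: numeral_2_eq_2)
  have c: "Ck_on 1 UNIV \<phi>" "compact (closure {x. \<phi> x \<noteq> 0})" using \<phi> by (auto simp: test_functions_def smooth_on_def)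
  then have \<phi>1: "Ck_on (Suc 0) UNIV \<phi>" by simp
  define F' where "F' j x v = \<phi> x \<bullet> frechet_derivative (g j) (at x) v + frechet_derivative \<phi> (at x) v \<bullet> g j x" for j x v
  have der: "((\<lambda>x. \<phi> x \<bullet> g j x) has_derivative F' j x) (at x)" for j x
    unfolding F'_def[abs_def] by (intro has_derivative_inner Ck_on_Suc_has_derivative[OF \<phi>1] Ck_on_Suc_has_derivative[OF g] UNIV_I)
  have cont: "continuous_on UNIV (\<lambda>x. F' j x (axis j 1))" for j
    unfolding F'_def using Ck_on_continuous[OF g] Ck_on_continuous[OF \<phi>1] Ck_on_Suc_frechet[OF g] Ck_on_Suc_frechet[OF \<phi>1]
    by (intro continuous_intros) simp_all
  have bd: "bounded (closure {x. \<phi> x \<noteq> 0})" using c(2) by (rule compact_imp_bounded)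
  have "\<phi> x \<bullet> g j x = 0" if "x \<notin> closure {x. \<phi> x \<noteq> 0}" for x j
  proof -
    have "\<phi> x = 0" using that closure_subset[of "{x. \<phi> x \<noteq> 0}"] by blast
    then show ?thesis by simp
  qed
  note * = integral_directional_derivative_zero[OF der cont bd this]
  have "(\<integral>x. (\<Sum>j\<in>UNIV. F' j x (axis j 1)) \<partial>lborel) = 0" using * by simp
  moreover have "(\<Sum>j\<in>UNIV. F' j x (axis j 1)) = grad \<phi> x \<bullet> grad \<psi> x + \<phi> x \<bullet> laplacian \<psi> x" for x
    by (simp add: F'_def laplacian_def grad_def inner_vec_def g_def[abs_def] sum.distrib inner_sum_right)
  ultimately show ?thesis by simp
qed

lemma test_function_derivatives_zero:
  assumes "\<psi> \<in> test_functions S" "x \<notin> S"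
  shows "\<psi> x = 0" "grad \<psi> x = 0" "laplacian \<psi> x = 0"
proof -
  let ?W = "- closure {x. \<psi> x \<noteq> 0}"
  have W: "open ?W" "x \<in> ?W" using assms by (auto simp: test_functions_def)
  have 0: "\<psi> y = 0" if "y \<in> ?W" for y using that closure_subset[of "{x. \<psi> x \<noteq> 0}"] by blast
  show "\<psi> x = 0" using W 0 by blast
  have 1: "frechet_derivative \<psi> (at y) v = 0" if "y \<in> ?W" for y v by (rule frechet_derivative_zero_open[OF W(1) that 0])
  then show "grad \<psi> x = 0" using W by (simp add: grad_def vec_eq_iff)
  have "frechet_derivative (\<lambda>x. frechet_derivative \<psi> (at x) w) (at y) v = 0" if "y \<in> ?W" for y v w
    by (rule frechet_derivative_zero_open[OF W(1) that 1])
  then show "laplacian \<psi> x = 0" using W by (simp add: laplacian_def)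
qed

context ab_domain
begin

lemma nn_integral_lborel_lebesgue:
  assumes "AE x in lebesgue. f x = g (x::real^2)"
  shows "(\<integral>\<^sup>+x. f x \<partial>lborel) = (\<integral>\<^sup>+x. g x \<partial>lebesgue)"
  unfolding nn_integral_completion[of lborel f, symmetric] by (rule nn_integral_cong_AE[OF assms])

lemma Bop_self:
  assumes f: "sqint f" and d: "small d"
  shows "Bop d (abs_l2 f) \<bullet> abs_l2 f = (\<integral>x. Jac d x * (\<beta> x * (norm (snd (f x)))\<^sup>2) \<partial>lebesgue)"
    "integrable lebesgue (\<lambda>x. Jac d x * (\<beta> x * (norm (snd (f x)))\<^sup>2))"
    "Jac d x * (\<beta> x * (norm (snd (f x)))\<^sup>2) \<ge> 0"
proof -
  have eq: "(Jac d x *\<^sub>R \<beta>sym x (f x)) \<bullet> f x = Jac d x * (\<beta> x * (norm (snd (f x)))\<^sup>2)" for x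
    by (simp add: \<beta>sym_def inner_prod_def dot_square_norm)
  note g = l2_symbol_sqint[OF Bop_symbol[of d] f]
  show "Bop d (abs_l2 f) \<bullet> abs_l2 f = (\<integral>x. Jac d x * (\<beta> x * (norm (snd (f x)))\<^sup>2) \<partial>lebesgue)"
    unfolding Bop_def l2_mult[OF Bop_symbol f] inner_abs_l2[OF g f] eq ..
  show "integrable lebesgue (\<lambda>x. Jac d x * (\<beta> x * (norm (snd (f x)))\<^sup>2))"
    using sqint_inner_integrable[OF g f] unfolding eq .
  have "\<beta> x \<ge> 0" using \<beta>_bound by blast
  then show "Jac d x * (\<beta> x * (norm (snd (f x)))\<^sup>2) \<ge> 0" using Jac_pos(2)[OF d, of x] by simp
qed

lemma small_0: "small 0" using rR by (simp add: small_def)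

lemma Jac_0: "Jac 0 x = 1" by (simp add: Jac_def)

text \<open>Only the Jacobian depends on d, so the form of B changes by a small relative amount.
  This gives positivity for all small d as well as continuity of eigenvalues.\<close>

lemma Bop_close:
  assumes d: "small d"
  shows "\<bar>Bop d U \<bullet> U - Bop 0 U \<bullet> U\<bar> \<le> (norm d * lip) * (Bop 0 U \<bullet> U)"
    and "0 \<le> Bop 0 U \<bullet> U"
proof -
  obtain f where f: "sqint f" "U = abs_l2 f" by (rule l2_cases)
  note i = Bop_self[OF f(1) d] and i0 = Bop_self[OF f(1) small_0, unfolded Jac_0 mult_1]
  have "\<bar>Bop d U \<bullet> U - Bop 0 U \<bullet> U\<bar> = norm (\<integral>x. (Jac d x - 1) * (\<beta> x * (norm (snd (f x)))\<^sup>2) \<partial>lebesgue)"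
    unfolding f(2) i(1) i0(1) using i(2) i0(2) by (simp add: left_diff_distrib)
  also have "\<dots> \<le> (\<integral>x. (norm d * lip) * (\<beta> x * (norm (snd (f x)))\<^sup>2) \<partial>lebesgue)"
  proof (rule Bochner_Integration.integral_norm_bound_integral)
    show "integrable lebesgue (\<lambda>x. (Jac d x - 1) * (\<beta> x * (norm (snd (f x)))\<^sup>2))" using i(2) i0(2) by (simp add: left_diff_distrib)
    show "integrable lebesgue (\<lambda>x. (norm d * lip) * (\<beta> x * (norm (snd (f x)))\<^sup>2))" using i0(2) by simp
    show "norm ((Jac d x - 1) * (\<beta> x * (norm (snd (f x)))\<^sup>2)) \<le> (norm d * lip) * (\<beta> x * (norm (snd (f x)))\<^sup>2)" for x
      by (simp only: real_norm_def abs_mult[of "Jac d x - 1"] abs_of_nonneg[OF i0(3)]) (rule mult_right_mono[OF Jac_bounds(3)[OF d] i0(3)])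
  qed
  also have "\<dots> = (norm d * lip) * (Bop 0 U \<bullet> U)" unfolding f(2) i0(1) by simp
  finally show "\<bar>Bop d U \<bullet> U - Bop 0 U \<bullet> U\<bar> \<le> (norm d * lip) * (Bop 0 U \<bullet> U)" .
  show "0 \<le> Bop 0 U \<bullet> U" unfolding f(2) i0(1) by (rule Bochner_Integration.integral_nonneg) (rule i0(3))
qed

lemma Bop_half:
  assumes d: "small d"
  shows "Bop d U \<bullet> U \<le> 3/2 * (Bop 0 U \<bullet> U)" "1/2 * (Bop 0 U \<bullet> U) \<le> Bop d U \<bullet> U"
proof -
  have "(norm d * lip) * (Bop 0 U \<bullet> U) \<le> 1/2 * (Bop 0 U \<bullet> U)"
    using d Bop_close(2)[OF d, of U] by (intro mult_right_mono) (auto simp: small_def)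
  then show "Bop d U \<bullet> U \<le> 3/2 * (Bop 0 U \<bullet> U)" "1/2 * (Bop 0 U \<bullet> U) \<le> Bop d U \<bullet> U"
    using Bop_close(1)[OF d, of U] unfolding abs_le_iff by linarith+
qed

lemma Bop_test:
  assumes "\<psi> \<in> test_functions (\<Omega> - {a0})"
  shows "ennreal (Bop 0 (abs_l2 (Up 0 \<psi> (grad \<psi>))) \<bullet> abs_l2 (Up 0 \<psi> (grad \<psi>))) = (\<integral>\<^sup>+x. ennreal ((norm (\<psi> x))\<^sup>2) \<partial>lborel)"
proof -
  note s = sqint_Up_test[OF assms]
  note i = Bop_self[OF s small_0, unfolded Jac_0 mult_1]
  have "ennreal (Bop 0 (abs_l2 (Up 0 \<psi> (grad \<psi>))) \<bullet> abs_l2 (Up 0 \<psi> (grad \<psi>))) = (\<integral>\<^sup>+x. ennreal (\<beta> x * (norm (snd (Up 0 \<psi> (grad \<psi>) x)))\<^sup>2) \<partial>lebesgue)"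
    unfolding i(1) by (rule nn_integral_eq_integral[symmetric, OF i(2)]) (simp add: i(3))
  also have "\<dots> = (\<integral>\<^sup>+x. ennreal ((norm (\<psi> x))\<^sup>2) \<partial>lborel)"
  proof (rule nn_integral_lborel_lebesgue[symmetric], use AE_neq_point[of a0] in eventually_elim)
    case (elim x)
    then show ?case using test_function_derivatives_zero(1)[OF assms, of x]
      by (cases "x \<in> \<Omega>") (auto simp: Up0 \<beta>_def norm_divide power_divide)
  qed
  finally show ?thesis .
qed

end

lemma quadratic_form_diff_le:
  fixes A B :: "'h::real_inner \<Rightarrow>\<^sub>L 'h"
  shows "\<bar>A x \<bullet> x - B x \<bullet> x\<bar> \<le> norm (A - B) * (norm x)\<^sup>2"
proof -
  have "\<bar>(A - B) x \<bullet> x\<bar> \<le> norm ((A - B) x) * norm x" by (rule Cauchy_Schwarz_ineq2)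
  also have "\<dots> \<le> (norm (A - B) * norm x) * norm x" by (intro mult_right_mono norm_blinfun) simp
  finally show ?thesis by (simp add: blinfun.bilinear_simps inner_simps power2_eq_square)
qed

context ab_domain
begin

lemma sqint_continuous:
  fixes f :: "real^2 \<Rightarrow> 'b::euclidean_space"
  assumes f: "continuous_on UNIV f" and 0: "\<And>x. x \<notin> \<Omega> \<Longrightarrow> f x = 0"
  shows "sqint f"
proof -
  have "compact (f ` closure \<Omega>)" using \<Omega>_bounded by (intro compact_continuous_image continuous_on_subset[OF f]) auto
  then have "bounded (f ` closure \<Omega>)" by (rule compact_imp_bounded)
  then obtain K where "\<forall>y\<in>f ` closure \<Omega>. norm y \<le> K" unfolding bounded_iff by blast
  then have K: "\<And>x. x \<in> closure \<Omega> \<Longrightarrow> norm (f x) \<le> K" by blast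
  have "a0 \<in> closure \<Omega>" using a0_\<Omega> closure_subset by blast
  from order_trans[OF norm_ge_zero K[OF this]] have K0: "K \<ge> 0" .
  show ?thesis
  proof (rule sqint_bounded_support[OF _ _ 0])
    show "f \<in> borel_measurable lebesgue" using f by (intro borel_imp_lebesgue_measurable borel_measurable_continuous_onI)
    show "norm (f x) \<le> K" for x using K[of x] 0[of x] K0 closure_subset[of \<Omega>] by (cases "x \<in> \<Omega>") auto
  qed
qed

lemma laplacian_continuous:
  assumes "\<psi> \<in> test_functions S"
  shows "continuous_on UNIV (laplacian \<psi>)"
proof -
  have "Ck_on (Suc (Suc 0)) UNIV \<psi>" by (rule test_function_smooth(1)[OF assms])
  then have "continuous_on UNIV (\<lambda>x. frechet_derivative (\<lambda>x. frechet_derivative \<psi> (at x) v) (at x) w)" for v w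
    by (metis Ck_on_Suc_frechet Ck_on_continuous)
  then show ?thesis unfolding laplacian_def[abs_def] by (intro continuous_intros) auto
qed

lemma P1_symbol: "l2_symbol (\<lambda>x::real^2. \<lambda>v::(complex^2) \<times> complex. (fst v, 0::complex))"
  by (rule l2_symbol_const) (auto intro!: bounded_linear_Pair bounded_linear_fst bounded_linear_zero)

text \<open>For W from a test function \<phi>, the pairing of gradients is moved onto the Laplacian
  of \<psi>, and so it is bounded by the norm of \<phi>, which is the square root of the form of B.
  Both sides are continuous, so the bound extends to V.\<close>

lemma P1_bound:
  assumes "U' \<in> D"
  obtains C where "\<And>W. W \<in> V \<Longrightarrow> \<bar>P1 W \<bullet> U'\<bar> \<le> C * sqrt (Bop 0 W \<bullet> W)"
proof -
  obtain \<psi> where \<psi>: "\<psi> \<in> test_functions (\<Omega> - {a0})" "U' = abs_l2 (Up 0 \<psi> (grad \<psi>))" using assms unfolding D_def by blast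
  have lap: "sqint (laplacian \<psi>)"
    using test_function_derivatives_zero(3)[OF \<psi>(1)] by (intro sqint_continuous laplacian_continuous[OF \<psi>(1)]) auto
  define C where "C = norm (abs_l2 (laplacian \<psi>))"
  have D: "\<bar>P1 W \<bullet> U'\<bar> \<le> C * sqrt (Bop 0 W \<bullet> W)" if "W \<in> D" for W
  proof -
    obtain \<phi> where \<phi>: "\<phi> \<in> test_functions (\<Omega> - {a0})" "W = abs_l2 (Up 0 \<phi> (grad \<phi>))" using \<open>W \<in> D\<close> unfolding D_def by blast
    have \<phi>c: "continuous_on UNIV \<phi>" "continuous_on UNIV (grad \<phi>)" "continuous_on UNIV (grad \<psi>)"
      using Ck_on_1_grad(2,3)[OF test_function_smooth(3)[OF \<phi>(1)]] Ck_on_1_grad(3)[OF test_function_smooth(3)[OF \<psi>(1)]] by auto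
    have s\<phi>: "sqint \<phi>" using test_function_derivatives_zero(1)[OF \<phi>(1)] by (intro sqint_continuous \<phi>c) auto
    have sg: "sqint (grad \<phi>)" "sqint (grad \<psi>)"
      using test_function_derivatives_zero(2)[OF \<phi>(1)] test_function_derivatives_zero(2)[OF \<psi>(1)] by (intro sqint_continuous \<phi>c; auto)+
    have ivec: "ivec z \<bullet> ivec w = z \<bullet> w" for z w by (simp add: ivec_def inner_vec_def inner_complex_def add.commute)
    have "P1 W \<bullet> U' = (\<integral>x. (fst (Up 0 \<phi> (grad \<phi>) x), 0) \<bullet> Up 0 \<psi> (grad \<psi>) x \<partial>lebesgue)"
      unfolding P1_def \<phi>(2) \<psi>(2) l2_mult[OF P1_symbol sqint_Up_test[OF \<phi>(1)]]
      by (rule inner_abs_l2[OF l2_symbol_sqint[OF P1_symbol sqint_Up_test[OF \<phi>(1)]] sqint_Up_test[OF \<psi>(1)]])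
    also have "\<dots> = (\<integral>x. grad \<phi> x \<bullet> grad \<psi> x \<partial>lebesgue)"
      using test_function_derivatives_zero(2)[OF \<phi>(1)]
      by (intro Bochner_Integration.integral_cong refl) (auto simp: Up0 inner_prod_def ivec)
    finally have 1: "P1 W \<bullet> U' = (\<integral>x. grad \<phi> x \<bullet> grad \<psi> x \<partial>lebesgue)" .
    have "(\<lambda>x. grad \<phi> x \<bullet> grad \<psi> x + \<phi> x \<bullet> laplacian \<psi> x) \<in> borel_measurable lborel"
      using \<phi>c laplacian_continuous[OF \<psi>(1)] by (simp, intro borel_measurable_continuous_onI continuous_intros) auto
    from integral_completion[OF this] have "(\<integral>x. grad \<phi> x \<bullet> grad \<psi> x + \<phi> x \<bullet> laplacian \<psi> x \<partial>lebesgue) = 0"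
      using integration_by_parts[OF \<phi>(1) test_function_smooth(1)[OF \<psi>(1)]] by simp
    then have "(\<integral>x. grad \<phi> x \<bullet> grad \<psi> x \<partial>lebesgue) + (\<integral>x. \<phi> x \<bullet> laplacian \<psi> x \<partial>lebesgue) = 0"
      using Bochner_Integration.integral_add[OF sqint_inner_integrable[OF sg] sqint_inner_integrable[OF s\<phi> lap]] by simp
    then have 2: "P1 W \<bullet> U' = - (abs_l2 \<phi> \<bullet> abs_l2 (laplacian \<psi>))"
      unfolding 1 inner_abs_l2[OF s\<phi> lap] by simp
    have "ennreal ((norm (abs_l2 \<phi>))\<^sup>2) = ennreal (Bop 0 W \<bullet> W)"
      unfolding \<phi>(2) Bop_test[OF \<phi>(1)] nn_norm_abs_l2[OF s\<phi>, symmetric] by (rule nn_integral_lborel_lebesgue[symmetric]) simp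
    then have "(norm (abs_l2 \<phi>))\<^sup>2 = Bop 0 W \<bullet> W" using Bop_close(2)[OF small_0] by (simp add: ennreal_inj)
    then have "norm (abs_l2 \<phi>) = sqrt (Bop 0 W \<bullet> W)" by (metis norm_ge_zero real_sqrt_abs abs_of_nonneg)
    then show ?thesis using Cauchy_Schwarz_ineq2[of "abs_l2 \<phi>" "abs_l2 (laplacian \<psi>)"] by (simp add: 2 C_def mult.commute)
  qed
  have "closed {W. \<bar>P1 W \<bullet> U'\<bar> \<le> C * sqrt (Bop 0 W \<bullet> W)}" by (intro closed_Collect_le continuous_intros)
  moreover have "D \<subseteq> {W. \<bar>P1 W \<bullet> U'\<bar> \<le> C * sqrt (Bop 0 W \<bullet> W)}" using D by blast
  ultimately have "V \<subseteq> {W. \<bar>P1 W \<bullet> U'\<bar> \<le> C * sqrt (Bop 0 W \<bullet> W)}" unfolding V_eq by (intro closure_minimal)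
  then show thesis by (intro that[of C]) blast
qed

text \<open>This is the closability of the gradient.\<close>

lemma B_definite:
  assumes W: "W \<in> V" "Bop 0 W \<bullet> W = 0"
  shows "W = 0"
proof -
  define f where "f = rep_l2 W"
  have f: "sqint f" "abs_l2 f = W" by (simp_all add: f_def rep_l2)
  note i = Bop_self[OF f(1) small_0, unfolded Jac_0 mult_1 f(2)]
  have "AE x in lebesgue. \<beta> x * (norm (snd (f x)))\<^sup>2 = 0"
    using integral_nonneg_eq_0_iff_AE[OF i(2) AE_I2[OF i(3)]] W(2) i(1) by simp
  then have "AE x in lebesgue. (fst (f x), 0) = f x"
    using V_vanish[OF W(1)] AE_neq_point[of a0]
  proof eventually_elim
    case (elim x)
    then show ?case by (cases "x \<in> \<Omega>") (auto simp: \<beta>_def f_def prod_eq_iff)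
  qed
  \<comment> \<open>The second component vanishes, so W is its own gradient part. The preceding
    bound with right-hand side 0 then makes W orthogonal to D, and thus to V and to itself.\<close>
  then have P: "P1 W = W"
    unfolding P1_def f(2)[symmetric] l2_mult[OF P1_symbol f(1)] using abs_l2_eq_iff[OF l2_symbol_sqint[OF P1_symbol f(1)] f(1)] by simp
  have "W \<bullet> U' = 0" if "U' \<in> D" for U'
  proof -
    from P1_bound[OF that] obtain C where "\<And>W. W \<in> V \<Longrightarrow> \<bar>P1 W \<bullet> U'\<bar> \<le> C * sqrt (Bop 0 W \<bullet> W)" by blast
    from this[OF W(1)] show ?thesis by (simp add: P W(2))
  qed
  then have "D \<subseteq> {U'. W \<bullet> U' = 0}" by blast
  moreover have "closed {U'. W \<bullet> U' = 0}" by (intro closed_Collect_eq continuous_intros)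
  ultimately have "V \<subseteq> {U'. W \<bullet> U' = 0}" unfolding V_eq by (rule closure_minimal)
  then show ?thesis using W(1) by auto
qed

lemma B_positive:
  assumes "small d" "W \<in> V" "W \<noteq> 0"
  shows "Bop d W \<bullet> W > 0"
  using B_definite[OF assms(2)] Bop_half(2)[OF assms(1), of W] Bop_close(2)[OF small_0, of W] assms(3) by fastforce

lemma cis_neq_1:
  assumes "\<alpha> \<notin> \<int>"
  shows "cis (- (2 * pi * \<alpha>)) \<noteq> 1"
proof
  assume "cis (- (2 * pi * \<alpha>)) = 1"
  then have "cos (2 * pi * \<alpha>) = 1" by (simp add: complex_eq_iff)
  then obtain n :: int where "2 * pi * \<alpha> = real_of_int n * 2 * pi" using cos_one_2pi_int by blast
  then have "\<alpha> = of_int n" by simp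
  then show False using assms by simp
qed

lemma Aop_0: "Aop 0 \<alpha> U \<bullet> U = (norm (Lop 0 \<alpha> U))\<^sup>2"
  unfolding Aop_inner by (simp add: Jop_expand power2_norm_eq_inner)

lemma Lsym_0: "fst (Lsym 0 \<alpha> x v) = fst v + vec_cmult (\<alpha> *\<^sub>R perp (e0 x)) (snd v)" "snd (Lsym 0 \<alpha> x v) = 0" "Lsym d \<alpha> x 0 = 0"
  by (simp_all add: Lsym_def q_def Jac_0 vec_cmult_def vec_eq_iff prod_eq_iff)

text \<open>The Hardy inequality bounds the second component s by the magnetic gradient. The first
  component is the magnetic gradient minus a bounded multiple of s, so it is bounded as well;
  density of D does the rest.\<close>

lemma coercive_0:
  assumes \<alpha>: "\<alpha> \<notin> \<int>"
  obtains \<gamma> where "\<gamma> > 0" "\<And>U. U \<in> V \<Longrightarrow> \<gamma> * (norm U)\<^sup>2 \<le> Aop 0 \<alpha> U \<bullet> U"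
proof -
  define c where "c = (cmod (cis (- (2 * pi * \<alpha>)) - 1))\<^sup>2"
  have c: "c > 0" using cis_neq_1[OF \<alpha>] by (simp add: c_def)
  define K where "K = 2 * c + (1 + 2 * \<alpha>\<^sup>2) * (2 * pi)\<^sup>2"
  have "(1 + 2 * \<alpha>\<^sup>2) * (2 * pi)\<^sup>2 \<ge> 0" by (intro mult_nonneg_nonneg) auto
  then have K: "K > 0" unfolding K_def using c by (intro add_pos_nonneg) auto
  have D: "c / K * (norm U)\<^sup>2 \<le> Aop 0 \<alpha> U \<bullet> U" if U: "U \<in> D" for U
  proof -
    obtain \<psi> where \<psi>: "\<psi> \<in> test_functions (\<Omega> - {a0})" "U = abs_l2 (Up 0 \<psi> (grad \<psi>))" using U unfolding D_def by blast
    define f where "f = Up 0 \<psi> (grad \<psi>)"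
    have f: "sqint f" "U = abs_l2 f" using sqint_Up_test[OF \<psi>(1)] \<psi>(2) by (auto simp: f_def)
    have z: "\<psi> x = 0" "grad \<psi> x = 0" if "x \<notin> \<Omega>" for x using test_function_derivatives_zero[OF \<psi>(1)] that by auto
    note [measurable] = sqint_measurable[OF f(1)]
    define s where "s x = snd (f x)" for x
    have s: "sqint s"
    proof (rule sqint_bound[OF f(1), of _ 1])
      show "s \<in> borel_measurable lebesgue" unfolding s_def[abs_def] by measurable
      show "AE x in lebesgue. norm (s x) \<le> 1 * norm (f x)" using norm_snd_le[of "snd (f x)" "fst (f x)" for x] by (simp add: s_def)
    qed
    have S: "(\<integral>\<^sup>+x. ennreal ((norm (\<psi> x) / norm (x - a0))\<^sup>2) \<partial>lborel) = ennreal ((norm (abs_l2 s))\<^sup>2)"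
      unfolding nn_norm_abs_l2[OF s, symmetric]
      by (rule nn_integral_lborel_lebesgue) (auto simp: s_def f_def Up0 z norm_divide)
    have Lf: "sqint (\<lambda>x. Lsym 0 \<alpha> x (f x))" "Lop 0 \<alpha> U = abs_l2 (\<lambda>x. Lsym 0 \<alpha> x (f x))"
      unfolding Lop_def f(2) using l2_symbol_sqint[OF Lop_expand(2)[OF small_0] f(1)] l2_mult[OF Lop_expand(2)[OF small_0] f(1)] by auto
    have "(\<integral>\<^sup>+x. ennreal ((norm (magnetic_grad a0 \<alpha> \<psi> (grad \<psi>) x))\<^sup>2) \<partial>lborel) = ennreal ((norm (Lop 0 \<alpha> U))\<^sup>2)"
      unfolding Lf(2) nn_norm_abs_l2[OF Lf(1), symmetric]
    proof (rule nn_integral_lborel_lebesgue, use AE_neq_point[of a0] in eventually_elim)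
      case (elim x)
      have n: "norm (Lsym 0 \<alpha> x v) = norm (fst (Lsym 0 \<alpha> x v))" for v using Lsym_0(2)[of \<alpha> x v] by (simp add: norm_prod_def)
      show ?case
      proof (cases "x \<in> \<Omega>")
        case True
        then show ?thesis using Up_nth(2)[OF small_0 True elim, of \<alpha> \<psi> "grad \<psi>"] by (simp add: n f_def \<Phi>_0)
      next
        case False
        then show ?thesis by (simp add: f_def Up_def Lsym_0(3) magnetic_grad_vec z ivec_def vec_cmult_def zero_vec_def[symmetric])
      qed
    qed
    then have "ennreal c * ennreal ((norm (abs_l2 s))\<^sup>2) \<le> ennreal ((2 * pi)\<^sup>2) * ennreal ((norm (Lop 0 \<alpha> U))\<^sup>2)"
      using hardy_inequality[OF test_function_smooth(3)[OF \<psi>(1)], of \<alpha> a0] by (simp add: c_def S)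
    then have h: "c * (norm (abs_l2 s))\<^sup>2 \<le> (2 * pi)\<^sup>2 * (norm (Lop 0 \<alpha> U))\<^sup>2"
      using c by (simp add: ennreal_mult[symmetric])
    \<comment> \<open>From |x + y|^2 <= 2|x|^2 + 2|y|^2 for the first component. Multiplying its
      integral by c and inserting the Hardy bound yields the constant K.\<close>
    have pt: "(norm (f x))\<^sup>2 \<le> 2 * (norm (Lsym 0 \<alpha> x (f x)))\<^sup>2 + (1 + 2 * \<alpha>\<^sup>2) * (norm (s x))\<^sup>2" for x
    proof -
      have "fst (f x) = fst (Lsym 0 \<alpha> x (f x)) + - vec_cmult (\<alpha> *\<^sub>R perp (e0 x)) (s x)" unfolding Lsym_0 s_def by simp
      then have "(norm (fst (f x)))\<^sup>2 \<le> 2 * (norm (fst (Lsym 0 \<alpha> x (f x))))\<^sup>2 + 2 * (norm (vec_cmult (\<alpha> *\<^sub>R perp (e0 x)) (s x)))\<^sup>2"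
        using norm_add_sq_le[of "fst (Lsym 0 \<alpha> x (f x))" "- vec_cmult (\<alpha> *\<^sub>R perp (e0 x)) (s x)"] by simp
      moreover have "(norm (fst (Lsym 0 \<alpha> x (f x))))\<^sup>2 = (norm (Lsym 0 \<alpha> x (f x)))\<^sup>2" using Lsym_0(2)[of \<alpha> x "f x"] by (simp add: norm_prod_def)
      moreover have "(norm (vec_cmult (\<alpha> *\<^sub>R perp (e0 x)) (s x)))\<^sup>2 \<le> \<alpha>\<^sup>2 * (norm (s x))\<^sup>2"
      proof -
        have "(norm (e0 x))\<^sup>2 \<le> 1" using power_mono[OF e0_norm[of x] norm_ge_zero, of 2] by simp
        then have "(norm (e0 x))\<^sup>2 * (\<alpha>\<^sup>2 * (norm (s x))\<^sup>2) \<le> 1 * (\<alpha>\<^sup>2 * (norm (s x))\<^sup>2)" by (intro mult_right_mono) auto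
        then show ?thesis by (simp add: norm_vec_cmult norm_perp power_mult_distrib mult_ac)
      qed
      moreover have "(norm (f x))\<^sup>2 = (norm (fst (f x)))\<^sup>2 + (norm (s x))\<^sup>2" by (simp add: norm_prod_def s_def)
      ultimately show ?thesis by (simp add: algebra_simps)
    qed
    have "(norm U)\<^sup>2 \<le> 2 * (norm (Lop 0 \<alpha> U))\<^sup>2 + (1 + 2 * \<alpha>\<^sup>2) * (norm (abs_l2 s))\<^sup>2"
    proof -
      have i: "integrable lebesgue (\<lambda>x. (norm (f x))\<^sup>2)" "integrable lebesgue (\<lambda>x. (norm (Lsym 0 \<alpha> x (f x)))\<^sup>2)" "integrable lebesgue (\<lambda>x. (norm (s x))\<^sup>2)"
        using f(1) Lf(1) s by (auto simp: sqint_def)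
      have "(\<integral>x. (norm (f x))\<^sup>2 \<partial>lebesgue) \<le> (\<integral>x. 2 * (norm (Lsym 0 \<alpha> x (f x)))\<^sup>2 + (1 + 2 * \<alpha>\<^sup>2) * (norm (s x))\<^sup>2 \<partial>lebesgue)"
        using i by (intro integral_mono pt) auto
      then show ?thesis unfolding Lf(2) unfolding f(2) using i by (simp add: norm_abs_l2 f(1) Lf(1) s)
    qed
    then have "c * (norm U)\<^sup>2 \<le> c * (2 * (norm (Lop 0 \<alpha> U))\<^sup>2 + (1 + 2 * \<alpha>\<^sup>2) * (norm (abs_l2 s))\<^sup>2)" using c by (intro mult_left_mono) auto
    also have "\<dots> = 2 * c * (norm (Lop 0 \<alpha> U))\<^sup>2 + (1 + 2 * \<alpha>\<^sup>2) * (c * (norm (abs_l2 s))\<^sup>2)" by (simp add: algebra_simps)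
    also have "\<dots> \<le> 2 * c * (norm (Lop 0 \<alpha> U))\<^sup>2 + (1 + 2 * \<alpha>\<^sup>2) * ((2 * pi)\<^sup>2 * (norm (Lop 0 \<alpha> U))\<^sup>2)" by (intro add_left_mono mult_left_mono h) auto
    also have "\<dots> = K * (Aop 0 \<alpha> U \<bullet> U)" unfolding Aop_0 K_def by (simp add: algebra_simps)
    finally show ?thesis using K by (simp add: field_simps)
  qed
  have "closed {U. c / K * (norm U)\<^sup>2 \<le> Aop 0 \<alpha> U \<bullet> U}" by (intro closed_Collect_le continuous_intros)
  moreover have "D \<subseteq> {U. c / K * (norm U)\<^sup>2 \<le> Aop 0 \<alpha> U \<bullet> U}" using D by blast
  ultimately have "V \<subseteq> {U. c / K * (norm U)\<^sup>2 \<le> Aop 0 \<alpha> U \<bullet> U}" unfolding V_eq by (intro closure_minimal)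
  then show thesis using c K by (intro that[of "c / K"]) auto
qed

lemma Bop_0_triangle: "Bop 0 (x + y) \<bullet> (x + y) \<le> 2 * (Bop 0 x \<bullet> x) + 2 * (Bop 0 y \<bullet> y)"
proof -
  have "Bop 0 (x - y) \<bullet> (x - y) \<ge> 0" by (rule Bop_close(2)[OF small_0])
  then show ?thesis by (simp add: blinfun.bilinear_simps inner_simps)
qed

text \<open>Elements of V are replaced by test functions at distance less than 1/(n + 1), to which
  Rellich's theorem applies; the replacement error is controlled since the form of B is
  bounded.\<close>

lemma compact_V:
  fixes u :: "nat \<Rightarrow> ab_space"
  assumes d: "small d" and u: "\<And>n. u n \<in> V" and b: "bounded (range u)"
  shows "\<exists>r::nat\<Rightarrow>nat. strict_mono r \<and> (\<forall>\<epsilon>>0. \<exists>N. \<forall>m\<ge>N. \<forall>n\<ge>N. Bop d (u (r m) - u (r n)) \<bullet> (u (r m) - u (r n)) < \<epsilon>)"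
proof -
  have "\<exists>\<psi>. \<psi> \<in> test_functions (\<Omega> - {a0}) \<and> norm (abs_l2 (Up 0 \<psi> (grad \<psi>)) - u n) < 1 / real (Suc n)" for n
  proof -
    have "\<exists>y\<in>D. dist y (u n) < 1 / real (Suc n)" using u[of n] unfolding V_eq closure_approachable by simp
    then show ?thesis unfolding D_def dist_norm by blast
  qed
  then obtain \<psi> where \<psi>: "\<And>n. \<psi> n \<in> test_functions (\<Omega> - {a0})" and close: "\<And>n. norm (abs_l2 (Up 0 (\<psi> n) (grad (\<psi> n))) - u n) < 1 / real (Suc n)" by metis
  define w where "w n = abs_l2 (Up 0 (\<psi> n) (grad (\<psi> n)))" for n
  obtain L where L: "\<And>n. norm (u n) \<le> L" using b unfolding bounded_iff by blast
  have w: "norm (w n) \<le> L + 1" for n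
  proof -
    have "norm (w n) \<le> norm (u n) + norm (w n - u n)" using norm_triangle_sub[of "w n" "u n"] by simp
    moreover have "1 / real (Suc n) \<le> 1" by simp
    ultimately show ?thesis using L[of n] close[of n] unfolding w_def by linarith
  qed
  define M where "M = norm (Bop 0)"
  have BM: "Bop 0 x \<bullet> x \<le> M * (norm x)\<^sup>2" for x
  proof -
    have "Bop 0 x \<bullet> x \<le> norm (Bop 0 x) * norm x" by (rule norm_cauchy_schwarz)
    also have "\<dots> \<le> (M * norm x) * norm x" unfolding M_def by (intro mult_right_mono norm_blinfun) simp
    finally show ?thesis by (simp add: power2_eq_square)
  qed
  \<comment> \<open>Large enough for both requirements: M(L + 1)^2 bounds the functions and (L +
    1)^2 their gradients.\<close>
  define K where "K = (M + 1) * (L + 1)\<^sup>2"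
  have M0: "M \<ge> 0" by (simp add: M_def)
  have w2: "(norm (w n))\<^sup>2 \<le> (L + 1)\<^sup>2" for n using w[of n] by (intro power_mono) auto
  obtain r :: "nat \<Rightarrow> nat" where r: "strict_mono r"
    "\<And>\<epsilon>. \<epsilon> > 0 \<Longrightarrow> \<exists>N. \<forall>m\<ge>N. \<forall>n\<ge>N. (\<integral>\<^sup>+x. ennreal ((norm (\<psi> (r m) x - \<psi> (r n) x))\<^sup>2) \<partial>lborel) < ennreal \<epsilon>"
  proof (rule rellich_smooth[where f=\<psi>, OF test_function_smooth(3)[OF \<psi>] \<Omega>_bounded])
    show "x \<notin> \<Omega> \<Longrightarrow> \<psi> n x = 0" for n x using test_function_derivatives_zero(1)[OF \<psi>] by blast
    show "K \<ge> 0" using M0 by (simp add: K_def)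
    show "(\<integral>\<^sup>+x. ennreal ((norm (\<psi> n x))\<^sup>2) \<partial>lborel) \<le> ennreal K" for n
    proof -
      have "Bop 0 (w n) \<bullet> w n \<le> M * (L + 1)\<^sup>2" using BM[of "w n"] mult_left_mono[OF w2 M0, of n] by linarith
      also have "\<dots> \<le> K" by (simp add: K_def mult_right_mono)
      finally show ?thesis unfolding Bop_test[OF \<psi>, symmetric] w_def by (rule ennreal_leI)
    qed
    show "(\<integral>\<^sup>+x. ennreal ((norm (grad (\<psi> n) x))\<^sup>2) \<partial>lborel) \<le> ennreal K" for n
    proof -
      have "(\<integral>\<^sup>+x. ennreal ((norm (grad (\<psi> n) x))\<^sup>2) \<partial>lborel) = (\<integral>\<^sup>+x. ennreal ((norm (grad (\<psi> n) x))\<^sup>2) \<partial>lebesgue)"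
        by (rule nn_integral_lborel_lebesgue) simp
      also have "\<dots> \<le> (\<integral>\<^sup>+x. ennreal ((norm (Up 0 (\<psi> n) (grad (\<psi> n)) x))\<^sup>2) \<partial>lebesgue)"
        using test_function_derivatives_zero(2)[OF \<psi>, of _ n]
        by (intro nn_integral_mono ennreal_leI) (auto simp: Up0 norm_prod_def norm_ivec)
      also have "\<dots> = ennreal ((norm (w n))\<^sup>2)" unfolding w_def by (rule nn_norm_abs_l2[OF sqint_Up_test[OF \<psi>]])
      also have "\<dots> \<le> ennreal K"
      proof (rule ennreal_leI)
        have "1 * (L + 1)\<^sup>2 \<le> K" unfolding K_def using M0 by (intro mult_right_mono) auto
        then show "(norm (w n))\<^sup>2 \<le> K" using w2[of n] by simp
      qed
      finally show ?thesis .
    qed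
  qed blast
  have diff: "ennreal (Bop 0 (w m - w n) \<bullet> (w m - w n)) = (\<integral>\<^sup>+x. ennreal ((norm (\<psi> m x - \<psi> n x))\<^sup>2) \<partial>lborel)" for m n
  proof -
    have t: "(\<lambda>x. \<psi> m x - \<psi> n x) \<in> test_functions (\<Omega> - {a0})"
      using test_functions_add_cmul(1)[OF \<psi>[of m] test_functions_add_cmul(2)[OF \<psi>[of n] \<psi>[of n], of "-1"]] by simp
    have "grad (\<lambda>x. \<psi> m x - \<psi> n x) = (\<lambda>x. grad (\<psi> m) x - grad (\<psi> n) x)"
      by (simp add: fun_eq_iff grad_diff[OF test_function_smooth(2)[OF \<psi>] test_function_smooth(2)[OF \<psi>]])
    then have "Up 0 (\<lambda>x. \<psi> m x - \<psi> n x) (grad (\<lambda>x. \<psi> m x - \<psi> n x)) = (\<lambda>x. Up 0 (\<psi> m) (grad (\<psi> m)) x - Up 0 (\<psi> n) (grad (\<psi> n)) x)"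
      by (simp only: Up_diff[abs_def])
    then have "w m - w n = abs_l2 (Up 0 (\<lambda>x. \<psi> m x - \<psi> n x) (grad (\<lambda>x. \<psi> m x - \<psi> n x)))"
      unfolding w_def by (simp add: abs_l2_diff sqint_Up_test[OF \<psi>])
    then show ?thesis using Bop_test[OF t] by simp
  qed
  show ?thesis
  proof (intro exI[of _ r] conjI r(1) allI impI)
    fix \<epsilon> :: real assume \<epsilon>: "\<epsilon> > 0"
    \<comment> \<open>Splitting the form over x + y costs a factor 2 and passing from d = 0 to d a
      factor 3/2; two terms with factor 3 give the 6.\<close>
    define \<epsilon>' where "\<epsilon>' = \<epsilon> / 6"
    have \<epsilon>': "\<epsilon>' > 0" using \<epsilon> by (simp add: \<epsilon>'_def)
    obtain N1 where N1: "\<And>m n. m \<ge> N1 \<Longrightarrow> n \<ge> N1 \<Longrightarrow> (\<integral>\<^sup>+x. ennreal ((norm (\<psi> (r m) x - \<psi> (r n) x))\<^sup>2) \<partial>lborel) < ennreal \<epsilon>'"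
      using r(2)[OF \<epsilon>'] by blast
    have "(\<lambda>n. M * (2 * (1 / real (Suc n)))\<^sup>2) \<longlonglongrightarrow> M * (2 * 0)\<^sup>2"
      by (intro tendsto_intros LIMSEQ_Suc[OF lim_1_over_n])
    then have "eventually (\<lambda>n. M * (2 * (1 / real (Suc n)))\<^sup>2 < \<epsilon>') sequentially" using \<epsilon>' by (intro order_tendstoD(2)) auto
    then obtain N2 where N2: "M * (2 * (1 / real (Suc N2)))\<^sup>2 < \<epsilon>'" unfolding eventually_sequentially by blast
    show "\<exists>N. \<forall>m\<ge>N. \<forall>n\<ge>N. Bop d (u (r m) - u (r n)) \<bullet> (u (r m) - u (r n)) < \<epsilon>"
    proof (intro exI[of _ "max N1 N2"] allI impI)
      fix m n assume mn: "max N1 N2 \<le> m" "max N1 N2 \<le> n"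
      define y where "y = w (r m) - w (r n)"
      define x where "x = (u (r m) - u (r n)) - y"
      have close': "norm (w (r k) - u (r k)) \<le> 1 / real (Suc N2)" if "N2 \<le> k" for k
      proof -
        have "N2 \<le> r k" using that seq_suble[OF r(1), of k] by linarith
        then have "1 / real (Suc (r k)) \<le> 1 / real (Suc N2)" by (intro divide_left_mono) auto
        then show ?thesis using close[of "r k"] unfolding w_def by linarith
      qed
      have "x = (w (r n) - u (r n)) - (w (r m) - u (r m))" by (simp add: x_def y_def)
      then have "norm x \<le> norm (w (r n) - u (r n)) + norm (w (r m) - u (r m))" by (metis norm_triangle_ineq4)
      then have "norm x \<le> 2 * (1 / real (Suc N2))" using close'[of m] close'[of n] mn by simp
      then have "M * (norm x)\<^sup>2 \<le> M * (2 * (1 / real (Suc N2)))\<^sup>2" by (intro mult_left_mono power_mono M0) auto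
      then have x: "Bop 0 x \<bullet> x < \<epsilon>'" using BM[of x] N2 by linarith
      have "ennreal (Bop 0 y \<bullet> y) < ennreal \<epsilon>'" using N1[of m n] mn unfolding diff[symmetric] y_def by simp
      then have y: "Bop 0 y \<bullet> y < \<epsilon>'" using Bop_close(2)[OF small_0, of y] \<epsilon>' by (simp add: ennreal_less_iff)
      have "Bop d (x + y) \<bullet> (x + y) \<le> 3 * (Bop 0 x \<bullet> x) + 3 * (Bop 0 y \<bullet> y)"
        using Bop_half(1)[OF d, of "x + y"] Bop_0_triangle[of x y] by linarith
      also have "\<dots> < \<epsilon>" using x y unfolding \<epsilon>'_def by linarith
      finally show "Bop d (u (r m) - u (r n)) \<bullet> (u (r m) - u (r n)) < \<epsilon>" by (simp add: x_def)
    qed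
  qed
qed

text \<open>Bumps with disjoint supports are orthogonal, also after multiplication by the imaginary
  unit, hence independent over the complex numbers.\<close>

lemma infinite_dim_V:
  "\<exists>f::nat \<Rightarrow> ab_space. (\<forall>i<n. f i \<in> V) \<and> (\<forall>c. (\<Sum>i<n. Jc.cscale (c i) (f i)) = 0 \<longrightarrow> (\<forall>i<n. c i = 0))"
proof -
  \<comment> \<open>The centres lie on a ray at distances h, 2h, ..., nh from a0. Balls of radius
    h/4 around them are disjoint, avoid a0 and stay within distance (n + 1)h = R.\<close>
  define h where "h = R / real (Suc n)"
  have h: "h > 0" using rR by (simp add: h_def)
  define p where "p i = a0 + (h * real (Suc i)) *\<^sub>R axis 1 (1::real)" for i
  have pa: "norm (p i - a0) = h * real (Suc i)" for i using h by (simp add: p_def)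
  have pp: "norm (p i - p j) = h * \<bar>real i - real j\<bar>" for i j
  proof -
    have "p i - p j = (h * (real i - real j)) *\<^sub>R axis 1 1" by (simp add: p_def algebra_simps)
    then show ?thesis using h by (simp add: abs_mult)
  qed
  define B where "B i = cball (p i) (h / 4)" for i
  define \<psi> where "\<psi> i x = complex_of_real (bump (p i) (h / 4) x)" for i x
  have supp: "{x. \<psi> i x \<noteq> 0} = ball (p i) (h / 4)" for i using h by (auto simp: \<psi>_def bump_eq_0_iff)
  have cl: "closure {x. \<psi> i x \<noteq> 0} = B i" for i unfolding supp B_def using h by (intro closure_ball) simp
  have "Ck_on m UNIV (\<psi> i)" for m i
    unfolding \<psi>_def[abs_def] by (rule Ck_on_bounded_linear[OF open_UNIV bounded_linear_of_real Ck_on_bump])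
  then have tB: "\<psi> i \<in> test_functions (B i)" for i
    unfolding test_functions_def smooth_on_def mem_Collect_eq cl by (simp add: B_def)
  have sub: "B i \<subseteq> \<Omega> - {a0}" if "i < n" for i
  proof
    fix x assume "x \<in> B i"
    then have x: "norm (p i - x) \<le> h / 4" by (simp add: B_def dist_norm)
    have "norm (x - a0) \<le> norm (p i - a0) + norm (p i - x)" using norm_triangle_ineq4[of "p i - a0" "p i - x"] by simp
    also have "\<dots> \<le> h * real (Suc i) + h" using x h pa[of i] by simp
    also have "\<dots> = h * real (Suc (Suc i))" by (simp add: algebra_simps)
    also have "\<dots> \<le> h * real (Suc n)" using that h by (intro mult_left_mono) auto
    finally have "norm (x - a0) \<le> R" by (simp add: h_def)
    then have "x \<in> \<Omega>" using ball_\<Omega> by (auto simp: dist_norm norm_minus_commute)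
    moreover have "x \<noteq> a0"
    proof
      assume "x = a0"
      then have "h * real (Suc i) \<le> h / 4" using x pa[of i] by simp
      moreover have "h * 1 \<le> h * real (Suc i)" using h by (intro mult_left_mono) auto
      ultimately show False using h by simp
    qed
    ultimately show "x \<in> \<Omega> - {a0}" by simp
  qed
  have t: "\<psi> i \<in> test_functions (\<Omega> - {a0})" if "i < n" for i
    using tB[of i] sub[OF that] by (auto simp: test_functions_def)
  have disj: "x \<notin> B i \<or> x \<notin> B j" if "i \<noteq> j" for i j x
  proof (rule ccontr)
    assume "\<not> ?thesis"
    then have x: "norm (p i - x) \<le> h / 4" "norm (p j - x) \<le> h / 4" by (auto simp: B_def dist_norm)
    have "norm (p i - p j) \<le> norm (p i - x) + norm (p j - x)" using norm_triangle_ineq4[of "p i - x" "p j - x"] by simp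
    moreover have "h * 1 \<le> norm (p i - p j)" unfolding pp using that h by (intro mult_left_mono) auto
    ultimately show False using x h by linarith
  qed
  define U where "U i = Up 0 (\<psi> i) (grad (\<psi> i))" for i
  define F where "F i = abs_l2 (U i)" for i
  have sq: "sqint (U i)" if "i < n" for i unfolding U_def by (rule sqint_Up_test[OF t[OF that]])
  have U0: "U i x = 0" if "x \<notin> B i" for i x
    using test_function_derivatives_zero(1,2)[OF tB that] by (simp add: U_def Up0 prod_eq_iff ivec_def vec_eq_iff)
  have orth: "F i \<bullet> F j = 0" "Jc (F i) \<bullet> F j = 0" if ij: "i < n" "j < n" "i \<noteq> j" for i j
  proof -
    have "U i x \<bullet> U j x = 0" "cmul \<i> (U i x) \<bullet> U j x = 0" for x
      using disj[OF ij(3), of x] U0[of x i] U0[of x j] by (auto simp: cmul_def inner_vec_def inner_prod_def)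
    then show "F i \<bullet> F j = 0" "Jc (F i) \<bullet> F j = 0"
      unfolding F_def using sq ij by (simp_all add: Jc_abs inner_abs_l2 l2_symbol_sqint[OF cmul_symbol])
  qed
  have F: "F i \<noteq> 0" if i: "i < n" for i
  proof
    assume "F i = 0"
    then have "(\<integral>\<^sup>+x. ennreal ((norm (\<psi> i x))\<^sup>2) \<partial>lborel) = 0"
      using Bop_test[OF t[OF i]] by (simp add: F_def U_def blinfun.zero_right)
    then have "(\<integral>\<^sup>+x. ennreal ((norm (\<psi> i x))\<^sup>2) \<partial>lebesgue) = 0" by (simp add: nn_integral_completion)
    moreover have "(\<lambda>x. ennreal ((norm (\<psi> i x))\<^sup>2)) \<in> borel_measurable lebesgue"
      using Ck_on_1_grad(4)[OF test_function_smooth(3)[OF tB[of i]]] by (intro borel_imp_lebesgue_measurable) measurable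
    ultimately have "AE x in lebesgue. ennreal ((norm (\<psi> i x))\<^sup>2) = 0" by (simp add: nn_integral_0_iff_AE)
    then have "AE x in lebesgue. x \<notin> ball (p i) (h / 4)" unfolding supp[symmetric] by eventually_elim simp
    then have "ball (p i) (h / 4) \<in> null_sets lebesgue" by (subst AE_iff_null_sets) auto
    then show False using h open_not_negligible[of "ball (p i) (h / 4)"] by (simp add: negligible_iff_null_sets)
  qed
  show ?thesis
  proof (intro exI[of _ F] conjI allI impI)
    show "F i \<in> V" if "i < n" for i using D_V t[OF that] unfolding D_def F_def U_def by blast
    fix c i assume 0: "(\<Sum>i<n. Jc.cscale (c i) (F i)) = 0" and i: "i < n"
    have JF: "Jc (F i) \<bullet> F i = 0" using Jc.J_left[of "F i" "F i"] by (simp add: inner_commute)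
    have "(\<Sum>j<n. Jc.cscale (c j) (F j)) \<bullet> F i = (\<Sum>j<n. if j = i then Re (c i) * (F i \<bullet> F i) else 0)"
      unfolding inner_sum_left by (rule sum.cong) (auto simp: Jc.cscale_def inner_simps orth i JF)
    then have 1: "Re (c i) * (F i \<bullet> F i) = 0" using 0 i by simp
    have "(\<Sum>j<n. Jc.cscale (c j) (F j)) \<bullet> Jc (F i) = (\<Sum>j<n. if j = i then Im (c i) * (F i \<bullet> F i) else 0)"
      unfolding inner_sum_left
    proof (rule sum.cong[OF refl])
      fix j assume "j \<in> {..<n}"
      moreover have "F j \<bullet> Jc (F i) = - (Jc (F j) \<bullet> F i)" by (simp add: Jc.J_left)
      ultimately show "Jc.cscale (c j) (F j) \<bullet> Jc (F i) = (if j = i then Im (c i) * (F i \<bullet> F i) else 0)"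
        by (cases "j = i") (auto simp: Jc.cscale_def inner_simps orth i JF Jc.J_inner)
    qed
    then have 2: "Im (c i) * (F i \<bullet> F i) = 0" using 0 i by simp
    show "c i = 0" using 1 2 F[OF i] by (simp add: complex_eq_iff)
  qed
qed

text \<open>Only coercivity needs a smaller neighbourhood: where A differs from its value at the
  centre by at most half of the constant in operator norm, the other half remains.\<close>

lemma pencil_exists:
  assumes \<alpha>0: "\<alpha>0 \<notin> \<int>"
  obtains N' \<gamma> where "open N'" "(a0, \<alpha>0) \<in> N'" "N' \<subseteq> N" "\<gamma> > 0"
    "\<And>p. p \<in> N' \<Longrightarrow> pencil Jc V (Aop (fst p - a0) (snd p)) (Bop (fst p - a0)) \<gamma>"
proof -
  obtain \<gamma> where \<gamma>: "\<gamma> > 0" "\<And>U. U \<in> V \<Longrightarrow> \<gamma> * (norm U)\<^sup>2 \<le> Aop 0 \<alpha>0 U \<bullet> U" using coercive_0[OF \<alpha>0] by blast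
  have "continuous_on N (\<lambda>p. Aop (fst p - a0) (snd p))" using Aop_smooth[of 0] by simp
  moreover have mem: "(a0, \<alpha>0) \<in> N" using \<delta>(1) by (simp add: N_def)
  ultimately obtain e where e: "e > 0" "\<And>p. p \<in> N \<Longrightarrow> dist p (a0, \<alpha>0) < e \<Longrightarrow> dist (Aop (fst p - a0) (snd p)) (Aop 0 \<alpha>0) < \<gamma> / 2"
    unfolding continuous_on_iff using \<gamma>(1) half_gt_zero by (metis diff_self fst_conv snd_conv)
  show thesis
  proof (rule that[of "N \<inter> ball (a0, \<alpha>0) e" "\<gamma> / 2"])
    fix p assume p: "p \<in> N \<inter> ball (a0, \<alpha>0) e"
    have d: "small (fst p - a0)" using p N_small by blast
    interpret complex_subspace Jc V by (rule V_complex_subspace)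
    show "pencil Jc V (Aop (fst p - a0) (snd p)) (Bop (fst p - a0)) (\<gamma> / 2)"
    proof unfold_locales
      fix x assume x: "x \<in> V"
      have "norm (Aop (fst p - a0) (snd p) - Aop 0 \<alpha>0) \<le> \<gamma> / 2" using e(2)[of p] p by (auto simp: dist_norm norm_minus_commute)
      then have "norm (Aop (fst p - a0) (snd p) - Aop 0 \<alpha>0) * (norm x)\<^sup>2 \<le> \<gamma> / 2 * (norm x)\<^sup>2" by (intro mult_right_mono) auto
      then have "\<bar>Aop (fst p - a0) (snd p) x \<bullet> x - Aop 0 \<alpha>0 x \<bullet> x\<bar> \<le> \<gamma> / 2 * (norm x)\<^sup>2"
        using quadratic_form_diff_le[of "Aop (fst p - a0) (snd p)" x "Aop 0 \<alpha>0"] by linarith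
      then show "\<gamma> / 2 * (norm x)\<^sup>2 \<le> Aop (fst p - a0) (snd p) x \<bullet> x"
        using \<gamma>(2)[OF x] unfolding times_divide_eq_left abs_le_iff by linarith
    qed (rule Aop_sym Bop_sym Aop_Jc[OF d] Bop_Jc infinite_dim_V half_gt_zero[OF \<gamma>(1)] B_positive[OF d] compact_V[OF d] | assumption)+
  qed (use e(1) mem \<gamma>(1) N_open in auto)
qed

section \<open>Eigenvalues\<close>

lemma in_H10_add:
  assumes d: "small d" and u: "in_H10 \<Omega> (a0 + d) u G" and v: "in_H10 \<Omega> (a0 + d) v H"
  shows "in_H10 \<Omega> (a0 + d) (\<lambda>x. u x + v x) (\<lambda>x. G x + H x)"
    and "abs_l2 (Up d (\<lambda>x. u x + v x) (\<lambda>x. G x + H x)) = abs_l2 (Up d u G) + abs_l2 (Up d v H)"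
proof -
  note u = in_H10_D[OF d u] and v = in_H10_D[OF d v]
  have m: "(\<lambda>x. u x + v x) \<in> borel_measurable (lebesgue_on \<Omega>)" "(\<lambda>x. G x + H x) \<in> borel_measurable (lebesgue_on \<Omega>)"
    by (intro borel_measurable_add u v)+
  show *: "abs_l2 (Up d (\<lambda>x. u x + v x) (\<lambda>x. G x + H x)) = abs_l2 (Up d u G) + abs_l2 (Up d v H)"
    unfolding Up_add[abs_def] by (rule abs_l2_add[OF u(3) v(3)])
  have "sqint (Up d (\<lambda>x. u x + v x) (\<lambda>x. G x + H x))"
    unfolding Up_add[abs_def] by (rule sqint_add[OF u(3) v(3)])
  then show "in_H10 \<Omega> (a0 + d) (\<lambda>x. u x + v x) (\<lambda>x. G x + H x)"
    unfolding in_H10_iff[OF d m] * using V_add[OF u(4) v(4)] by blast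
qed

lemma in_H10_cmul:
  assumes d: "small d" and u: "in_H10 \<Omega> (a0 + d) u G"
  shows "in_H10 \<Omega> (a0 + d) (\<lambda>x. c * u x) (\<lambda>x. \<chi> j. c * G x $ j)"
    and "abs_l2 (Up d (\<lambda>x. c * u x) (\<lambda>x. \<chi> j. c * G x $ j)) = Jc.cscale c (abs_l2 (Up d u G))"
proof -
  note u = in_H10_D[OF d u]
  note [measurable] = u(1,2)
  have m: "(\<lambda>x. c * u x) \<in> borel_measurable (lebesgue_on \<Omega>)" "(\<lambda>x. \<chi> j. c * G x $ j) \<in> borel_measurable (lebesgue_on \<Omega>)"
    by measurable
  show *: "abs_l2 (Up d (\<lambda>x. c * u x) (\<lambda>x. \<chi> j. c * G x $ j)) = Jc.cscale c (abs_l2 (Up d u G))"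
    unfolding Up_cmul[abs_def] by (rule cscale_abs[OF u(3), symmetric])
  have "sqint (Up d (\<lambda>x. c * u x) (\<lambda>x. \<chi> j. c * G x $ j))"
    unfolding Up_cmul[abs_def] by (rule l2_symbol_sqint[OF cmul_symbol u(3)])
  then show "in_H10 \<Omega> (a0 + d) (\<lambda>x. c * u x) (\<lambda>x. \<chi> j. c * G x $ j)"
    unfolding in_H10_iff[OF d m] * using V_cscale[OF u(4)] by blast
qed

lemma in_H10_combination:
  fixes m :: nat
  assumes d: "small d" and u: "\<And>i. i < m \<Longrightarrow> in_H10 \<Omega> (a0 + d) (u i) (G i)"
  shows "\<exists>H. in_H10 \<Omega> (a0 + d) (\<lambda>x. \<Sum>i<m. c i * u i x) H \<and>
    abs_l2 (Up d (\<lambda>x. \<Sum>i<m. c i * u i x) H) = (\<Sum>i<m. Jc.cscale (c i) (abs_l2 (Up d (u i) (G i))))"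
  using u
proof (induction m)
  case 0
  have "Up d (\<lambda>x. 0) (\<lambda>x. 0) x = 0" for x
    using Up_diff[of d "\<lambda>x. 0" "\<lambda>x. 0" "\<lambda>x. 0" "\<lambda>x. 0" x] by simp
  then have U: "Up d (\<lambda>x. 0) (\<lambda>x. 0) = (\<lambda>x. 0)" by (simp add: fun_eq_iff)
  have "in_H10 \<Omega> (a0 + d) (\<lambda>x. 0) (\<lambda>x. 0)"
    using in_H10_iff[OF d, of "\<lambda>x. 0" "\<lambda>x. 0"] D_V[OF D_nonempty] by (simp add: U abs_l2_0)
  then show ?case by (intro exI[of _ "\<lambda>x. 0"]) (simp add: U abs_l2_0)
next
  case (Suc m)
  then obtain H where H: "in_H10 \<Omega> (a0 + d) (\<lambda>x. \<Sum>i<m. c i * u i x) H"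
    "abs_l2 (Up d (\<lambda>x. \<Sum>i<m. c i * u i x) H) = (\<Sum>i<m. Jc.cscale (c i) (abs_l2 (Up d (u i) (G i))))" by auto
  have um: "in_H10 \<Omega> (a0 + d) (u m) (G m)" using Suc.prems by simp
  note cm = in_H10_cmul[OF d um, of "c m"]
  show ?case
    using in_H10_add[OF d H(1) cm(1)] by (intro exI[of _ "\<lambda>x. H x + (\<chi> j. c m * G m x $ j)"]) (simp add: H(2) cm(2))
qed

text \<open>If u vanishes, so does the form of B on its class, and definiteness kills the whole
  class: a function determines its gradient. The converse is the norm equivalence.\<close>

lemma class_zero_iff:
  assumes d: "small d" and u: "in_H10 \<Omega> (a0 + d) u G"
  shows "(AE x in lebesgue_on \<Omega>. u x = 0) \<longleftrightarrow> abs_l2 (Up d u G) = 0"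
proof
  note u' = in_H10_D[OF d u]
  assume "AE x in lebesgue_on \<Omega>. u x = 0"
  then have ae: "AE x in lebesgue_on \<Omega>. u x * cnj (u x) = 0" by eventually_elim simp
  note [measurable] = u'(1)
  have "(\<integral>x. u x * cnj (u x) \<partial>lebesgue_on \<Omega>) = (\<integral>x. 0 \<partial>lebesgue_on \<Omega>)" by (rule integral_cong_AE[OF _ _ ae]) measurable
  then have "Bop d (abs_l2 (Up d u G)) \<bullet> abs_l2 (Up d u G) = 0"
    unfolding form_identities(1)[OF d u u] by (simp add: complex_eq_iff)
  then show "abs_l2 (Up d u G) = 0" using B_positive[OF d u'(4)] by fastforce
next
  note u' = in_H10_D[OF d u]
  assume 0: "abs_l2 (Up d u G) = 0"
  obtain C where "H1a_norm_sq \<Omega> (a0 + d) u G \<le> ennreal C * (\<integral>\<^sup>+x. ennreal ((norm (Up d u G x))\<^sup>2) \<partial>lebesgue)"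
    using Up_norm_lower d u'(1,2) by metis
  then have "H1a_norm_sq \<Omega> (a0 + d) u G = 0" unfolding nn_norm_abs_l2[OF u'(3)] 0 by simp
  then have "(\<integral>\<^sup>+x. ennreal ((norm (u x))\<^sup>2) \<partial>lebesgue_on \<Omega>) = 0" by (simp add: H1a_norm_sq_def)
  then have "AE x in lebesgue_on \<Omega>. ennreal ((norm (u x))\<^sup>2) = 0" using u'(1) by (subst (asm) nn_integral_0_iff_AE) auto
  then show "AE x in lebesgue_on \<Omega>. u x = 0" by eventually_elim simp
qed

lemma class_eq_iff:
  assumes d: "small d" and u: "in_H10 \<Omega> (a0 + d) u G" and v: "in_H10 \<Omega> (a0 + d) v H"
  shows "(AE x in lebesgue_on \<Omega>. u x = v x) \<longleftrightarrow> abs_l2 (Up d u G) = abs_l2 (Up d v H)"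
proof -
  note m = in_H10_cmul[OF d v, of "-1"]
  have "(AE x in lebesgue_on \<Omega>. u x + - 1 * v x = 0) \<longleftrightarrow> abs_l2 (Up d u G) + Jc.cscale (-1) (abs_l2 (Up d v H)) = 0"
    unfolding class_zero_iff[OF d in_H10_add(1)[OF d u m(1)]] in_H10_add(2)[OF d u m(1)] m(2) ..
  then show ?thesis by (simp add: Jc.cscale_def)
qed

context
  fixes d \<alpha> \<gamma> assumes d: "small d" and pen: "pencil Jc V (Aop d \<alpha>) (Bop d) \<gamma>"
begin

interpretation P: pencil Jc V "Aop d \<alpha>" "Bop d" \<gamma> by (rule pen)

text \<open>The definition only asks for some gradient G. As u determines the class of the pair, any
  admissible gradient decides membership, and V consists of such classes.\<close>

lemma AB_eigenspace_iff:
  assumes u: "in_H10 \<Omega> (a0 + d) u G"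
  shows "u \<in> AB_eigenspace \<Omega> (a0 + d) \<alpha> \<mu> \<longleftrightarrow> abs_l2 (Up d u G) \<in> P.eigenspace \<mu>"
proof -
  have *: "abs_l2 (Up d u G) \<in> P.eigenspace \<mu> \<longleftrightarrow> (\<forall>v H. in_H10 \<Omega> (a0 + d) v H \<longrightarrow>
       (\<integral>x. (\<Sum>j\<in>UNIV. magnetic_grad (a0 + d) \<alpha> u G x $ j * cnj (magnetic_grad (a0 + d) \<alpha> v H x $ j)) \<partial>lebesgue_on \<Omega>)
       = \<mu> * (\<integral>x. u x * cnj (v x) \<partial>lebesgue_on \<Omega>))" if u: "in_H10 \<Omega> (a0 + d) u G" for G
  proof (intro iffI allI impI)
    fix v H assume "abs_l2 (Up d u G) \<in> P.eigenspace \<mu>" and v: "in_H10 \<Omega> (a0 + d) v H"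
    then show "(\<integral>x. (\<Sum>j\<in>UNIV. magnetic_grad (a0 + d) \<alpha> u G x $ j * cnj (magnetic_grad (a0 + d) \<alpha> v H x $ j)) \<partial>lebesgue_on \<Omega>)
       = \<mu> * (\<integral>x. u x * cnj (v x) \<partial>lebesgue_on \<Omega>)"
      unfolding form_identities[OF d u v] using in_H10_D(4)[OF d v] by (simp add: P.eigenspace_def P.ac_def P.bc_def)
  next
    assume A: "\<forall>v H. in_H10 \<Omega> (a0 + d) v H \<longrightarrow>
       (\<integral>x. (\<Sum>j\<in>UNIV. magnetic_grad (a0 + d) \<alpha> u G x $ j * cnj (magnetic_grad (a0 + d) \<alpha> v H x $ j)) \<partial>lebesgue_on \<Omega>)
       = \<mu> * (\<integral>x. u x * cnj (v x) \<partial>lebesgue_on \<Omega>)"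
    have "P.ac (abs_l2 (Up d u G)) W = \<mu> * P.bc (abs_l2 (Up d u G)) W" if W: "W \<in> V" for W
    proof -
      obtain v H where v: "in_H10 \<Omega> (a0 + d) v H" "abs_l2 (Up d v H) = W" using V_total[OF d W] by blast
      show ?thesis using A[rule_format, OF v(1)] unfolding form_identities[OF d u v(1)] v(2) P.ac_def P.bc_def .
    qed
    then show "abs_l2 (Up d u G) \<in> P.eigenspace \<mu>" unfolding P.eigenspace_def using in_H10_D(4)[OF d u] by blast
  qed
  show ?thesis
  proof
    assume "u \<in> AB_eigenspace \<Omega> (a0 + d) \<alpha> \<mu>"
    then obtain G' where G': "in_H10 \<Omega> (a0 + d) u G'" "abs_l2 (Up d u G') \<in> P.eigenspace \<mu>"
      unfolding AB_eigenspace_def using * by blast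
    moreover have "abs_l2 (Up d u G') = abs_l2 (Up d u G)" using class_eq_iff[OF d G'(1) u] by simp
    ultimately show "abs_l2 (Up d u G) \<in> P.eigenspace \<mu>" by simp
  next
    assume "abs_l2 (Up d u G) \<in> P.eigenspace \<mu>"
    then show "u \<in> AB_eigenspace \<Omega> (a0 + d) \<alpha> \<mu>" unfolding AB_eigenspace_def using * u by blast
  qed
qed

lemma AB_eigenspace_D: "u \<in> AB_eigenspace \<Omega> (a0 + d) \<alpha> \<mu> \<Longrightarrow> \<exists>G. in_H10 \<Omega> (a0 + d) u G"
  unfolding AB_eigenspace_def by blast

text \<open>Representatives and classes correspond under complex combinations, so a basis modulo
  null functions on one side is a basis in V on the other. In each direction the missing gradients
  or representatives are chosen index by index.\<close>

lemma has_multiplicity_iff: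
  "has_multiplicity \<Omega> (a0 + d) \<alpha> \<mu> m \<longleftrightarrow> (\<exists>f. Jc.is_basis m f (P.eigenspace \<mu>))"
proof -
  have transfer: "((\<forall>i<m. u i \<in> AB_eigenspace \<Omega> (a0 + d) \<alpha> \<mu>) \<and>
       (\<forall>c. (AE x in lebesgue_on \<Omega>. (\<Sum>i<m. c i * u i x) = 0) \<longrightarrow> (\<forall>i<m. c i = 0)) \<and>
       (\<forall>v\<in>AB_eigenspace \<Omega> (a0 + d) \<alpha> \<mu>. \<exists>c. AE x in lebesgue_on \<Omega>. v x = (\<Sum>i<m. c i * u i x)))
     \<longleftrightarrow> Jc.is_basis m f (P.eigenspace \<mu>)"
    if u: "\<And>i. i < m \<Longrightarrow> in_H10 \<Omega> (a0 + d) (u i) (G i)" and f: "\<And>i. i < m \<Longrightarrow> f i = abs_l2 (Up d (u i) (G i))" for u G f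
  proof -
    have comb: "\<exists>H. in_H10 \<Omega> (a0 + d) (\<lambda>x. \<Sum>i<m. c i * u i x) H \<and>
      abs_l2 (Up d (\<lambda>x. \<Sum>i<m. c i * u i x) H) = (\<Sum>i<m. Jc.cscale (c i) (f i))" for c
      using in_H10_combination[where m=m and c=c and u=u and G=G, OF d u] f by simp
    have 1: "(\<forall>i<m. u i \<in> AB_eigenspace \<Omega> (a0 + d) \<alpha> \<mu>) \<longleftrightarrow> (\<forall>i<m. f i \<in> P.eigenspace \<mu>)"
      using AB_eigenspace_iff[OF u] f by auto
    have 2: "(AE x in lebesgue_on \<Omega>. (\<Sum>i<m. c i * u i x) = 0) \<longleftrightarrow> (\<Sum>i<m. Jc.cscale (c i) (f i)) = 0" for c
    proof -
      obtain H where H: "in_H10 \<Omega> (a0 + d) (\<lambda>x. \<Sum>i<m. c i * u i x) H"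
        "abs_l2 (Up d (\<lambda>x. \<Sum>i<m. c i * u i x) H) = (\<Sum>i<m. Jc.cscale (c i) (f i))" using comb[of c] by blast
      show ?thesis unfolding class_zero_iff[OF d H(1)] H(2) ..
    qed
    have 3: "(AE x in lebesgue_on \<Omega>. v x = (\<Sum>i<m. c i * u i x)) \<longleftrightarrow> abs_l2 (Up d v H) = (\<Sum>i<m. Jc.cscale (c i) (f i))"
      if v: "in_H10 \<Omega> (a0 + d) v H" for v H c
    proof -
      obtain H' where H': "in_H10 \<Omega> (a0 + d) (\<lambda>x. \<Sum>i<m. c i * u i x) H'"
        "abs_l2 (Up d (\<lambda>x. \<Sum>i<m. c i * u i x) H') = (\<Sum>i<m. Jc.cscale (c i) (f i))" using comb[of c] by blast
      show ?thesis unfolding class_eq_iff[OF d v H'(1)] H'(2) ..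
    qed
    have 4: "(\<forall>v\<in>AB_eigenspace \<Omega> (a0 + d) \<alpha> \<mu>. \<exists>c. AE x in lebesgue_on \<Omega>. v x = (\<Sum>i<m. c i * u i x)) \<longleftrightarrow>
      (\<forall>x\<in>P.eigenspace \<mu>. \<exists>c. x = (\<Sum>i<m. Jc.cscale (c i) (f i)))"
    proof (intro iffI ballI)
      fix x assume A: "\<forall>v\<in>AB_eigenspace \<Omega> (a0 + d) \<alpha> \<mu>. \<exists>c. AE x in lebesgue_on \<Omega>. v x = (\<Sum>i<m. c i * u i x)"
        and x: "x \<in> P.eigenspace \<mu>"
      then have "x \<in> V" by (simp add: P.eigenspace_def)
      then obtain v H where v: "in_H10 \<Omega> (a0 + d) v H" "abs_l2 (Up d v H) = x" using V_total[OF d] by metis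
      then have "v \<in> AB_eigenspace \<Omega> (a0 + d) \<alpha> \<mu>" using AB_eigenspace_iff x by blast
      then show "\<exists>c. x = (\<Sum>i<m. Jc.cscale (c i) (f i))" using A 3[OF v(1)] v(2) by blast
    next
      fix v assume A: "\<forall>x\<in>P.eigenspace \<mu>. \<exists>c. x = (\<Sum>i<m. Jc.cscale (c i) (f i))" and v: "v \<in> AB_eigenspace \<Omega> (a0 + d) \<alpha> \<mu>"
      then obtain H where H: "in_H10 \<Omega> (a0 + d) v H" using AB_eigenspace_D by blast
      then have "abs_l2 (Up d v H) \<in> P.eigenspace \<mu>" using AB_eigenspace_iff v by blast
      then show "\<exists>c. AE x in lebesgue_on \<Omega>. v x = (\<Sum>i<m. c i * u i x)" using A 3[OF H] by blast
    qed
    show ?thesis unfolding Jc.is_basis_def 1 2 4 ..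
  qed
  show ?thesis
  proof
    assume "has_multiplicity \<Omega> (a0 + d) \<alpha> \<mu> m"
    then obtain u where u: "(\<forall>i<m. u i \<in> AB_eigenspace \<Omega> (a0 + d) \<alpha> \<mu>) \<and>
       (\<forall>c. (AE x in lebesgue_on \<Omega>. (\<Sum>i<m. c i * u i x) = 0) \<longrightarrow> (\<forall>i<m. c i = 0)) \<and>
       (\<forall>v\<in>AB_eigenspace \<Omega> (a0 + d) \<alpha> \<mu>. \<exists>c. AE x in lebesgue_on \<Omega>. v x = (\<Sum>i<m. c i * u i x))"
      unfolding has_multiplicity_def ..
    from conjunct1[OF u] have "\<forall>i. \<exists>G. i < m \<longrightarrow> in_H10 \<Omega> (a0 + d) (u i) G" using AB_eigenspace_D by blast
    from choice[OF this] obtain G where G: "\<And>i. i < m \<Longrightarrow> in_H10 \<Omega> (a0 + d) (u i) (G i)" by blast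
    show "\<exists>f. Jc.is_basis m f (P.eigenspace \<mu>)"
      by (rule exI, rule iffD1[OF transfer[OF G refl] u])
  next
    assume "\<exists>f. Jc.is_basis m f (P.eigenspace \<mu>)"
    then obtain f where f: "Jc.is_basis m f (P.eigenspace \<mu>)" ..
    have fV: "f i \<in> V" if "i < m" for i using f that by (auto simp: Jc.is_basis_def P.eigenspace_def)
    have "\<exists>u G. i < m \<longrightarrow> in_H10 \<Omega> (a0 + d) u G \<and> f i = abs_l2 (Up d u G)" for i
    proof (cases "i < m")
      case True
      obtain u G where "in_H10 \<Omega> (a0 + d) u G" "abs_l2 (Up d u G) = f i" by (rule V_total[OF d fV[OF True]])
      then show ?thesis by (intro exI[of _ u] exI[of _ G]) simp
    qed simp
    then have "\<forall>i. \<exists>u G. i < m \<longrightarrow> in_H10 \<Omega> (a0 + d) u G \<and> f i = abs_l2 (Up d u G)" ..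
    from choice[OF this] obtain u where "\<forall>i. \<exists>G. i < m \<longrightarrow> in_H10 \<Omega> (a0 + d) (u i) G \<and> f i = abs_l2 (Up d (u i) G)" by blast
    from choice[OF this] obtain G where G: "\<And>i. i < m \<Longrightarrow> in_H10 \<Omega> (a0 + d) (u i) (G i)" "\<And>i. i < m \<Longrightarrow> f i = abs_l2 (Up d (u i) (G i))" by blast
    show "has_multiplicity \<Omega> (a0 + d) \<alpha> \<mu> m" unfolding has_multiplicity_def
      by (rule exI, rule iffD2[OF transfer[OF G] f])
  qed
qed

text \<open>Eigensystems are indexed from 0 and the enumeration from 1. The shift sends the two
  indices 0 and 1 to the same eigenvalue, but the counts start at 1.\<close>

lemma enumerates_eigensystem:
  assumes es: "P.eigensystem e s"
  shows "enumerates_eigenvalues \<Omega> (a0 + d) \<alpha> (\<lambda>j. s (j - 1))"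
  unfolding enumerates_eigenvalues_def
proof (intro conjI allI impI)
  show "0 < s (j - 1)" for j by (rule P.eig_pos[OF es])
  show "mono_on {1..} (\<lambda>j. s (j - 1))" by (intro mono_onI P.eig_mono[OF es]) simp
  show "filterlim (\<lambda>j. s (j - 1)) at_top sequentially"
    by (rule filterlim_compose[OF P.eig_at_top[OF es] filterlim_minus_const_nat_at_top])
  fix \<mu>
  have "{j. 1 \<le> j \<and> complex_of_real (s (j - 1)) = \<mu>} = Suc ` {j. complex_of_real (s j) = \<mu>}"
  proof (intro set_eqI iffI)
    fix j assume "j \<in> {j. 1 \<le> j \<and> complex_of_real (s (j - 1)) = \<mu>}"
    then show "j \<in> Suc ` {j. complex_of_real (s j) = \<mu>}" by (intro image_eqI[of _ _ "j - 1"]) auto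
  qed auto
  then have "card {j. 1 \<le> j \<and> complex_of_real (s (j - 1)) = \<mu>} = card {j. complex_of_real (s j) = \<mu>}"
    by (simp add: card_image)
  then show "has_multiplicity \<Omega> (a0 + d) \<alpha> \<mu> (card {j. 1 \<le> j \<and> complex_of_real (s (j - 1)) = \<mu>})"
    unfolding has_multiplicity_iff using P.eigensystem_basis[OF es] by simp
qed

lemma enumeration_unique:
  assumes "enumerates_eigenvalues \<Omega> (a0 + d) \<alpha> s" "enumerates_eigenvalues \<Omega> (a0 + d) \<alpha> t" "1 \<le> k"
  shows "s k = t k"
proof (rule mono_sequences_eq[OF _ _ _ _ _ assms(3)])
  fix \<mu> :: real
  have *: "has_multiplicity \<Omega> (a0 + d) \<alpha> \<mu> (card {j. 1 \<le> j \<and> f j = \<mu>})" if "enumerates_eigenvalues \<Omega> (a0 + d) \<alpha> f" for f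
    using that[unfolded enumerates_eigenvalues_def, THEN conjunct2, THEN conjunct2, THEN conjunct2, THEN spec, of "complex_of_real \<mu>"]
    by (simp only: of_real_eq_iff)
  obtain f where f: "Jc.is_basis (card {j. 1 \<le> j \<and> s j = \<mu>}) f (P.eigenspace \<mu>)" using *[OF assms(1)] unfolding has_multiplicity_iff ..
  obtain g where g: "Jc.is_basis (card {j. 1 \<le> j \<and> t j = \<mu>}) g (P.eigenspace \<mu>)" using *[OF assms(2)] unfolding has_multiplicity_iff ..
  show "card {j. 1 \<le> j \<and> s j = \<mu>} = card {j. 1 \<le> j \<and> t j = \<mu>}" by (rule Jc.is_basis_unique[OF f g])
qed (use assms(1,2) in \<open>auto simp: enumerates_eigenvalues_def\<close>)

lemma AB_eigenvalue_eq:
  assumes es: "P.eigensystem e s" and k: "1 \<le> k"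
  shows "AB_eigenvalue \<Omega> k (a0 + d) \<alpha> = s (k - 1)"
  unfolding AB_eigenvalue_def
proof (rule the_equality)
  show "\<exists>s'. enumerates_eigenvalues \<Omega> (a0 + d) \<alpha> s' \<and> s' k = s (k - 1)"
    using enumerates_eigensystem[OF es] by (intro exI[of _ "\<lambda>j. s (j - 1)"]) simp
  show "t = s (k - 1)" if "\<exists>s'. enumerates_eigenvalues \<Omega> (a0 + d) \<alpha> s' \<and> s' k = t" for t
    using that enumeration_unique[OF _ enumerates_eigensystem[OF es] k] by blast
qed

end

text \<open>Near the centre both forms change by at most a relative error \<tau>, so all Rayleigh
  quotients, and hence all eigenvalues, change by factors at most (1 + \<tau>)/(1 - \<tau>) in
  either direction.\<close>

lemma AB_eigenvalue_continuous:
  assumes \<alpha>0: "\<alpha>0 \<notin> \<int>" and k: "1 \<le> k"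
  shows "continuous (at (a0, \<alpha>0)) (\<lambda>(a, \<alpha>). AB_eigenvalue \<Omega> k a \<alpha>)"
proof -
  obtain N' \<gamma> where N': "open N'" "(a0, \<alpha>0) \<in> N'" "N' \<subseteq> N" and \<gamma>: "\<gamma> > 0"
    and pen: "\<And>p. p \<in> N' \<Longrightarrow> pencil Jc V (Aop (fst p - a0) (snd p)) (Bop (fst p - a0)) \<gamma>"
    using pencil_exists[OF \<alpha>0] by blast
  interpret P0: pencil Jc V "Aop 0 \<alpha>0" "Bop 0" \<gamma> using pen[OF N'(2)] by simp
  obtain e s where es: "P0.eigensystem e s" using P0.eigensystem_exists by blast
  \<comment> \<open>A common relative error: the first entry is for A, where coercivity converts the
    operator norm into a multiple of the form, and the second is for B.\<close>
  define t where "t p = max (norm (Aop (fst p - a0) (snd p) - Aop 0 \<alpha>0) / \<gamma>) (norm (fst p - a0) * lip)" for p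
  define l where "l = s (k - 1)"
  have l0: "AB_eigenvalue \<Omega> k a0 \<alpha>0 = l"
    using AB_eigenvalue_eq[OF small_0 P0.pencil_axioms es k] by (simp add: l_def)
  have l_pos: "l > 0" unfolding l_def by (rule P0.eig_pos[OF es])
  have bound: "\<bar>AB_eigenvalue \<Omega> k (fst p) (snd p) - l\<bar> \<le> 4 * t p * l" if p: "p \<in> N'" and tp: "t p \<le> 1/2" for p
  proof -
    have d: "small (fst p - a0)" using N_small N'(3) p by blast
    interpret P: pencil Jc V "Aop (fst p - a0) (snd p)" "Bop (fst p - a0)" \<gamma> by (rule pen[OF p])
    obtain e' s' where es': "P.eigensystem e' s'" using P.eigensystem_exists by blast
    define \<tau> where "\<tau> = t p"
    have \<tau>: "0 \<le> \<tau>" "\<tau> \<le> 1/2" using tp lip by (auto simp: \<tau>_def t_def le_max_iff_disj)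
    have a: "\<bar>P.a x x - P0.a x x\<bar> \<le> \<tau> * P0.a x x" if x: "x \<in> V" for x
    proof -
      have "norm (Aop (fst p - a0) (snd p) - Aop 0 \<alpha>0) \<le> \<tau> * \<gamma>"
        using \<gamma> by (simp add: \<tau>_def t_def pos_divide_le_eq[symmetric])
      then have "norm (Aop (fst p - a0) (snd p) - Aop 0 \<alpha>0) * (norm x)\<^sup>2 \<le> \<tau> * \<gamma> * (norm x)\<^sup>2" by (intro mult_right_mono) auto
      also have "\<dots> \<le> \<tau> * P0.a x x" unfolding mult.assoc using \<tau>(1) P0.coercive(2)[OF x] by (intro mult_left_mono) auto
      finally show ?thesis using quadratic_form_diff_le[of "Aop (fst p - a0) (snd p)" x "Aop 0 \<alpha>0"] by linarith
    qed
    have b: "\<bar>P.b x x - P0.b x x\<bar> \<le> \<tau> * P0.b x x" for x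
    proof -
      have "(norm (fst p - a0) * lip) * P0.b x x \<le> \<tau> * P0.b x x"
        using Bop_close(2)[OF small_0, of x] by (intro mult_right_mono) (auto simp: \<tau>_def t_def)
      then show ?thesis using Bop_close(1)[OF d, of x] by linarith
    qed
    have nn: "0 \<le> P0.a x x" "0 \<le> P.a x x" "0 \<le> P0.b x x" "0 \<le> P.b x x" if x: "x \<in> V" for x
    proof -
      have "0 \<le> \<gamma> * (norm x)\<^sup>2" using \<gamma> by simp
      then show "0 \<le> P0.a x x" "0 \<le> P.a x x" using P0.coercive(2)[OF x] P.coercive(2)[OF x] by linarith+
      show "0 \<le> P0.b x x" by (rule Bop_close(2)[OF small_0])
      then show "0 \<le> P.b x x" using Bop_half(2)[OF d, of x] by linarith
    qed
    define C where "C = (1 + \<tau>) / (1 - \<tau>)"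
    have C: "C \<ge> 0" using \<tau> by (simp add: C_def)
    have *: "(1 - \<tau>) * (y * z) \<le> (1 + \<tau>) * (y' * z')" if "0 \<le> y" "0 \<le> z" "0 \<le> y'" "0 \<le> z'" "y \<le> (1 + \<tau>) * y'" "(1 - \<tau>) * z \<le> z'" for y z y' z' :: real
    proof -
      have "y * ((1 - \<tau>) * z) \<le> ((1 + \<tau>) * y') * z'" using that \<tau> by (intro mult_mono) auto
      then show ?thesis by (simp add: mult_ac)
    qed
    have C_iff: "y * z \<le> C * y' * z'" if "(1 - \<tau>) * (y * z) \<le> (1 + \<tau>) * (y' * z')" for y z y' z'
      using that \<tau> by (simp add: C_def field_simps)
    have up: "s' j \<le> C * s j" for j
    proof (rule eigenvalue_comparison[OF P0.pencil_axioms P.pencil_axioms es es' C])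
      fix x assume x: "x \<in> V"
      show "P.a x x * P0.b x x \<le> C * P0.a x x * P.b x x"
        using a[OF x] b[of x] nn[OF x] by (intro C_iff *) (auto simp: abs_le_iff algebra_simps)
    qed
    have dn: "s j \<le> C * s' j" for j
    proof (rule eigenvalue_comparison[OF P.pencil_axioms P0.pencil_axioms es' es C])
      fix x assume x: "x \<in> V"
      have "(1 - \<tau>) * (P.b x x * P0.a x x) \<le> (1 + \<tau>) * (P0.b x x * P.a x x)"
        using a[OF x] b[of x] nn[OF x] by (intro *) (auto simp: abs_le_iff algebra_simps)
      then show "P0.a x x * P.b x x \<le> C * P.a x x * P0.b x x" by (intro C_iff) (simp add: mult.commute)
    qed
    define m where "m = s' (k - 1)"
    have "m \<le> (1 + \<tau>) / (1 - \<tau>) * l" "l \<le> (1 + \<tau>) / (1 - \<tau>) * m" using up dn by (simp_all add: m_def l_def C_def)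
    then have "(1 - \<tau>) * m \<le> (1 + \<tau>) * l" "(1 - \<tau>) * l \<le> (1 + \<tau>) * m" using \<tau> by (simp_all add: field_simps)
    then have ml: "m - l \<le> \<tau> * m + \<tau> * l" "l - m \<le> \<tau> * m + \<tau> * l" by (simp_all add: algebra_simps)
    have m0: "m \<ge> 0" unfolding m_def using P.eig_pos[OF es', of "k - 1"] by simp
    \<comment> \<open>With \<tau> <= 1/2 the first inequality of \<open>ml\<close> gives m <= 3l,
      and then \<tau> m + \<tau> l is at most 4 \<tau> l.\<close>
    have "\<tau> * m \<le> 1/2 * m" "\<tau> * l \<le> 1/2 * l" using \<tau> m0 l_pos by (intro mult_right_mono; simp)+
    then have "m \<le> 3 * l" using ml by linarith
    then have "\<tau> * m \<le> \<tau> * (3 * l)" using \<tau> by (intro mult_left_mono)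
    then have "\<bar>m - l\<bar> \<le> 4 * \<tau> * l" using ml by (simp add: abs_le_iff)
    moreover have "AB_eigenvalue \<Omega> k (fst p) (snd p) = m"
      using AB_eigenvalue_eq[OF d P.pencil_axioms es' k] by (simp add: m_def)
    ultimately show ?thesis by (simp add: \<tau>_def)
  qed
  have "isCont (\<lambda>p. Aop (fst p - a0) (snd p)) (a0, \<alpha>0)"
  proof -
    have "continuous_on N' (\<lambda>p. Aop (fst p - a0) (snd p))" using Aop_smooth[of 0] N'(3) by (auto intro: continuous_on_subset)
    then show ?thesis using N'(1,2) continuous_on_eq_continuous_at by blast
  qed
  then have "isCont t (a0, \<alpha>0)" unfolding t_def[abs_def] using \<gamma> by (intro continuous_intros) auto
  moreover have "t (a0, \<alpha>0) = 0" by (simp add: t_def)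
  ultimately have t_lim: "(t \<longlongrightarrow> 0) (at (a0, \<alpha>0))" by (simp add: isCont_def)
  have "((\<lambda>p. AB_eigenvalue \<Omega> k (fst p) (snd p) - l) \<longlongrightarrow> 0) (at (a0, \<alpha>0))"
  proof (rule Lim_null_comparison)
    have "eventually (\<lambda>p. t p < 1/2) (at (a0, \<alpha>0))" using t_lim by (rule order_tendstoD) simp
    moreover have "eventually (\<lambda>p. p \<in> N') (at (a0, \<alpha>0))" using N'(1,2) by (rule eventually_at_in_open')
    ultimately show "eventually (\<lambda>p. norm (AB_eigenvalue \<Omega> k (fst p) (snd p) - l) \<le> 4 * t p * l) (at (a0, \<alpha>0))"
      by eventually_elim (simp add: bound)
    show "((\<lambda>p. 4 * t p * l) \<longlongrightarrow> 0) (at (a0, \<alpha>0))" using tendsto_mult_right[OF tendsto_mult_left[OF t_lim, of 4], of l] by simp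
  qed
  then have "((\<lambda>p. AB_eigenvalue \<Omega> k (fst p) (snd p)) \<longlongrightarrow> l) (at (a0, \<alpha>0))" by (rule LIM_zero_cancel)
  then show ?thesis by (simp add: continuous_at case_prod_beta' l0)
qed

text \<open>Continuity on the whole parameter set is assumed here because its proof lets the centre
  a0 vary, whereas the present context keeps it fixed.\<close>

lemma AB_eigenvalue_smooth:
  assumes \<alpha>0: "\<alpha>0 \<notin> \<int>" and k: "1 \<le> k"
    and simple: "simple_eigenvalue \<Omega> a0 \<alpha>0 (AB_eigenvalue \<Omega> k a0 \<alpha>0)"
    and cont: "continuous_on (\<Omega> \<times> (UNIV - \<int>)) (\<lambda>(a, \<alpha>). AB_eigenvalue \<Omega> k a \<alpha>)"
  shows "\<exists>U. open U \<and> (a0, \<alpha>0) \<in> U \<and> U \<subseteq> \<Omega> \<times> (UNIV - \<int>) \<and> smooth_on U (\<lambda>(a, \<alpha>). AB_eigenvalue \<Omega> k a \<alpha>)"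
proof -
  obtain N' \<gamma> where N': "open N'" "(a0, \<alpha>0) \<in> N'" "N' \<subseteq> N" and \<gamma>: "\<gamma> > 0"
    and pen: "\<And>p. p \<in> N' \<Longrightarrow> pencil Jc V (Aop (fst p - a0) (snd p)) (Bop (fst p - a0)) \<gamma>"
    using pencil_exists[OF \<alpha>0] by blast
  define M where "M = N' \<inter> \<Omega> \<times> (UNIV - \<int>)"
  have M: "open M" "(a0, \<alpha>0) \<in> M" "M \<subseteq> N'" "M \<subseteq> \<Omega> \<times> (UNIV - \<int>)"
    using N' \<Omega>_open a0_\<Omega> \<alpha>0 by (auto simp: M_def intro!: open_Int open_Times open_Diff)
  have d: "small (fst p - a0)" if "p \<in> M" for p using N_small N'(3) M(3) that by blast
  let ?lam = "\<lambda>p. AB_eigenvalue \<Omega> k (fst p) (snd p)"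
  have eig: "\<exists>x\<in>V. x \<noteq> 0 \<and> (\<forall>y\<in>V. Aop (fst p - a0) (snd p) x \<bullet> y = ?lam p * (Bop (fst p - a0) x \<bullet> y))" if p: "p \<in> M" for p
  proof -
    interpret P: pencil Jc V "Aop (fst p - a0) (snd p)" "Bop (fst p - a0)" \<gamma> using pen p M(3) by blast
    obtain e s where es: "P.eigensystem e s" using P.eigensystem_exists by blast
    have "?lam p = s (k - 1)" using AB_eigenvalue_eq[OF d[OF p] P.pencil_axioms es k] by simp
    moreover have "e (k - 1) \<noteq> 0" using P.eig_b[OF es, of "k - 1"] by (auto simp: blinfun.zero_right)
    ultimately show ?thesis using P.eig_V[OF es] P.eig_eq[OF es] by (intro bexI[of _ "e (k - 1)"]) auto
  qed
  interpret P0: pencil Jc V "Aop 0 \<alpha>0" "Bop 0" \<gamma> using pen[OF N'(2)] by simp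
  obtain f where f: "Jc.is_basis 1 f (P0.eigenspace (complex_of_real (?lam (a0, \<alpha>0))))"
    using simple has_multiplicity_iff[OF small_0 P0.pencil_axioms, of "complex_of_real (?lam (a0, \<alpha>0))" 1]
    unfolding simple_eigenvalue_def by auto
  have "\<exists>U. open U \<and> (a0, \<alpha>0) \<in> U \<and> U \<subseteq> M \<and> smooth_on U ?lam"
  proof (rule simple_eigenvalue_smooth[OF M(1,2), where u="f 0"])
    show "pencil Jc V (Aop (fst p - a0) (snd p)) (Bop (fst p - a0)) \<gamma>" if "p \<in> M" for p using pen M(3) that by blast
    show "Ck_on n M (\<lambda>p. Aop (fst p - a0) (snd p))" "Ck_on n M (\<lambda>p. Bop (fst p - a0))" for n
      using Ck_on_subset[OF Aop_smooth] Ck_on_subset[OF Bop_smooth] M(3) N'(3) by blast+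
    show "continuous_on M ?lam" using continuous_on_subset[OF cont M(4)] by (simp add: case_prod_beta')
    \<comment> \<open>Simplicity means a basis with one element, so the eigenspace is the complex
      line through f 0.\<close>
    show "\<exists>c. x = Jc.cscale c (f 0)" if "x \<in> V" "\<And>y. y \<in> V \<Longrightarrow> Aop (fst (a0, \<alpha>0) - a0) (snd (a0, \<alpha>0)) x \<bullet> y = ?lam (a0, \<alpha>0) * (Bop (fst (a0, \<alpha>0) - a0) x \<bullet> y)" for x
    proof -
      have "x \<in> P0.eigenspace (complex_of_real (?lam (a0, \<alpha>0)))" using that by (simp add: P0.eigenspace_of_real)
      then obtain c where "x = (\<Sum>i<1. Jc.cscale (c i) (f i))" using f unfolding Jc.is_basis_def by blast
      then show ?thesis by (intro exI[of _ "c 0"]) simp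
    qed
  qed (rule eig)
  then show ?thesis using M(4) by (auto simp: case_prod_beta')
qed

end

lemma ab_domain_at:
  assumes "open \<Omega>" "bounded \<Omega>" "a \<in> \<Omega>"
  obtains r R where "ab_domain \<Omega> a r R"
proof -
  obtain R where "R > 0" "cball a R \<subseteq> \<Omega>" using assms open_contains_cball by metis
  then show thesis using assms by (intro that[of "R / 2" R]) (simp add: ab_domain_def)
qed

theorem theorem1p5:
  fixes \<Omega> :: "(real^2) set" and k :: nat
  assumes "open \<Omega>" and "bounded \<Omega>" and "connected \<Omega>" and "simply_connected \<Omega>"
    and "0 \<in> \<Omega>" and "k \<noteq> 0"
  shows "continuous_on (\<Omega> \<times> (UNIV - \<int>)) (\<lambda>(a, \<alpha>). AB_eigenvalue \<Omega> k a \<alpha>) \<and>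
    (\<forall>\<alpha>\<^sub>0::real. \<alpha>\<^sub>0 \<notin> \<int> \<longrightarrow> simple_eigenvalue \<Omega> 0 \<alpha>\<^sub>0 (AB_eigenvalue \<Omega> k 0 \<alpha>\<^sub>0) \<longrightarrow>
      (\<exists>U. open U \<and> (0, \<alpha>\<^sub>0) \<in> U \<and> U \<subseteq> \<Omega> \<times> (UNIV - \<int>) \<and>
        smooth_on U (\<lambda>(a, \<alpha>). AB_eigenvalue \<Omega> k a \<alpha>)))"
proof -
  have k: "1 \<le> k" using assms(6) by simp
  have cont: "continuous_on (\<Omega> \<times> (UNIV - \<int>)) (\<lambda>(a, \<alpha>). AB_eigenvalue \<Omega> k a \<alpha>)"
  proof (intro continuous_at_imp_continuous_on ballI)
    fix p assume "p \<in> \<Omega> \<times> (UNIV - (\<int> :: real set))"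
    then obtain a \<alpha> where p: "p = (a, \<alpha>)" "a \<in> \<Omega>" "\<alpha> \<notin> \<int>" by auto
    \<comment> \<open>Continuity at (a, \<alpha>) is proved with the construction centred at that
      very pole.\<close>
    obtain r R where "ab_domain \<Omega> a r R" using ab_domain_at[OF assms(1,2) p(2)] by blast
    then interpret ab_domain \<Omega> a r R .
    show "isCont (\<lambda>(a, \<alpha>). AB_eigenvalue \<Omega> k a \<alpha>) p" unfolding p(1) by (rule AB_eigenvalue_continuous[OF p(3) k])
  qed
  obtain r R where "ab_domain \<Omega> 0 r R" using ab_domain_at[OF assms(1,2,5)] by blast
  then interpret ab_domain \<Omega> 0 r R .
  show ?thesis using cont AB_eigenvalue_smooth[OF _ k _ cont] by blast
qed

end
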